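(* Let $\phi\in\mathcal M^{2,1}(\mathbb R^2)$ and let $m,M>0$. There exist constants $\varepsilon_0=\varepsilon_0(\phi,m,M)\in(0,1)$ and $C=C(\phi,m,M)>0$ such that for any bounded $C^2$ open set $E\subset\mathbb R^2$ satisfying $|E|=m$, $P_\phi(E)\le M$ and $\|\kappa^\phi_E-\overline\kappa^\phi_E\|_{L^2(\partial E)}\le\varepsilon_0$, the following hold: (1) $E$ is diffeomorphic to a disjoint union of Wulff shapes $F=\bigcup_{j=1}^d W_\phi(x_j,r)$ such that $|E|=|F|$ and $$|P_\phi(E)-P_\phi(F)|\le C\|\kappa^\phi_E-\overline\kappa^\phi_E\|_{L^2(\partial E)}^2.$$ (2) Each boundary component of $E$ may be parametrized as a normal graph over (the boundary of) some $W_\phi(x_j,r)$, i.e. as $x\mapsto x+f(x)\nu(x)$, $x\in\partial W_\phi(x_j,r)$, with $\nu$ the outer unit normal of $W_\phi(x_j,r)$, where the $C^{1,1/2}$ norm of $f$ is at most $C\|\kappa^\phi_E-\overline\kappa^\phi_E\|_{L^2(\partial E)}$.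
   Context: A norm $\phi$ on $\mathbb R^2$ is a regular elliptic integrand if $\gamma:=\phi|_{\mathbb S^1}$ is $C^2$ and strictly positive and there is $c>0$ with $e\cdot(D^2\phi(\nu)e)\ge c|e-(\nu\cdot e)\nu|^2$ for all $\nu,e\in\mathbb S^1$. $\mathcal M^{2,1}(\mathbb R^2)$ is the set of regular elliptic integrands with $\gamma\in C^{2,1}(\mathbb S^1)$. $W_\phi=\{x\in\mathbb R^2:x\cdot\nu\le\phi(\nu)\ \forall\nu\in\mathbb R^2\}$, $W_\phi(x,r)=x+rW_\phi$. $P_\phi(E)=\int_{\partial E}\phi(\nu_E)\,d\mathcal H^1$, $\nu_E$ the outward unit normal. For a $C^2$ set $E\subset\mathbb R^2$, the mean $\phi$-curvature is $\kappa^\phi_E=\operatorname{div}_\tau\nabla\phi(\nu_E)=\kappa_E\,(\gamma+\gamma'')(\nu_E)$, where $\kappa_E$ is the usual curvature of $\partial E$ with respect to the outward normal (positive for convex sets) and $\gamma$ is regarded as a function of the angle. $\overline\kappa^\phi_E=\frac{1}{\mathcal H^1(\partial E)}\int_{\partial E}\kappa^\phi_E\,d\mathcal H^1$ is its average. *)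

theory Defs
  imports "HOL-Analysis.Analysis"
begin

section \<open>One-dimensional Hausdorff measure\<close>

definition hausdorff1_pre :: "real \<Rightarrow> 'a::metric_space set \<Rightarrow> ennreal" where
  "hausdorff1_pre \<delta> A =
     Inf {(\<Sum>n. ennreal (diameter (U n))) | U :: nat \<Rightarrow> 'a set.
            A \<subseteq> (\<Union>n. U n) \<and> (\<forall>n. bounded (U n) \<and> diameter (U n) \<le> \<delta>)}"

definition hausdorff1_outer :: "'a::metric_space set \<Rightarrow> ennreal" where
  "hausdorff1_outer A = (SUP \<delta>\<in>{0<..}. hausdorff1_pre \<delta> A)"

text \<open>The outer measure is a metric outer measure, hence (Caratheodory) countably additive on the
  Borel sets; so \<open>measure_of\<close> does not degenerate here and \<open>emeasure hausdorff1\<close> is the restriction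
  of \<open>hausdorff1_outer\<close> to the Borel sets.\<close>

definition hausdorff1 :: "'a::metric_space measure" where
  "hausdorff1 = measure_of UNIV (sets borel) hausdorff1_outer"


section \<open>Differential calculus\<close>

definition C2_on :: "'a::real_normed_vector set \<Rightarrow> ('a \<Rightarrow> 'b::real_normed_vector) \<Rightarrow> bool" where
  "C2_on S f \<longleftrightarrow>
     (\<exists>(f' :: 'a \<Rightarrow> 'a \<Rightarrow>\<^sub>L 'b) (f'' :: 'a \<Rightarrow> 'a \<Rightarrow>\<^sub>L 'a \<Rightarrow>\<^sub>L 'b).
        (\<forall>x\<in>S. (f has_derivative blinfun_apply (f' x)) (at x)) \<and>
        (\<forall>x\<in>S. (f' has_derivative blinfun_apply (f'' x)) (at x)) \<and>
        continuous_on S f'')"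

definition grad :: "('a::real_inner \<Rightarrow> real) \<Rightarrow> 'a \<Rightarrow> 'a" where
  "grad f x = (THE D. GDERIV f x :> D)"

definition rot90 :: "real^2 \<Rightarrow> real^2" where
  "rot90 v = vector [- (v $ 2), v $ 1]"

text \<open>The derivative of a function on a curve \<open>S\<close> at \<open>x\<close> along a tangent vector \<open>v\<close>. A linear map
  which is a derivative within \<open>S\<close> is only determined on tangent vectors of \<open>S\<close>, which is all that
  is used: the value at such a \<open>v\<close> does not depend on the choice.\<close>

definition tangential_deriv ::
    "(real^2) set \<Rightarrow> (real^2 \<Rightarrow> 'b::real_normed_vector) \<Rightarrow> real^2 \<Rightarrow> real^2 \<Rightarrow> 'b" where
  "tangential_deriv S f x v = frechet_derivative f (at x within S) v"


section \<open>Anisotropies\<close>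

definition is_norm :: "(real^2 \<Rightarrow> real) \<Rightarrow> bool" where
  "is_norm \<phi> \<longleftrightarrow>
     (\<forall>x. 0 \<le> \<phi> x) \<and> (\<forall>x. \<phi> x = 0 \<longleftrightarrow> x = 0) \<and>
     (\<forall>a x. \<phi> (a *\<^sub>R x) = \<bar>a\<bar> * \<phi> x) \<and>
     (\<forall>x y. \<phi> (x + y) \<le> \<phi> x + \<phi> y)"

text \<open>The restriction of \<open>\<phi>\<close> to the unit circle, as a function of the angle.\<close>

definition angular :: "(real^2 \<Rightarrow> real) \<Rightarrow> real \<Rightarrow> real" where
  "angular \<phi> t = \<phi> (vector [cos t, sin t])"

definition regular_elliptic_integrand :: "(real^2 \<Rightarrow> real) \<Rightarrow> bool" where
  "regular_elliptic_integrand \<phi> \<longleftrightarrow>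
     is_norm \<phi> \<and> C2_on UNIV (angular \<phi>) \<and> (\<forall>t. 0 < angular \<phi> t) \<and>
     (\<exists>c>0. \<forall>\<nu> e. norm \<nu> = 1 \<longrightarrow> norm e = 1 \<longrightarrow>
        e \<bullet> frechet_derivative (grad \<phi>) (at \<nu>) e \<ge> c * (norm (e - (\<nu> \<bullet> e) *\<^sub>R \<nu>))\<^sup>2)"

definition M21 :: "(real^2 \<Rightarrow> real) set" where
  "M21 = {\<phi>. regular_elliptic_integrand \<phi> \<and>
             (\<exists>L. L-lipschitz_on UNIV (deriv (deriv (angular \<phi>))))}"

definition wulff :: "(real^2 \<Rightarrow> real) \<Rightarrow> (real^2) set" where
  "wulff \<phi> = {x. \<forall>\<nu>. x \<bullet> \<nu> \<le> \<phi> \<nu>}"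

definition wulff_at :: "(real^2 \<Rightarrow> real) \<Rightarrow> real^2 \<Rightarrow> real \<Rightarrow> (real^2) set" where
  "wulff_at \<phi> x r = (\<lambda>w. x + r *\<^sub>R w) ` wulff \<phi>"


section \<open>Sets with \<open>C\<^sup>2\<close> boundary\<close>

text \<open>Near each boundary point, and in suitable orthonormal coordinates, the set is the subgraph of
  a \<open>C\<^sup>2\<close> function of one variable.\<close>

definition C2_open_set :: "(real^2) set \<Rightarrow> bool" where
  "C2_open_set E \<longleftrightarrow> open E \<and>
     (\<forall>p\<in>frontier E. \<exists>(e :: real^2) (g :: real \<Rightarrow> real) \<delta>.
        norm e = 1 \<and> \<delta> > 0 \<and> C2_on UNIV g \<and>
        E \<inter> ball p \<delta> = {y \<in> ball p \<delta>. y \<bullet> e < g (y \<bullet> rot90 e)})"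

text \<open>The unit vector that is orthogonal to the boundary at \<open>x\<close> and points out of the set. It is
  meant for open sets as well as for closed ones such as Wulff shapes.\<close>

definition is_outer_normal :: "(real^2) set \<Rightarrow> real^2 \<Rightarrow> real^2 \<Rightarrow> bool" where
  "is_outer_normal E x \<nu> \<longleftrightarrow> norm \<nu> = 1 \<and>
     ((\<lambda>y. (\<nu> \<bullet> (y - x)) / norm (y - x)) \<longlongrightarrow> 0) (at x within frontier E) \<and>
     (\<forall>\<^sub>F t in at_right 0. x - t *\<^sub>R \<nu> \<in> interior E \<and> x + t *\<^sub>R \<nu> \<notin> closure E)"

definition outer_normal :: "(real^2) set \<Rightarrow> real^2 \<Rightarrow> real^2" where
  "outer_normal E x = (THE \<nu>. is_outer_normal E x \<nu>)"

text \<open>The unit tangent, oriented consistently along the boundary (counterclockwise rotation of the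
  outer normal); reversing all orientations would change nothing below.\<close>

definition unit_tangent :: "(real^2) set \<Rightarrow> real^2 \<Rightarrow> real^2" where
  "unit_tangent E x = rot90 (outer_normal E x)"

definition aniso_perimeter :: "(real^2 \<Rightarrow> real) \<Rightarrow> (real^2) set \<Rightarrow> real" where
  "aniso_perimeter \<phi> E = (LINT x:frontier E|hausdorff1. \<phi> (outer_normal E x))"

text \<open>The tangential divergence of \<open>\<nabla>\<phi> \<circ> \<nu>\<^sub>E\<close>.\<close>

definition aniso_curvature :: "(real^2 \<Rightarrow> real) \<Rightarrow> (real^2) set \<Rightarrow> real^2 \<Rightarrow> real" where
  "aniso_curvature \<phi> E x =
     unit_tangent E x \<bullet>
       tangential_deriv (frontier E) (\<lambda>y. grad \<phi> (outer_normal E y)) x (unit_tangent E x)"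

definition mean_aniso_curvature :: "(real^2 \<Rightarrow> real) \<Rightarrow> (real^2) set \<Rightarrow> real" where
  "mean_aniso_curvature \<phi> E =
     (LINT x:frontier E|hausdorff1. aniso_curvature \<phi> E x) / measure hausdorff1 (frontier E)"

definition curvature_deficit :: "(real^2 \<Rightarrow> real) \<Rightarrow> (real^2) set \<Rightarrow> real" where
  "curvature_deficit \<phi> E =
     sqrt (LINT x:frontier E|hausdorff1. (aniso_curvature \<phi> E x - mean_aniso_curvature \<phi> E)\<^sup>2)"


section \<open>Diffeomorphic domains and normal graphs\<close>

text \<open>\<open>A\<close> and \<open>B\<close> are compared as compact surfaces with boundary (so that an open set may be compared
  with a closed one): the diffeomorphism is of class \<open>C\<^sup>2\<close> up to the boundary, and it
  takes interior to interior and closure to closure.\<close>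

definition diffeomorphic_domains :: "(real^2) set \<Rightarrow> (real^2) set \<Rightarrow> bool" where
  "diffeomorphic_domains A B \<longleftrightarrow>
     (\<exists>U V \<Phi> \<Psi>. open U \<and> open V \<and> closure A \<subseteq> U \<and> closure B \<subseteq> V \<and>
        homeomorphism U V \<Phi> \<Psi> \<and> C2_on U \<Phi> \<and> C2_on V \<Psi> \<and>
        \<Phi> ` interior A = interior B \<and> \<Phi> ` closure A = closure B)"

text \<open>The \<open>C\<^sup>1\<^sup>,\<^sup>1\<^sup>/\<^sup>2\<close> norm of a function on the boundary of \<open>W\<close>; infinite if the function is
  not differentiable along the boundary.\<close>

definition C1_half_norm :: "(real^2) set \<Rightarrow> (real^2 \<Rightarrow> real) \<Rightarrow> ennreal" where
  "C1_half_norm W f =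
    (let S = frontier W; f' = (\<lambda>x. tangential_deriv S f x (unit_tangent W x)) in
     if \<forall>x\<in>S. f differentiable (at x within S)
     then (SUP x\<in>S. ennreal \<bar>f x\<bar>) + (SUP x\<in>S. ennreal \<bar>f' x\<bar>) +
          (SUP x\<in>S. SUP y\<in>S - {x}. ennreal (\<bar>f' x - f' y\<bar> / sqrt (dist x y)))
     else \<infinity>)"

definition normal_graph_map :: "(real^2) set \<Rightarrow> (real^2 \<Rightarrow> real) \<Rightarrow> real^2 \<Rightarrow> real^2" where
  "normal_graph_map W f x = x + f x *\<^sub>R outer_normal W x"

end

theory Submission imports Defs begin

text \<open>
  Along a boundary curve \<open>c\<close> with normal angle \<open>\<alpha>\<close>, put \<open>Y = \<nabla>\<phi> \<circ> ev\<close> and let \<open>a\<close> be the mean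
  curvature. Then \<open>Z = Y(\<alpha>) - a c\<close> satisfies \<open>Z' = (\<kappa> - a) c'\<close>, so by Cauchy-Schwarz it is constant up to
  \<open>\<eta> = \<delta> sqrt L\<close>, with \<open>\<delta>\<close> the deficit, and even \<open>1/2\<close>-Hoelder with constant \<open>\<delta>\<close>. Hence \<open>c\<close> is \<open>\<eta> / a\<close>-close to a
  Wulff shape of radius \<open>1 / a\<close>, at equal normal angle; it is star-shaped, winds once, and is a normal graph over the
  Wulff shape, \<open>b - \<alpha>\<close> (with \<open>b\<close> the angle of the foot point) inheriting the Hoelder bound. The integral of
  \<open>rot90 Z \<bullet> Z'\<close> is quadratic in the deficit and expresses \<open>|W| - a P + a\<^sup>2 A\<close> for a component of perimeter \<open>P\<close> and
  enclosed area \<open>A\<close>; this gives the quadratic estimate of the perimeter. The enclosed star-shaped pieces are the components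
  of \<open>E\<close>, since all normals point away from the centres. Finally the centres are spread apart by a factor
  \<open>1 + O(\<eta>)\<close> within clusters, which makes the Wulff shapes of the correct total area disjoint.
\<close>

text \<open>Two orders of smallness must be kept apart. \<open>a * r - 1\<close> and the distance to
  the Wulff shapes are of first order in the deficit, but the perimeters must agree to second order.
  This works because the common radius \<open>r\<close> is fixed by the area and not as
  \<open>1 / a\<close>: summing the defect over the components then completes a square, and
  \<open>2 * a\<close> times the difference of the perimeters equals
  \<open>d * omW * (a * r - 1)^2\<close> minus the defects. All constants rest on two-sided bounds
  for \<open>a\<close>: the lower one is the total turning \<open>a * L = d * lW\<close>, the upper
  one balances the area against the number \<open>d\<close> of components, which the length bounds
  linearly in \<open>a\<close>. The exponent 1/2 is what Cauchy-Schwarz gives on a short arc, and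
  the Lipschitz bound on the second derivative enters only in the Hoelder estimate of the derivative
  of the graph function. A further obstacle is that \<open>E\<close> is given by local graphs: the
  components of its frontier must first become closed unit speed curves, and Hausdorff integrals
  become integrals over one period.\<close>

notation scaleR (infixr "*." 75) and has_vector_derivative (infix "hvd" 50)

abbreviation hrd :: "(real => real) => real => real filter => bool" (infix "hrd" 50)
 where "(f hrd D) F == (f has_real_derivative D) F"

lemmas hrd_iff_hvd = has_real_derivative_iff_has_vector_derivative
lemmas bounded_linear_hvd = bounded_linear.has_vector_derivative
lemmas bounded_bilinear_hvd = bounded_bilinear.has_vector_derivative
lemmas hfd_at_within = has_field_derivative_at_within
lemmas cont_at_imp_cont_on = continuous_at_imp_continuous_on

section \<open>The Euclidean plane\<close>

lemma rot90_nth [simp]: "rot90 v $ 1 = - (v $ 2)" "rot90 v $ 2 = v $ 1"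
 by (simp_all add: rot90_def)

lemma inner_real2: "(x::real^2) \<bullet> y = x $ 1 * y $ 1 + x $ 2 * y $ 2"
 by (simp add: inner_vec_def sum_2)

lemma real2_eq_iff: "(x::real^2) = y \<longleftrightarrow> x $ 1 = y $ 1 & x $ 2 = y $ 2"
 by (simp add: vec_eq_iff forall_2)

lemma rot90_add: "rot90 (x + y) = rot90 x + rot90 y"
 and rot90_scaleR: "rot90 (a *. x) = a *. rot90 x"
 and rot90_minus: "rot90 (- x) = - rot90 x"
 and rot90_diff: "rot90 (x - y) = rot90 x - rot90 y"
 and rot90_rot90: "rot90 (rot90 x) = - x"
 and rot90_0: "rot90 0 = 0"
 by (simp_all add: real2_eq_iff)

lemma rot90_inner_rot90: "rot90 x \<bullet> rot90 y = x \<bullet> y"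
 and rot90_inner_self: "rot90 x \<bullet> x = 0" "x \<bullet> rot90 x = 0"
 and rot90_inner_left: "rot90 x \<bullet> y = - (x \<bullet> rot90 y)"
 by (simp_all add: inner_real2)

lemma norm_rot90 [simp]: "norm (rot90 x) = norm x"
 by (simp add: norm_eq_sqrt_inner rot90_inner_rot90)

lemma rot90_eq_0_iff [simp]: "rot90 x = 0 \<longleftrightarrow> x = 0"
 by (metis norm_eq_zero norm_rot90)

lemma bounded_linear_rot90: "bounded_linear rot90"
 by (intro bounded_linear_intro[where K = 1]) (simp_all add: rot90_add rot90_scaleR)

lemma rot90_abs_inner_le: "\<bar>rot90 x \<bullet> y\<bar> <= norm x * norm y"
 using Cauchy_Schwarz_ineq2[of "rot90 x" y] by simp

definition ev :: "real => real^2" where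
 "ev t = vector [cos t, sin t]"

lemma ev_nth [simp]: "ev t $ 1 = cos t" "ev t $ 2 = sin t"
 by (simp_all add: ev_def)

lemma norm_ev [simp]: "norm (ev t) = 1"
 by (simp add: norm_eq_sqrt_inner inner_real2 flip: power2_eq_square)

lemma ev_inner_ev: "ev s \<bullet> ev t = cos (s - t)"
 and rot90_ev_inner_ev: "rot90 (ev s) \<bullet> ev t = sin (t - s)"
 and ev_inner_rot90_ev: "ev t \<bullet> rot90 (ev s) = sin (t - s)"
 by (simp_all add: inner_real2 cos_diff sin_diff)

lemma ev_plus_pi: "ev (t + pi) = - ev t"
 by (simp add: real2_eq_iff)

lemma ev_eq_iff: "ev s = ev t \<longleftrightarrow> (EX k::int. s = t + 2 * pi * k)"
 using sin_cos_eq_iff[of s t] by (auto simp: real2_eq_iff)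

lemma ev_periodic: "ev (t + 2 * pi * of_int k) = ev t"
 by (subst ev_eq_iff) blast

lemma ex_ev: "norm v = 1 ==> EX t. v = ev t"
 using sincos_total_2pi[of "v $ 1" "v $ 2"]
 by (metis ev_nth inner_real2 norm_eq_1 power2_eq_square real2_eq_iff)

lemma has_derivative_ev [derivative_intros]:
 "(f hrd f') (at t within S) ==>
  ((%t. ev (f t)) hvd f' *. rot90 (ev (f t))) (at t within S)"
proof -
 assume f: "(f hrd f') (at t within S)"
 have ev_axis: "ev u = cos u *. axis 1 1 + sin u *. axis 2 1" for u
  by (simp add: real2_eq_iff axis_def)
 show ?thesis
 proof -
  have *: "((%t. cos (f t) *. axis 1 1 + sin (f t) *. axis 2 1 :: real^2) hvd
    (cos (f t) *. 0 + (- sin (f t) * f') *. axis 1 1) +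
    (sin (f t) *. 0 + (cos (f t) * f') *. axis 2 1)) (at t within S)"
   by (intro has_vector_derivative_add has_vector_derivative_scaleR has_vector_derivative_const
     DERIV_chain2[OF DERIV_cos f] DERIV_chain2[OF DERIV_sin f])
  have "(cos (f t) *. 0 + (- sin (f t) * f') *. axis 1 1) +
    (sin (f t) *. 0 + (cos (f t) * f') *. axis 2 1) = f' *. rot90 (ev (f t))"
   by (simp add: real2_eq_iff axis_def)
  then show ?thesis using * unfolding ev_axis[abs_def] by metis
 qed
qed

lemma ev_decomp: "v = (v \<bullet> ev t) *. ev t + (v \<bullet> rot90 (ev t)) *. rot90 (ev t)"
proof -
 have "cos t * (cos t * a) + sin t * (sin t * a) = a" for a
  by (metis (no_types) cos_squared_eq diff_add_cancel distrib_right mult.assoc mult_1 power2_eq_square)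
 from this[of "v $ 1"] this[of "v $ 2"] show ?thesis
  by (simp add: real2_eq_iff inner_real2 algebra_simps)
qed

lemma orthonormal_decomp:
 assumes "norm e = 1" shows "v = (v \<bullet> e) *. e + (v \<bullet> rot90 e) *. rot90 e"
 using ex_ev[OF assms] ev_decomp by metis


section \<open>The one-dimensional Hausdorff measure\<close>

lemma hausdorff1_pre_le:
 assumes "A \<subseteq> (\<Union>n. U n)" "!!n. bounded (U n)" "!!n. diameter (U n) <= dl"
 shows "hausdorff1_pre dl A <= (\<Sum>n. ennreal (diameter (U n)))"
 unfolding hausdorff1_pre_def by (rule Inf_lower) (use assms in auto)

lemma hausdorff1_pre_antimono: "dl <= dl' ==> hausdorff1_pre dl' A <= hausdorff1_pre dl A"
 unfolding hausdorff1_pre_def[of dl]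
 by (rule Inf_greatest, clarify, rule hausdorff1_pre_le) (auto intro: order_trans)

lemma hausdorff1_pre_le_outer: "0 < dl ==> hausdorff1_pre dl A <= hausdorff1_outer A"
 unfolding hausdorff1_outer_def by (rule SUP_upper) auto

lemma hausdorff1_outer_leI:
 "(!!dl. 0 < dl ==> hausdorff1_pre dl A <= x) ==> hausdorff1_outer A <= x"
 unfolding hausdorff1_outer_def by (rule SUP_least) auto

lemma hausdorff1_pre_mono: "A \<subseteq> B ==> hausdorff1_pre dl A <= hausdorff1_pre dl B"
 unfolding hausdorff1_pre_def[of _ B]
 by (rule Inf_greatest, clarify, rule hausdorff1_pre_le) auto

lemma hausdorff1_outer_mono: "A \<subseteq> B ==> hausdorff1_outer A <= hausdorff1_outer B"
 by (meson hausdorff1_outer_leI hausdorff1_pre_le_outer hausdorff1_pre_mono order_trans)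

lemma hausdorff1_outer_empty [simp]: "hausdorff1_outer {} = 0"
proof -
 have "hausdorff1_pre dl {} <= 0" if "0 < dl" for dl
  using hausdorff1_pre_le[of "{}" "%_. {}" dl] that by simp
 then show ?thesis
  by (metis bot.extremum bot_ennreal hausdorff1_outer_leI order_antisym)
qed

lemma hausdorff1_pre_lessE:
 assumes "hausdorff1_pre dl A < x"
 obtains U where "A \<subseteq> (\<Union>n. U n)" "!!n. bounded (U n)" "!!n. diameter (U n) <= dl"
  "(\<Sum>n. ennreal (diameter (U n))) < x"
 using assms unfolding hausdorff1_pre_def Inf_less_iff by blast

text \<open>The usual argument with slack \<open>e / 2^(n+1)\<close>, carried out at each fixed
  scale \<open>dl\<close>; only the last comparison passes to the supremum over the scales.\<close>

lemma hausdorff1_outer_countably_subadditive: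
 "hausdorff1_outer (\<Union>i. A i) <= (\<Sum>i::nat. hausdorff1_outer (A i))"
proof (rule hausdorff1_outer_leI)
 fix dl :: real assume dl: "0 < dl"
 have "hausdorff1_pre dl (\<Union>i. A i) <= (\<Sum>i. hausdorff1_pre dl (A i))"
 proof (rule ennreal_le_epsilon)
  fix e :: real assume "0 < e" "(\<Sum>i. hausdorff1_pre dl (A i)) < top"
  then have *: "!!n. hausdorff1_pre dl (A n) < hausdorff1_pre dl (A n) + e * (1/2)^Suc n"
   by (auto simp add: less_top dest!: ennreal_suminf_lessD)
  have "EX U. A n \<subseteq> (\<Union>i. U i) & (ALL i. bounded (U i) & diameter (U i) <= dl) &
    (\<Sum>i. ennreal (diameter (U i))) <= hausdorff1_pre dl (A n) + e * (1/2)^(Suc n)" for n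
   by (rule hausdorff1_pre_lessE[OF *[of n]]) (meson less_imp_le)
  then obtain B where B: "!!n. A n \<subseteq> (\<Union>i. B n i)" "!!n i. bounded (B n i)"
   "!!n i. diameter (B n i) <= dl"
   "!!n. (\<Sum>i. ennreal (diameter (B n i))) <= hausdorff1_pre dl (A n) + e * (1/2)^(Suc n)"
   by metis
  define C where "C = case_prod B o prod_decode"
  have "(\<Union>i. A i) \<subseteq> (\<Union>i. C i)"
   using B(1) by (auto simp add: C_def subset_eq) (metis prod.case prod_encode_inverse)
  then have "hausdorff1_pre dl (\<Union>i. A i) <= (\<Sum>i. ennreal (diameter (C i)))"
   by (rule hausdorff1_pre_le) (auto simp: C_def B split: prod.split)
  also have "... = (\<Sum>n. \<Sum>i. ennreal (diameter (B n i)))"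
   unfolding C_def comp_def
   by (subst suminf_ennreal_2dimen[where f = "%p. ennreal (diameter (case_prod B p))", symmetric])
     auto
  also have "... <= (\<Sum>n. hausdorff1_pre dl (A n) + e * (1/2) ^ Suc n)"
   by (intro suminf_le allI B(4)) auto
  also have "... = (\<Sum>n. hausdorff1_pre dl (A n)) + (\<Sum>n. ennreal e * ennreal ((1/2) ^ Suc n))"
   using \<open>0 < e\<close> by (subst suminf_add[symmetric])
            (auto simp del: ennreal_suminf_cmult simp add: ennreal_mult[symmetric])
  also have "... = (\<Sum>n. hausdorff1_pre dl (A n)) + e"
   unfolding ennreal_suminf_cmult
   by (subst suminf_ennreal_eq[OF zero_le_power power_half_series]) auto
  finally show "hausdorff1_pre dl (\<Union>i. A i) <= (\<Sum>n. hausdorff1_pre dl (A n)) + e" .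
 qed
 also have "... <= (\<Sum>i. hausdorff1_outer (A i))"
  by (intro suminf_le hausdorff1_pre_le_outer dl) auto
 finally show "hausdorff1_pre dl (\<Union>i. A i) <= (\<Sum>i. hausdorff1_outer (A i))" .
qed

lemma hausdorff1_outer_Un: "hausdorff1_outer (A \<union> B) <= hausdorff1_outer A + hausdorff1_outer B"
proof -
 define C where "C i = (if i = 0 then A else if i = 1 then B else {})" for i :: nat
 have "hausdorff1_outer (\<Union>i. C i) <= (\<Sum>i. hausdorff1_outer (C i))"
  by (rule hausdorff1_outer_countably_subadditive)
 also have "(\<Sum>i. hausdorff1_outer (C i)) = (\<Sum>i\<in>{0,1}. hausdorff1_outer (C i))"
  by (rule suminf_finite) (auto simp: C_def)
 also have "(\<Union>i. C i) = A \<union> B"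
  by (auto simp: C_def split: if_splits intro: exI[of _ 0] exI[of _ 1])
 finally show ?thesis by (simp add: C_def)
qed

text \<open>A cover by sets of diameter below \<open>d\<close> splits into the sets that meet
  \<open>A\<close> and those that meet \<open>B\<close>, because a set meeting both would have
  diameter at least \<open>d\<close>.\<close>

lemma hausdorff1_outer_separated:
 assumes "0 < d" and sep: "!!x y. x \<in> A ==> y \<in> B ==> d <= dist x y"
 shows "hausdorff1_outer A + hausdorff1_outer B <= hausdorff1_outer (A \<union> B)"
proof -
 have "hausdorff1_pre dl A + hausdorff1_pre dl' B <= hausdorff1_outer (A \<union> B)"
  if "0 < dl" "0 < dl'" for dl dl'
 proof -
  \<comment> \<open>Fine enough for both scales, as \<open>hausdorff1_pre\<close> grows when the
    scale shrinks, and strictly below the separation \<open>d\<close>.\<close>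
  define eta where "eta = min (min dl dl') (d / 2)"
  have eta: "0 < eta" "eta <= dl" "eta <= dl'" "eta < d"
   using that \<open>0 < d\<close> by (auto simp: eta_def)
  have "hausdorff1_pre dl A + hausdorff1_pre dl' B <= hausdorff1_pre eta A + hausdorff1_pre eta B"
   by (intro add_mono hausdorff1_pre_antimono eta)
  also have "... <= hausdorff1_pre eta (A \<union> B)"
   unfolding hausdorff1_pre_def[of eta "A \<union> B"]
  proof (rule Inf_greatest, clarify)
   fix U assume U: "A \<union> B \<subseteq> (\<Union>n::nat. U n)" "ALL n. bounded (U n) & diameter (U n) <= eta"
   define UA where "UA n = (if U n \<inter> A = {} then {} else U n)" for n
   define UB where "UB n = (if U n \<inter> B = {} then {} else U n)" for n
   have nd: "0 <= diameter (U n)" for n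
    using U(2) diameter_ge_0 by blast
   have "hausdorff1_pre eta A <= (\<Sum>n. ennreal (diameter (UA n)))"
    by (rule hausdorff1_pre_le) (use U eta in \<open>auto simp: UA_def subset_eq\<close>, blast)
   moreover have "hausdorff1_pre eta B <= (\<Sum>n. ennreal (diameter (UB n)))"
    by (rule hausdorff1_pre_le) (use U eta in \<open>auto simp: UB_def subset_eq\<close>, blast)
   moreover have "ennreal (diameter (UA n)) + ennreal (diameter (UB n)) <= ennreal (diameter (U n))" for n
   proof (cases "U n \<inter> A = {} | U n \<inter> B = {}")
    case True
    then show ?thesis by (auto simp: UA_def UB_def nd)
   next
    case False
    then obtain x y where xy: "x \<in> U n" "x \<in> A" "y \<in> U n" "y \<in> B" by blast
    then have "d <= diameter (U n)"
     using sep U(2) diameter_bounded_bound[of "U n" x y] by (meson order_trans)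
    then show ?thesis using U(2) eta by (meson leD order_trans)
   qed
   then have "(\<Sum>n. ennreal (diameter (UA n))) + (\<Sum>n. ennreal (diameter (UB n)))
     <= (\<Sum>n. ennreal (diameter (U n)))"
    by (subst suminf_add) (auto intro!: suminf_le)
   ultimately show "hausdorff1_pre eta A + hausdorff1_pre eta B <= (\<Sum>n. ennreal (diameter (U n)))"
    by (meson add_mono order_trans)
  qed
  also have "... <= hausdorff1_outer (A \<union> B)"
   by (rule hausdorff1_pre_le_outer[OF eta(1)])
  finally show ?thesis .
 qed
 then have "(SUP dl\<in>{0<..}. SUP dl'\<in>{0<..}. hausdorff1_pre dl A + hausdorff1_pre dl' B)
   <= hausdorff1_outer (A \<union> B)"
  by (intro SUP_least) auto
 moreover have "{0::real<..} ~= {}" by (metis empty_iff greaterThan_iff zero_less_one)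
 ultimately show ?thesis
  unfolding hausdorff1_outer_def[of A] hausdorff1_outer_def[of B]
  by (simp only: ennreal_SUP_add_right[symmetric] ennreal_SUP_add_left[symmetric] not_False_eq_True)
qed

text \<open>Caratheodory's argument: with \<open>B\<^sub>n\<close> the points of \<open>A\<close> at distance at least \<open>1/(n+1)\<close> from the
 closed set, the rings \<open>B\<^sub>n\<^sub>+\<^sub>2 - B\<^sub>n\<^sub>+\<^sub>1\<close> are separated from \<open>B\<^sub>n\<close>, so that their outer measures are
 summable.\<close>

lemma hausdorff1_outer_closed_split:
 assumes "closed F"
 shows "hausdorff1_outer (F \<inter> A) + hausdorff1_outer (A - F) <= hausdorff1_outer A"
proof (cases "F = {} | hausdorff1_outer A = top")
 case True
 then show ?thesis by auto
next
 case False
 then have F: "F ~= {}" and fin: "hausdorff1_outer A ~= top" by auto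
 define B where "B n = {x \<in> A. 1 / real (n + 1) <= infdist x F}" for n
 define R where "R n = B (n + 2) - B (n + 1)" for n
 have mono: "B n \<subseteq> B (n + 1)" for n
 proof -
  have "1 / real (n + 1 + 1) <= 1 / real (n + 1)" by (simp add: field_simps)
  then show ?thesis by (auto simp: B_def simp del: of_nat_add)
 qed
 have BA: "B n \<subseteq> A" for n by (auto simp: B_def)
 have sepd: "hausdorff1_outer X + hausdorff1_outer Y <= hausdorff1_outer Z"
  if "p < q" "!!x. x \<in> X ==> q <= infdist x F" "!!y. y \<in> Y ==> infdist y F <= p" "X \<union> Y \<subseteq> Z"
  for X Y Z p q
 proof -
  have "q - p <= dist x y" if "x \<in> X" "y \<in> Y" for x y
   using infdist_triangle[of x F y] \<open>!!x. x \<in> X ==> q <= infdist x F\<close>[OF that(1)]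
    \<open>!!y. y \<in> Y ==> infdist y F <= p\<close>[OF that(2)] by simp
  then have "hausdorff1_outer X + hausdorff1_outer Y <= hausdorff1_outer (X \<union> Y)"
   using \<open>p < q\<close> by (intro hausdorff1_outer_separated[of "q - p"]) auto
  also have "... <= hausdorff1_outer Z" by (intro hausdorff1_outer_mono that)
  finally show ?thesis .
 qed
 have step: "hausdorff1_outer (B n) + hausdorff1_outer (R n) <= hausdorff1_outer (B (n + 2))" for n
  by (rule sepd[of "1 / real (n + 2)" "1 / real (n + 1)"])
    (use mono[of n] mono[of "n+1"] in \<open>auto simp: R_def B_def field_simps\<close>)
 \<comment> \<open>One induction handles even and odd indices together: \<open>step\<close> merges
   \<open>R n\<close> with \<open>B n\<close> into \<open>B (n + 2)\<close>, so the pair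
   \<open>n, n + 1\<close> becomes the pair \<open>n + 1, n + 2\<close>.\<close>
 have sums: "(\<Sum>k<n. hausdorff1_outer (R k)) <= hausdorff1_outer (B n) + hausdorff1_outer (B (n + 1))" for n
 proof (induction n)
  case (Suc n)
  have "(\<Sum>k<Suc n. hausdorff1_outer (R k))
    <= hausdorff1_outer (B n) + hausdorff1_outer (B (n + 1)) + hausdorff1_outer (R n)"
   using Suc by (simp add: add_right_mono)
  also have "... <= hausdorff1_outer (B (n + 1)) + hausdorff1_outer (B (n + 2))"
   using add_left_mono[OF step[of n], of "hausdorff1_outer (B (n + 1))"] by (simp add: ac_simps)
  finally show ?case by simp
 qed simp
 have "(\<Sum>k. hausdorff1_outer (R k)) <= hausdorff1_outer A + hausdorff1_outer A"
  by (intro suminf_le_const summableI)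
    (rule order_trans[OF sums add_mono[OF hausdorff1_outer_mono[OF BA] hausdorff1_outer_mono[OF BA]]])
 then have Rfin: "(\<Sum>k. hausdorff1_outer (R k)) ~= top"
  using fin by (auto simp: top_unique ennreal_add_eq_top)
 have bound: "hausdorff1_outer (F \<inter> A) + hausdorff1_outer (A - F)
   <= hausdorff1_outer A + (\<Sum>k. hausdorff1_outer (R (k + n)))" for n
 proof -
  have "x \<in> B (n + 1) \<union> (\<Union>k. R (k + n))" if x: "x \<in> A - F" for x
  proof -
   have "0 < infdist x F"
    using x assms F in_closed_iff_infdist_zero[of F x] infdist_nonneg[of x F] by fastforce
   then obtain N where "1 / real (Suc N) < infdist x F"
    using nat_approx_posE by metis
   then have ex: "EX N. x \<in> B N" using x by (intro exI[of _ N]) (simp add: B_def)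
   define N0 where "N0 = (LEAST N. x \<in> B N)"
   have N0: "x \<in> B N0" "!!k. k < N0 ==> x \<notin> B k"
    using ex LeastI_ex not_less_Least unfolding N0_def by metis+
   show ?thesis
   proof (cases "N0 <= n + 1")
    case True
    have "B N0 \<subseteq> B (n + 1)"
     by (rule lift_Suc_mono_le[of B]) (use mono True in auto)
    then show ?thesis using N0 by blast
   next
    case False
    \<comment> \<open>\<open>N0\<close> is the first index with \<open>x \<in> B N0\<close>, so
      \<open>x\<close> lies in the ring \<open>R (N0 - 2)\<close>; the truncated subtractions are
      exact because \<open>N0 > n + 1\<close>.\<close>
    then have "(N0 - 2 - n) + n + 2 = N0" "(N0 - 2 - n) + n + 1 < N0" by linarith+
    then have "x \<in> R ((N0 - 2 - n) + n)"
     unfolding R_def using N0(1) N0(2)[of "(N0 - 2 - n) + n + 1"] by (simp only: Diff_iff) blast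
    then show ?thesis by blast
   qed
  qed
  then have "hausdorff1_outer (A - F) <= hausdorff1_outer (B (n + 1) \<union> (\<Union>k. R (k + n)))"
   by (intro hausdorff1_outer_mono) blast
  also have "... <= hausdorff1_outer (B (n + 1)) + hausdorff1_outer (\<Union>k. R (k + n))"
   by (rule hausdorff1_outer_Un)
  also have "... <= hausdorff1_outer (B (n + 1)) + (\<Sum>k. hausdorff1_outer (R (k + n)))"
   by (intro add_left_mono hausdorff1_outer_countably_subadditive)
  finally have "hausdorff1_outer (F \<inter> A) + hausdorff1_outer (A - F) <=
    (hausdorff1_outer (B (n + 1)) + hausdorff1_outer (F \<inter> A)) + (\<Sum>k. hausdorff1_outer (R (k + n)))"
   using add_left_mono[of "hausdorff1_outer (A - F)" _ "hausdorff1_outer (F \<inter> A)"] by (simp add: ac_simps)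
  also have "hausdorff1_outer (B (n + 1)) + hausdorff1_outer (F \<inter> A) <= hausdorff1_outer A"
   by (rule sepd[of 0 "1 / real (n + 2)"]) (auto simp: B_def)
  finally show ?thesis by (simp add: add_right_mono)
 qed
 have "(%n. \<Sum>k. hausdorff1_outer (R (k + n))) \<longlonglongrightarrow> 0"
 proof -
  have "(\<Sum>k. hausdorff1_outer (R (k + n))) = ennreal (\<Sum>k. enn2real (hausdorff1_outer (R (k + n))))"
   and sm: "summable (%k. enn2real (hausdorff1_outer (R k)))" for n
  proof -
   have fin_k: "hausdorff1_outer (R k) ~= top" for k
    using Rfin ennreal_suminf_lessD[of "%k. hausdorff1_outer (R k)" top k] by (simp add: less_top)
   have e: "hausdorff1_outer (R k) = ennreal (enn2real (hausdorff1_outer (R k)))" for k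
    using fin_k by (simp add: less_top)
   show sm: "summable (%k. enn2real (hausdorff1_outer (R k)))"
    by (rule summable_suminf_not_top) (auto simp: e[symmetric] Rfin)
   then have "summable (%k. enn2real (hausdorff1_outer (R (k + n))))"
    by (subst summable_iff_shift)
   then show "(\<Sum>k. hausdorff1_outer (R (k + n))) = ennreal (\<Sum>k. enn2real (hausdorff1_outer (R (k + n))))"
    by (subst e) (intro suminf_ennreal_eq summable_sums, auto)
  qed
  moreover have "(%n. \<Sum>k. enn2real (hausdorff1_outer (R (k + n)))) \<longlonglongrightarrow> 0"
   by (rule suminf_exist_split2[OF sm])
  ultimately show ?thesis using tendsto_ennrealI by fastforce
 qed
 then have "(%n. hausdorff1_outer A + (\<Sum>k. hausdorff1_outer (R (k + n)))) \<longlonglongrightarrow> hausdorff1_outer A + 0"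
  by (intro tendsto_add tendsto_const)
 then have "hausdorff1_outer (F \<inter> A) + hausdorff1_outer (A - F) <= hausdorff1_outer A + 0"
  by (rule LIMSEQ_le_const) (use bound in auto)
 then show ?thesis by simp
qed

text \<open>By Caratheodory the outer measure is countably additive on its lambda system. The closed
  sets belong to it by the preceding splitting, hence so do the Borel sets. Without this
  \<open>measure_of\<close> in the definition of \<open>hausdorff1\<close> would collapse to
  zero.\<close>

lemma measure_space_hausdorff1: "measure_space UNIV (sets borel) hausdorff1_outer"
proof -
 interpret sigma_algebra UNIV "UNIV :: 'a set set" using sigma_algebra_Pow[of "UNIV::'a set"] by simp
 have oms: "outer_measure_space (UNIV :: 'a set set) hausdorff1_outer"
  by (auto simp: outer_measure_space_def positive_def increasing_def countably_subadditive_def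
    hausdorff1_outer_mono hausdorff1_outer_countably_subadditive)
 define L where "L = lambda_system UNIV (UNIV :: 'a set set) hausdorff1_outer"
 have ms: "measure_space UNIV L hausdorff1_outer"
  unfolding L_def by (rule caratheodory_lemma[OF oms])
 have cl: "F \<in> L" if "closed F" for F
 proof -
  have "hausdorff1_outer (F \<inter> A) + hausdorff1_outer (A - F) = hausdorff1_outer A" for A
   using hausdorff1_outer_closed_split[OF that, of A] hausdorff1_outer_Un[of "F \<inter> A" "A - F"]
   by (metis Int_Diff_Un Int_commute antisym)
  then show ?thesis
   by (simp add: L_def lambda_system_def Diff_eq Int_commute)
 qed
 have "sigma_algebra UNIV L" using ms by (simp add: measure_space_def)
 then have "sigma_sets UNIV {F::'a set. closed F} \<subseteq> L"
  by (rule sigma_algebra.sigma_sets_subset) (use cl in auto)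
 then have "sets borel \<subseteq> L"
  by (simp add: borel_eq_closed)
 then show ?thesis
  by (rule measure_down[OF ms, rotated]) (metis sets.sigma_algebra_axioms space_borel)
qed

lemma sets_hausdorff1 [simp, measurable_cong]: "sets hausdorff1 = sets borel"
 unfolding hausdorff1_def by (simp add: sets_measure_of_conv) (metis sets.sigma_sets_eq space_borel)

lemma space_hausdorff1 [simp]: "space hausdorff1 = UNIV"
 by (simp add: hausdorff1_def space_measure_of_conv)

lemma emeasure_hausdorff1: "A \<in> sets borel ==> emeasure hausdorff1 A = hausdorff1_outer A"
 unfolding hausdorff1_def
 by (rule emeasure_measure_of_sigma)
   (use measure_space_hausdorff1 in \<open>auto simp: measure_space_def\<close>)

section \<open>Lipschitz images, Lebesgue measure on the line and arc length\<close>

lemma hausdorff1_outer_lipschitz_image: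
 fixes f :: "'a::metric_space => 'b::metric_space"
 assumes "0 < K" and lip: "!!x y. x \<in> A ==> y \<in> A ==> dist (f x) (f y) <= K * dist x y"
 shows "hausdorff1_outer (f ` A) <= ennreal K * hausdorff1_outer A"
proof (rule hausdorff1_outer_leI)
 fix dl :: real assume "0 < dl"
 have "hausdorff1_pre dl (f ` A) / K <= hausdorff1_pre (dl / K) A"
  unfolding hausdorff1_pre_def[of _ A]
 proof (rule Inf_greatest, clarify)
  fix U assume U: "A \<subseteq> (\<Union>n::nat. U n)" "ALL n. bounded (U n) & diameter (U n) <= dl / K"
  have nd: "0 <= diameter (U n)" for n
   using U(2) diameter_ge_0 by blast
  \<comment> \<open>The map is Lipschitz only on \<open>A\<close>, so the covering sets are cut down
    to \<open>A\<close> before they are mapped.\<close>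
  define V where "V n = f ` (U n \<inter> A)" for n
  have VV: "dist p q <= K * diameter (U n)" if pq: "p \<in> V n" "q \<in> V n" for n p q
  proof -
   obtain x y where xy: "x \<in> U n" "y \<in> U n" "x \<in> A" "y \<in> A" "p = f x" "q = f y"
    using pq unfolding V_def by blast
   have "dist p q <= K * dist x y" using xy lip by auto
   also have "... <= K * diameter (U n)"
    using U(2) xy \<open>0 < K\<close> by (simp add: diameter_bounded_bound)
   finally show ?thesis .
  qed
  have bV: "bounded (V n)" for n
   unfolding bounded_two_points using VV by blast
  have dV: "diameter (V n) <= K * diameter (U n)" for n
  proof (cases "V n = {}")
   case False
   then have "(SUP (x, y)\<in>V n \<times> V n. dist x y) <= K * diameter (U n)"
    using VV by (intro cSUP_least) auto
   then show ?thesis using False by (simp add: diameter_def[of "V n"])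
  qed (use nd \<open>0 < K\<close> in auto)
  have "hausdorff1_pre dl (f ` A) <= (\<Sum>n. ennreal (diameter (V n)))"
  proof (rule hausdorff1_pre_le)
   show "f ` A \<subseteq> (\<Union>n. V n)" using U(1) by (auto simp: V_def subset_eq) blast
   show "diameter (V n) <= dl" for n
    using dV[of n] U(2) \<open>0 < K\<close> by (auto simp: field_simps intro: order_trans)
  qed (rule bV)
  also have "... <= (\<Sum>n. ennreal K * ennreal (diameter (U n)))"
   using dV nd \<open>0 < K\<close> by (intro suminf_le) (auto simp: ennreal_mult[symmetric] intro!: ennreal_leI)
  finally have "hausdorff1_pre dl (f ` A) <= ennreal K * (\<Sum>n. ennreal (diameter (U n)))" by simp
  then show "hausdorff1_pre dl (f ` A) / K <= (\<Sum>n. ennreal (diameter (U n)))"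
   using \<open>0 < K\<close> by (intro divide_le_posI_ennreal) auto
 qed
 also have "... <= hausdorff1_outer A"
  using \<open>0 < dl\<close> \<open>0 < K\<close> by (intro hausdorff1_pre_le_outer) auto
 finally have "ennreal K * (hausdorff1_pre dl (f ` A) / K) <= ennreal K * hausdorff1_outer A"
  by (rule mult_left_mono) simp
 also have "ennreal K * (hausdorff1_pre dl (f ` A) / K) = hausdorff1_pre dl (f ` A)"
  using \<open>0 < K\<close> by (cases "hausdorff1_pre dl (f ` A)")
   (auto simp: divide_ennreal ennreal_mult[symmetric] ennreal_top_divide ennreal_mult_top)
 finally show "hausdorff1_pre dl (f ` A) <= ennreal K * hausdorff1_outer A" .
qed

lemma hausdorff1_outer_interval_le:
 assumes "a <= b" shows "hausdorff1_outer {a..b::real} <= ennreal (b - a)"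
proof (rule hausdorff1_outer_leI)
 fix dl :: real assume "0 < dl"
 obtain N :: nat where N: "(b - a) / dl < N" using reals_Archimedean2 by blast
 then have N0: "0 < N" using assms \<open>0 < dl\<close> by (cases N) (auto simp: field_simps)
 define h where "h = (b - a) / N"
 have h: "0 <= h" "h <= dl" "N * h = b - a"
  using N N0 assms \<open>0 < dl\<close> by (auto simp: h_def field_simps)
 define U where "U n = (if n < N then {a + n * h .. a + (n + 1) * h} else {})" for n :: nat
 have dU: "diameter (U n) = (if n < N then h else 0)" for n
  using h by (auto simp: U_def diameter_closed_interval algebra_simps)
 have "hausdorff1_pre dl {a..b} <= (\<Sum>n. ennreal (diameter (U n)))"
 proof (rule hausdorff1_pre_le)
  show "{a..b} \<subseteq> (\<Union>n. U n)"
  proof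
   fix x assume x: "x \<in> {a..b}"
   show "x \<in> (\<Union>n. U n)"
   \<comment> \<open>For \<open>x = b\<close> the floor would give \<open>N\<close>, one past the
     last piece; and \<open>h = 0\<close> forces \<open>a = b\<close>, hence again
     \<open>x = b\<close>.\<close>
   proof (cases "x = b | h = 0")
    case True
    then have "x = b" using x h by auto
    then have "x \<in> U (N - 1)" using N0 h by (auto simp: U_def algebra_simps)
    then show ?thesis by blast
   next
    case False
    then have hp: "0 < h" and xb: "x < b" using h x by auto
    define n where "n = nat \<lfloor>(x - a) / h\<rfloor>"
    have "real n <= (x - a) / h" "(x - a) / h < real n + 1"
     using x hp by (auto simp: n_def)
    then have n: "real n * h <= x - a" "x - a < (real n + 1) * h"
     using hp by (auto simp: field_simps)
    then have "real n * h < N * h" using xb h by linarith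
    then have "n < N" using hp by simp
    then have "x \<in> U n" using n by (auto simp: U_def algebra_simps)
    then show ?thesis by blast
   qed
  qed
 qed (use h \<open>0 < dl\<close> in \<open>auto simp: dU, auto simp: U_def\<close>)
 also have "... = (\<Sum>n<N. ennreal (diameter (U n)))"
  by (rule suminf_finite) (auto simp: dU)
 also have "... = ennreal (b - a)"
  using h by (simp add: dU flip: h(3)) (simp add: ennreal_mult ennreal_of_nat_eq_real_of_nat)
 finally show "hausdorff1_pre dl {a..b} <= ennreal (b - a)" .
qed

text \<open>Every bounded subset of the line lies in a closed interval whose length is its diameter,
  so each cover bounds the Lebesgue measure; the scale 1 is as good as any other.\<close>

lemma emeasure_lborel_le_hausdorff1_outer:
 assumes "B \<in> sets borel" shows "emeasure lborel B <= hausdorff1_outer (B :: real set)"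
proof -
 have "emeasure lborel B <= hausdorff1_pre 1 B"
  unfolding hausdorff1_pre_def
 proof (rule Inf_greatest, clarify)
  fix U assume U: "B \<subseteq> (\<Union>n::nat. U n)" "ALL n. bounded (U n) & diameter (U n) <= 1"
  have "\<exists>V \<in> sets borel. U n \<subseteq> V & emeasure lborel V = ennreal (diameter (U n))" for n
  proof (cases "U n = {}")
   case False
   have b: "bounded (U n)" using U by blast
   define a where "a = Inf (U n)"
   have sub: "U n \<subseteq> {a .. a + diameter (U n)}"
   proof
    fix x assume x: "x \<in> U n"
    have "a <= x" unfolding a_def by (rule cInf_lower[OF x]) (rule bounded_imp_bdd_below[OF b])
    moreover have "x - diameter (U n) <= a"
     unfolding a_def
    proof (rule cInf_greatest[OF False])
     fix y assume "y \<in> U n"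
     then have "dist x y <= diameter (U n)" using diameter_bounded_bound[OF b x] by blast
     then show "x - diameter (U n) <= y" by (auto simp: dist_real_def)
    qed
    ultimately show "x \<in> {a .. a + diameter (U n)}" by auto
   qed
   then show ?thesis using diameter_ge_0[OF b] by (intro bexI[of _ "{a .. a + diameter (U n)}"]) auto
  qed auto
  then obtain V where V: "!!n. V n \<in> sets borel" "!!n. U n \<subseteq> V n"
   "!!n. emeasure lborel (V n) = ennreal (diameter (U n))" by metis
  have "B \<subseteq> (\<Union>n. V n)" using U(1) V(2) by blast
  then have "emeasure lborel B <= emeasure lborel (\<Union>n. V n)"
   using V by (intro emeasure_mono) auto
  also have "... <= (\<Sum>n. emeasure lborel (V n))"
   using V by (intro emeasure_subadditive_countably) auto
  finally show "emeasure lborel B <= (\<Sum>n. ennreal (diameter (U n)))" by (simp add: V)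
 qed
 then show ?thesis using hausdorff1_pre_le_outer[of 1 B] by simp
qed

lemma hausdorff1_real: "(hausdorff1 :: real measure) = lborel"
proof (rule lborel_eqI[symmetric])
 fix l u :: real assume "!!b. b \<in> Basis ==> l \<bullet> b <= u \<bullet> b"
 then have "l <= u" by simp
 have "emeasure hausdorff1 (box l u) = hausdorff1_outer {l<..<u}"
  by (simp add: emeasure_hausdorff1)
 also have "... = ennreal (u - l)"
 proof (rule antisym)
  show "hausdorff1_outer {l<..<u} <= ennreal (u - l)"
   using hausdorff1_outer_interval_le[OF \<open>l <= u\<close>] hausdorff1_outer_mono[of "{l<..<u}" "{l..u}"]
   by (meson greaterThanLessThan_subseteq_atLeastAtMost_iff order_refl order_trans)
  show "ennreal (u - l) <= hausdorff1_outer {l<..<u}"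
   using emeasure_lborel_le_hausdorff1_outer[of "{l<..<u}"] \<open>l <= u\<close> by simp
 qed
 finally show "emeasure hausdorff1 (box l u) = ennreal (\<Prod>b\<in>Basis. (u - l) \<bullet> b)" by simp
qed simp

text \<open>Where the speed is \<open>v\<close> up to \<open>eps\<close>, the map \<open>c\<close>
  changes distances by factors between \<open>v - eps\<close> and \<open>v + eps\<close>. Both
  measures then lie between \<open>(v - eps) * l\<close> and \<open>(v + eps) * l\<close>, with
  \<open>l\<close> the length of \<open>B\<close>; for the lower Hausdorff bound the inverse of
  \<open>c\<close> is Lipschitz with constant \<open>1 / (v - eps)\<close>, and if
  \<open>v <= eps\<close> the lower bounds are trivial.\<close>

lemma hausdorff1_biLipschitz_piece:
 fixes c :: "real => 'a::euclidean_space"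
 assumes B: "B \<in> sets borel" "emeasure lborel B < top" and cB: "c ` B \<in> sets borel"
  and cont: "continuous_on UNIV c'" and eps: "0 < eps" and v: "0 <= v"
  and speed: "!!s. s \<in> B ==> \<bar>norm (c' s) - v\<bar> <= eps"
  and lip: "!!s t. s \<in> B ==> t \<in> B ==> \<bar>dist (c s) (c t) - v * \<bar>s - t\<bar>\<bar> <= eps * \<bar>s - t\<bar>"
 defines "D \<equiv> density lborel (%s. ennreal (norm (c' s :: 'a)))"
 shows "emeasure hausdorff1 (c ` B) <= emeasure D B + 2 * ennreal eps * emeasure lborel B"
  and "emeasure D B <= emeasure hausdorff1 (c ` B) + 2 * ennreal eps * emeasure lborel B"
proof -
 have [measurable]: "c' \<in> borel_measurable borel"
  using cont by (rule borel_measurable_continuous_onI)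
 obtain l where l: "0 <= l" "emeasure lborel B = ennreal l"
  using B(2) by (cases "emeasure lborel B") auto
 have HB: "hausdorff1_outer B = ennreal l"
  using emeasure_hausdorff1[OF B(1)] l by (simp add: hausdorff1_real)
 have D: "emeasure D B = (\<integral>\<^sup>+ s. ennreal (norm (c' s)) * indicator B s \<partial>lborel)"
  unfolding D_def using B(1) by (subst emeasure_density) auto
 have D_le: "emeasure D B <= ennreal ((v + eps) * l)"
 proof -
  have "emeasure D B <= (\<integral>\<^sup>+ s. ennreal (v + eps) * indicator B s \<partial>lborel)"
   unfolding D by (intro nn_integral_mono) (use speed in \<open>auto simp: indicator_def abs_le_iff intro!: ennreal_leI\<close>, force)
  also have "... = ennreal ((v + eps) * l)"
   using B(1) l v eps by (simp add: nn_integral_cmult_indicator ennreal_mult)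
  finally show ?thesis .
 qed
 have D_ge: "ennreal ((v - eps) * l) <= emeasure D B"
 proof (cases "eps <= v")
  case True
  have "ennreal ((v - eps) * l) = (\<integral>\<^sup>+ s. ennreal (v - eps) * indicator B s \<partial>lborel)"
   using B(1) l True by (simp add: nn_integral_cmult_indicator ennreal_mult)
  also have "... <= emeasure D B"
   unfolding D by (intro nn_integral_mono) (use speed in \<open>auto simp: indicator_def abs_le_iff intro!: ennreal_leI\<close>, force)
  finally show ?thesis .
 qed (use l in \<open>simp add: mult_nonpos_nonneg ennreal_neg\<close>)
 have H: "emeasure hausdorff1 (c ` B) = hausdorff1_outer (c ` B)"
  by (rule emeasure_hausdorff1[OF cB])
 have H_le: "emeasure hausdorff1 (c ` B) <= ennreal ((v + eps) * l)"
 proof -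
  have "hausdorff1_outer (c ` B) <= ennreal (v + eps) * hausdorff1_outer B"
  proof (rule hausdorff1_outer_lipschitz_image)
   show "dist (c s) (c t) <= (v + eps) * dist s t" if "s \<in> B" "t \<in> B" for s t
    using lip[OF that] by (simp add: dist_real_def abs_le_iff algebra_simps)
  qed (use eps v in simp)
  then show ?thesis using HB H l v eps by (simp add: ennreal_mult)
 qed
 have H_ge: "ennreal ((v - eps) * l) <= emeasure hausdorff1 (c ` B)"
 proof (cases "eps < v")
  case True
  have low: "\<bar>s - t\<bar> <= (1 / (v - eps)) * dist (c s) (c t)" if "s \<in> B" "t \<in> B" for s t
  proof -
   have "(v - eps) * \<bar>s - t\<bar> <= dist (c s) (c t)"
    using lip[OF that] by (simp add: abs_le_iff left_diff_distrib)
   then show ?thesis using True by (simp add: pos_le_divide_eq mult.commute)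
  qed
  have inj: "inj_on c B" using low by (fastforce intro!: inj_onI)
  have "hausdorff1_outer (the_inv_into B c ` c ` B) <= ennreal (1 / (v - eps)) * hausdorff1_outer (c ` B)"
   by (rule hausdorff1_outer_lipschitz_image)
     (use True low in \<open>auto simp: the_inv_into_f_f[OF inj] dist_real_def\<close>)
  then have "ennreal l <= ennreal (1 / (v - eps)) * hausdorff1_outer (c ` B)"
   using HB by (simp add: the_inv_into_onto[OF inj])
  then have "ennreal (v - eps) * ennreal l
    <= ennreal (v - eps) * (ennreal (1 / (v - eps)) * hausdorff1_outer (c ` B))"
   by (rule mult_left_mono) simp
  also have "... = hausdorff1_outer (c ` B)"
   using True by (simp add: mult.assoc[symmetric] ennreal_mult[symmetric])
  finally show ?thesis using True H l by (simp add: ennreal_mult)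
 qed (use l in \<open>simp add: mult_nonpos_nonneg ennreal_neg\<close>)
 have *: "ennreal ((v + eps) * l) <= x + 2 * ennreal eps * emeasure lborel B"
  if "ennreal ((v - eps) * l) <= x" for x
 proof -
  have "ennreal ((v + eps) * l) <= ennreal (max 0 ((v - eps) * l) + 2 * eps * l)"
   by (intro ennreal_leI) (simp add: algebra_simps)
  also have "... = ennreal ((v - eps) * l) + 2 * ennreal eps * ennreal l"
   using l eps by (simp add: ennreal_plus ennreal_mult max_def ennreal_neg)
  finally show ?thesis using that l by (metis add_right_mono order_trans)
 qed
 show "emeasure hausdorff1 (c ` B) <= emeasure D B + 2 * ennreal eps * emeasure lborel B"
  using H_le *[OF D_ge] by (rule order_trans)
 show "emeasure D B <= emeasure hausdorff1 (c ` B) + 2 * ennreal eps * emeasure lborel B"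
  using D_le *[OF H_ge] by (rule order_trans)
qed

text \<open>The area formula for curves. By uniform continuity of \<open>c'\<close> the period is
  cut into pieces on which the previous lemma applies with the same \<open>eps\<close>; the errors
  add up to at most \<open>2 * eps * T\<close>, and \<open>eps\<close> tends to 0. The half-open
  period is what makes \<open>c\<close> injective.\<close>

lemma emeasure_hausdorff1_curve:
 fixes c :: "real => 'a::euclidean_space"
 assumes "0 < T" and der: "!!s. (c hvd c' s) (at s)"
  and cont: "continuous_on UNIV c'" and inj: "inj_on c {0..<T}" and A: "A \<in> sets borel"
 shows "c ` {0..<T} \<in> sets borel"
  and "emeasure hausdorff1 (A \<inter> c ` {0..<T})
   = (\<integral>\<^sup>+ s. ennreal (norm (c' s)) * indicator (c -` A \<inter> {0..<T}) s \<partial>lborel)"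
proof -
 define D where "D = density lborel (%s. ennreal (norm (c' s)))"
 have [measurable]: "c' \<in> borel_measurable borel"
  using cont by (rule borel_measurable_continuous_onI)
 have cc: "continuous_on UNIV c"
  using has_vector_derivative_continuous[OF der] by (intro cont_at_imp_cont_on) blast
 then have [measurable]: "c \<in> borel_measurable borel"
  by (rule borel_measurable_continuous_onI)
 \<comment> \<open>Images of half-open intervals are countable unions of compact sets.\<close>
 have half_open: "c ` {a..<b} \<in> sets borel" for a b
 proof -
  have "{a..<b} = (\<Union>n. {a..b - 1 / real (Suc n)})"
  proof (intro equalityI subsetI)
   fix x assume "x \<in> {a..<b}"
   then have "a <= x" "0 < b - x" by auto
   then obtain n where "1 / real (Suc n) < b - x" using nat_approx_posE by metis
   then show "x \<in> (\<Union>n. {a..b - 1 / real (Suc n)})" using \<open>a <= x\<close> by (intro UN_I[of n]) auto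
  next
   fix x assume "x \<in> (\<Union>n. {a..b - 1 / real (Suc n)})"
   then obtain n where "a <= x" "x <= b - 1 / real (Suc n)" by auto
   moreover have "0 < 1 / real (Suc n)" by simp
   ultimately show "x \<in> {a..<b}" by (metis atLeastLessThan_iff diff_gt_0_iff_gt diff_less_eq less_add_same_cancel1 order_le_less_trans)
  qed
  then have "c ` {a..<b} = (\<Union>n. c ` {a..b - 1 / real (Suc n)})" by (simp add: image_UN)
  moreover have "c ` {a..b - 1 / real (Suc n)} \<in> sets borel" for n
   by (intro borel_compact compact_continuous_image continuous_on_subset[OF cc]) auto
  ultimately show ?thesis by auto
 qed
 show "c ` {0..<T} \<in> sets borel" by (rule half_open)
 define G where "G = c -` A \<inter> {0..<T}"
 have [measurable]: "G \<in> sets borel"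
  unfolding G_def using A measurable_sets_borel[of c borel A] by (auto simp: Int_commute)
 have main: "emeasure hausdorff1 (A \<inter> c ` {0..<T}) <= emeasure D G + 2 * ennreal eps * ennreal T &
   emeasure D G <= emeasure hausdorff1 (A \<inter> c ` {0..<T}) + 2 * ennreal eps * ennreal T"
  if eps: "0 < eps" for eps :: real
 proof -
  have "uniformly_continuous_on {0..T} c'"
   by (intro compact_uniformly_continuous continuous_on_subset[OF cont]) auto
  then obtain d where d: "0 < d"
   "!!s t. s \<in> {0..T} ==> t \<in> {0..T} ==> dist t s < d ==> dist (c' t) (c' s) < eps"
   unfolding uniformly_continuous_on_def using eps by metis
  obtain N :: nat where N: "T / d < N" using reals_Archimedean2 by blast
  then have N0: "0 < real N" using \<open>0 < T\<close> d(1) by (smt (verit) divide_pos_pos)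
  define h where "h = T / N"
  have h: "0 < h" "h < d" "N * h = T"
   using N N0 \<open>0 < T\<close> d(1) by (auto simp: h_def field_simps)
  define I where "I k = {real k * h..<(real k + 1) * h}" for k
  define B where "B k = G \<inter> I k" for k
  have Bm [measurable]: "B k \<in> sets borel" for k by (simp add: B_def I_def)
  have disjI: "disjoint_family I"
  proof -
   have "I i \<inter> I j = {}" if "i < j" for i j
   proof -
    have "(real i + 1) * h <= real j * h" using that h(1) by (intro mult_right_mono) auto
    then show ?thesis by (auto simp: I_def)
   qed
   then show ?thesis unfolding disjoint_family_on_def
    by (metis Int_commute linorder_neqE_nat)
  qed
  have cover: "{0..<T} \<subseteq> (\<Union>k<N. I k)"
  proof
   fix x assume x: "x \<in> {0..<T}"
   define n where "n = nat \<lfloor>x / h\<rfloor>"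
   have "real n <= x / h" "x / h < real n + 1"
    using x h by (auto simp: n_def)
   then have n: "real n * h <= x" "x < (real n + 1) * h"
    using h by (auto simp: field_simps)
   then have "real n * h < real N * h" using x h by auto
   then have "n < N" using h(1) by (metis mult_less_cancel_right_pos of_nat_less_iff)
   then show "x \<in> (\<Union>k<N. I k)" using n by (auto simp: I_def)
  qed
  have I_sub: "I k \<subseteq> {real k * h .. (real k + 1) * h}" "{real k * h .. (real k + 1) * h} \<subseteq> {0..T}"
   if "k < N" for k
  proof -
   have "(real k + 1) * h <= N * h" using that h by (intro mult_right_mono) auto
   then show "{real k * h .. (real k + 1) * h} \<subseteq> {0..T}" using h by (auto intro: order_trans[of _ "real k * h"])
  qed (auto simp: I_def)
  have GB: "G = (\<Union>k<N. B k)" using cover by (auto simp: B_def G_def)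
  have disjB: "disjoint_family_on B {..<N}"
   using disjI by (auto simp: disjoint_family_on_def B_def)
  have imG: "A \<inter> c ` {0..<T} = (\<Union>k<N. c ` B k)"
  proof -
   have "A \<inter> c ` {0..<T} = c ` G" by (auto simp: G_def)
   then show ?thesis using GB by (simp add: image_UN)
  qed
  have cB: "c ` B k \<in> sets borel" if "k < N" for k
  proof -
   have "I k \<subseteq> {0..<T}"
   proof -
    have "(real k + 1) * h <= N * h" using that h by (intro mult_right_mono) auto
    then show ?thesis using h by (auto simp: I_def intro: order_trans[of _ "real k * h"])
   qed
   then have "c ` B k = A \<inter> c ` I k" by (auto simp: B_def G_def)
   then show ?thesis using half_open A by (auto simp: I_def)
  qed
  have disjcB: "disjoint_family_on (%k. c ` B k) {..<N}"
   unfolding disjoint_family_on_def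
  proof (intro ballI impI)
   fix i j assume ij: "i \<in> {..<N}" "j \<in> {..<N}" "i ~= j"
   have "c ` B i \<inter> c ` B j = c ` (B i \<inter> B j)"
    using inj_on_image_Int[OF inj, of "B i" "B j"] by (auto simp: B_def G_def)
   then show "c ` B i \<inter> c ` B j = {}" using disjB ij by (auto simp: disjoint_family_on_def)
  qed
  have len: "emeasure lborel (B k) < top" for k
  proof -
   have "emeasure lborel (B k) <= emeasure lborel (I k)" by (rule emeasure_mono) (auto simp: B_def I_def)
   also have "... < top" using h(1) by (simp add: I_def)
   finally show ?thesis .
  qed
  note piece = hausdorff1_biLipschitz_piece[OF Bm len cB cont eps norm_ge_zero[of "c' (real k * h)" for k], folded D_def]
  have small: "norm (c' s - c' (real k * h)) <= eps" if "k < N" "s \<in> {real k * h .. (real k + 1) * h}" for k s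
  proof -
   have "real k * h \<in> {real k * h .. (real k + 1) * h}" using h by simp
   then have "real k * h \<in> {0..T}" "s \<in> {0..T}" using I_sub(2)[OF that(1)] that(2) by blast+
   moreover have "dist s (real k * h) < d" using that(2) h by (auto simp: dist_real_def algebra_simps)
   ultimately show ?thesis using d(2) by (metis dist_norm less_imp_le)
  qed
  have pc: "emeasure hausdorff1 (c ` B k) <= emeasure D (B k) + 2 * ennreal eps * emeasure lborel (B k) &
    emeasure D (B k) <= emeasure hausdorff1 (c ` B k) + 2 * ennreal eps * emeasure lborel (B k)"
   if k: "k < N" for k
  proof -
   let ?J = "{real k * h .. (real k + 1) * h}" and ?v = "norm (c' (real k * h))"
   have sp: "\<bar>norm (c' s) - ?v\<bar> <= eps" if "s \<in> B k" for s
    using small[OF k, of s] I_sub(1)[OF k] that norm_triangle_ineq3[of "c' s" "c' (real k * h)"]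
    by (auto simp: B_def)
   have lp: "\<bar>dist (c s) (c t) - ?v * \<bar>s - t\<bar>\<bar> <= eps * \<bar>s - t\<bar>" if "s \<in> B k" "t \<in> B k" for s t
   proof -
    have st: "s \<in> ?J" "t \<in> ?J" using that I_sub(1)[OF k] by (auto simp: B_def)
    \<comment> \<open>Mean value inequality against the linearization at the left end of the
      piece.\<close>
    have "norm (c s - c t - (s - t) *. c' (real k * h)) <= norm (s - t) * eps"
    proof (rule vector_differentiable_bound_linearization[where S = ?J])
     show "closed_segment t s \<subseteq> ?J" using st by (intro closed_segment_subset) auto
     show "real k * h \<in> ?J" using h by simp
    qed (use der small[OF k] in \<open>auto intro: has_vector_derivative_at_within\<close>)
    then have "\<bar>norm (c s - c t) - norm ((s - t) *. c' (real k * h))\<bar> <= norm (s - t) * eps"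
     using norm_triangle_ineq3 order_trans by blast
    then show ?thesis by (simp add: dist_norm mult.commute)
   qed
   show ?thesis
    using hausdorff1_biLipschitz_piece[OF Bm len cB[OF k] cont eps norm_ge_zero sp lp]
    by (simp add: D_def)
  qed
  have Hsum: "emeasure hausdorff1 (A \<inter> c ` {0..<T}) = (\<Sum>k<N. emeasure hausdorff1 (c ` B k))"
   unfolding imG by (rule sum_emeasure[symmetric]) (use cB disjcB in auto)
  have Dsum: "emeasure D G = (\<Sum>k<N. emeasure D (B k))"
   unfolding GB by (rule sum_emeasure[symmetric]) (use disjB in \<open>auto simp: D_def\<close>)
  have "(\<Sum>k<N. emeasure lborel (B k)) = emeasure lborel G"
   unfolding GB by (rule sum_emeasure) (use disjB in auto)
  also have "... <= emeasure lborel {0..<T}" by (rule emeasure_mono) (auto simp: G_def)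
  also have "... = ennreal T" using \<open>0 < T\<close> by simp
  finally have "(\<Sum>k<N. emeasure lborel (B k)) <= ennreal T" .
  then have Ls: "(\<Sum>k<N. 2 * ennreal eps * emeasure lborel (B k)) <= 2 * ennreal eps * ennreal T"
   by (simp add: sum_distrib_left[symmetric] mult_left_mono)
  have "emeasure hausdorff1 (A \<inter> c ` {0..<T}) <= (\<Sum>k<N. emeasure D (B k) + 2 * ennreal eps * emeasure lborel (B k))"
   unfolding Hsum by (intro sum_mono) (use pc in auto)
  also have "... <= emeasure D G + 2 * ennreal eps * ennreal T"
   unfolding sum.distrib Dsum by (intro add_left_mono Ls)
  finally have 1: "emeasure hausdorff1 (A \<inter> c ` {0..<T}) <= emeasure D G + 2 * ennreal eps * ennreal T" .
  have "emeasure D G <= (\<Sum>k<N. emeasure hausdorff1 (c ` B k) + 2 * ennreal eps * emeasure lborel (B k))"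
   unfolding Dsum by (intro sum_mono) (use pc in auto)
  also have "... <= emeasure hausdorff1 (A \<inter> c ` {0..<T}) + 2 * ennreal eps * ennreal T"
   unfolding sum.distrib Hsum by (intro add_left_mono Ls)
  finally show ?thesis using 1 by simp
 qed
 have eps: "x <= y" if "!!eps. 0 < eps ==> x <= y + 2 * ennreal eps * ennreal T" for x y
 proof (rule ennreal_le_epsilon)
  fix e :: real assume "0 < e"
  then have "x <= y + 2 * ennreal (e / (2 * T)) * ennreal T" using that \<open>0 < T\<close> by simp
  also have "2 * ennreal (e / (2 * T)) * ennreal T = ennreal e"
   using \<open>0 < T\<close> \<open>0 < e\<close> by (simp add: ennreal_mult[symmetric] ennreal_numeral[symmetric] del: ennreal_numeral)
  finally show "x <= y + ennreal e" .
 qed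
 have "emeasure hausdorff1 (A \<inter> c ` {0..<T}) = emeasure D G"
  using eps[OF conjunct1[OF main]] eps[OF conjunct2[OF main]] by (rule antisym)
 also have "... = (\<integral>\<^sup>+ s. ennreal (norm (c' s)) * indicator G s \<partial>lborel)"
  unfolding D_def by (subst emeasure_density) auto
 finally show "emeasure hausdorff1 (A \<inter> c ` {0..<T})
   = (\<integral>\<^sup>+ s. ennreal (norm (c' s)) * indicator (c -` A \<inter> {0..<T}) s \<partial>lborel)"
  by (simp add: G_def)
qed


section \<open>Closed regular curves\<close>

text \<open>\<open>eq_iff\<close> encodes in one equivalence that \<open>T\<close> is a period and
  that the curve is embedded. Working on the whole line instead of one period avoids endpoints,
  where derivatives would be one-sided.\<close>

locale closed_curve =
 fixes c c' :: "real => real^2" and T :: real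
 assumes T_pos: "0 < T"
  and der: "(c hvd c' s) (at s)"
  and cont': "continuous_on UNIV c'"
  and nz: "c' s ~= 0"
  and eq_iff: "c s = c t \<longleftrightarrow> (EX k::int. s = t + T * k)"
begin

lemma cont: "continuous_on A c"
 using has_vector_derivative_continuous[OF der] by (intro cont_at_imp_cont_on) blast

lemma cont'_on: "continuous_on A c'"
 using cont' continuous_on_subset by blast

lemma periodic: "c (s + T * of_int k) = c s"
 by (subst eq_iff) blast

lemma periodic_1: "c (s + T) = c s"
 using periodic[of s 1] by simp

lemma shift_into:
 obtains k :: int where "s + T * k \<in> {a..<a + T}"
proof -
 define k where "k = - \<lfloor>(s - a) / T\<rfloor>"
 have "real_of_int (- k) <= (s - a) / T" "(s - a) / T < real_of_int (- k) + 1"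
  by (simp_all add: k_def)
 then have "real_of_int (- k) * T <= s - a" "s - a < (real_of_int (- k) + 1) * T"
  using T_pos by (simp_all add: field_simps)
 then show ?thesis by (intro that[of k]) (auto simp: algebra_simps)
qed

lemma image_period: "c ` {a..<a + T} = range c"
proof -
 have "c s \<in> c ` {a..<a + T}" for s
  using shift_into[of s a] periodic[of s] by (metis image_eqI)
 then show ?thesis by auto
qed

lemma image_period0: "c ` {0..<T} = range c" "c ` {0..T} = range c"
proof -
 show 1: "c ` {0..<T} = range c" using image_period[of 0] by simp
 have "c ` {0..<T} \<subseteq> c ` {0..T}" by (rule image_mono) auto
 then show "c ` {0..T} = range c" unfolding 1 by blast
qed

lemma inj_period: "inj_on c {a..<a + T}"
proof (rule inj_onI)
 fix s t assume st: "s \<in> {a..<a + T}" "t \<in> {a..<a + T}" "c s = c t"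
 then obtain k :: int where k: "s = t + T * k" using eq_iff by blast
 then have "\<bar>T * k\<bar> < T" using st by auto
 then have "\<bar>real_of_int k\<bar> < 1" using T_pos by (simp add: abs_mult)
 then have "k = 0" by linarith
 then show "s = t" using k by simp
qed

lemma compact_range: "compact (range c)"
 unfolding image_period0(2)[symmetric] by (intro compact_continuous_image cont) auto

text \<open>The complementary arc is compact and misses \<open>c t0\<close>, so it keeps a positive
  distance from it. This is the form in which embeddedness is used: it reduces limits within the
  range to limits in the parameter.\<close>

lemma near_range:
 assumes "0 < eps"
 shows "EX dl>0. \<forall>y\<in>range c. dist y (c t0) < dl --> (EX t. \<bar>t - t0\<bar> < eps & y = c t)"
proof -
 define eps' where "eps' = min eps (T / 2)"
 have eps': "0 < eps'" "eps' <= eps" "eps' <= T / 2" using assms T_pos by (auto simp: eps'_def)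
 define K where "K = c ` {t0 + eps'..t0 + T - eps'}"
 have "closed K" unfolding K_def
  by (intro compact_imp_closed compact_continuous_image cont) auto
 moreover have "c t0 \<notin> K"
 proof
  assume "c t0 \<in> K"
  then obtain s where s: "s \<in> {t0 + eps'..t0 + T - eps'}" "c s = c t0" by (auto simp: K_def)
  then have "s = t0" using eps' T_pos by (intro inj_onD[OF inj_period[of t0]]) auto
  then show False using s eps' by auto
 qed
 ultimately obtain dl where dl: "0 < dl" "ball (c t0) dl \<subseteq> - K"
  using open_contains_ball_eq[of "- K"] by auto
 have "EX t. \<bar>t - t0\<bar> < eps & y = c t" if y: "y \<in> range c" "dist y (c t0) < dl" for y
 proof -
  obtain t where t: "t \<in> {t0..<t0 + T}" "y = c t" using y(1) image_period[of t0] by blast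
  have "y \<notin> K" using dl(2) y(2) by (auto simp: dist_commute)
  then have "t \<notin> {t0 + eps'..t0 + T - eps'}" using t by (auto simp: K_def)
  then consider "t < t0 + eps'" | "t0 + T - eps' < t" by force
  then show ?thesis
  proof cases
   case 1 then show ?thesis using t eps' by (intro exI[of _ t]) auto
  next
   case 2
   then show ?thesis using t eps' periodic_1[of "t - T"] by (intro exI[of _ "t - T"]) auto
  qed
 qed
 then show ?thesis using dl(1) by blast
qed

text \<open>By the area formula, \<open>hausdorff1\<close> restricted to the curve is the image
  under \<open>c\<close> of the density \<open>norm (c' s)\<close> on one half-open period; the
  integral follows by change of variables.\<close>

lemma hausdorff1_integral:
 fixes h :: "real^2 => real"
 assumes "continuous_on (range c) h"
 shows "set_integrable hausdorff1 (range c) h"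
  and "(LINT x:range c|hausdorff1. h x) = integral {0..T} (%s. norm (c' s) * h (c s))"
proof -
 have [measurable]: "c' \<in> borel_measurable borel"
  using cont' by (rule borel_measurable_continuous_onI)
 have [measurable]: "c \<in> borel_measurable borel"
  by (rule borel_measurable_continuous_onI[OF cont])
 define Gam where "Gam = range c"
 have Gamb [measurable]: "Gam \<in> sets borel" unfolding Gam_def by (rule borel_compact[OF compact_range])
 have inj0: "inj_on c {0..<T}" using inj_period[of 0] by simp
 define w where "w s = indicator {0..<T} s * norm (c' s)" for s :: real
 have [measurable]: "w \<in> borel_measurable borel" unfolding w_def by measurable
 have dens: "density hausdorff1 (indicator Gam) = distr (density lborel w) borel c"
 proof (rule measure_eqI)
  fix A assume "A \<in> sets (density hausdorff1 (indicator Gam :: real^2 => ennreal))"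
  then have A [measurable]: "A \<in> sets borel" by simp
  have "emeasure (density hausdorff1 (indicator Gam)) A = emeasure hausdorff1 (A \<inter> c ` {0..<T})"
   using A by (subst emeasure_restricted) (auto simp: Int_commute image_period0 Gam_def[symmetric])
  also have "... = (\<integral>\<^sup>+ s. ennreal (norm (c' s)) * indicator (c -` A \<inter> {0..<T}) s \<partial>lborel)"
   by (rule emeasure_hausdorff1_curve[OF T_pos der cont' inj0 A])
  also have "... = emeasure (density lborel w) (c -` A)"
   by (subst emeasure_density)
     (auto simp: w_def indicator_def measurable_sets_borel[of c borel A] intro!: nn_integral_cong)
  also have "... = emeasure (distr (density lborel w) borel c) A"
   by (subst emeasure_distr) auto
  finally show "emeasure (density hausdorff1 (indicator Gam)) A = emeasure (distr (density lborel w) borel c) A" .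
 qed simp
 define h' where "h' x = indicator Gam x *. h x" for x
 have h' [measurable]: "h' \<in> borel_measurable borel"
  unfolding h'_def using assms Gamb by (intro borel_measurable_continuous_on_indicator) (auto simp: Gam_def)
 have wp: "AE s in lborel. 0 <= w s" by (auto simp: w_def)
 have cont_hc: "continuous_on {0..T} (%s. norm (c' s) * h (c s))"
  by (intro continuous_intros cont'_on continuous_on_compose2[OF assms cont]) auto
 have "set_integrable lborel {0..T} (%s. norm (c' s) * h (c s))"
  by (rule borel_integrable_atLeastAtMost'[OF cont_hc])
 then have int_w: "set_integrable lborel {0..<T} (%s. norm (c' s) * h (c s))"
  by (rule set_integrable_subset) auto
 have eq_w: "w s *. h' (c s) = indicator {0..<T} s *. (norm (c' s) * h (c s))" for s
  by (auto simp: w_def h'_def Gam_def indicator_def)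
 have "integrable (distr (density lborel w) borel c) h'"
  by (subst integrable_distr_eq) (use int_w in \<open>auto simp: integrable_density wp set_integrable_def eq_w[symmetric] simp del: real_scaleR_def\<close>)
 then have "integrable (density hausdorff1 (%x. ennreal (indicator Gam x))) h'"
  using dens by (simp add: ennreal_indicator)
 moreover have mH: "h' \<in> borel_measurable hausdorff1"
   "(indicator Gam :: _ => real) \<in> borel_measurable hausdorff1"
   "AE x in hausdorff1. 0 <= (indicator Gam x :: real)"
  using h' Gamb by (simp_all add: measurable_cong_sets[OF sets_hausdorff1 refl])
 ultimately have "integrable hausdorff1 (%x. indicator Gam x *. h' x)"
  using integrable_density[OF mH] by blast
 moreover have "indicator Gam x *. h' x = indicator Gam x *. h x" for x
  by (auto simp: h'_def indicator_def)
 ultimately show "set_integrable hausdorff1 (range c) h"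
  unfolding set_integrable_def Gam_def[symmetric] by (simp only:)
 have "(LINT x:range c|hausdorff1. h x) = integral\<^sup>L hausdorff1 (%x. indicator Gam x *. h' x)"
  unfolding set_lebesgue_integral_def by (intro Bochner_Integration.integral_cong) (auto simp: h'_def Gam_def indicator_def)
 also have "... = integral\<^sup>L (density hausdorff1 (%x. ennreal (indicator Gam x))) h'"
  by (rule integral_density[OF mH, symmetric])
 also have "... = integral\<^sup>L (distr (density lborel w) borel c) h'"
  using dens by (simp add: ennreal_indicator)
 also have "... = integral\<^sup>L (density lborel w) (%s. h' (c s))"
  by (rule integral_distr) auto
 also have "... = integral\<^sup>L lborel (%s. w s *. h' (c s))"
  by (rule integral_density[OF _ _ wp]) auto
 also have "... = (LINT s:{0..<T}|lborel. norm (c' s) * h (c s))"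
  unfolding eq_w set_lebesgue_integral_def ..
 also have "... = integral {0..<T} (%s. norm (c' s) * h (c s))"
  by (rule set_borel_integral_eq_integral[OF int_w])
 also have "... = integral {0..T} (%s. norm (c' s) * h (c s))"
  by (rule integral_spike_set) (auto intro: negligible_subset[of "{T}"])
 finally show "(LINT x:range c|hausdorff1. h x) = integral {0..T} (%s. norm (c' s) * h (c s))" .
qed

end


section \<open>Derivatives and normals along curves\<close>

text \<open>Points of \<open>S\<close> near \<open>c t0\<close> are values \<open>c t\<close> with
  \<open>t\<close> near \<open>t0\<close>, and there both \<open>y - c t0\<close> and the increment
  of \<open>f\<close> are linear in \<open>t - t0\<close> up to small errors. The derivative given
  here first projects orthogonally on the velocity, which fixes its otherwise arbitrary values off
  the tangent.\<close>

lemma has_derivative_within_curve: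
 fixes c :: "real => 'a::real_inner" and f :: "'a => 'b::real_normed_vector"
 assumes c: "(c hvd v) (at t0)" and "v ~= 0"
  and near: "!!eps. 0 < eps ==> EX dl>0. \<forall>y\<in>S. dist y (c t0) < dl --> (EX t. \<bar>t - t0\<bar> < eps & y = c t)"
  and f: "((%t. f (c t)) hvd w) (at t0)"
 shows "(f has_derivative (%h. ((h \<bullet> v) / (v \<bullet> v)) *. w)) (at (c t0) within S)"
 unfolding has_derivative_within_alt
proof (intro conjI allI impI)
 show bl: "bounded_linear (%h. ((h \<bullet> v) / (v \<bullet> v)) *. w)"
  by (intro bounded_linear_scaleR_const bounded_linear_compose[OF bounded_linear_divide] bounded_linear_inner_left)
 fix e :: real assume "0 < e"
 define K where "K = 1 + norm w / norm v"
 \<comment> \<open>\<open>norm v / 2\<close> ensures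
   \<open>\<bar>t - t0\<bar> * norm v <= 2 * norm (y - c t0)\<close>; the second entry absorbs the
   factor \<open>K\<close>, which collects the errors of \<open>c\<close> and of
   \<open>f\<close>.\<close>
 define e1 where "e1 = min (norm v / 2) (e * norm v / (2 * K))"
 have K: "1 <= K" by (simp add: K_def)
 have e1: "0 < e1" "e1 <= norm v / 2" "e1 * K <= e * norm v / 2"
 proof -
  show "0 < e1" "e1 <= norm v / 2" using \<open>v ~= 0\<close> \<open>0 < e\<close> K by (auto simp: e1_def)
  have "e1 <= e * norm v / (2 * K)" by (simp add: e1_def)
  then show "e1 * K <= e * norm v / 2" using K by (simp add: field_simps)
 qed
 obtain d1 where d1: "0 < d1" "!!t. \<bar>t - t0\<bar> < d1 ==> norm (c t - c t0 - (t - t0) *. v) <= e1 * \<bar>t - t0\<bar>"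
  using c e1(1) unfolding has_vector_derivative_def has_derivative_at_alt by (metis real_norm_def)
 obtain d2 where d2: "0 < d2" "!!t. \<bar>t - t0\<bar> < d2 ==> norm (f (c t) - f (c t0) - (t - t0) *. w) <= e1 * \<bar>t - t0\<bar>"
  using f e1(1) unfolding has_vector_derivative_def has_derivative_at_alt by (metis real_norm_def)
 obtain dl where dl: "0 < dl" "!!y. y \<in> S ==> dist y (c t0) < dl ==> EX t. \<bar>t - t0\<bar> < min d1 d2 & y = c t"
  using near[of "min d1 d2"] d1(1) d2(1) by auto
 show "EX d>0. \<forall>y\<in>S. norm (y - c t0) < d -->
   norm (f y - f (c t0) - ((y - c t0) \<bullet> v / (v \<bullet> v)) *. w) <= e * norm (y - c t0)"
 proof (intro exI[of _ dl] conjI ballI impI dl(1))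
  fix y assume "y \<in> S" "norm (y - c t0) < dl"
  then obtain t where t: "\<bar>t - t0\<bar> < d1" "\<bar>t - t0\<bar> < d2" "y = c t"
   using dl(2)[of y] by (auto simp: dist_norm)
  define z where "z = c t - c t0 - (t - t0) *. v"
  have z: "norm z <= e1 * \<bar>t - t0\<bar>" using d1(2)[OF t(1)] by (simp add: z_def)
  have yz: "y - c t0 = z + (t - t0) *. v" by (simp add: z_def t)
  have "((y - c t0) \<bullet> v / (v \<bullet> v)) = z \<bullet> v / (v \<bullet> v) + (t - t0)"
   using \<open>v ~= 0\<close> by (simp add: yz inner_add_left add_divide_distrib)
  then have "norm (f y - f (c t0) - ((y - c t0) \<bullet> v / (v \<bullet> v)) *. w)
    = norm ((f (c t) - f (c t0) - (t - t0) *. w) - (z \<bullet> v / (v \<bullet> v)) *. w)"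
   by (simp add: t scaleR_add_left diff_diff_eq add_ac)
  also have "... <= e1 * \<bar>t - t0\<bar> + norm ((z \<bullet> v / (v \<bullet> v)) *. w)"
   using d2(2)[OF t(2)]
    norm_triangle_ineq4[of "f (c t) - f (c t0) - (t - t0) *. w" "(z \<bullet> v / (v \<bullet> v)) *. w"]
   by linarith
  also have "norm ((z \<bullet> v / (v \<bullet> v)) *. w) <= e1 * \<bar>t - t0\<bar> * (norm w / norm v)"
  proof -
   have "\<bar>z \<bullet> v\<bar> / (v \<bullet> v) <= norm z * norm v / (v \<bullet> v)"
    by (intro divide_right_mono Cauchy_Schwarz_ineq2) auto
   also have "... = norm z / norm v"
    using \<open>v ~= 0\<close> by (simp add: dot_square_norm power2_eq_square)
   also have "... <= e1 * \<bar>t - t0\<bar> / norm v" using z by (intro divide_right_mono) auto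
   finally have "\<bar>z \<bullet> v\<bar> / (v \<bullet> v) * norm w <= e1 * \<bar>t - t0\<bar> / norm v * norm w"
    by (rule mult_right_mono) simp
   then show ?thesis by simp
  qed
  finally have 1: "norm (f y - f (c t0) - ((y - c t0) \<bullet> v / (v \<bullet> v)) *. w) <= e1 * K * \<bar>t - t0\<bar>"
   by (simp add: K_def algebra_simps)
  have "norm ((t - t0) *. v) - norm z <= norm (y - c t0)"
   unfolding yz using norm_diff_ineq[of "(t - t0) *. v" z] by (simp add: add.commute)
  then have "\<bar>t - t0\<bar> * norm v - norm v / 2 * \<bar>t - t0\<bar> <= norm (y - c t0)"
   using z mult_right_mono[OF e1(2) abs_ge_zero[of "t - t0"]] by (simp only: norm_scaleR)
  then have 2: "\<bar>t - t0\<bar> * norm v / 2 <= norm (y - c t0)" by (simp add: algebra_simps)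
  have "e1 * K * \<bar>t - t0\<bar> <= e * norm v / 2 * \<bar>t - t0\<bar>" by (rule mult_right_mono[OF e1(3)]) simp
  also have "... <= e * norm (y - c t0)" using mult_left_mono[OF 2, of e] \<open>0 < e\<close> by (simp add: algebra_simps)
  finally show "norm (f y - f (c t0) - ((y - c t0) \<bullet> v / (v \<bullet> v)) *. w) <= e * norm (y - c t0)"
   using 1 by linarith
 qed
qed

text \<open>Whichever derivative within \<open>S\<close> is picked by
  \<open>frechet_derivative\<close>, the chain rule along \<open>c\<close> forces its value on the
  velocity.\<close>

lemma tangential_deriv_curve:
 assumes f: "f differentiable (at (c t0) within S)" and S: "\<forall>\<^sub>F t in nhds t0. c t \<in> S"
  and c: "(c hvd v) (at t0)"
  and fc: "((%t. f (c t)) hvd w) (at t0)"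
 shows "tangential_deriv S f (c t0) v = w"
proof -
 obtain d where d: "0 < d" "!!t. dist t t0 < d ==> c t \<in> S"
  using S unfolding eventually_nhds_metric by blast
 have "(f has_derivative frechet_derivative f (at (c t0) within S)) (at (c t0) within c ` ball t0 d)"
  using f unfolding frechet_derivative_works
  by (rule has_derivative_subset) (use d in \<open>auto simp: dist_commute\<close>)
 moreover have "(c has_derivative (%h. h *. v)) (at t0 within ball t0 d)"
  using c has_derivative_at_withinI unfolding has_vector_derivative_def by blast
 ultimately have "((%t. f (c t)) has_derivative (%h. frechet_derivative f (at (c t0) within S) (h *. v)))
   (at t0 within ball t0 d)"
  by (rule has_derivative_in_compose[rotated])
 then have "((%t. f (c t)) has_derivative (%h. frechet_derivative f (at (c t0) within S) (h *. v))) (at t0)"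
  using d(1) by (simp add: at_within_open[of t0 "ball t0 d"])
 then have "(%h. frechet_derivative f (at (c t0) within S) (h *. v)) = (%h. h *. w)"
  using fc has_derivative_unique unfolding has_vector_derivative_def by blast
 then have "frechet_derivative f (at (c t0) within S) (1 *. v) = 1 *. w" by (rule fun_cong)
 then show ?thesis by (simp add: tangential_deriv_def)
qed

text \<open>The difference quotients of \<open>c\<close> tend to \<open>v\<close>, while the
  definition of the normal makes their normal component negligible. The limit is taken from the
  right because dividing by \<open>t - t0\<close> and by its absolute value agree only
  there.\<close>

lemma is_outer_normal_perp_curve:
 assumes n: "is_outer_normal A (c t0) n" and S: "\<forall>\<^sub>F t in nhds t0. c t \<in> frontier A"
  and c: "(c hvd v) (at t0)" and "v ~= 0"
 shows "n \<bullet> v = 0"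
proof -
 define q where "q t = (c t - c t0) /\<^sub>R (t - t0)" for t
 have "((%t. norm ((c t - c t0) - (t - t0) *. v) / norm (t - t0)) \<longlongrightarrow> 0) (at t0)"
  using c by (simp add: has_vector_derivative_def has_derivative_iff_norm)
 moreover have "\<forall>\<^sub>F t in at t0. norm ((c t - c t0) - (t - t0) *. v) / norm (t - t0) = norm (q t - v)"
 proof (rule eventually_at_topological[THEN iffD2], intro exI[of _ UNIV] conjI ballI impI)
  fix t assume "t ~= t0"
  then have "q t - v = ((c t - c t0) - (t - t0) *. v) /\<^sub>R (t - t0)"
   by (simp add: q_def scaleR_diff_right[of "inverse (t - t0)" "c t - c t0"])
  then show "norm ((c t - c t0) - (t - t0) *. v) / norm (t - t0) = norm (q t - v)"
   by (simp add: divide_inverse mult.commute)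
 qed auto
 ultimately have "((%t. norm (q t - v)) \<longlongrightarrow> 0) (at t0)"
  by (rule Lim_transform_eventually)
 then have q: "(q \<longlongrightarrow> v) (at t0)"
  by (rule LIM_zero_cancel[OF tendsto_norm_zero_cancel])
 have ne: "\<forall>\<^sub>F t in at t0. c t ~= c t0"
  using tendsto_imp_eventually_ne[OF q \<open>v ~= 0\<close>] by eventually_elim (auto simp: q_def)
 have S': "\<forall>\<^sub>F t in at t0. c t \<in> frontier A"
  using S by (simp add: eventually_at_filter eventually_mono)
 have ct: "(c \<longlongrightarrow> c t0) (at t0)"
  using has_vector_derivative_continuous[OF c] by (simp add: continuous_within)
 have fl: "filterlim c (at (c t0) within frontier A) (at t0)"
  unfolding filterlim_at by (intro conjI ct eventually_conj ne S')
 have nl: "((%y. (n \<bullet> (y - c t0)) / norm (y - c t0)) \<longlongrightarrow> 0) (at (c t0) within frontier A)"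
  using n unfolding is_outer_normal_def by simp
 have "((%t. (n \<bullet> (c t - c t0)) / norm (c t - c t0)) \<longlongrightarrow> 0) (at t0)"
  by (rule filterlim_compose[OF nl fl])
 then have 0: "((%t. (n \<bullet> (c t - c t0)) / norm (c t - c t0)) \<longlongrightarrow> 0) (at_right t0)"
  by (rule tendsto_within_subset) simp
 have "((%t. (n \<bullet> q t) / norm (q t)) \<longlongrightarrow> (n \<bullet> v) / norm v) (at t0)"
  using q \<open>v ~= 0\<close> by (intro tendsto_intros) auto
 then have "((%t. (n \<bullet> q t) / norm (q t)) \<longlongrightarrow> (n \<bullet> v) / norm v) (at_right t0)"
  by (rule tendsto_within_subset) simp
 moreover have "\<forall>\<^sub>F t in at_right t0. (n \<bullet> q t) / norm (q t) = (n \<bullet> (c t - c t0)) / norm (c t - c t0)"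
  by (rule eventually_at_rightI[of t0 "t0 + 1"]) (auto simp: q_def)
 ultimately have "((%t. (n \<bullet> (c t - c t0)) / norm (c t - c t0)) \<longlongrightarrow> (n \<bullet> v) / norm v) (at_right t0)"
  by (rule Lim_transform_eventually)
 then have "(n \<bullet> v) / norm v = 0"
  using 0 by (rule tendsto_unique[rotated]) simp
 then show ?thesis using \<open>v ~= 0\<close> by simp
qed

text \<open>Two candidates are both perpendicular to the velocity, hence equal up to sign, and
  opposite signs would put the same points inside \<open>A\<close> and outside its closure.\<close>

lemma outer_normal_eqI:
 assumes n: "is_outer_normal A (c t0) n" and S: "\<forall>\<^sub>F t in nhds t0. c t \<in> frontier A"
  and c: "(c hvd v) (at t0)" and "v ~= 0"
 shows "outer_normal A (c t0) = n"
 unfolding outer_normal_def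
proof (rule the_equality)
 show "is_outer_normal A (c t0) n" by (rule n)
 fix m assume m: "is_outer_normal A (c t0) m"
 have nm: "norm n = 1" "norm m = 1" using n m by (auto simp: is_outer_normal_def)
 have perp: "n \<bullet> v = 0" "m \<bullet> v = 0"
  by (intro is_outer_normal_perp_curve[OF _ S c \<open>v ~= 0\<close>] n m)+
 define e where "e = v /\<^sub>R norm v"
 have e: "norm e = 1" "n \<bullet> e = 0" "m \<bullet> e = 0"
  using \<open>v ~= 0\<close> perp by (simp_all add: e_def)
 have ne: "n = (n \<bullet> rot90 e) *. rot90 e" "m = (m \<bullet> rot90 e) *. rot90 e"
  using orthonormal_decomp[OF e(1), of n] orthonormal_decomp[OF e(1), of m] e by simp_all
 have "\<bar>n \<bullet> rot90 e\<bar> = 1" "\<bar>m \<bullet> rot90 e\<bar> = 1"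
  using arg_cong[OF ne(1), of norm] arg_cong[OF ne(2), of norm] nm e(1) by simp_all
 then have "n = rot90 e | n = - rot90 e" "m = rot90 e | m = - rot90 e"
  using ne by (auto simp: abs_eq_iff' eq_commute[of _ "n"] eq_commute[of _ m])
 then have "m = n | m = - n" by auto
 moreover have "m ~= - n"
 proof
  assume mn: "m = - n"
  have "\<forall>\<^sub>F t in at_right 0. c t0 - t *. n \<in> interior A" "\<forall>\<^sub>F t in at_right 0. c t0 + t *. m \<notin> closure A"
   using n m by (auto simp: is_outer_normal_def elim: eventually_mono)
  then have "\<forall>\<^sub>F t in at_right (0::real). False"
   by eventually_elim (use mn interior_subset closure_subset in auto)
  then show False by simp
 qed
 ultimately show "m = n" by blast
qed

section \<open>Calculus of \<open>C\<^sup>2\<close> maps\<close>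

text \<open>Mirrors \<open>C2_on\<close>, so that \<open>C2_on\<close> asks for a derivative that is
  \<open>C1_on\<close> and closure properties can be lifted by one order.\<close>

definition C1_on :: "'a::real_normed_vector set => ('a => 'b::real_normed_vector) => bool" where
 "C1_on S f \<longleftrightarrow> (EX f' :: 'a => 'a \<Rightarrow>\<^sub>L 'b.
   (\<forall>x\<in>S. (f has_derivative blinfun_apply (f' x)) (at x)) & continuous_on S f')"

lemma C2_on_iff_C1_on:
 "C2_on S f \<longleftrightarrow> (EX f'. (\<forall>x\<in>S. (f has_derivative blinfun_apply (f' x)) (at x)) & C1_on S f')"
 unfolding C2_on_def C1_on_def by blast

lemma C1_on_imp_continuous_on: "C1_on S f ==> continuous_on S f"
 unfolding C1_on_def
 by (meson cont_at_imp_cont_on has_derivative_continuous)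

lemma C2_on_imp_C1_on: "C2_on S f ==> C1_on S f"
 unfolding C2_on_iff_C1_on by (metis C1_on_def C1_on_imp_continuous_on)

lemma C2_on_subset: "C2_on S f ==> T \<subseteq> S ==> C2_on T f"
 unfolding C2_on_def by (meson continuous_on_subset subsetD)

lemma C1_on_const: "C1_on S (%x. c)"
 unfolding C1_on_def by (intro exI[of _ "%_. 0"]) (auto simp: zero_blinfun.rep_eq)

lemma C1_on_bounded_linear: "bounded_linear h ==> C1_on S h"
 unfolding C1_on_def
 by (intro exI[of _ "%_. Blinfun h"])
   (simp add: bounded_linear_Blinfun_apply bounded_linear_imp_has_derivative)

lemma Blinfun_bilinear:
 fixes pr :: "'a::real_normed_vector => 'b::real_normed_vector => 'c::real_normed_vector"
 assumes "bounded_bilinear pr"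
 shows blinfun_apply_bilinear: "blinfun_apply (Blinfun (pr a)) = pr a"
  and bounded_linear_Blinfun_bilinear: "bounded_linear (%a. Blinfun (pr a))"
proof -
 have *: "bounded_linear (pr a)" for a by (rule bounded_bilinear.bounded_linear_right[OF assms])
 then show "blinfun_apply (Blinfun (pr a)) = pr a" for a by (rule bounded_linear_Blinfun_apply)
 obtain K where K: "0 < K" "!!a b. norm (pr a b) <= norm a * norm b * K"
  using bounded_bilinear.pos_bounded[OF assms] by blast
 show "bounded_linear (%a. Blinfun (pr a))"
 proof (rule bounded_linear_intro)
  show "norm (Blinfun (pr a)) <= norm a * K" for a
   using K by (intro norm_blinfun_bound) (auto simp: bounded_linear_Blinfun_apply[OF *] ac_simps)
 qed (auto intro!: blinfun_eqI simp: bounded_linear_Blinfun_apply[OF *] blinfun.add_left blinfun.scaleR_left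
   bounded_bilinear.add_left[OF assms] bounded_bilinear.scaleR_left[OF assms])
qed

text \<open>One product rule for multiplication, scaling, inner products and composition of
  operators; the last one is needed for second derivatives of compositions.\<close>

lemma C1_on_bilinear:
 assumes "bounded_bilinear pr" "C1_on S f" "C1_on S g"
 shows "C1_on S (%x. pr (f x) (g x))"
proof -
 note flip = bounded_bilinear.flip[OF assms(1)]
 obtain f' g' where f: "!!x. x \<in> S ==> (f has_derivative blinfun_apply (f' x)) (at x)" "continuous_on S f'"
  and g: "!!x. x \<in> S ==> (g has_derivative blinfun_apply (g' x)) (at x)" "continuous_on S g'"
  using assms(2,3) unfolding C1_on_def by blast
 show ?thesis unfolding C1_on_def
 proof (intro exI[of _ "%x. (Blinfun (pr (f x)) o\<^sub>L g' x) + (Blinfun (%a. pr a (g x)) o\<^sub>L f' x)"] conjI ballI)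
  fix x assume "x \<in> S"
  have "((%x. pr (f x) (g x)) has_derivative (%h. pr (f x) (g' x h) + pr (f' x h) (g x))) (at x)"
   by (intro bounded_bilinear.FDERIV[OF assms(1)] f g \<open>x \<in> S\<close>)
  then show "((%x. pr (f x) (g x)) has_derivative
    blinfun_apply ((Blinfun (pr (f x)) o\<^sub>L g' x) + (Blinfun (%a. pr a (g x)) o\<^sub>L f' x))) (at x)"
   by (rule has_derivative_eq_rhs)
     (simp add: blinfun.add_left fun_eq_iff blinfun_apply_bilinear[OF assms(1)] blinfun_apply_bilinear[OF flip])
 next
  have "continuous_on S f" "continuous_on S g"
   using assms(2,3) C1_on_imp_continuous_on by auto
  then show "continuous_on S (%x. (Blinfun (pr (f x)) o\<^sub>L g' x) + (Blinfun (%a. pr a (g x)) o\<^sub>L f' x))"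
   by (intro continuous_on_add bounded_bilinear.continuous_on[OF bounded_bilinear_blinfun_compose]
     bounded_linear.continuous_on[OF bounded_linear_Blinfun_bilinear[OF assms(1)]]
     bounded_linear.continuous_on[OF bounded_linear_Blinfun_bilinear[OF flip]] f g)
 qed
qed

lemma C1_on_compose:
 assumes "C1_on S f" "C1_on T g" "f ` S \<subseteq> T"
 shows "C1_on S (%x. g (f x))"
proof -
 obtain f' g' where f: "!!x. x \<in> S ==> (f has_derivative blinfun_apply (f' x)) (at x)" "continuous_on S f'"
  and g: "!!x. x \<in> T ==> (g has_derivative blinfun_apply (g' x)) (at x)" "continuous_on T g'"
  using assms(1,2) unfolding C1_on_def by blast
 show ?thesis unfolding C1_on_def
 proof (intro exI[of _ "%x. g' (f x) o\<^sub>L f' x"] conjI ballI)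
  fix x assume "x \<in> S"
  then show "((%x. g (f x)) has_derivative blinfun_apply (g' (f x) o\<^sub>L f' x)) (at x)"
   using has_derivative_compose[OF f(1) g(1)] assms(3) by (simp add: blinfun_compose.rep_eq comp_def image_subset_iff)
 next
  show "continuous_on S (%x. g' (f x) o\<^sub>L f' x)"
   by (intro bounded_bilinear.continuous_on[OF bounded_bilinear_blinfun_compose]
     continuous_on_compose2[OF g(2)] f C1_on_imp_continuous_on assms)
 qed
qed

lemma C1_on_add: "C1_on S f ==> C1_on S g ==> C1_on S (%x. f x + g x)"
 unfolding C1_on_def
 by (elim exE conjE, rule_tac x = "%x. f' x + f'a x" in exI)
   (auto intro!: derivative_eq_intros continuous_intros simp: blinfun.add_left)

lemma C2_on_const: "C2_on S (%x. c)"
 unfolding C2_on_iff_C1_on by (intro exI[of _ "%_. 0"]) (auto simp: C1_on_const zero_blinfun.rep_eq)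

lemma C2_on_bounded_linear: "bounded_linear h ==> C2_on S h"
 unfolding C2_on_iff_C1_on
 by (intro exI[of _ "%_. Blinfun h"])
   (simp add: bounded_linear_Blinfun_apply bounded_linear_imp_has_derivative C1_on_const)

lemma C2_on_bilinear:
 assumes "bounded_bilinear pr" "C2_on S f" "C2_on S g"
 shows "C2_on S (%x. pr (f x) (g x))"
proof -
 note flip = bounded_bilinear.flip[OF assms(1)]
 obtain f' g' where f: "!!x. x \<in> S ==> (f has_derivative blinfun_apply (f' x)) (at x)" "C1_on S f'"
  and g: "!!x. x \<in> S ==> (g has_derivative blinfun_apply (g' x)) (at x)" "C1_on S g'"
  using assms(2,3) unfolding C2_on_iff_C1_on by blast
 show ?thesis unfolding C2_on_iff_C1_on
 proof (intro exI[of _ "%x. (Blinfun (pr (f x)) o\<^sub>L g' x) + (Blinfun (%a. pr a (g x)) o\<^sub>L f' x)"] conjI ballI)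
  fix x assume "x \<in> S"
  have "((%x. pr (f x) (g x)) has_derivative (%h. pr (f x) (g' x h) + pr (f' x h) (g x))) (at x)"
   by (intro bounded_bilinear.FDERIV[OF assms(1)] f g \<open>x \<in> S\<close>)
  then show "((%x. pr (f x) (g x)) has_derivative
    blinfun_apply ((Blinfun (pr (f x)) o\<^sub>L g' x) + (Blinfun (%a. pr a (g x)) o\<^sub>L f' x))) (at x)"
   by (rule has_derivative_eq_rhs)
     (simp add: blinfun.add_left fun_eq_iff blinfun_apply_bilinear[OF assms(1)] blinfun_apply_bilinear[OF flip])
 next
  show "C1_on S (%x. (Blinfun (pr (f x)) o\<^sub>L g' x) + (Blinfun (%a. pr a (g x)) o\<^sub>L f' x))"
   by (intro C1_on_add C1_on_bilinear[OF bounded_bilinear_blinfun_compose] f g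
     C1_on_compose[OF C2_on_imp_C1_on C1_on_bounded_linear[OF bounded_linear_Blinfun_bilinear[OF assms(1)], of UNIV]]
     C1_on_compose[OF C2_on_imp_C1_on C1_on_bounded_linear[OF bounded_linear_Blinfun_bilinear[OF flip], of UNIV]] assms)
     auto
 qed
qed

lemma C2_on_compose:
 assumes "C2_on S f" "C2_on T g" "f ` S \<subseteq> T"
 shows "C2_on S (%x. g (f x))"
proof -
 obtain f' g' where f: "!!x. x \<in> S ==> (f has_derivative blinfun_apply (f' x)) (at x)" "C1_on S f'"
  and g: "!!x. x \<in> T ==> (g has_derivative blinfun_apply (g' x)) (at x)" "C1_on T g'"
  using assms(1,2) unfolding C2_on_iff_C1_on by blast
 show ?thesis unfolding C2_on_iff_C1_on
 proof (intro exI[of _ "%x. g' (f x) o\<^sub>L f' x"] conjI ballI)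
  fix x assume "x \<in> S"
  then show "((%x. g (f x)) has_derivative blinfun_apply (g' (f x) o\<^sub>L f' x)) (at x)"
   using has_derivative_compose[OF f(1) g(1)] assms(3) by (simp add: blinfun_compose.rep_eq comp_def image_subset_iff)
 next
  show "C1_on S (%x. g' (f x) o\<^sub>L f' x)"
   by (intro C1_on_bilinear[OF bounded_bilinear_blinfun_compose]
     C1_on_compose[OF C2_on_imp_C1_on g(2)] f assms)
 qed
qed

lemma C2_on_add: "C2_on S f ==> C2_on S g ==> C2_on S (%x. f x + g x)"
 unfolding C2_on_iff_C1_on
 by (elim exE conjE, rule_tac x = "%x. f' x + f'a x" in exI)
   (auto intro!: derivative_eq_intros C1_on_add simp: blinfun.add_left)

lemma C1_on_realI:
 assumes f: "!!x. x \<in> S ==> (f hvd f' x) (at x)" and c: "continuous_on S f'"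
 shows "C1_on S (f :: real => _)"
 unfolding C1_on_def
proof (intro exI[of _ "%x. blinfun_scaleR_left (f' x)"] conjI ballI)
 show "(f has_derivative blinfun_apply (blinfun_scaleR_left (f' x))) (at x)" if "x \<in> S" for x
  using f[OF that] by (simp add: has_vector_derivative_def)
 show "continuous_on S (%x. blinfun_scaleR_left (f' x))"
  using c by (intro continuous_intros)
qed

lemma C2_on_realI:
 assumes f: "!!x. x \<in> S ==> (f hvd f' x) (at x)"
  and f': "!!x. x \<in> S ==> (f' hvd f'' x) (at x)" and c: "continuous_on S f''"
 shows "C2_on S (f :: real => _)"
 unfolding C2_on_iff_C1_on
proof (intro exI[of _ "%x. blinfun_scaleR_left (f' x)"] conjI ballI)
 show "(f has_derivative blinfun_apply (blinfun_scaleR_left (f' x))) (at x)" if "x \<in> S" for x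
  using f[OF that] by (simp add: has_vector_derivative_def)
 show "C1_on S (%x. blinfun_scaleR_left (f' x))"
  by (rule C1_on_compose[OF C1_on_realI[OF f' c] C1_on_bounded_linear[OF bounded_linear_blinfun_scaleR_left, of UNIV]])
    auto
qed

lemma C2_on_realE:
 assumes "C2_on UNIV (f :: real => 'b::real_normed_vector)"
 obtains f1 f2 where "!!x. (f hvd f1 x) (at x)"
  "!!x. (f1 hvd f2 x) (at x)" "continuous_on UNIV f2"
proof -
 obtain f' f'' where f: "!!x. (f has_derivative blinfun_apply (f' x)) (at x)"
   "!!x. (f' has_derivative blinfun_apply (f'' x)) (at x)" "continuous_on UNIV f''"
  using assms unfolding C2_on_def by auto
 have "(f hvd f' x 1) (at x)" for x
 proof -
  have "blinfun_apply (f' x) = (%h. h *. f' x 1)"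
   by (metis blinfun.scaleR_right mult.right_neutral real_scaleR_def)
  then show ?thesis using f(1)[of x] by (simp add: has_vector_derivative_def)
 qed
 moreover have "((%x. f' x 1) hvd f'' x 1 1) (at x)" for x
 proof -
  have "((%x. f' x 1) has_derivative (%h. f'' x h 1)) (at x)"
   by (rule bounded_linear.has_derivative[OF blinfun.bounded_linear_left f(2)])
  moreover have "(%h. f'' x h 1) = (%h. h *. f'' x 1 1)"
  proof
   show "f'' x h 1 = h *. f'' x 1 1" for h
    using blinfun.scaleR_right[of "f'' x" h 1] by (simp add: blinfun.scaleR_left)
  qed
  ultimately show ?thesis by (simp add: has_vector_derivative_def)
 qed
 moreover have "continuous_on UNIV (%x. f'' x 1 1)"
  by (intro continuous_intros f)
 ultimately show ?thesis by (rule that)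
qed

lemma C2_on_cong:
 assumes "open S" "!!x. x \<in> S ==> f x = g x" "C2_on S g" shows "C2_on S f"
proof -
 obtain g' where g: "!!x. x \<in> S ==> (g has_derivative blinfun_apply (g' x)) (at x)" "C1_on S g'"
  using assms(3) unfolding C2_on_iff_C1_on by blast
 have "(f has_derivative blinfun_apply (g' x)) (at x)" if "x \<in> S" for x
  using has_derivative_transform_within_open[OF g(1)[OF that] assms(1) that] assms(2) by simp
 then show ?thesis unfolding C2_on_iff_C1_on using g(2) by blast
qed

text \<open>\<open>C2_on\<close> asks for derivatives chosen at once on all of \<open>S\<close>.
  Local choices agree because derivatives at interior points are unique, so
  \<open>frechet_derivative\<close> serves as the global choice.\<close>

lemma C2_on_local:
 assumes "!!x. x \<in> S ==> EX U. open U & x \<in> U & C2_on U f"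
 shows "C2_on S f"
proof -
 define f' where "f' x = Blinfun (frechet_derivative f (at x))" for x
 define f'' where "f'' x = Blinfun (frechet_derivative f' (at x))" for x
 have *: "(f has_derivative blinfun_apply (f' x)) (at x) & (f' has_derivative blinfun_apply (f'' x)) (at x) &
   isCont f'' x" if "x \<in> S" for x
 proof -
  obtain U where U: "open U" "x \<in> U" "C2_on U f" using assms \<open>x \<in> S\<close> by blast
  obtain g g' where g: "!!y. y \<in> U ==> (f has_derivative blinfun_apply (g y)) (at y)"
    "!!y. y \<in> U ==> (g has_derivative blinfun_apply (g' y)) (at y)" "continuous_on U g'"
   using U(3) unfolding C2_on_def by blast
  have e1: "f' y = g y" if "y \<in> U" for y
   using frechet_derivative_at[OF g(1)[OF that]] by (metis blinfun_apply_inverse f'_def)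
  have d: "(f' has_derivative blinfun_apply (g' y)) (at y)" if "y \<in> U" for y
   using has_derivative_transform_within_open[OF g(2)[OF that] U(1) that] e1 by simp
  have e2: "f'' y = g' y" if "y \<in> U" for y
   using frechet_derivative_at[OF d[OF that]] by (metis blinfun_apply_inverse f''_def)
  have "continuous_on U f''" using g(3) e2 by (simp cong: continuous_on_cong)
  then have "isCont f'' x" using U by (simp add: continuous_on_eq_continuous_at)
  then show ?thesis using g(1)[OF U(2)] d[OF U(2)] e1[OF U(2)] e2[OF U(2)] by simp
 qed
 then show ?thesis unfolding C2_on_def
  by (intro exI[of _ f'] exI[of _ f'']) (auto intro: cont_at_imp_cont_on)
qed

text \<open>At a zero of \<open>G\<close> the increment of \<open>F\<close> is multiplied by
  something of first order, so continuity of \<open>F\<close> suffices. This fits the resolvent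
  identity below, where the left factor is the inverse whose differentiability is still to be
  shown.\<close>

lemma has_derivative_bilinear_null:
 fixes F :: "'a::real_normed_vector => 'b::real_normed_vector" and G :: "'a => 'c::real_normed_vector"
 assumes "bounded_bilinear pr" and F: "isCont F y" and G: "(G has_derivative G') (at y)" "G y = 0"
 shows "((%x. pr (F x) (G x)) has_derivative (%h. pr (F y) (G' h))) (at y)"
proof -
 note flip = bounded_bilinear.flip[OF assms(1)]
 have bl: "bounded_linear G'" using G(1) by (rule has_derivative_bounded_linear)
 have G0: "((%x. (G x - G' (x - y)) /\<^sub>R norm (x - y)) \<longlongrightarrow> 0) (at y)"
  using G by (simp add: has_derivative_at_within)
 obtain K where K: "!!h. norm (G' h) <= norm h * K" using bounded_linear.bounded[OF bl] by blast
 have "norm (G' (x - y) /\<^sub>R norm (x - y)) <= \<bar>K\<bar>" for x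
  using order_trans[OF K[of "x - y"] mult_left_mono[OF abs_ge_self[of K] norm_ge_zero[of "x - y"]]]
  by (cases "x = y") (auto simp: field_simps)
 then have B: "Bfun (%x. G' (x - y) /\<^sub>R norm (x - y)) (at y)"
  by (intro BfunI[of _ "\<bar>K\<bar>"]) auto
 have "((%x. pr (F x) ((G x - G' (x - y)) /\<^sub>R norm (x - y))) \<longlongrightarrow> pr (F y) 0) (at y)"
  using F G0 by (intro bounded_bilinear.tendsto[OF assms(1)]) (simp_all add: isCont_def)
 moreover have "((%x. pr (F x - F y) (G' (x - y) /\<^sub>R norm (x - y))) \<longlongrightarrow> 0) (at y)"
  using bounded_bilinear.Zfun_prod_Bfun[OF assms(1) _ B, of "%x. F x - F y"] F
  by (simp add: tendsto_Zfun_iff isCont_def)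
 ultimately have "((%x. pr (F x) ((G x - G' (x - y)) /\<^sub>R norm (x - y)) +
   pr (F x - F y) (G' (x - y) /\<^sub>R norm (x - y))) \<longlongrightarrow> pr (F y) 0 + 0) (at y)"
  by (rule tendsto_add)
 then have "((%x. (pr (F x) (G x) - pr (F y) (G y) - pr (F y) (G' (x - y))) /\<^sub>R norm (x - y)) \<longlongrightarrow> 0) (at y)"
  by (simp add: G(2) bounded_bilinear.zero_right[OF assms(1)] bounded_bilinear.scaleR_right[OF assms(1)]
    bounded_bilinear.diff_right[OF assms(1)] bounded_bilinear.diff_left[OF assms(1)] scaleR_diff_right)
 then show ?thesis
  by (simp add: has_derivative_at_within bounded_linear_compose[OF bounded_bilinear.bounded_linear_right[OF assms(1)] bl])
qed

text \<open>The inverse is \<open>C\<^sup>2\<close> because the inverse \<open>B\<close> of an operator-valued function \<open>A\<close> satisfies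
 \<open>B y - B z = - B y (A y - A z) B z\<close>.\<close>

lemma C2_on_inverse:
 fixes f g :: "'a::euclidean_space => 'a"
 assumes f: "C2_on UNIV f" and hom: "homeomorphism UNIV UNIV f g"
  and inj: "!!x D h. (f has_derivative D) (at x) ==> D h = 0 ==> h = 0"
 shows "C2_on UNIV g"
proof -
 obtain f' where f': "!!x. (f has_derivative blinfun_apply (f' x)) (at x)" "C1_on UNIV f'"
  using f unfolding C2_on_iff_C1_on by blast
 note bc = bounded_bilinear_blinfun_compose[where 'a = 'a and 'b = 'a and 'c = 'a]
 note bc' = bounded_bilinear.flip[OF bc]
 have fg: "f (g y) = y" "g (f y) = y" for y using hom by (auto simp: homeomorphism_def)
 have cg: "continuous_on UNIV g" using hom by (simp add: homeomorphism_def)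
 define A where "A y = f' (g y)" for y
 have "EX B. B o\<^sub>L A y = id_blinfun & A y o\<^sub>L B = id_blinfun" for y
 proof -
  have lin: "linear (blinfun_apply (A y))" by (simp add: blinfun.bounded_linear_right bounded_linear.linear)
  have "inj (blinfun_apply (A y))"
   using inj[OF f'(1)] lin linear_injective_0 unfolding A_def by blast
  then obtain h where h: "linear h" "h \<circ> blinfun_apply (A y) = id"
   using linear_injective_left_inverse[OF lin] by blast
  then have "blinfun_apply (A y) \<circ> h = id" using linear_inverse_left[OF h(1) lin] by simp
  then show ?thesis using h
   by (intro exI[of _ "Blinfun h"] conjI blinfun_eqI)
     (simp_all add: bounded_linear_Blinfun_apply linear_conv_bounded_linear[symmetric] pointfree_idE)
 qed
 then obtain B where B: "!!y. B y o\<^sub>L A y = id_blinfun" "!!y. A y o\<^sub>L B y = id_blinfun" by metis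
 have BA: "B y (A y h) = h" "A y (B y h) = h" for y h
  using B[of y] by (metis blinfun_apply_blinfun_compose blinfun_apply_id_blinfun id_apply)+
 have dg: "(g has_derivative blinfun_apply (B y)) (at y)" for y
  by (rule has_derivative_inverse_basic[where f = f and f' = "blinfun_apply (A y)" and T = UNIV])
    (use BA cg fg f'(1)[of "g y"] in \<open>auto simp: fun_eq_iff A_def[symmetric] blinfun.bounded_linear_right continuous_on_eq_continuous_at\<close>)
 obtain f'' where f'': "!!x. (f' has_derivative blinfun_apply (f'' x)) (at x)" "continuous_on UNIV f''"
  using f'(2) unfolding C1_on_def by blast
 define A' where "A' y = f'' (g y) o\<^sub>L B y" for y
 have dA: "(A has_derivative blinfun_apply (A' y)) (at y)" for y
  using has_derivative_compose[OF dg f''(1)] by (simp add: A_def[abs_def] A'_def blinfun_compose.rep_eq comp_def)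
 have cA: "isCont A y" for y using dA has_derivative_continuous by blast
 have resolvent: "B y = B z - ((B y o\<^sub>L (A y - A z)) o\<^sub>L B z)" for y z
  by (rule blinfun_eqI) (simp add: blinfun.diff_left blinfun.diff_right BA)
 have cB: "isCont B z" for z
 proof -
  \<comment> \<open>The resolvent identity is used twice: for \<open>y\<close> near \<open>z\<close>
    it first absorbs its own right side and gives \<open>norm (B y) <= 2 * b\<close>, and then it
    bounds the difference.\<close>
  define b where "b = norm (B z) + 1"
  have b: "norm (B z) <= b" "0 < b" by (auto simp: b_def add_nonneg_pos)
  have "\<forall>\<^sub>F y in at z. norm (A y - A z) < 1 / (2 * b)"
   using cA[of z] b(2) unfolding isCont_def tendsto_iff dist_norm by simp
  then have "\<forall>\<^sub>F y in at z. norm (B y - B z) <= 2 * b * b * norm (A y - A z)"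
  proof eventually_elim
   case (elim y)
   have "norm (B y) = norm (B z - ((B y o\<^sub>L (A y - A z)) o\<^sub>L B z))"
    using resolvent[of y z] by simp
   also have "... <= norm (B z) + norm (B y) * norm (A y - A z) * norm (B z)"
    by (intro order_trans[OF norm_triangle_ineq4] add_left_mono
      order_trans[OF norm_blinfun_compose] mult_right_mono norm_blinfun_compose) auto
   also have "... <= b + norm (B y) * (1 / (2 * b)) * b"
    using elim b by (intro add_mono mult_mono) auto
   finally have By: "norm (B y) <= 2 * b" using b(2) by simp
   have "norm (B y - B z) = norm ((B y o\<^sub>L (A y - A z)) o\<^sub>L B z)"
    by (subst resolvent[of y z]) simp
   also have "... <= norm (B y) * norm (A y - A z) * norm (B z)"
    by (intro order_trans[OF norm_blinfun_compose] mult_right_mono norm_blinfun_compose) auto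
   also have "... <= (2 * b) * norm (A y - A z) * b"
    using By b by (intro mult_mono) auto
   finally show ?case by (simp add: ac_simps)
  qed
  moreover have "((%y. 2 * b * b * norm (A y - A z)) \<longlongrightarrow> 0) (at z)"
   using cA[of z] unfolding isCont_def by (intro tendsto_mult_right_zero tendsto_norm_zero LIM_zero)
  ultimately have "((%y. B y - B z) \<longlongrightarrow> 0) (at z)"
   by (rule Lim_null_comparison)
  then show ?thesis unfolding isCont_def by (rule LIM_zero_cancel)
 qed
 define L where "L z = - (Blinfun (%X. X o\<^sub>L B z) o\<^sub>L (Blinfun (%X. B z o\<^sub>L X) o\<^sub>L A' z))" for z
 have dB: "(B has_derivative blinfun_apply (L z)) (at z)" for z
 proof -
  have "((%y. A y - A z) has_derivative blinfun_apply (A' z)) (at z)"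
   using has_derivative_diff[OF dA has_derivative_const] by simp
  then have "((%y. B y o\<^sub>L (A y - A z)) has_derivative (%h. B z o\<^sub>L A' z h)) (at z)"
   by (rule has_derivative_bilinear_null[OF bounded_bilinear_blinfun_compose cB]) simp
  then have "((%y. (B y o\<^sub>L (A y - A z)) o\<^sub>L B z) has_derivative (%h. (B z o\<^sub>L A' z h) o\<^sub>L B z)) (at z)"
   by (rule bounded_linear.has_derivative[OF
      bounded_bilinear.bounded_linear_left[OF bounded_bilinear_blinfun_compose]])
  then have "((%y. B z - ((B y o\<^sub>L (A y - A z)) o\<^sub>L B z)) has_derivative (%h. 0 - ((B z o\<^sub>L A' z h) o\<^sub>L B z))) (at z)"
   by (intro has_derivative_diff has_derivative_const)
  moreover have "(%y. B z - ((B y o\<^sub>L (A y - A z)) o\<^sub>L B z)) = B"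
   using resolvent[of _ z] by auto
  ultimately show ?thesis
   by (simp add: L_def blinfun.minus_left fun_eq_iff has_derivative_eq_rhs
     blinfun_apply_bilinear[OF bc] blinfun_apply_bilinear[OF bc'])
 qed
 have "continuous_on UNIV B" using cB by (simp add: cont_at_imp_cont_on)
 moreover from this have "continuous_on UNIV A'"
  unfolding A'_def
  by (intro bounded_bilinear.continuous_on[OF bounded_bilinear_blinfun_compose]
    continuous_on_compose2[OF f''(2)] cg) auto
 ultimately have "continuous_on UNIV L"
  unfolding L_def
  by (intro continuous_on_minus bounded_bilinear.continuous_on[OF bounded_bilinear_blinfun_compose]
    bounded_linear.continuous_on[OF bounded_linear_Blinfun_bilinear[OF bc']]
    bounded_linear.continuous_on[OF bounded_linear_Blinfun_bilinear[OF bc]])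
 then show ?thesis
  unfolding C2_on_def using dg dB by blast
qed

section \<open>Polar coordinates and star-shaped domains\<close>

lemma ev_add: "ev (t + b) = cos b *. ev t + sin b *. rot90 (ev t)"
 by (simp add: real2_eq_iff cos_add sin_add)

lemma inner_self_ev: "x \<bullet> x = (x \<bullet> ev t)\<^sup>2 + (x \<bullet> rot90 (ev t))\<^sup>2"
proof -
 have "x \<bullet> x = x \<bullet> ((x \<bullet> ev t) *. ev t + (x \<bullet> rot90 (ev t)) *. rot90 (ev t))"
  using ev_decomp[of x t] by simp
 then show ?thesis by (simp add: inner_add_right power2_eq_square)
qed

lemma polar_arctan:
 assumes "0 < x \<bullet> ev t"
 shows "x = norm x *. ev (t + arctan ((x \<bullet> rot90 (ev t)) / (x \<bullet> ev t)))"
proof -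
 define p q where "p = x \<bullet> ev t" "q = x \<bullet> rot90 (ev t)"
 have p: "0 < p" using assms by (simp add: p_q_def)
 have "sqrt (1 + (q / p)\<^sup>2) = norm x / p"
 proof -
  have "1 + (q / p)\<^sup>2 = (norm x / p)\<^sup>2"
   using p inner_self_ev[of x t] by (simp add: p_q_def power_divide dot_square_norm field_simps)
  then show ?thesis using p by simp
 qed
 then have "norm x *. ev (t + arctan (q / p)) = norm x *. ((p / norm x) *. ev t + (q / norm x) *. rot90 (ev t))"
  using p by (simp add: ev_add cos_arctan sin_arctan)
 also have "... = p *. ev t + q *. rot90 (ev t)"
  using assms by (cases "x = 0") (auto simp: scaleR_add_right)
 also have "... = x" using ev_decomp[of x t] by (simp add: p_q_def)
 finally show ?thesis by (simp add: p_q_def)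
qed

lemma ex_polar: "EX t. x = norm x *. ev t"
proof (cases "x = 0")
 case False
 then have "norm (x /\<^sub>R norm x) = 1" by simp
 then obtain t where "x /\<^sub>R norm x = ev t" using ex_ev by blast
 then have "x = norm x *. ev t" using False by (metis divideR_right norm_eq_zero)
 then show ?thesis by blast
qed simp

text \<open>The reference angle \<open>ang\<close> cancels: corrected by the \<open>arctan\<close>
  term it becomes the true polar angle of \<open>c\<close>, whose derivative is the cross product
  over the squared radius.\<close>

lemma polar_angle_derivative:
 assumes c: "(c hvd v) (at s)" and ang: "(ang hrd a) (at s)"
  and p: "0 < c s \<bullet> ev (ang s)"
 shows "((%s. ang s + arctan ((c s \<bullet> rot90 (ev (ang s))) / (c s \<bullet> ev (ang s)))) hrd
  (rot90 (c s) \<bullet> v) / (c s \<bullet> c s)) (at s)"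
proof -
 let ?e = "ev (ang s)"
 let ?f = "rot90 (ev (ang s))"
 have 1: "((%s. c s \<bullet> ev (ang s)) hrd (c s \<bullet> (a *. ?f) + v \<bullet> ?e)) (at s)"
  using bounded_bilinear_hvd[OF bounded_bilinear_inner c has_derivative_ev[OF ang]]
  by (simp add: hrd_iff_hvd)
 have 2: "((%s. c s \<bullet> rot90 (ev (ang s))) hrd (c s \<bullet> rot90 (a *. ?f) + v \<bullet> ?f)) (at s)"
  using bounded_bilinear_hvd[OF bounded_bilinear_inner c
    bounded_linear_hvd[OF bounded_linear_rot90 has_derivative_ev[OF ang]]]
  by (simp add: hrd_iff_hvd)
 define P Q where "P = c s \<bullet> ?e" "Q = c s \<bullet> ?f"
 have cc: "c s \<bullet> c s = P\<^sup>2 + Q\<^sup>2" unfolding P_Q_def by (rule inner_self_ev)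
 have cv: "rot90 (c s) \<bullet> v = P * (v \<bullet> ?f) - Q * (v \<bullet> ?e)"
 proof -
  have "rot90 (c s) = P *. ?f - Q *. ?e"
   using arg_cong[OF ev_decomp[of "c s" "ang s"], of rot90] by (simp add: rot90_add rot90_scaleR rot90_rot90 P_Q_def)
  then show ?thesis by (simp add: inner_diff_left inner_diff_right inner_commute[of _ v])
 qed
 have "a + (1 / (1 + (Q / P)\<^sup>2)) * (((c s \<bullet> rot90 (a *. ?f) + v \<bullet> ?f) * P - Q * (c s \<bullet> (a *. ?f) + v \<bullet> ?e)) / (P * P))
   = (rot90 (c s) \<bullet> v) / (c s \<bullet> c s)"
 proof -
  have "1 + (Q / P)\<^sup>2 = (P\<^sup>2 + Q\<^sup>2) / (P * P)"
   using p by (simp add: P_Q_def(1)[symmetric] field_simps power2_eq_square)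
  then have 1: "(1 / (1 + (Q / P)\<^sup>2)) * (X / (P * P)) = X / (P\<^sup>2 + Q\<^sup>2)" for X
   using p by (simp add: P_Q_def(1)[symmetric])
  have nz: "P\<^sup>2 + Q\<^sup>2 ~= 0" using p by (simp add: P_Q_def(1)[symmetric] sum_power2_eq_zero_iff)
  have 2: "a + ((- (a * P) + x) * P - Q * (a * Q + y)) / (P\<^sup>2 + Q\<^sup>2) = (P * x - Q * y) / (P\<^sup>2 + Q\<^sup>2)" for x y
  proof -
   have "a = a * (P\<^sup>2 + Q\<^sup>2) / (P\<^sup>2 + Q\<^sup>2)" using nz by simp
   then have "a + ((- (a * P) + x) * P - Q * (a * Q + y)) / (P\<^sup>2 + Q\<^sup>2)
     = (a * (P\<^sup>2 + Q\<^sup>2) + ((- (a * P) + x) * P - Q * (a * Q + y))) / (P\<^sup>2 + Q\<^sup>2)"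
    by (simp only: add_divide_distrib)
   then show ?thesis by (simp add: algebra_simps power2_eq_square)
  qed
  have 3: "c s \<bullet> rot90 (a *. ?f) = - (a * P)" "c s \<bullet> (a *. ?f) = a * Q"
   by (simp_all add: rot90_scaleR rot90_rot90 P_Q_def)
  show ?thesis unfolding cc cv 1 3 by (rule 2)
 qed
 moreover have "((%s. ang s + arctan ((c s \<bullet> rot90 (ev (ang s))) / (c s \<bullet> ev (ang s)))) hrd
   a + inverse (1 + (Q / P)\<^sup>2) *
    (((c s \<bullet> rot90 (a *. ?f) + v \<bullet> ?f) * P - Q * (c s \<bullet> (a *. ?f) + v \<bullet> ?e)) / (P * P))) (at s)"
  unfolding P_Q_def
  by (intro DERIV_add[OF ang] DERIV_chain2[OF DERIV_arctan] DERIV_divide[OF 2 1]) (use p in simp)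
 ultimately show ?thesis by (simp only: inverse_eq_divide)
qed

lemma pos_part_power_derivative:
 "((%s::real. (max 0 (s - a)) ^ Suc (Suc n)) hrd real (Suc (Suc n)) * (max 0 (s - a)) ^ Suc n) (at s)"
proof -
 consider "s < a" | "s = a" | "a < s" by linarith
 then show ?thesis
 proof cases
  case 1
  have "((%s::real. 0) hrd 0) (at s)" by simp
  then show ?thesis
   by (rule has_field_derivative_transform_within_open[of _ _ _ "{..<a}", THEN DERIV_cong]) (use 1 in auto)
 next
  case 3
  have "((%s::real. (s - a) ^ Suc (Suc n)) hrd real (Suc (Suc n)) * (s - a) ^ Suc n) (at s)"
   using DERIV_power[OF DERIV_diff[OF DERIV_ident DERIV_const[of a]], of "Suc (Suc n)" s UNIV] by simp
  then show ?thesis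
   by (rule has_field_derivative_transform_within_open[of _ _ _ "{a<..}", THEN DERIV_cong]) (use 3 in auto)
 next
  case 2
  have "((%y. ((max 0 (y - a)) ^ Suc (Suc n) - (max 0 (a - a)) ^ Suc (Suc n)) / (y - a)) \<longlongrightarrow> 0) (at a)"
  proof (rule Lim_null_comparison)
   show "\<forall>\<^sub>F y in at a. norm (((max 0 (y - a)) ^ Suc (Suc n) - (max 0 (a - a)) ^ Suc (Suc n)) / (y - a)) <= (max 0 (y - a)) ^ Suc n"
    by (rule always_eventually) (auto simp: max_def)
   have "isCont (%y. (max 0 (y - a)) ^ Suc n) a" by (intro continuous_intros)
   then show "((%y. (max 0 (y - a)) ^ Suc n) \<longlongrightarrow> 0) (at a)" by (simp add: isCont_def)
  qed
  then show ?thesis using 2 by (simp add: has_field_derivative_iff)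
 qed
qed

lemma real_diffeomorphism_inverse:
 fixes A :: "real => real"
 assumes A: "!!s. (A hrd A' s) (at s)" and pos: "!!s. 0 < A' s" and surj: "surj A"
 obtains u where "!!y. A (u y) = y" "!!s. u (A s) = s"
  "!!y. (u hrd 1 / A' (u y)) (at y)" "strict_mono A" "strict_mono u"
proof -
 have mono: "strict_mono A"
  by (rule strict_monoI) (rule DERIV_pos_imp_increasing, use A pos in auto)
 then have inj: "inj A" by (rule strict_mono_imp_inj_on)
 define u where "u = inv A"
 have Au: "A (u y) = y" "u (A s) = s" for y s
  using surj inj by (simp_all add: u_def surj_f_inv_f)
 have cA: "continuous_on UNIV A"
  using A DERIV_continuous_on hfd_at_within by blast
 have "continuous_on (A ` UNIV) u"
  by (rule continuous_on_inverse_open[of UNIV A]) (use cA Au in auto)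
 then have cu: "isCont u y" for y using surj by (simp add: continuous_on_eq_continuous_at)
 have "(u hrd inverse (A' (u y))) (at y)" for y
  by (rule DERIV_inverse_function[where f = A and a = "y - 1" and b = "y + 1"])
    (use A cu Au pos[of "u y"] in auto)
 moreover have "strict_mono u"
  by (rule strict_monoI) (metis Au(1) mono not_less_iff_gr_or_eq strict_mono_less)
 ultimately show ?thesis using Au mono by (intro that[of u]) (auto simp: inverse_eq_divide)
qed

lemma surj_quasi_periodic:
 fixes A :: "real => real"
 assumes cA: "continuous_on UNIV A" and per: "!!s. A (s + T) = A s + L" and L: "0 < L"
 shows "surj A"
proof -
 have up: "A (s + real k * T) = A s + real k * L" for k s
 proof (induction k)
  case (Suc k)
  then show ?case using per[of "s + real k * T"] by (simp add: algebra_simps)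
 qed simp
 have down: "A (s - real k * T) = A s - real k * L" for k s
  using up[of "s - real k * T" k] by simp
 have "EX s. A s = y" for y
 proof -
  obtain k :: nat where k: "\<bar>y - A 0\<bar> / L < k" using reals_Archimedean2 by blast
  then have "\<bar>y - A 0\<bar> < real k * L" using L by (simp add: field_simps)
  then have "A (- real k * T) < y" "y < A (real k * T)" using up[of 0 k] down[of 0 k] by auto
  moreover have "connected (range A)" by (rule connected_continuous_image[OF cA]) simp
  ultimately have "y \<in> range A"
   by (meson connectedD_interval less_imp_le rangeI)
  then show ?thesis by auto
 qed
 then show ?thesis by (metis surjI surj_def)
qed

section \<open>A \<open>C2_on\<close> diffeomorphism of the plane taking the unit disc to a given
  star-shaped domain\<close>

locale polar_star =
 fixes P :: "real => real"
 assumes P_C2: "C2_on UNIV P" and P_periodic: "P (t + 2 * pi) = P t" and P_pos: "0 < P t"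
begin

text \<open>\<open>P\<close> as a function of the direction. Any angle of \<open>x\<close> may be
  picked since \<open>P\<close> is periodic; at the origin the value is immaterial because it gets
  multiplied by zero in \<open>Th\<close>.\<close>

definition R :: "real^2 => real" where "R x = P (SOME t. x = norm x *. ev t)"

lemma P_periodic_int: "P (t + 2 * pi * of_int k) = P t"
proof -
 have nat: "P (t + 2 * pi * real n) = P t" for t n
 proof (induction n)
  case (Suc n)
  then show ?case using P_periodic[of "t + 2 * pi * real n"] by (simp add: algebra_simps)
 qed simp
 show ?thesis
 proof (cases "0 <= k")
  case True then show ?thesis using nat[of t "nat k"] by simp
 next
  case False
  then show ?thesis using nat[of "t + 2 * pi * of_int k" "nat (- k)"] by simp
 qed
qed

lemma P_cong: "ev s = ev t ==> P s = P t"
 using P_periodic_int ev_eq_iff by metis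

lemma R_polar: "0 < r ==> R (r *. ev t) = P t"
proof -
 assume "0 < r"
 have "r *. ev t = norm (r *. ev t) *. ev (SOME s. r *. ev t = norm (r *. ev t) *. ev s)"
  by (rule someI_ex[OF ex_polar])
 then show ?thesis unfolding R_def using \<open>0 < r\<close> by (auto intro: P_cong)
qed

lemma R_local: "0 < x \<bullet> ev t ==> R x = P (t + arctan ((x \<bullet> rot90 (ev t)) / (x \<bullet> ev t)))"
 using polar_arctan[of x t] R_polar[of "norm x"]
 by (metis inner_zero_left less_irrefl zero_less_norm_iff)

lemma C2_R: "C2_on (- {0}) R"
proof (rule C2_on_local)
 fix x :: "real^2" assume "x \<in> - {0}"
 obtain t where t: "x = norm x *. ev t" using ex_polar by blast
 let ?U = "{x. 0 < x \<bullet> ev t}"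
 have "open ?U" by (intro open_Collect_less continuous_intros)
 moreover have "x \<in> ?U"
  using \<open>x \<in> - {0}\<close> by (subst t) (simp add: ev_inner_ev)
 moreover have "C2_on ?U R"
 proof (rule C2_on_cong[OF \<open>open ?U\<close> R_local])
  have inv: "C2_on {0<..} (%y::real. 1 / y)"
   by (rule C2_on_realI[where f' = "%y. - 1 / y^2" and f'' = "%y. 2 / y^3"])
     (auto intro!: derivative_eq_intros continuous_intros
      simp: hrd_iff_hvd[symmetric] field_simps power2_eq_square eval_nat_numeral)
  have at: "C2_on UNIV arctan"
  proof (rule C2_on_realI[where f' = "%y. 1 / (1 + y^2)" and f'' = "%y. - (2 * y) / (1 + y^2)^2"])
   have "1 + y\<^sup>2 ~= 0" for y :: real by (smt (verit) zero_le_power2)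
   then show "continuous_on UNIV (%y::real. - (2 * y) / (1 + y^2)^2)"
    and "((%y. 1 / (1 + y^2)) hvd - (2 * y) / (1 + y^2)^2) (at y)" for y :: real
    unfolding hrd_iff_hvd[symmetric]
    by (auto intro!: derivative_eq_intros continuous_intros simp: power2_eq_square[of "1 + y\<^sup>2"])
  qed (auto intro!: derivative_eq_intros simp: hrd_iff_hvd[symmetric] inverse_eq_divide)
  have "C2_on ?U (%x. (x \<bullet> rot90 (ev t)) * (1 / (x \<bullet> ev t)))"
   by (intro C2_on_bilinear[OF bounded_bilinear_mult] C2_on_compose[OF _ inv]
     C2_on_bounded_linear bounded_linear_inner_left) auto
  then show "C2_on ?U (%x. P (t + arctan ((x \<bullet> rot90 (ev t)) / (x \<bullet> ev t))))"
   by (intro C2_on_compose[OF _ P_C2] C2_on_add C2_on_const C2_on_compose[OF _ at]) auto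
 qed auto
 ultimately show "EX U. open U & x \<in> U & C2_on U R" by blast
qed

text \<open>A cut-off that vanishes up to 1/2, where it keeps \<open>Th\<close> linear around the
  singularity of polar coordinates. The cube is the lowest truncated power of class
  \<open>C2_on\<close>, and the factor 8 gives \<open>chi 1 = 1\<close>.\<close>

definition chi :: "real => real" where "chi s = 8 * (max 0 (s - 1/2)) ^ 3"

lemma chi_derivative: "(chi hrd 24 * (max 0 (s - 1/2))\<^sup>2) (at s)"
 unfolding chi_def[abs_def]
 using DERIV_cmult[OF pos_part_power_derivative[of "1/2" 1 s], of 8] by (simp add: eval_nat_numeral)

lemma C2_chi: "C2_on UNIV chi"
proof (rule C2_on_realI)
 show "(chi hvd 24 * (max 0 (s - 1/2))\<^sup>2) (at s)" for s
  using chi_derivative by (simp add: hrd_iff_hvd)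
 show "((%s. 24 * (max 0 (s - 1/2))\<^sup>2) hvd 48 * max 0 (s - 1/2)) (at s)" for s :: real
  using DERIV_cmult[OF pos_part_power_derivative[of "1/2" 0 s], of 24]
  by (simp add: eval_nat_numeral hrd_iff_hvd)
qed (intro continuous_intros)

lemma chi_mono: "s <= t ==> chi s <= chi t"
 unfolding chi_def by (intro mult_left_mono power_mono) auto

text \<open>A slope below all values of \<open>P\<close>: the factor \<open>P t - k\<close> in
  \<open>psi\<close> is then positive, so \<open>psi t\<close> is increasing with slope at least
  \<open>k\<close>.\<close>

definition k :: real where "k = (SOME k. 0 < k & (ALL t. k < P t))"

lemma k: "0 < k" "k < P t"
proof -
 have cP: "continuous_on A P" for A
  using C1_on_imp_continuous_on[OF C2_on_imp_C1_on[OF P_C2]] continuous_on_subset by blast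
 obtain t0 where t0: "t0 \<in> {0..2*pi}" "!!t. t \<in> {0..2*pi} ==> P t0 <= P t"
  using continuous_attains_inf[OF compact_Icc _ cP] by (metis atLeastAtMost_iff empty_iff order_refl pi_ge_zero zero_le_mult_iff zero_le_numeral)
 have "P t0 / 2 < P t" for t
 proof -
  obtain s where "0 <= s" "s < 2 * pi" "cos t = cos s" "sin t = sin s"
   using sincos_total_2pi[of "cos t" "sin t"] by auto
  then have "P t = P s" by (intro P_cong) (simp add: real2_eq_iff)
  then show ?thesis using t0(2)[of s] P_pos[of t0] \<open>0 <= s\<close> \<open>s < 2 * pi\<close> by auto
 qed
 then have "EX k. 0 < k & (ALL t. k < P t)" using P_pos[of t0] by (intro exI[of _ "P t0 / 2"]) auto
 from someI_ex[OF this] show "0 < k" "k < P t" unfolding k_def by auto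
qed

definition psi :: "real => real => real" where "psi t l = k * l + (P t - k) * chi l"

text \<open>Every ray is mapped to itself, the one of angle \<open>t\<close> by
  \<open>psi t\<close>, which is \<open>k * l\<close> near the origin and equals \<open>P t\<close>
  at radius 1.\<close>

definition Th :: "real^2 => real^2" where
 "Th x = k *. x + ((R x - k) * (chi (norm x) / norm x)) *. x"

lemma Th_polar: "0 <= r ==> Th (r *. ev t) = psi t r *. ev t"
 by (cases "r = 0")
   (auto simp: Th_def psi_def R_polar chi_def scaleR_add_left)

lemma psi_facts: "psi t 0 = 0" "psi t 1 = P t" "strict_mono (psi t)" "0 <= l ==> k * l <= psi t l"
 "continuous_on A (psi t)"
proof -
 show "psi t 0 = 0" "psi t 1 = P t" by (simp_all add: psi_def chi_def power3_eq_cube)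
 show "strict_mono (psi t)"
 proof (rule strict_monoI)
  fix x y :: real assume "x < y"
  then have "k * x < k * y" "(P t - k) * chi x <= (P t - k) * chi y"
   using k(1) k(2)[of t] by (auto intro!: mult_left_mono chi_mono)
  then show "psi t x < psi t y" by (simp add: psi_def)
 qed
 show "k * l <= psi t l" if "0 <= l" using k(1) k(2)[of t] by (simp add: psi_def chi_def)
 show "continuous_on A (psi t)" unfolding psi_def chi_def by (intro continuous_intros)
qed

lemma psi_surj: "0 <= y ==> \<exists>l\<ge>0. psi t l = y"
proof -
 assume "0 <= y"
 have "y <= psi t (y / k)" using psi_facts(4)[of "y / k" t] k(1) \<open>0 <= y\<close> by simp
 then have "\<exists>l\<ge>0. l <= y / k & psi t l = y"
  using IVT'[of "psi t" 0 y "y / k"] psi_facts(1,5) k(1) \<open>0 <= y\<close> by auto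
 then show ?thesis by blast
qed

lemma C2_Th: "C2_on UNIV Th"
proof (rule C2_on_local)
 fix x :: "real^2"
 show "EX U. open U & x \<in> U & C2_on U Th"
 proof (cases "x = 0")
  case True
  have "C2_on (ball 0 (1/2)) Th"
  proof (rule C2_on_cong)
   show "C2_on (ball 0 (1/2)) ((*.) k :: real^2 => _)"
    by (intro C2_on_bounded_linear bounded_linear_scaleR_right)
  qed (auto simp: Th_def chi_def)
  then show ?thesis using True by (intro exI[of _ "ball 0 (1/2)"]) auto
 next
  case False
  have sq: "C2_on {0<..} (%y::real. chi (sqrt y) * (1 / sqrt y))"
  proof -
   have s1: "C2_on {0<..} sqrt"
    by (rule C2_on_realI[where f' = "%y. inverse (sqrt y) / 2" and f'' = "%y. - inverse (sqrt y * y) / 4"])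
      (auto intro!: derivative_eq_intros continuous_intros
       simp: hrd_iff_hvd[symmetric] field_simps power2_eq_square)
   have inv: "C2_on {0<..} (%y::real. 1 / y)"
    by (rule C2_on_realI[where f' = "%y. - 1 / y^2" and f'' = "%y. 2 / y^3"])
      (auto intro!: derivative_eq_intros continuous_intros
       simp: hrd_iff_hvd[symmetric] field_simps power2_eq_square eval_nat_numeral)
   show ?thesis
    by (intro C2_on_bilinear[OF bounded_bilinear_mult] C2_on_compose[OF s1 C2_chi] C2_on_compose[OF s1 inv]) auto
  qed
  have nn: "C2_on (- {0}) (%x :: real^2. chi (norm x) * (1 / norm x))"
   unfolding norm_eq_sqrt_inner
   by (rule C2_on_compose[OF _ sq])
     (auto intro!: C2_on_bilinear[OF bounded_bilinear_inner C2_on_bounded_linear[OF bounded_linear_ident]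
       C2_on_bounded_linear[OF bounded_linear_ident]])
  have "C2_on (- {0}) (%x. k *. x + ((R x + (- k)) * (chi (norm x) * (1 / norm x))) *. x)"
   by (intro C2_on_add C2_on_const C2_on_bilinear[OF bounded_bilinear_scaleR] C2_on_bilinear[OF bounded_bilinear_mult]
     C2_R nn C2_on_bounded_linear bounded_linear_ident bounded_linear_scaleR_right)
  moreover have "Th = (%x. k *. x + ((R x + (- k)) * (chi (norm x) * (1 / norm x))) *. x)"
   by (auto simp: Th_def)
  ultimately show ?thesis using False by (intro exI[of _ "- {0}"]) auto
 qed
qed

lemma inj_Th: "inj Th"
proof (rule injI)
 fix x y assume eq: "Th x = Th y"
 obtain s t where s: "x = norm x *. ev s" and t: "y = norm y *. ev t" using ex_polar by metis
 have e: "psi s (norm x) *. ev s = psi t (norm y) *. ev t"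
  using eq Th_polar[of "norm x" s] Th_polar[of "norm y" t] s t by simp
 have nn: "0 <= psi s (norm x)" "0 <= psi t (norm y)"
  using psi_facts(4) k(1) by (meson mult_nonneg_nonneg norm_ge_zero order_trans less_imp_le)+
 then have e1: "psi s (norm x) = psi t (norm y)" using arg_cong[OF e, of norm] by simp
 have z: "psi u l = 0 ==> l = 0" for u l
  using psi_facts(1)[of u] strict_mono_eq[OF psi_facts(3)[of u]] by metis
 show "x = y"
 proof (cases "psi s (norm x) = 0")
  case True then show ?thesis using z e1 by (metis norm_eq_zero)
 next
  case False
  then have "ev s = ev t" using e e1 by simp
  moreover from this have "P s = P t" by (rule P_cong)
  then have "psi t = psi s" unfolding psi_def[abs_def] by simp
  then have "norm x = norm y" using e1 strict_mono_eq[OF psi_facts(3)] by metis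
  ultimately show ?thesis using s t by metis
 qed
qed

lemma Th_image: "Th ` {x. norm x \<in> A} = {l *. ev t | l t. l \<in> psi t ` A}" if "A \<subseteq> {0..}"
proof (intro equalityI subsetI)
 fix y assume "y \<in> Th ` {x. norm x \<in> A}"
 then obtain x where x: "y = Th x" "norm x \<in> A" by auto
 obtain s where "x = norm x *. ev s" using ex_polar by blast
 then have "y = psi s (norm x) *. ev s" using x Th_polar[of "norm x" s] by simp
 then show "y \<in> {l *. ev t | l t. l \<in> psi t ` A}" using x by blast
next
 fix y assume "y \<in> {l *. ev t | l t. l \<in> psi t ` A}"
 then obtain r t where "y = psi t r *. ev t" "r \<in> A" by auto
 then show "y \<in> Th ` {x. norm x \<in> A}"
  using that by (intro image_eqI[of _ _ "r *. ev t"]) (auto simp: Th_polar)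
qed

lemma surj_Th: "surj Th"
proof -
 have "y \<in> range Th" for y
 proof -
  obtain t where t: "y = norm y *. ev t" using ex_polar by blast
  obtain l where "0 <= l" "psi t l = norm y" using psi_surj[of "norm y" t] by auto
  then show ?thesis using t Th_polar[of l t] by (metis rangeI)
 qed
 then show ?thesis by blast
qed

text \<open>Near the origin the derivative is \<open>k\<close> times the identity. Elsewhere it is
  triangular in the frame \<open>ev t\<close>, \<open>rot90 (ev t)\<close>: it maps
  \<open>ev t\<close> to a positive multiple of itself, and \<open>rot90 (ev t)\<close> to a vector
  with positive component along \<open>rot90 (ev t)\<close>.\<close>

lemma Th_derivative_injective:
 assumes D: "(Th has_derivative D) (at x)" and "D h = 0" shows "h = 0"
proof (cases "norm x < 1/2")
 case True
 have "((*.) k has_derivative (*.) k) (at x)" by (intro bounded_linear_imp_has_derivative bounded_linear_scaleR_right)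
 then have "(Th has_derivative (*.) k) (at x)"
  by (rule has_derivative_transform_within_open[of _ _ _ _ "ball 0 (1/2)"])
    (use True in \<open>auto simp: Th_def chi_def\<close>)
 then have "D = (*.) k" using D has_derivative_unique by blast
 then show ?thesis using \<open>D h = 0\<close> k(1) by simp
next
 case False
 define r where "r = norm x"
 have r: "0 < r" using False unfolding r_def by linarith
 obtain t where t: "x = r *. ev t" using ex_polar r_def by blast
 interpret D: bounded_linear D using D by (rule has_derivative_bounded_linear)
 have chain: "((%l. Th (q l)) hvd D v) (at s)"
  if q: "(q hvd v) (at s)" "q s = x" for q v s
  using has_derivative_compose[OF q(1)[unfolded has_vector_derivative_def], of Th D] D q(2)
  by (simp add: has_vector_derivative_def D.scaleR)
 have e1: "D (ev t) = (k + (P t - k) * (24 * (max 0 (r - 1/2))\<^sup>2)) *. ev t"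
 proof -
  have "((%l. l *. ev t) hvd ev t) (at r)"
   by (auto intro!: derivative_eq_intros)
  then have "((%l. Th (l *. ev t)) hvd D (ev t)) (at r)"
   by (rule chain) (simp add: t)
  moreover have "((%l. psi t l *. ev t) hvd (k + (P t - k) * (24 * (max 0 (r - 1/2))\<^sup>2)) *. ev t) (at r)"
  proof -
   have "(psi t hrd k + (P t - k) * (24 * (max 0 (r - 1/2))\<^sup>2)) (at r)"
    unfolding psi_def[abs_def] by (auto intro!: derivative_eq_intros chi_derivative)
   then show ?thesis using has_vector_derivative_scaleR[OF _ has_vector_derivative_const] by fastforce
  qed
  then have "((%l. Th (l *. ev t)) hvd (k + (P t - k) * (24 * (max 0 (r - 1/2))\<^sup>2)) *. ev t) (at r)"
   by (rule has_vector_derivative_transform_within_open[of _ _ _ "{0<..}"]) (use r in \<open>auto simp: Th_polar\<close>)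
  ultimately show ?thesis by (rule vector_derivative_unique_at)
 qed
 obtain P1 where P1: "!!x. (P hvd P1 x) (at x)" using C2_on_realE[OF P_C2] by metis
 have e2: "r *. D (rot90 (ev t)) = (P1 t * chi r) *. ev t + psi t r *. rot90 (ev t)"
 proof -
  have ev': "(ev hvd rot90 (ev t)) (at t)" using has_derivative_ev[of "%x. x" 1 t UNIV] by simp
  then have "((%u. r *. ev u) hvd r *. rot90 (ev t)) (at t)"
   by (rule bounded_linear_hvd[OF bounded_linear_scaleR_right])
  then have "((%u. Th (r *. ev u)) hvd D (r *. rot90 (ev t))) (at t)"
   by (rule chain) (simp add: t)
  moreover have "((%u. psi u r *. ev u) hvd (psi t r *. rot90 (ev t) + (P1 t * chi r) *. ev t)) (at t)"
  proof (rule has_vector_derivative_scaleR[OF _ ev'])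
   show "((%u. psi u r) hrd P1 t * chi r) (at t)"
    unfolding psi_def using P1[of t] by (auto intro!: derivative_eq_intros simp: hrd_iff_hvd[symmetric])
  qed
  then have "((%u. Th (r *. ev u)) hvd (psi t r *. rot90 (ev t) + (P1 t * chi r) *. ev t)) (at t)"
   using r by (simp add: Th_polar)
  ultimately have "D (r *. rot90 (ev t)) = psi t r *. rot90 (ev t) + (P1 t * chi r) *. ev t"
   by (rule vector_derivative_unique_at)
  then show ?thesis by (simp add: D.scaleR add.commute)
 qed
 have "0 = r *. D ((h \<bullet> ev t) *. ev t + (h \<bullet> rot90 (ev t)) *. rot90 (ev t))"
  using \<open>D h = 0\<close> ev_decomp[of h t] by simp
 also have "... = (h \<bullet> ev t) *. r *. D (ev t) + (h \<bullet> rot90 (ev t)) *. (r *. D (rot90 (ev t)))"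
  by (simp add: D.add D.scaleR scaleR_add_right mult.commute)
 finally have eq: "(h \<bullet> ev t) *. r *. D (ev t) + (h \<bullet> rot90 (ev t)) *. (r *. D (rot90 (ev t))) = 0" by simp
 have "(h \<bullet> rot90 (ev t)) * psi t r = 0"
  using arg_cong[OF eq, of "%v. v \<bullet> rot90 (ev t)"]
  by (simp add: e1 e2 inner_add_left inner_add_right rot90_inner_self rot90_inner_rot90 ev_inner_ev)
 moreover have "0 < psi t r" using psi_facts(4)[of r t] r k(1)       by (intro less_le_trans[of 0 "k * r" "psi t r"] mult_pos_pos) auto
 ultimately have h2: "h \<bullet> rot90 (ev t) = 0" by simp
 have "(h \<bullet> ev t) * (r * (k + (P t - k) * (24 * (max 0 (r - 1/2))\<^sup>2))) = 0"
  using arg_cong[OF eq, of "%v. v \<bullet> ev t"] h2 by (simp add: e1 ev_inner_ev)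
 moreover have "0 < r * (k + (P t - k) * (24 * (max 0 (r - 1/2))\<^sup>2))"
  using r k(1) k(2)[of t] by (intro mult_pos_pos add_pos_nonneg) auto
 ultimately have "h \<bullet> ev t = 0" by (metis less_irrefl mult_eq_0_iff)
 then show ?thesis using h2 ev_decomp[of h t] by simp
qed

lemma polar_star_diffeomorphism:
 obtains Phi Psi :: "real^2 => real^2" where "homeomorphism UNIV UNIV Phi Psi" "C2_on UNIV Phi" "C2_on UNIV Psi"
  "Phi ` ball 0 1 = {l *. ev t | l t. 0 <= l & l < P t}"
  "Phi ` cball 0 1 = {l *. ev t | l t. 0 <= l & l <= P t}"
  "Phi ` sphere 0 1 = {P t *. ev t | t. True}"
proof -
 have c: "continuous_on UNIV Th" using C2_Th C2_on_imp_C1_on C1_on_imp_continuous_on by blast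
 \<comment> \<open>Invariance of domain supplies the continuity of the inverse.\<close>
 obtain g where g: "homeomorphism UNIV (Th ` UNIV) Th g"
  using invariance_of_domain_homeomorphism[of UNIV Th] c inj_Th by auto
 then have h: "homeomorphism UNIV UNIV Th g" using surj_Th by simp
 have im: "psi t ` {0..<1} = {0..<P t}" "psi t ` {0..1} = {0..P t}" for t
 proof -
  have m: "psi t l < psi t l' \<longleftrightarrow> l < l'" "psi t l <= psi t l' \<longleftrightarrow> l <= l'" for l l'
   using psi_facts(3) strict_mono_less strict_mono_less_eq by blast+
  have "y \<in> psi t ` {0..1}" if "y \<in> {0..P t}" for y
   using psi_surj[of y t] that m(2)[of _ 1] psi_facts(2)[of t] by auto
  moreover have "y \<in> psi t ` {0..<1}" if "y \<in> {0..<P t}" for y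
   using psi_surj[of y t] that m(1)[of _ 1] psi_facts(2)[of t] by auto
  moreover have "psi t ` {0..<1} \<subseteq> {0..<P t}" "psi t ` {0..1} \<subseteq> {0..P t}"
   using m(1)[of _ 1] m(2)[of 0] m(2)[of _ 1] psi_facts(1,2)[of t] by auto
  ultimately show "psi t ` {0..<1} = {0..<P t}" "psi t ` {0..1} = {0..P t}" by blast+
 qed
 have "Th ` ball 0 1 = {l *. ev t | l t. 0 <= l & l < P t}"
 proof -
  have "{0..<1::real} \<subseteq> {0..}" by auto
  from Th_image[OF this] show ?thesis by (simp add: im ball_def)
 qed
 moreover have "Th ` cball 0 1 = {l *. ev t | l t. 0 <= l & l <= P t}"
  using Th_image[of "{0..1}"] by (simp add: im cball_def)
 moreover have "Th ` sphere 0 1 = {P t *. ev t | t. True}"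
  using Th_image[of "{1}"] by (simp add: psi_facts(2) sphere_def)
 moreover have "C2_on UNIV g"
  by (rule C2_on_inverse[OF C2_Th h]) (use Th_derivative_injective in blast)
 ultimately show ?thesis
  using that[OF h C2_Th] by blast
qed

end

lemma ex_real_antiderivative:
 fixes f :: "real => real"
 assumes "continuous_on UNIV f"
 obtains F where "!!x. (F hrd f x) (at x)" "F 0 = 0"
proof -
 have "EX F. ALL x. - \<infinity> < ereal x --> ereal x < \<infinity> --> (F hvd f x) (at x)"
  by (rule einterval_antiderivative) (use assms in \<open>auto simp: continuous_on_eq_continuous_at\<close>)
 then obtain F where F: "!!x. (F hrd f x) (at x)"
  by (auto simp: hrd_iff_hvd)
 have "((%x. F x - F 0) hrd f x) (at x)" for x
  using DERIV_diff[OF F DERIV_const] by simp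
 then show ?thesis using that by force
qed

lemma antiderivative_quasi_periodic:
 fixes F f :: "real => real"
 assumes F: "!!x. (F hrd f x) (at x)" and per: "!!x. f (x + T) = f x"
 shows "F (x + T) = F x + (F T - F 0)"
proof -
 have "((%x. F (x + T) - F x) hrd 0) (at x)" for x
  using DERIV_diff[OF DERIV_chain2[OF F DERIV_add[OF DERIV_ident DERIV_const[of T]]] F] per by simp
 then have "F (x + T) - F x = F (0 + T) - F 0"
  by (rule DERIV_isconst_all[rule_format, where f = "%x. F (x + T) - F x"]) 
 then show ?thesis by simp
qed

lemma antiderivative_integral:
 fixes F f :: "real => real"
 assumes F: "!!x. (F hrd f x) (at x)" and "a <= b"
 shows "(f has_integral F b - F a) {a..b}" "integral {a..b} f = F b - F a"
proof -
 show "(f has_integral F b - F a) {a..b}"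
  by (rule fundamental_theorem_of_calculus[OF \<open>a <= b\<close>])
    (use F in \<open>auto simp: hrd_iff_hvd intro: has_vector_derivative_at_within\<close>)
 then show "integral {a..b} f = F b - F a" by (rule integral_unique)
qed

lemma C2_on_realI':
 assumes "!!x. x \<in> S ==> (f hvd f' x) (at x)" "C1_on S f'"
 shows "C2_on S (f :: real => _)"
 unfolding C2_on_iff_C1_on
proof (intro exI[of _ "%x. blinfun_scaleR_left (f' x)"] conjI ballI)
 show "(f has_derivative blinfun_apply (blinfun_scaleR_left (f' x))) (at x)" if "x \<in> S" for x
  using assms(1)[OF that] by (simp add: has_vector_derivative_def)
 show "C1_on S (%x. blinfun_scaleR_left (f' x))"
  by (rule C1_on_compose[OF assms(2) C1_on_bounded_linear[OF bounded_linear_blinfun_scaleR_left, of UNIV]]) auto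
qed

lemma homeomorphism_ball_image:
 fixes Phi :: "'a::euclidean_space => 'a"
 assumes "homeomorphism UNIV UNIV Phi Psi"
 shows "open (Phi ` ball 0 1)" "closure (Phi ` ball 0 1) = Phi ` cball 0 1"
  "frontier (Phi ` ball 0 1) = Phi ` sphere 0 1" "connected (Phi ` ball 0 1)" "bounded (Phi ` ball 0 1)"
proof -
 have inv: "Phi (Psi y) = y" "Psi (Phi x) = x" for x y using assms by (auto simp: homeomorphism_def)
 have c: "continuous_on A Phi" "continuous_on UNIV Psi" for A
  using assms continuous_on_subset by (auto simp: homeomorphism_def)
 have "Phi ` ball 0 1 = Psi -` ball 0 1"
 proof (intro equalityI subsetI)
  show "y \<in> Phi ` ball 0 1" if "y \<in> Psi -` ball 0 1" for y
   using that inv(1)[of y] by (intro image_eqI[of _ _ "Psi y"]) auto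
 qed (auto simp: inv)
 then show o: "open (Phi ` ball 0 1)" using open_vimage[OF _ c(2)] by simp
 have cp: "compact (Phi ` cball 0 1)" by (intro compact_continuous_image c compact_cball)
 have "Phi ` cball 0 1 \<subseteq> closure (Phi ` ball 0 1)"
  using image_closure_subset[OF c(1) closed_closure closure_subset, of "ball 0 1"] by simp
 moreover have "closure (Phi ` ball 0 1) \<subseteq> Phi ` cball 0 1"
  using cp by (intro closure_minimal image_mono ball_subset_cball compact_imp_closed)
 ultimately show cl: "closure (Phi ` ball 0 1) = Phi ` cball 0 1" by blast
 have "inj Phi" using inv by (metis injI)
 then have "Phi ` cball 0 1 - Phi ` ball 0 1 = Phi ` (cball 0 1 - ball 0 1)" by (simp add: image_set_diff)
 then show "frontier (Phi ` ball 0 1) = Phi ` sphere 0 1"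
  using o cl by (simp add: frontier_def interior_open cball_diff_eq_sphere)
 show "connected (Phi ` ball 0 1)" by (intro connected_continuous_image c) auto
 show "bounded (Phi ` ball 0 1)"
  using cp by (meson ball_subset_cball bounded_subset compact_imp_bounded image_mono)
qed

section \<open>Curves winding once around the origin: the enclosed star-shaped domain and its
  area\<close>

locale star_curve = closed_curve c c' T for c c' :: "real => real^2" and T +
 fixes c'' :: "real => real^2" and tht :: "real => real"
 assumes der2: "(c' hvd c'' s) (at s)" and cont'': "continuous_on UNIV c''"
  and polar: "c s = norm (c s) *. ev (tht s)"
  and cross: "0 < rot90 (c s) \<bullet> c' s"
  and tht_der: "(tht hrd (rot90 (c s) \<bullet> c' s) / (c s \<bullet> c s)) (at s)"
  and tht_T: "tht (s + T) = tht s + 2 * pi"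
begin

definition D :: "(real^2) set" where "D = {l *. c s | l s. 0 <= l & l < 1}"

lemma c_nz: "c s ~= 0" using cross[of s] by (auto simp: rot90_0)

lemma surj_tht: "surj tht"
 by (rule surj_quasi_periodic[where A = tht and T = T, OF _ tht_T])
   (use DERIV_continuous_on[OF hfd_at_within[OF tht_der]] in auto)

lemma tht_inverse:
 obtains u where "!!y. tht (u y) = y" "!!s. u (tht s) = s"
  "!!y. (u hrd (c (u y) \<bullet> c (u y)) / (rot90 (c (u y)) \<bullet> c' (u y))) (at y)"
  "strict_mono tht"
proof -
 have pos: "0 < (rot90 (c s) \<bullet> c' s) / (c s \<bullet> c s)" for s using cross c_nz by simp
 show ?thesis
  by (rule real_diffeomorphism_inverse[OF tht_der pos surj_tht]) (intro that, auto)
qed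

text \<open>The radius as a function of the polar angle is \<open>norm (c (u t))\<close> with
  \<open>u\<close> the inverse of \<open>tht\<close>, so everything rests on the regularity of
  \<open>u\<close>.\<close>

lemma polar_star:
 obtains P where "polar_star P" "!!s. c s = P (tht s) *. ev (tht s)" "!!t. EX s. tht s = t & c s = P t *. ev t"
proof -
 obtain u where u: "!!y. tht (u y) = y" "!!s. u (tht s) = s"
  "!!y. (u hrd (c (u y) \<bullet> c (u y)) / (rot90 (c (u y)) \<bullet> c' (u y))) (at y)" "strict_mono tht"
  by (rule tht_inverse) (rule that, assumption+)
 define P where "P t = norm (c (u t))" for t
 have c: "c s = P (tht s) *. ev (tht s)" for s using polar[of s] by (simp add: P_def u)
 have C1c: "C1_on UNIV c" "C1_on UNIV c'"
  by (rule C1_on_realI[OF der cont'], rule C1_on_realI[OF der2 cont''])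
 have inv: "C1_on {0<..} (%y::real. 1 / y)"
  by (rule C1_on_realI[where f' = "%y. - 1 / y^2"])
    (auto intro!: derivative_eq_intros continuous_intros
     simp: hrd_iff_hvd[symmetric] field_simps power2_eq_square)
 have h: "C1_on UNIV (%s. (c s \<bullet> c s) * (1 / (rot90 (c s) \<bullet> c' s)))"
  by (intro C1_on_bilinear[OF bounded_bilinear_mult] C1_on_bilinear[OF bounded_bilinear_inner]
    C1_on_compose[OF _ inv] C1_on_compose[OF C1c(1) C1_on_bounded_linear[OF bounded_linear_rot90, of UNIV]] C1c)
    (use cross in auto)
 have uv: "(u hvd (c (u y) \<bullet> c (u y)) * (1 / (rot90 (c (u y)) \<bullet> c' (u y)))) (at y)" for y
  using u(3)[of y] by (simp add: hrd_iff_hvd)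
 have cu: "continuous_on UNIV u"
  using has_vector_derivative_continuous[OF uv] by (intro cont_at_imp_cont_on) blast
 \<comment> \<open>A bootstrap: the derivative of \<open>u\<close> is a fixed \<open>C1_on\<close>
   function evaluated at \<open>u\<close>, so continuity of \<open>u\<close> gives
   \<open>C1_on\<close> and this in turn gives \<open>C2_on\<close>.\<close>
 have "C1_on UNIV u"
  by (rule C1_on_realI[OF uv continuous_on_compose2[OF C1_on_imp_continuous_on[OF h] cu]]) auto
 then have "C2_on UNIV u"
  by (intro C2_on_realI'[OF uv] C1_on_compose[OF _ h]) auto
 moreover have "C2_on UNIV c" by (rule C2_on_realI[OF der der2 cont''])
 ultimately have cu2: "C2_on UNIV (%t. c (u t))" by (rule C2_on_compose[where f = u and T = UNIV]) auto
 have sq: "C2_on {0<..} sqrt"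
  by (rule C2_on_realI[where f' = "%y. inverse (sqrt y) / 2" and f'' = "%y. - inverse (sqrt y * y) / 4"])
    (auto intro!: derivative_eq_intros continuous_intros
     simp: hrd_iff_hvd[symmetric] field_simps power2_eq_square)
 have "polar_star P"
 proof
  show "C2_on UNIV P"
   unfolding P_def norm_eq_sqrt_inner
   by (intro C2_on_compose[OF _ sq] C2_on_bilinear[OF bounded_bilinear_inner] cu2) (use c_nz in auto)
  show "0 < P t" for t using c_nz by (simp add: P_def)
  show "P (t + 2 * pi) = P t" for t
   using u(2)[of "u t + T"] periodic_1[of "u t"] by (simp add: P_def tht_T u(1))
 qed
 moreover have "EX s. tht s = t & c s = P t *. ev t" for t using c[of "u t"] u(1) by auto
 ultimately show ?thesis using that c by blast
qed

lemma diffeomorphism: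
 obtains Phi Psi :: "real^2 => real^2" where "homeomorphism UNIV UNIV Phi Psi" "C2_on UNIV Phi" "C2_on UNIV Psi"
  "Phi ` ball 0 1 = D" "Phi ` cball 0 1 = {l *. c s | l s. 0 <= l & l <= 1}" "Phi ` sphere 0 1 = range c"
proof -
 obtain P where P: "polar_star P" "!!s. c s = P (tht s) *. ev (tht s)" "!!t. EX s. tht s = t & c s = P t *. ev t"
  by (rule polar_star) (rule that, assumption+)
 have pos: "0 < P t" for t using P(1) by (simp add: polar_star_def)
 have eq: "{l *. ev t | l t. l \<in> (*) (P t) ` A} = {l *. c s | l s. l \<in> A}" for A
 proof (intro equalityI subsetI)
  fix y assume "y \<in> {l *. ev t | l t. l \<in> (*) (P t) ` A}"
  then obtain l t where "y = (P t * l) *. ev t" "l \<in> A" by auto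
  moreover obtain s where "c s = P t *. ev t" using P(3)[of t] by blast
  ultimately have "y = l *. c s & l \<in> A" by (simp add: mult.commute)
  then show "y \<in> {l *. c s | l s. l \<in> A}" by blast
 next
  fix y assume "y \<in> {l *. c s | l s. l \<in> A}"
  then obtain l s where "y = l *. c s" "l \<in> A" by auto
  then have "y = (P (tht s) * l) *. ev (tht s)" using P(2)[of s] by (simp add: mult.commute)
  then show "y \<in> {l *. ev t | l t. l \<in> (*) (P t) ` A}" using \<open>l \<in> A\<close> by blast
 qed
 have im: "(*) (P t) ` {0..<1} = {0..<P t}" "(*) (P t) ` {0..1} = {0..P t}" "(*) (P t) ` {1} = {P t}" for t
 proof -
  have "y \<in> (*) (P t) ` {0..<1}" if "y \<in> {0..<P t}" for y
   using that pos[of t] by (intro image_eqI[of _ _ "y / P t"]) auto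
  then show "(*) (P t) ` {0..<1} = {0..<P t}" using pos[of t] by auto
 qed (use pos[of t] in \<open>simp_all add: image_mult_atLeastAtMost\<close>)
 show ?thesis
 proof (rule polar_star.polar_star_diffeomorphism[OF P(1)])
  fix Phi Psi :: "real^2 => real^2"
  assume a: "homeomorphism UNIV UNIV Phi Psi" "C2_on UNIV Phi" "C2_on UNIV Psi"
   "Phi ` ball 0 1 = {l *. ev t |l t. 0 <= l & l < P t}"
   "Phi ` cball 0 1 = {l *. ev t |l t. 0 <= l & l <= P t}"
   "Phi ` sphere 0 1 = {P t *. ev t |t. True}"
  show thesis
   by (rule that[OF a(1-3)])
     (use a(4-6) eq[of "{0..<1}"] eq[of "{0..1}"] eq[of "{1}"] in
      \<open>simp_all add: im D_def, auto simp: full_SetCompr_eq\<close>)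
 qed
qed

lemma open_D: "open D" and closure_D: "closure D = {l *. c s | l s. 0 <= l & l <= 1}"
 and frontier_D: "frontier D = range c" and connected_D: "connected D" and bounded_D: "bounded D"
proof -
 obtain Phi Psi :: "real^2 => real^2" where "homeomorphism UNIV UNIV Phi Psi"
  "Phi ` ball 0 1 = D" "Phi ` cball 0 1 = {l *. c s | l s. 0 <= l & l <= 1}" "Phi ` sphere 0 1 = range c"
  by (rule diffeomorphism) blast
 then show "open D" "closure D = {l *. c s | l s. 0 <= l & l <= 1}" "frontier D = range c" "connected D" "bounded D"
  using homeomorphism_ball_image[of Phi Psi] by auto
qed

lemma c'_periodic: "c' (s + T) = c' s"
proof -
 have "((%s. s + T) hvd 1) (at s)"
  by (auto intro!: derivative_eq_intros simp: hrd_iff_hvd[symmetric])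
 then have "((%s. c (s + T)) hvd c' (s + T)) (at s)"
  using vector_diff_chain_at[of "%s. s + T" 1 s c "c' (s + T)"] der by (simp add: comp_def)
 then show ?thesis using der[of s] vector_derivative_unique_at by (simp add: periodic_1)
qed

text \<open>In the coordinates (swept area, squared radial scale) the sector parametrization has constant
 Jacobian, so no iterated integral is needed.\<close>

lemma area_D: "measure lebesgue D = integral {0..T} (%s. rot90 (c s) \<bullet> c' s) / 2"
proof -
 define J where "J s = rot90 (c s) \<bullet> c' s" for s
 have cJ: "continuous_on UNIV J" unfolding J_def
  by (intro continuous_intros cont cont'_on bounded_linear.continuous_on[OF bounded_linear_rot90])
 obtain A where A: "!!s. (A hrd J s) (at s)" "A 0 = 0"
  using ex_real_antiderivative[OF cJ] by metis
 have L: "integral {0..T} J = A T" using antiderivative_integral[OF A(1), of 0 T] T_pos A(2) by simp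
 have AT: "A (s + T) = A s + A T" for s
  using antiderivative_quasi_periodic[OF A(1), of T s] A(2) by (simp add: J_def periodic_1 c'_periodic)
 have mono: "strict_mono A"
  by (rule strict_monoI) (rule DERIV_pos_imp_increasing, use A(1) cross in \<open>auto simp: J_def\<close>)
 have LT: "0 < A T" using strict_monoD[OF mono T_pos] A(2) by simp
 have Jp: "0 < J s" for s using cross by (simp add: J_def)
 have "surj A"
  by (rule surj_quasi_periodic[where A = A and T = T, OF _ AT LT]) (use DERIV_continuous_on[OF hfd_at_within[OF A(1)]] in auto)
 obtain w where w: "!!y. A (w y) = y" "!!s. w (A s) = s" "!!y. (w hrd 1 / J (w y)) (at y)"
  by (rule real_diffeomorphism_inverse[OF A(1) Jp \<open>surj A\<close>]) (rule that, assumption+)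
 define S :: "(real^2) set" where "S = box 0 (vector [A T, 1])"
 have S: "z \<in> S \<longleftrightarrow> 0 < z $ 1 & z $ 1 < A T & 0 < z $ 2 & z $ 2 < 1" for z
  by (auto simp: S_def mem_box_cart forall_2)
 have wS: "0 < w (z $ 1)" "w (z $ 1) < T" if "z \<in> S" for z
  using that S w(1) A(2) mono by (metis strict_mono_less)+
 define g :: "real^2 => real^2" where "g z = sqrt (z $ 2) *. c (w (z $ 1))" for z
 define g' where "g' z h = (h $ 1) *. (sqrt (z $ 2) *. ((1 / J (w (z $ 1))) *. c' (w (z $ 1))))
   + (h $ 2) *. ((inverse (sqrt (z $ 2)) / 2) *. c (w (z $ 1)))" for z h :: "real^2"
 have dg: "(g has_derivative g' z) (at z)" if "z \<in> S" for z
 proof -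
  have "((%y. c (w y)) hvd (1 / J (w (z $ 1))) *. c' (w (z $ 1))) (at (z $ 1))"
   using vector_diff_chain_at[of w _ "z $ 1" c] w(3) der
   by (simp add: hrd_iff_hvd comp_def)
  then have 1: "((%z. c (w (z $ 1))) has_derivative (%h. (h $ 1) *. ((1 / J (w (z $ 1))) *. c' (w (z $ 1))))) (at z)"
   unfolding has_vector_derivative_def
   by (rule has_derivative_compose[rotated]) (auto intro!: bounded_linear_imp_has_derivative bounded_linear_vec_nth)
  have 2: "((%z. sqrt (z $ 2)) has_derivative (%h. (h $ 2) * (inverse (sqrt (z $ 2)) / 2))) (at z)"
   by (rule has_derivative_compose[of "%z. z $ 2", OF _ DERIV_real_sqrt[unfolded has_field_derivative_def, THEN has_derivative_eq_rhs]])
     (use that S in \<open>auto intro!: bounded_linear_imp_has_derivative bounded_linear_vec_nth simp: fun_eq_iff\<close>)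
  show ?thesis
   unfolding g_def[abs_def] g'_def[abs_def]
   by (rule has_derivative_eq_rhs[OF has_derivative_scaleR[OF 2 1]])
     (simp add: fun_eq_iff mult.commute)
 qed
 have det: "\<bar>det (matrix (g' z))\<bar> = 1 / 2" if "z \<in> S" for z
 proof -
  have q: "sqrt (z $ 2) * inverse (sqrt (z $ 2)) = 1" using that S by simp
  define Q where "Q = sqrt (z $ 2)"
  define x where "x = c (w (z $ 1))"
  define v where "v = c' (w (z $ 1))"
  have Jx: "J (w (z $ 1)) = x $ 1 * v $ 2 - x $ 2 * v $ 1"
   by (simp add: J_def inner_real2 x_def v_def)
  have Jp: "0 < J (w (z $ 1))" using cross by (simp add: J_def)
  have "det (matrix (g' z)) = (Q * inverse Q) * (v $ 1 * x $ 2 - x $ 1 * v $ 2) / J (w (z $ 1)) / 2"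
  proof -
   have "Q ~= 0" using that S by (simp add: Q_def)
   then show ?thesis
    by (simp add: det_2 matrix_def g'_def axis_def x_def[symmetric] v_def[symmetric] Q_def[symmetric]
      diff_divide_distrib) (simp add: field_simps)
  qed
  also have "... = - (1 / 2)"
   using Jp q by (simp add: Q_def Jx field_simps)
  finally show ?thesis by simp
 qed
 have inj: "inj_on g S"
 proof (rule inj_onI)
  fix z z' assume z: "z \<in> S" "z' \<in> S" "g z = g z'"
  let ?s = "w (z $ 1)" and ?s' = "w (z' $ 1)"
  have pos: "0 < sqrt (z $ 2) * norm (c ?s)" "0 < sqrt (z' $ 2) * norm (c ?s')"
   using z S c_nz by auto
  have e: "(sqrt (z $ 2) * norm (c ?s)) *. ev (tht ?s) = (sqrt (z' $ 2) * norm (c ?s')) *. ev (tht ?s')"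
   using z(3) polar[of ?s] polar[of ?s'] unfolding g_def by (metis scaleR_scaleR)
  from arg_cong[OF this, of norm] have "sqrt (z $ 2) * norm (c ?s) = sqrt (z' $ 2) * norm (c ?s')"
   using pos by simp
  with e pos have "ev (tht ?s) = ev (tht ?s')" by (metis less_irrefl scaleR_cancel_left)
  then obtain k :: int where k: "tht ?s = tht ?s' + 2 * pi * k" using ev_eq_iff by blast
  have "strict_mono tht" by (rule tht_inverse)
  then have r: "tht 0 < tht s & tht s < tht 0 + 2 * pi" if "0 < s" "s < T" for s
   using that strict_monoD[of tht] tht_T[of 0] by (metis add_0)
  have "\<bar>2 * pi * real_of_int k\<bar> < 2 * pi" using r[OF wS[OF z(1)]] r[OF wS[OF z(2)]] k by auto
  then have "\<bar>real_of_int k\<bar> < 1" by (simp add: abs_mult)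
  then have "k = 0" by linarith
  then have "?s = ?s'" using k \<open>strict_mono tht\<close> strict_mono_eq by fastforce
  moreover from this have "sqrt (z $ 2) = sqrt (z' $ 2)" using z(3) c_nz[of ?s'] by (simp add: g_def)
  ultimately show "z = z'" using w(1) by (metis real2_eq_iff real_sqrt_eq_iff)
 qed
 have Sl: "S \<in> sets lebesgue" by (simp add: S_def)
 have "measure lebesgue (g ` S) = integral S (%z. \<bar>det (matrix (g' z))\<bar>)"
 proof (rule measure_differentiable_image_eq[OF Sl _ inj])
  show "(g has_derivative g' z) (at z within S)" if "z \<in> S" for z
   using dg[OF that] has_derivative_at_withinI by blast
  show "(%z. \<bar>det (matrix (g' z))\<bar>) integrable_on S"
  proof (subst integrable_cong[where g = "%_. 1/2"])
   show "(%_. 1 / 2 :: real) integrable_on S" unfolding S_def by (rule integrable_on_open_interval[THEN iffD2]) auto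
  qed (use det in auto)
 qed
 also have "... = integral S (%_. 1 / 2)" by (rule integral_cong) (use det in auto)
 also have "... = 1 / 2 * measure lebesgue S"
  using lmeasure_integral[of S] integral_mult_right[of S "1/2" "%_. 1 :: real"] by (simp add: S_def)
 also have "measure lebesgue S = A T"
 proof -
  have B: "(Basis :: (real^2) set) = {axis 1 1, axis 2 1}" by (auto simp: Basis_vec_def UNIV_2)
  have ne: "axis 1 1 ~= (axis 2 1 :: real^2)" by (simp add: axis_eq_axis)
  show ?thesis
   unfolding S_def measure_completion[OF sets_lborel[THEN equalityD2, THEN subsetD, OF borel_open[OF open_box]]]
    measure_lborel_box_eq B
   using LT ne by (simp add: inner_axis)
 qed
 finally have gS: "measure lebesgue (g ` S) = A T / 2" by simp
 have sub: "g ` S \<subseteq> D"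
 proof
  fix x assume "x \<in> g ` S"
  then obtain z where z: "z \<in> S" "x = g z" by blast
  then have "0 <= sqrt (z $ 2)" "sqrt (z $ 2) < 1" using S by auto
  then show "x \<in> D" unfolding D_def z(2) g_def by blast
 qed
 \<comment> \<open>What the sector parametrization misses, namely the origin and the segment towards
   \<open>c 0\<close>, lies on one line and is negligible.\<close>
 have diff: "D - g ` S \<subseteq> {x. rot90 (c 0) \<bullet> x = 0}"
 proof
  fix x assume x: "x \<in> D - g ` S"
  then obtain l s where ls: "x = l *. c s" "0 <= l" "l < 1" by (auto simp: D_def)
  obtain s0 where s0: "s0 \<in> {0..<T}" "c s = c s0" using image_period0 by (metis imageE rangeI)
  show "x \<in> {x. rot90 (c 0) \<bullet> x = 0}"
  proof (cases "l = 0 | s0 = 0")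
   case True
   then show ?thesis using ls s0 by (auto simp: rot90_inner_self)
  next
   case False
   define z :: "real^2" where "z = vector [A s0, l^2]"
   have "0 < s0" "s0 < T" using False s0(1) by auto
   then have "0 < A s0" "A s0 < A T" using strict_monoD[OF mono] A(2) by metis+
   moreover have "l^2 < 1" using ls False by (simp add: power_less_one_iff abs_square_less_1)
   ultimately have "z \<in> S" using False by (simp add: S z_def)
   moreover have "x = g z" using ls s0 by (simp add: g_def z_def w(2))
   ultimately show ?thesis using x by blast
  qed
 qed
 have "negligible {x. rot90 (c 0) \<bullet> x = 0}"
  by (rule negligible_hyperplane) (use c_nz in auto)
 then have "negligible (sym_diff D (g ` S))"
  using diff sub by (auto intro: negligible_subset)
 moreover have "D \<in> lmeasurable" using open_D bounded_D by (simp add: lmeasurable_open)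
 ultimately have "measure lebesgue (g ` S) = measure lebesgue D"
  using measure_negligible_symdiff by metis
 then show ?thesis using gS L by (simp add: J_def[abs_def])
qed

end

section \<open>Elliptic integrands and Wulff shapes\<close>

lemma periodic_bounded:
 fixes f :: "real => real"
 assumes "continuous_on UNIV f" and per: "!!t. f (t + 2 * pi) = f t"
 obtains a b where "!!t. f a <= f t" "!!t. f t <= f b"
proof -
 have c: "continuous_on {0..2*pi} f" using assms(1) continuous_on_subset by blast
 have ne: "{0..2*pi} ~= {}" by simp
 obtain a b where ab: "!!t. t \<in> {0..2*pi} ==> f a <= f t" "!!t. t \<in> {0..2*pi} ==> f t <= f b"
  using continuous_attains_inf[OF compact_Icc ne c] continuous_attains_sup[OF compact_Icc ne c] by metis
 have nat: "f (t + 2 * pi * real n) = f t" for t n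
 proof (induction n)
  case (Suc n)
  then show ?case using per[of "t + 2 * pi * real n"] by (simp add: algebra_simps)
 qed simp
 have "\<exists>s\<in>{0..2*pi}. f s = f t" for t
 proof -
  obtain s where "0 <= s" "s < 2 * pi" "cos t = cos s" "sin t = sin s"
   using sincos_total_2pi[of "cos t" "sin t"] by auto
  then obtain k :: int where k: "t = s + 2 * pi * k" using sin_cos_eq_iff[of t s] by auto
  have "f t = f s"
  proof (cases "0 <= k")
   case True then show ?thesis using nat[of s "nat k"] k by simp
  next
   case False then show ?thesis using nat[of t "nat (- k)"] k by simp
  qed
  then show ?thesis using \<open>0 <= s\<close> \<open>s < 2 * pi\<close> by force
 qed
 then show ?thesis using ab by (intro that[of a b]) metis+
qed

lemma polar_angle_has_derivative:
 assumes "0 < r"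
 shows "((%x. t + arctan ((x \<bullet> rot90 (ev t)) / (x \<bullet> ev t))) has_derivative
  (%h. (h \<bullet> rot90 (ev t)) / r)) (at (r *. ev t))"
proof -
 have z: "r *. ev t \<bullet> rot90 (ev t) = 0" "r *. ev t \<bullet> ev t = r"
  by (simp_all add: rot90_inner_self ev_inner_ev)
 have p: "((%x. x \<bullet> ev t) has_derivative (%h. h \<bullet> ev t)) (at (r *. ev t))"
  and q: "((%x. x \<bullet> rot90 (ev t)) has_derivative (%h. h \<bullet> rot90 (ev t))) (at (r *. ev t))"
  by (auto intro!: derivative_eq_intros)
 have "((%x. (x \<bullet> rot90 (ev t)) / (x \<bullet> ev t)) has_derivative (%h. (h \<bullet> rot90 (ev t)) / r)) (at (r *. ev t))"
  by (rule has_derivative_eq_rhs[OF has_derivative_divide'[OF q p]])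
    (use assms z in \<open>auto simp: fun_eq_iff field_simps\<close>)
 moreover have "(arctan has_derivative (%h. h)) (at ((r *. ev t \<bullet> rot90 (ev t)) / (r *. ev t \<bullet> ev t)))"
  using DERIV_arctan[of 0] unfolding z by (simp add: has_field_derivative_def has_derivative_eq_rhs fun_eq_iff)
 ultimately have "((%x. arctan ((x \<bullet> rot90 (ev t)) / (x \<bullet> ev t))) has_derivative (%h. (h \<bullet> rot90 (ev t)) / r)) (at (r *. ev t))"
  using has_derivative_compose by blast
 then show ?thesis using has_derivative_add[OF has_derivative_const] by fastforce
qed

locale smooth_norm =
 fixes \<phi> :: "real^2 => real" and gam gam1 gam2 :: "real => real"
 assumes norm_\<phi>: "is_norm \<phi>" and gam: "!!t. \<phi> (ev t) = gam t"
  and dgam: "!!t. (gam hrd gam1 t) (at t)"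
  and dgam1: "!!t. (gam1 hrd gam2 t) (at t)"
  and cgam2: "continuous_on UNIV gam2"
begin

text \<open>\<open>g\<close> is the radius of curvature of the boundary of the Wulff shape, and
  \<open>Y t\<close>, the gradient of the integrand at \<open>ev t\<close>, is the boundary point
  with outer normal \<open>ev t\<close>.\<close>

definition g :: "real => real" where "g t = gam t + gam2 t"
definition Y :: "real => real^2" where "Y t = gam t *. ev t + gam1 t *. rot90 (ev t)"

lemma gam_pos: "0 < gam t"
 using norm_\<phi> norm_ev[of t] by (metis gam is_norm_def less_eq_real_def norm_zero zero_neq_one)

lemma \<phi>_scale: "\<phi> (a *. x) = \<bar>a\<bar> * \<phi> x" using norm_\<phi> by (simp add: is_norm_def)

lemma gam_pi: "gam (t + pi) = gam t"
 using \<phi>_scale[of "-1" "ev t"] by (simp add: gam[symmetric] ev_plus_pi)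

lemma gam_periodic: "gam (t + 2 * pi) = gam t"
 using gam_pi[of t] gam_pi[of "t + pi"] by (simp add: add.assoc)

lemma shift_derivative: "(!!t. (f hrd f' t) (at t)) ==> (!!t. f (t + p) = f t) ==> f' (t + p) = f' t"
proof -
 assume f: "!!t. (f hrd f' t) (at t)" and p: "!!t. f (t + p) = f t"
 have "((%t. f (t + p)) hrd f' (t + p) * 1) (at t)"
  by (rule DERIV_chain2[OF f]) (auto intro!: derivative_eq_intros)
 then show ?thesis using f[of t] DERIV_unique by (simp add: p)
qed

lemma gam1_periodic: "gam1 (t + 2 * pi) = gam1 t"
 by (rule shift_derivative[OF dgam gam_periodic])

lemma gam2_periodic: "gam2 (t + 2 * pi) = gam2 t"
 by (rule shift_derivative[OF dgam1 gam1_periodic])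

lemma g_periodic: "g (t + 2 * pi) = g t"
 by (simp add: g_def gam_periodic gam2_periodic)

lemma cont_gam: "continuous_on A gam" and cont_gam1: "continuous_on A gam1" and cont_g: "continuous_on A g"
proof -
 show 1: "continuous_on A gam" for A by (rule DERIV_continuous_on[OF hfd_at_within[OF dgam]])
 show "continuous_on A gam1" by (rule DERIV_continuous_on[OF hfd_at_within[OF dgam1]])
 show "continuous_on A g" unfolding g_def
  by (intro continuous_intros 1 continuous_on_subset[OF cgam2]) auto
qed

lemma has_vector_derivative_ev: "(ev hvd rot90 (ev t)) (at t)"
 using has_derivative_ev[of "%x. x" 1 t UNIV] by simp

lemma has_vector_derivative_rot90_ev: "((%t. rot90 (ev t)) hvd - ev t) (at t)"
 using bounded_linear_hvd[OF bounded_linear_rot90 has_vector_derivative_ev] by (simp add: rot90_rot90)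

lemma dY: "(Y hvd g t *. rot90 (ev t)) (at t)"
 unfolding Y_def[abs_def]
 by (rule has_vector_derivative_eq_rhs[OF has_vector_derivative_add[
    OF has_vector_derivative_scaleR[OF dgam has_vector_derivative_ev]
      has_vector_derivative_scaleR[OF dgam1 has_vector_derivative_rot90_ev]]])
   (simp add: g_def algebra_simps)

lemma Y_periodic: "Y (t + 2 * pi) = Y t"
 using ev_periodic[of t 1] by (simp add: Y_def gam_periodic gam1_periodic)

lemma Y_inner: "Y t \<bullet> ev t = gam t" "Y t \<bullet> rot90 (ev t) = gam1 t"
 by (simp_all add: Y_def inner_add_left rot90_inner_self ev_inner_ev rot90_inner_rot90)

lemma \<phi>_gderiv: "0 < r ==> GDERIV \<phi> (r *. ev t) :> Y t"
proof -
 assume r: "0 < r"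
 let ?x = "r *. ev t"
 let ?A = "%x. t + arctan ((x \<bullet> rot90 (ev t)) / (x \<bullet> ev t))"
 have A0: "?A ?x = t" by (simp add: rot90_inner_self)
 have "(gam has_derivative (%h. h * gam1 t)) (at (?A ?x))"
  unfolding A0 using dgam[of t] by (simp add: has_field_derivative_def mult.commute[of "gam1 t"] mult_commute_abs)
 then have "((%x. gam (?A x)) has_derivative (%h. (h \<bullet> rot90 (ev t)) / r * gam1 t)) (at ?x)"
  by (rule has_derivative_compose[OF polar_angle_has_derivative[OF r]])
 moreover have "(norm has_derivative (%h. h \<bullet> ev t)) (at ?x)"
  using r norm_ev[of t] by (intro has_derivative_eq_rhs[OF has_derivative_norm])
   (auto simp: sgn_div_norm fun_eq_iff inner_commute simp del: norm_ev)
 ultimately have "((%x. norm x * gam (?A x)) has_derivative (%h. norm ?x * ((h \<bullet> rot90 (ev t)) / r * gam1 t) + (h \<bullet> ev t) * gam (?A ?x))) (at ?x)"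
  by (rule has_derivative_mult[rotated])
 then have "((%x. norm x * gam (?A x)) has_derivative (%h. h \<bullet> Y t)) (at ?x)"
  by (rule has_derivative_eq_rhs) (use r in \<open>auto simp: rot90_inner_self Y_def inner_add_right fun_eq_iff\<close>)
 then have "(\<phi> has_derivative (%h. h \<bullet> Y t)) (at ?x)"
 proof (rule has_derivative_transform_within_open)
  show "open {x. 0 < x \<bullet> ev t}" by (intro open_Collect_less continuous_intros)
  show "?x \<in> {x. 0 < x \<bullet> ev t}" using r by (simp add: ev_inner_ev)
  fix x assume "x \<in> {x. 0 < x \<bullet> ev t}"
  then have "x = norm x *. ev (?A x)" using polar_arctan by blast
  then show "norm x * gam (?A x) = \<phi> x" using \<phi>_scale[of "norm x"] gam by (metis abs_norm_cancel)
 qed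
 then show ?thesis by (simp add: gderiv_def)
qed

lemma grad_polar: "0 < r ==> grad \<phi> (r *. ev t) = Y t"
 unfolding grad_def
proof (rule the_equality)
 show "0 < r ==> GDERIV \<phi> (r *. ev t) :> Y t" by (rule \<phi>_gderiv)
 fix D assume "0 < r" "GDERIV \<phi> (r *. ev t) :> D"
 then have "(%h. h \<bullet> D) = (%h. h \<bullet> Y t)"
  using \<phi>_gderiv has_derivative_unique unfolding gderiv_def by blast
 then show "D = Y t" by (metis inner_eq_zero_iff inner_diff_right right_minus_eq)
qed

lemma grad_ev: "grad \<phi> (ev t) = Y t"
 using grad_polar[of 1 t] by simp

text \<open>At \<open>e\<close> tangent to the circle the Hessian of \<open>\<phi>\<close> is multiplication by \<open>gam + gam''\<close>.\<close>

lemma ellipticity_angular: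
 assumes ell: "!!nu e. norm nu = 1 ==> norm e = 1 ==>
   c * (norm (e - (nu \<bullet> e) *. nu))\<^sup>2 <= e \<bullet> frechet_derivative (grad \<phi>) (at nu) e"
 shows "c <= g t"
proof -
 let ?A = "%x. t + arctan ((x \<bullet> rot90 (ev t)) / (x \<bullet> ev t))"
 have A0: "?A (ev t) = t" by (simp add: rot90_inner_self)
 have "(Y has_derivative (%h. h *. g t *. rot90 (ev t))) (at (?A (ev t)))"
  unfolding A0 using dY[of t] by (simp add: has_vector_derivative_def)
 then have "((%x. Y (?A x)) has_derivative (%h. ((h \<bullet> rot90 (ev t)) / 1) *. g t *. rot90 (ev t))) (at (ev t))"
  using has_derivative_compose[OF polar_angle_has_derivative[OF zero_less_one, of t]] by simp
 then have "(grad \<phi> has_derivative (%h. ((h \<bullet> rot90 (ev t)) / 1) *. g t *. rot90 (ev t))) (at (ev t))"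
 proof (rule has_derivative_transform_within_open)
  show "open {x. 0 < x \<bullet> ev t}" by (intro open_Collect_less continuous_intros)
  show "ev t \<in> {x. 0 < x \<bullet> ev t}" by (simp add: ev_inner_ev)
  fix x assume x: "x \<in> {x. 0 < x \<bullet> ev t}"
  then have "x = norm x *. ev (?A x)" "0 < norm x" using polar_arctan by (blast, auto)
  then show "Y (?A x) = grad \<phi> x" using grad_polar by metis
 qed
 then have "frechet_derivative (grad \<phi>) (at (ev t)) = (%h. ((h \<bullet> rot90 (ev t)) / 1) *. g t *. rot90 (ev t))"
  by (rule frechet_derivative_at[symmetric])
 then show ?thesis
  using ell[of "ev t" "rot90 (ev t)"] by (simp add: rot90_inner_self rot90_inner_rot90 ev_inner_ev)
qed

end

text \<open>\<open>k0\<close> is the ellipticity constant, a lower bound for the radius of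
  curvature. \<open>Lam\<close> expresses the Lipschitz bound on the second derivative; it is spent
  when the derivative of a graph function is compared at two points.\<close>

locale anisotropy = smooth_norm +
 fixes k0 Lam :: real
 assumes ell: "!!t. k0 <= g t" and k0: "0 < k0"
  and g_lip: "!!s t. \<bar>g s - g t\<bar> <= Lam * \<bar>s - t\<bar>"
begin

lemma g_pos: "0 < g t"
 using ell[of t] k0 by auto

lemma Lam_nonneg: "0 <= Lam"
 using g_lip[of 0 1] by simp

text \<open>The gap \<open>h\<close> between support function and supporting line solves \<open>h'' + h = g\<close> with
 vanishing data at \<open>s\<close>; the bound is read off from the variation of constants formula.\<close>

lemma Y_support: "Y s \<bullet> ev t <= gam t - k0 * (1 - cos (t - s))"
proof -
 have close: "Y s \<bullet> ev t <= gam t - k0 * (1 - cos (t - s))" if "\<bar>t - s\<bar> <= pi" for t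
 proof -
  define h h' where "h v = gam v - Y s \<bullet> ev v" "h' v = gam1 v - Y s \<bullet> rot90 (ev v)" for v
  \<comment> \<open>The derivative of \<open>q\<close> is \<open>(g v - k0) * sin (t - v)\<close>,
    which has one sign between \<open>s\<close> and \<open>t\<close>, while
    \<open>q t = h t - k0\<close> and \<open>q s = - k0 * cos (t - s)\<close>.\<close>
  define q where "q v = h' v * sin (t - v) + h v * cos (t - v) - k0 * cos (t - v)" for v
  have dh: "(h hrd h' v) (at v)" for v
   unfolding h_h'_def
   by (intro DERIV_diff dgam)
     (use bounded_linear_hvd[OF bounded_linear_inner_right has_vector_derivative_ev]
     in \<open>auto simp: hrd_iff_hvd\<close>)
  have dh': "(h' hrd (g v - h v)) (at v)" for v
  proof -
   have "(h' hrd (gam2 v - Y s \<bullet> (- ev v))) (at v)"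
    unfolding h_h'_def
    by (intro DERIV_diff dgam1)
      (use bounded_linear_hvd[OF bounded_linear_inner_right has_vector_derivative_rot90_ev]
      in \<open>auto simp: hrd_iff_hvd\<close>)
   then show ?thesis by (simp add: h_h'_def g_def)
  qed
  have dq: "(q hrd (g v - k0) * sin (t - v)) (at v)" for v
   unfolding q_def[abs_def]
   by (rule derivative_eq_intros dh dh' refl | simp)+ (simp add: algebra_simps)
  have hs: "h s = 0" "h' s = 0" by (simp_all add: h_h'_def Y_inner)
  have "q s <= q t"
  proof (cases "s <= t")
   case True
   show ?thesis
   proof (rule DERIV_nonneg_imp_nondecreasing[OF True])
    fix v assume v: "s <= v" "v <= t"
    then have "0 <= sin (t - v)" using that True by (intro sin_ge_zero) auto
    then show "EX y. (q hrd y) (at v) & 0 <= y"           using dq ell[of v] by (intro exI[of _ "(g v - k0) * sin (t - v)"] conjI) auto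
   qed
  next
   case False
   show ?thesis
   proof (rule DERIV_nonpos_imp_nonincreasing[where f = q and a = t and b = s])
    show "t <= s" using False by simp
    fix v assume v: "t <= v" "v <= s"
    then have "0 <= sin (v - t)" using that False by (intro sin_ge_zero) auto
    then have "sin (t - v) <= 0" using sin_minus[of "t - v"] by simp
    then show "EX y. (q hrd y) (at v) & y <= 0" using dq ell[of v]
     by (intro exI[of _ "(g v - k0) * sin (t - v)"] conjI) (auto simp: mult_nonneg_nonpos)
   qed
  qed
  then show ?thesis by (simp add: q_def hs) (simp add: h_h'_def algebra_simps)
 qed
 obtain k :: int where "t + 2 * pi * k \<in> {s - pi..<s - pi + 2 * pi}"
 proof -
  define k where "k = - \<lfloor>(t - (s - pi)) / (2 * pi)\<rfloor>"
  have "real_of_int (- k) <= (t - (s - pi)) / (2 * pi)" "(t - (s - pi)) / (2 * pi) < real_of_int (- k) + 1"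
   by (simp_all add: k_def)
  then have "real_of_int (- k) * (2 * pi) <= t - (s - pi)" "t - (s - pi) < (real_of_int (- k) + 1) * (2 * pi)"
   using pi_gt_zero by (simp_all add: field_simps)
  then show thesis by (intro that[of k]) (auto simp: algebra_simps)
 qed
 then have "\<bar>t + 2 * pi * k - s\<bar> <= pi" by auto
 from close[OF this] have "Y s \<bullet> ev t <= gam (t + 2 * pi * k) - k0 * (1 - cos (t + 2 * pi * k - s))"
  by (simp add: ev_periodic)
 moreover have "gam (t + 2 * pi * k) = gam t" by (simp add: gam[symmetric] ev_periodic)
 moreover have "cos (t + 2 * pi * k - s) = cos (t - s)"
  using ev_inner_ev[of "t + 2 * pi * k" s] ev_inner_ev[of t s] by (simp add: ev_periodic)
 ultimately show ?thesis by simp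
qed

lemma Y_support': "Y s \<bullet> ev t <= gam t"
proof -
 have "0 <= k0 * (1 - cos (t - s))" using k0 by simp
 then show ?thesis using Y_support[of s t] by linarith
qed

text \<open>Strict convexity: equality in \<open>Y_support\<close> occurs only where the cosine is
  1, so a boundary point has a single normal.\<close>

lemma Y_eq_iff: "Y s = Y t \<longleftrightarrow> ev s = ev t"
proof
 assume "Y s = Y t"
 then have "k0 * (1 - cos (t - s)) <= 0" using Y_support[of s t] Y_inner(1)[of t] by simp
 then have "cos (t - s) \<ge> 1" using k0 by (simp add: mult_le_0_iff)
 then have "cos (t - s) = 1" by (simp add: antisym)
 then obtain n :: int where "t - s = real_of_int n * 2 * pi" unfolding cos_one_2pi_int by auto
 then have "t = s + 2 * pi * n" by (simp add: algebra_simps)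
 then show "ev s = ev t" using ev_periodic by metis
next
 assume "ev s = ev t"
 moreover have "gam s = gam t" using \<open>ev s = ev t\<close> by (simp add: gam[symmetric])
 moreover have "gam1 s = gam1 t"
 proof -
  obtain k :: int where k: "s = t + 2 * pi * k" using \<open>ev s = ev t\<close> ev_eq_iff by blast
  have "gam (u + 2 * pi * k) = gam u" for u by (simp add: gam[symmetric] ev_periodic)
  then show ?thesis using shift_derivative[OF dgam, of "2 * pi * k" t] k by simp
 qed
 ultimately show "Y s = Y t" by (simp add: Y_def)
qed

text \<open>Arc length on the boundary of the Wulff shape as a function of the normal angle, as
  \<open>norm\<close> of the derivative of \<open>Y\<close> is \<open>g\<close>. Accordingly
  \<open>lW\<close> is the Euclidean perimeter, \<open>u\<close> the normal angle at given arc
  length and \<open>Z\<close> the unit speed parametrization.\<close>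

definition G :: "real => real" where "G = (SOME G. (ALL x. (G hrd g x) (at x)) & G 0 = 0)"

lemma dG: "(G hrd g x) (at x)" and G_0: "G 0 = 0"
proof -
 have "EX G. (ALL x. (G hrd g x) (at x)) & G 0 = 0"
  using ex_real_antiderivative[OF cont_g] by metis
 from someI_ex[OF this] show "(G hrd g x) (at x)" "G 0 = 0" by (auto simp: G_def)
qed

definition lW :: real where "lW = G (2 * pi)"

lemma G_periodic: "G (x + 2 * pi) = G x + lW"
 using antiderivative_quasi_periodic[OF dG g_periodic, of x] by (simp add: G_0 lW_def)

lemma strict_mono_G: "strict_mono G"
 by (rule strict_monoI) (rule DERIV_pos_imp_increasing, use dG g_pos in auto)

lemma lW_pos: "0 < lW"
 using strict_monoD[OF strict_mono_G, of 0 "2 * pi"] by (simp add: lW_def G_0)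

lemma surj_G: "surj G"
 by (rule surj_quasi_periodic[where A = G, OF _ G_periodic lW_pos])
   (rule DERIV_continuous_on[OF hfd_at_within[OF dG]])

definition u :: "real => real" where "u = inv G"

lemma G_u: "G (u y) = y" and u_G: "u (G x) = x"
 using surj_G strict_mono_imp_inj_on[OF strict_mono_G] by (simp_all add: u_def surj_f_inv_f)

lemma du: "(u hrd 1 / g (u y)) (at y)"
proof -
 obtain v where v: "!!s. v (G s) = s" "!!y. (v hrd 1 / g (v y)) (at y)"
  by (rule real_diffeomorphism_inverse[OF dG g_pos surj_G]) (rule that, assumption+)
 have "v = u" using v(1) G_u by (metis ext)
 then show ?thesis using v(2) by simp
qed

lemma u_periodic: "u (y + lW) = u y + 2 * pi"
 by (metis G_periodic G_u u_G)

definition Z :: "real => real^2" where "Z y = Y (u y)"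

lemma dZ: "(Z hvd rot90 (ev (u y))) (at y)"
proof -
 have "(u hvd 1 / g (u y)) (at y)"
  using du by (simp add: hrd_iff_hvd)
 then have "(Y \<circ> u hvd (1 / g (u y)) *. g (u y) *. rot90 (ev (u y))) (at y)"
  by (rule vector_diff_chain_at) (rule dY)
 then show ?thesis using g_pos[of "u y"] by (simp add: comp_def Z_def[abs_def])
qed

definition thW :: "real => real" where
 "thW y = u y + arctan ((Z y \<bullet> rot90 (ev (u y))) / (Z y \<bullet> ev (u y)))"

text \<open>Star-shapedness about the origin is positivity of the support function: the component of
  \<open>Z y\<close> along its own normal \<open>ev (u y)\<close> is
  \<open>gam (u y)\<close>.\<close>

lemma star_curve_Z: "star_curve Z (%y. rot90 (ev (u y))) lW (%y. - (1 / g (u y)) *. ev (u y)) thW"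
proof
 have cu: "continuous_on UNIV u" by (rule DERIV_continuous_on[OF hfd_at_within[OF du]])
 have cev: "continuous_on A ev" for A
  using has_vector_derivative_continuous[OF has_vector_derivative_ev] by (intro cont_at_imp_cont_on) blast
 have ceu: "continuous_on UNIV (%y. ev (u y))" by (rule continuous_on_compose2[OF cev cu]) auto
 show "0 < lW" by (rule lW_pos)
 show "(Z hvd rot90 (ev (u s))) (at s)" for s by (rule dZ)
 show "continuous_on UNIV (%y. rot90 (ev (u y)))"
  by (rule bounded_linear.continuous_on[OF bounded_linear_rot90 ceu])
 show "rot90 (ev (u s)) ~= 0" for s by (metis norm_ev norm_rot90 norm_zero zero_neq_one)
 have up: "u (t + lW * of_int k) = u t + 2 * pi * of_int k" for t and k :: int
 proof -
  have nat: "u (t + lW * real n) = u t + 2 * pi * real n" for t n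
  proof (induction n)
   case (Suc n)
   then show ?case using u_periodic[of "t + lW * real n"] by (simp add: algebra_simps)
  qed simp
  show ?thesis
  proof (cases "0 <= k")
   case True then show ?thesis using nat[of t "nat k"] by simp
  next
   case False
   then show ?thesis using nat[of "t + lW * of_int k" "nat (- k)"] by simp
  qed
 qed
 show "Z s = Z t \<longleftrightarrow> (EX k::int. s = t + lW * of_int k)" for s t
 proof -
  have "Z s = Z t \<longleftrightarrow> (EX k::int. u s = u t + 2 * pi * k)" by (simp add: Z_def Y_eq_iff ev_eq_iff)
  also have "... \<longleftrightarrow> (EX k::int. u s = u (t + lW * of_int k))" by (simp add: up)
  also have "... \<longleftrightarrow> (EX k::int. s = t + lW * of_int k)" by (metis G_u)
  finally show ?thesis .
 qed
 show "((%y. rot90 (ev (u y))) hvd - (1 / g (u s)) *. ev (u s)) (at s)" for s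
  using bounded_linear_hvd[OF bounded_linear_rot90 has_derivative_ev[OF du[of s]]]
  by (simp add: rot90_scaleR rot90_rot90)
 show "continuous_on UNIV (%y. - (1 / g (u y)) *. ev (u y))"
  by (intro continuous_intros ceu continuous_on_compose2[OF cont_g cu, of UNIV]) (use g_pos in \<open>auto simp: less_imp_neq[symmetric]\<close>)
 have pos: "0 < Z s \<bullet> ev (u s)" for s by (simp add: Z_def Y_inner gam_pos)
 show "Z s = norm (Z s) *. ev (thW s)" for s
  unfolding thW_def by (rule polar_arctan[OF pos])
 show "0 < rot90 (Z s) \<bullet> rot90 (ev (u s))" for s using pos by (simp add: rot90_inner_rot90)
 show "(thW hrd rot90 (Z s) \<bullet> rot90 (ev (u s)) / (Z s \<bullet> Z s)) (at s)" for s
  unfolding thW_def[abs_def] by (rule polar_angle_derivative[OF dZ du pos])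
 show "thW (s + lW) = thW s + 2 * pi" for s
  using ev_periodic[of "u s" 1] by (simp add: thW_def Z_def u_periodic Y_periodic)
qed

sublocale W: star_curve Z "%y. rot90 (ev (u y))" lW "%y. - (1 / g (u y)) *. ev (u y)" thW
 by (rule star_curve_Z)

lemma range_Z: "range Z = range Y"
proof -
 have "Y t \<in> range Z" for t using rangeI[of Z "G t"] by (simp add: Z_def u_G)
 then show ?thesis by (auto simp: Z_def)
qed

section \<open>The Wulff shape, its interior, its boundary and its normal\<close>

lemma mem_wulff: "x \<in> wulff \<phi> \<longleftrightarrow> (ALL t. x \<bullet> ev t <= gam t)"
proof
 assume "x \<in> wulff \<phi>" then show "ALL t. x \<bullet> ev t <= gam t" by (auto simp: wulff_def gam[symmetric])
next
 assume a: "ALL t. x \<bullet> ev t <= gam t"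
 have "x \<bullet> n <= \<phi> n" for n
 proof -
  obtain t where t: "n = norm n *. ev t" using ex_polar by blast
  have "x \<bullet> n = norm n * (x \<bullet> ev t)" by (subst t) simp
  also have "... <= norm n * gam t" using a by (intro mult_left_mono) auto
  also have "... = \<phi> n" using \<phi>_scale[of "norm n" "ev t"] t gam by simp
  finally show ?thesis .
 qed
 then show "x \<in> wulff \<phi>" by (simp add: wulff_def)
qed

text \<open>A point on the ray through \<open>Z s\<close> need only be tested against the normal at
  \<open>Z s\<close>, where the supporting inequality is sharp.\<close>

lemma wulff_eq: "wulff \<phi> = {l *. Z s | l s. 0 <= l & l <= 1}"
proof (intro equalityI subsetI)
 fix x assume x: "x \<in> wulff \<phi>"
 obtain P where P: "polar_star P" "!!t. EX s. thW s = t & Z s = P t *. ev t"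
  by (rule W.polar_star) blast
 obtain t where t: "x = norm x *. ev t" using ex_polar by blast
 obtain s where s: "Z s = P t *. ev t" using P(2) by blast
 have Pt: "0 < P t" using P(1) by (simp add: polar_star_def)
 define l where "l = norm x / P t"
 have xl: "x = l *. Z s" using t s Pt by (simp add: l_def)
 have "l * gam (u s) <= gam (u s)"
  using x[unfolded mem_wulff, rule_format, of "u s"] by (simp add: xl Z_def Y_inner)
 then have "l <= 1" using gam_pos[of "u s"] by simp
 moreover have "0 <= l" using Pt by (simp add: l_def)
 ultimately show "x \<in> {l *. Z s | l s. 0 <= l & l <= 1}" using xl by blast
next
 fix x assume "x \<in> {l *. Z s | l s. 0 <= l & l <= 1}"
 then obtain l s where x: "x = l *. Z s" "0 <= l" "l <= 1" by blast
 have "l * (Z s \<bullet> ev t) <= gam t" for t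
 proof -
  have "l * (Z s \<bullet> ev t) <= l * gam t" using Y_support'[of "u s" t] x by (intro mult_left_mono) (auto simp: Z_def)
  also have "... <= gam t" using x gam_pos[of t] by (simp add: mult_left_le_one_le)
  finally show ?thesis .
 qed
 then show "x \<in> wulff \<phi>" by (simp add: mem_wulff x)
qed

lemma closure_W_D: "closure W.D = wulff \<phi>" using W.closure_D wulff_eq by simp

lemma mem_W_D: "(!!t. x \<bullet> ev t < gam t) ==> x \<in> W.D"
proof -
 assume a: "!!t. x \<bullet> ev t < gam t"
 then have "x \<in> wulff \<phi>" by (auto simp: mem_wulff intro: less_imp_le)
 then obtain l s where x: "x = l *. Z s" "0 <= l" "l <= 1" unfolding wulff_eq by blast
 have "l ~= 1" using a[of "u s"] x by (auto simp: Z_def Y_inner)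
 then show "x \<in> W.D" using x by (auto simp: W.D_def)
qed

text \<open>An interior point may be moved outwards in any direction \<open>ev t\<close>, so all its
  supporting inequalities are strict.\<close>

lemma interior_wulff: "interior (wulff \<phi>) = W.D"
proof
 show "W.D \<subseteq> interior (wulff \<phi>)"
  using W.open_D closure_W_D closure_subset[of W.D] by (simp add: interior_maximal)
 show "interior (wulff \<phi>) \<subseteq> W.D"
 proof
  fix x assume "x \<in> interior (wulff \<phi>)"
  then obtain e where e: "0 < e" "ball x e \<subseteq> wulff \<phi>" by (auto simp: mem_interior)
  have "x \<bullet> ev t < gam t" for t
  proof -
   have "x + (e/2) *. ev t \<in> wulff \<phi>" using e by (intro subsetD[OF e(2)]) (simp add: dist_norm)
   then have "(x + (e/2) *. ev t) \<bullet> ev t <= gam t" by (simp add: mem_wulff)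
   then show ?thesis using e(1) by (simp add: inner_add_left ev_inner_ev)
  qed
  then show "x \<in> W.D" by (rule mem_W_D)
 qed
qed

lemma closed_wulff: "closed (wulff \<phi>)" using closure_W_D closed_closure by metis

lemma wulff_at_eq: "wulff_at \<phi> x r = (+) x ` ((*.) r ` wulff \<phi>)"
 by (simp add: wulff_at_def image_image)

lemma closed_wulff_at: "closed (wulff_at \<phi> x r)"
 unfolding wulff_at_eq by (intro closed_translation closed_scaling closed_wulff)

lemma interior_wulff_at: "0 < r ==> interior (wulff_at \<phi> x r) = (%w. x + r *. w) ` W.D"
proof -
 assume "0 < r"
 then have "interior ((*.) r ` wulff \<phi>) = (*.) r ` W.D"
 proof -
  have "inj ((*.) r :: real^2 => real^2)" using \<open>0 < r\<close> by (auto intro: injI)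
  then show ?thesis
   using interior_injective_linear_image[of "(*.) r :: real^2 => real^2"] interior_wulff by (simp add: linear_scaleR)
 qed
 then show ?thesis unfolding wulff_at_eq interior_translation by (simp only: image_image)
qed

lemma frontier_wulff_at: "0 < r ==> frontier (wulff_at \<phi> x r) = range (%t. x + r *. Y t)"
proof -
 assume r: "0 < r"
 have "inj (%w. x + r *. w)" using r by (auto intro: injI)
 moreover have "wulff \<phi> - W.D = range Z"
  using W.frontier_D W.open_D closure_W_D by (simp add: frontier_def interior_open)
 ultimately have "frontier (wulff_at \<phi> x r) = (%w. x + r *. w) ` range Z"
  unfolding frontier_def interior_wulff_at[OF r] using closed_wulff_at[of x r]
  by (simp add: wulff_at_def image_set_diff[symmetric])
 then show ?thesis unfolding range_Z by (simp add: image_image)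
qed

lemma closed_curve_wulff_at:
 assumes "0 < r"
 shows "closed_curve (%t. x + r *. Y t) (%t. (r * g t) *. rot90 (ev t)) (2 * pi)"
proof
 have cev: "continuous_on UNIV (%t. rot90 (ev t))"
  using has_vector_derivative_continuous[OF has_vector_derivative_rot90_ev] by (intro cont_at_imp_cont_on) blast
 show "((%t. x + r *. Y t) hvd (r * g s) *. rot90 (ev s)) (at s)" for s
  using has_vector_derivative_add[OF has_vector_derivative_const
    bounded_linear_hvd[OF bounded_linear_scaleR_right dY]] by simp
 show "continuous_on UNIV (%t. (r * g t) *. rot90 (ev t))" by (intro continuous_intros cont_g cev)
 show "(r * g s) *. rot90 (ev s) ~= 0" for s
  using assms g_pos[of s] norm_ev[of s] by (auto simp del: norm_ev)
 show "x + r *. Y s = x + r *. Y t \<longleftrightarrow> (EX k::int. s = t + 2 * pi * k)" for s t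
  using assms by (simp add: Y_eq_iff ev_eq_iff)
qed simp

end

text \<open>Near \<open>c t0\<close> the frontier is the curve, so the tangency condition says that
  \<open>n \<bullet> c t\<close> has derivative zero at \<open>t0\<close>.\<close>

lemma is_outer_normal_curveI:
 assumes c: "(c hvd v) (at t0)" and "v ~= 0"
  and near: "!!eps. 0 < eps ==> EX dl>0. \<forall>y\<in>frontier A. dist y (c t0) < dl --> (EX t. \<bar>t - t0\<bar> < eps & y = c t)"
  and n: "norm n = 1" "n \<bullet> v = 0"
  and side: "\<forall>\<^sub>F t in at_right 0. c t0 - t *. n \<in> interior A & c t0 + t *. n \<notin> closure A"
 shows "is_outer_normal A (c t0) n"
proof -
 have "((%t. n \<bullet> c t) hvd 0) (at t0)"
  using bounded_linear_hvd[OF bounded_linear_inner_right c, of n] n(2) by simp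
 from has_derivative_within_curve[OF c \<open>v ~= 0\<close> near this]
 have "((%y. n \<bullet> y) has_derivative (%h. 0)) (at (c t0) within frontier A)" by simp
 then have "((%y. (n \<bullet> y - n \<bullet> c t0 - 0) /\<^sub>R norm (y - c t0)) \<longlongrightarrow> 0) (at (c t0) within frontier A)"
  unfolding has_derivative_at_within by blast
 then have "((%y. (n \<bullet> (y - c t0)) / norm (y - c t0)) \<longlongrightarrow> 0) (at (c t0) within frontier A)"
  by (simp add: inner_diff_right divide_inverse mult.commute)
 then show ?thesis using n side by (simp add: is_outer_normal_def)
qed

context anisotropy begin

lemma outer_normal_wulff_at:
 assumes r: "0 < r" shows "outer_normal (wulff_at \<phi> x r) (x + r *. Y t) = ev t"
proof -
 interpret C: closed_curve "%t. x + r *. Y t" "%t. (r * g t) *. rot90 (ev t)" "2 * pi"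
  by (rule closed_curve_wulff_at[OF r])
 have "is_outer_normal (wulff_at \<phi> x r) (x + r *. Y t) (ev t)"
 proof (rule is_outer_normal_curveI[where c = "%t. x + r *. Y t", OF C.der C.nz])
  show "EX dl>0. \<forall>y\<in>frontier (wulff_at \<phi> x r). dist y (x + r *. Y t) < dl --> (EX s. \<bar>s - t\<bar> < eps & y = x + r *. Y s)"
   if "0 < eps" for eps unfolding frontier_wulff_at[OF r] by (rule C.near_range[OF that])
  show "ev t \<bullet> ((r * g t) *. rot90 (ev t)) = 0" by (simp add: rot90_inner_self)
  \<comment> \<open>Moving inwards by \<open>eta = h / r < k0\<close> keeps all inequalities strict:
    by \<open>Y_support\<close> the remaining gap is \<open>k0 * (1 - cos) + eta * cos\<close> of
    the angle difference, which is at least \<open>eta\<close>.\<close>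
  have "x + r *. Y t - h *. ev t \<in> interior (wulff_at \<phi> x r) & x + r *. Y t + h *. ev t \<notin> wulff_at \<phi> x r"
   if h: "0 < h" "h < r * k0" for h
  proof
   define eta where "eta = h / r"
   have eta: "0 < eta" "eta < k0" using h r by (auto simp: eta_def field_simps)
   have "Y t - eta *. ev t \<in> W.D"
   proof (rule mem_W_D)
    fix tau
    have "(k0 - eta) * cos (tau - t) <= k0 - eta" using eta by (simp add: mult_left_le)
    then have "0 < k0 * (1 - cos (tau - t)) + eta * cos (tau - t)" using eta(1) by (simp add: algebra_simps)
    moreover have "cos (t - tau) = cos (tau - t)" using cos_minus[of "tau - t"] by simp
    ultimately show "(Y t - eta *. ev t) \<bullet> ev tau < gam tau"
     using Y_support[of t tau] by (simp add: inner_diff_left ev_inner_ev)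
   qed
   then show "x + r *. Y t - h *. ev t \<in> interior (wulff_at \<phi> x r)"
    unfolding interior_wulff_at[OF r]
    by (rule image_eqI[rotated]) (use r in \<open>simp add: eta_def scaleR_diff_right\<close>)
   show "x + r *. Y t + h *. ev t \<notin> wulff_at \<phi> x r"
   proof
    assume "x + r *. Y t + h *. ev t \<in> wulff_at \<phi> x r"
    then obtain w where w: "w \<in> wulff \<phi>" "r *. Y t + h *. ev t = r *. w"
     by (auto simp: wulff_at_def add.assoc)
    then have "r * gam t + h = r * (w \<bullet> ev t)"
    proof -
     have "(r *. Y t + h *. ev t) \<bullet> ev t = (r *. w) \<bullet> ev t" by (simp only: w(2))
     then show ?thesis by (simp only: inner_add_left inner_scaleR_left Y_inner ev_inner_ev diff_self cos_zero mult_1_right)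
    qed
    also have "... <= r * gam t" using w(1) r by (simp add: mem_wulff)
    finally show False using h by simp
   qed
  qed
  then show "\<forall>\<^sub>F h in at_right 0. x + r *. Y t - h *. ev t \<in> interior (wulff_at \<phi> x r) &
    x + r *. Y t + h *. ev t \<notin> closure (wulff_at \<phi> x r)"
   unfolding closure_closed[OF closed_wulff_at]
   by (intro eventually_at_rightI[of 0 "r * k0"]) (use r k0 in auto)
 qed simp
 then show ?thesis
  by (rule outer_normal_eqI[where c = "%t. x + r *. Y t", OF _ _ C.der C.nz])
    (auto simp: frontier_wulff_at[OF r] intro!: always_eventually)
qed

lemma unit_tangent_wulff_at: "0 < r ==> unit_tangent (wulff_at \<phi> x r) (x + r *. Y t) = rot90 (ev t)"
 by (simp add: unit_tangent_def outer_normal_wulff_at)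

end

section \<open>Boundary curves of \<open>C\<^sup>2\<close> sets\<close>

lemma unit_speed_lipschitz:
 assumes "!!t. (c hvd c1 t) (at t)" "!!t. norm (c1 t) = 1"
 shows "dist (c s) (c t) <= \<bar>s - t\<bar>"
proof -
 have "norm (c s - c t) <= 1 * norm (s - t)"
  by (rule differentiable_bound[of UNIV c "%t h. h *. c1 t"])
    (use assms in \<open>auto simp: has_vector_derivative_def intro!: onorm_le\<close>)
 then show ?thesis by (simp add: dist_norm)
qed

text \<open>\<open>sig\<close> recovers the parameter from the point and is differentiable on the
  whole plane, which makes changes of charts differentiable. The curve runs over the whole line, but
  it describes the frontier only within distance \<open>h\<close> of \<open>q\<close>.\<close>

definition boundary_chart ::
 "(real^2) set => real => real^2 => (real => real^2) => (real => real^2) => (real => real^2) => (real^2 => real) => bool" where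
 "boundary_chart E h q c c1 c2 sig \<longleftrightarrow> c 0 = q &
  (ALL t. (c hvd c1 t) (at t)) & (ALL t. (c1 hvd c2 t) (at t)) &
  continuous_on UNIV c2 & (ALL t. norm (c1 t) = 1) & (ALL y. sig differentiable (at y)) & (ALL t. sig (c t) = t) &
  frontier E \<inter> ball q h = range c \<inter> ball q h &
  (ALL t. c t \<in> ball q h --> is_outer_normal E (c t) (- rot90 (c1 t)))"

text \<open>Arc length \<open>A\<close> along the graph has slope at least 1, hence is onto; its
  inverse \<open>om\<close> is \<open>C2_on\<close> because the derivative of \<open>om\<close> is a
  \<open>C1_on\<close> function of \<open>om\<close>.\<close>

lemma graph_arc_length:
 assumes g: "C2_on UNIV g" and e: "norm e = 1"
 obtains c c1 c2 A om g1 where "!!t. (c hvd c1 t) (at t)"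
  "!!t. (c1 hvd c2 t) (at t)" "continuous_on UNIV c2"
  "!!t. c t = om t *. rot90 e + g (om t) *. e"
  "!!t. c1 t = (1 / sqrt (1 + (g1 (om t))\<^sup>2)) *. (rot90 e + g1 (om t) *. e)"
  "!!w. (g hrd g1 w) (at w)" "!!w. om (A w) = w" "!!t. A (om t) = t"
  "!!w. (A hrd sqrt (1 + (g1 w)\<^sup>2)) (at w)" "A w0 = 0"
proof -
 obtain g1 g2 where "!!x. (g hvd g1 x) (at x)" "!!x. (g1 hvd g2 x) (at x)"
   "continuous_on UNIV g2" by (rule C2_on_realE[OF g]) (rule that, assumption+)
 then have g1: "!!x. (g hrd g1 x) (at x)" and g2: "!!x. (g1 hrd g2 x) (at x)"
  and C1g1: "C1_on UNIV g1"
  using C1_on_realI[of UNIV g1 g2] by (auto simp: hrd_iff_hvd)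
 have cg1: "continuous_on UNIV g1" using C1_on_imp_continuous_on[OF C1g1] .
 have pos: "0 < 1 + (g1 w)\<^sup>2" for w by (simp add: add_pos_nonneg)
 have csq: "continuous_on UNIV (%w. sqrt (1 + (g1 w)\<^sup>2))" by (intro continuous_intros cg1)
 obtain A0 where A0: "!!w. (A0 hrd sqrt (1 + (g1 w)\<^sup>2)) (at w)"
  by (rule ex_real_antiderivative[OF csq]) (rule that, assumption)
 define A where "A w = A0 w - A0 w0" for w
 have A: "(A hrd sqrt (1 + (g1 w)\<^sup>2)) (at w)" for w
  unfolding A_def[abs_def] using DERIV_diff[OF A0 DERIV_const] by simp
 have grow: "b - a <= A b - A a" if "a <= b" for a b
 proof -
  have "A a - a <= A b - b"
   by (rule DERIV_nonneg_imp_nondecreasing[OF that])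
     (intro exI conjI, rule DERIV_diff[OF A DERIV_ident], simp)
  then show ?thesis by simp
 qed
 have cA: "continuous_on UNIV A" by (rule DERIV_continuous_on[OF hfd_at_within[OF A]])
 have "surj A"
 proof -
  have "EX w. A w = y" for y
  proof -
   define K where "K = \<bar>y - A 0\<bar>"
   have K: "0 <= K" "A 0 - K <= y" "y <= A 0 + K" by (auto simp: K_def)
   have "A (- K) <= y" "y <= A K" using grow[of "- K" 0] grow[of 0 K] K by auto
   moreover have "connected (range A)" by (rule connected_continuous_image[OF cA]) simp
   ultimately have "y \<in> range A" by (meson connectedD_interval rangeI)
   then show ?thesis by auto
  qed
  then show ?thesis by (metis surjI surj_def)
 qed
 note surjA = this
 have sqpos: "0 < sqrt (1 + (g1 w)\<^sup>2)" for w using pos by simp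
 obtain om where om: "!!t. A (om t) = t" "!!w. om (A w) = w"
  "!!t. (om hrd 1 / sqrt (1 + (g1 (om t))\<^sup>2)) (at t)"
  by (rule real_diffeomorphism_inverse[OF A sqpos surjA]) (rule that, assumption+)
 have inv: "C1_on {0<..} (%y::real. 1 / sqrt y)"
  by (rule C1_on_realI[where f' = "%y. - (1 / (2 * (sqrt y * y)))"])
    (auto intro!: derivative_eq_intros continuous_intros
     simp: hrd_iff_hvd[symmetric] field_simps)
 have h: "C1_on UNIV (%w. 1 / sqrt (1 + g1 w * g1 w))"
  by (rule C1_on_compose[OF _ inv, of UNIV "%w. 1 + g1 w * g1 w"])
    (use pos in \<open>auto intro!: C1_on_add C1_on_const C1_on_bilinear[OF bounded_bilinear_mult] C1g1 simp: power2_eq_square\<close>)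
 have omv: "(om hvd 1 / sqrt (1 + g1 (om t) * g1 (om t))) (at t)" for t
  using om(3)[of t] by (simp add: hrd_iff_hvd power2_eq_square)
 have com: "continuous_on UNIV om"
  using has_vector_derivative_continuous[OF omv] by (intro cont_at_imp_cont_on) blast
 have "C1_on UNIV om"
  by (rule C1_on_realI[OF omv continuous_on_compose2[OF C1_on_imp_continuous_on[OF h] com]]) auto
 then have C2om: "C2_on UNIV om"
  by (intro C2_on_realI'[OF omv] C1_on_compose[where f = om and T = UNIV, OF _ h]) auto
 define c where "c t = om t *. rot90 e + g (om t) *. e" for t
 have C2g: "C2_on UNIV (%t. g (om t))" by (rule C2_on_compose[where f = om and T = UNIV, OF C2om g]) auto
 have "C2_on UNIV c"
  unfolding c_def[abs_def]
  by (intro C2_on_add C2_on_bilinear[OF bounded_bilinear_scaleR] C2_on_const C2g C2om)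
 note C2c = this
 obtain c1 c2 where c: "!!t. (c hvd c1 t) (at t)" "!!t. (c1 hvd c2 t) (at t)"
   "continuous_on UNIV c2" by (rule C2_on_realE[OF C2c]) (rule that, assumption+)
 have c1: "c1 t = (1 / sqrt (1 + (g1 (om t))\<^sup>2)) *. (rot90 e + g1 (om t) *. e)" for t
 proof (rule vector_derivative_unique_at[OF c(1)])
  show "(c hvd (1 / sqrt (1 + (g1 (om t))\<^sup>2)) *. (rot90 e + g1 (om t) *. e)) (at t)"
   unfolding c_def[abs_def]
   by (rule has_vector_derivative_eq_rhs[OF has_vector_derivative_add[
      OF has_vector_derivative_scaleR[OF om(3) has_vector_derivative_const]
        has_vector_derivative_scaleR[OF DERIV_chain2[OF g1 om(3)] has_vector_derivative_const]]])
     (simp add: scaleR_add_right)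
 qed
 show thesis
  by (rule that[OF c c_def c1 g1 om(2,1) A]) (simp add: A_def)
qed

text \<open>Inside the ball \<open>E\<close> is the set where \<open>f\<close> is negative, and
  \<open>f\<close> has positive derivative along \<open>n\<close> on the graph. Hence graph points
  are frontier points and \<open>n\<close> points out of \<open>E\<close>.\<close>

lemma boundary_chart_exists:
 assumes E: "C2_open_set E" and p: "p \<in> frontier E"
 obtains h c c1 c2 sig where "0 < h" "boundary_chart E h p c c1 c2 sig"
proof -
 obtain e g dl where e: "norm e = 1" and dl: "0 < dl" and g: "C2_on UNIV g"
  and Eg: "E \<inter> ball p dl = {y \<in> ball p dl. y \<bullet> e < g (y \<bullet> rot90 e)}"
  using E p unfolding C2_open_set_def by blast
 have oE: "open E" using E by (simp add: C2_open_set_def)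
 obtain c c1 c2 A om g1 where c: "!!t. (c hvd c1 t) (at t)"
  "!!t. (c1 hvd c2 t) (at t)" "continuous_on UNIV c2"
  and cw: "!!t. c t = om t *. rot90 e + g (om t) *. e"
  and c1: "!!t. c1 t = (1 / sqrt (1 + (g1 (om t))\<^sup>2)) *. (rot90 e + g1 (om t) *. e)"
  and g1: "!!w. (g hrd g1 w) (at w)" and omA: "!!w. om (A w) = w" "!!t. A (om t) = t"
  and A: "!!w. (A hrd sqrt (1 + (g1 w)\<^sup>2)) (at w)" "A (p \<bullet> rot90 e) = 0"
  by (rule graph_arc_length[OF g e, of "p \<bullet> rot90 e"]) (rule that, assumption+)
 have ee: "e \<bullet> e = 1" "rot90 e \<bullet> rot90 e = 1" "e \<bullet> rot90 e = 0" "rot90 e \<bullet> e = 0"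
  using e by (simp_all add: rot90_inner_self rot90_inner_rot90 norm_eq_1)
 have dec: "y = (y \<bullet> e) *. e + (y \<bullet> rot90 e) *. rot90 e" for y by (rule orthonormal_decomp[OF e])
 have cc: "c t \<bullet> e = g (om t)" "c t \<bullet> rot90 e = om t" for t
  by (simp_all add: cw inner_add_left ee)
 define f where "f y = y \<bullet> e - g (y \<bullet> rot90 e)" for y
 have cg: "continuous_on UNIV g" using C1_on_imp_continuous_on[OF C2_on_imp_C1_on[OF g]] .
 have cf: "continuous_on UNIV f" unfolding f_def
  by (intro continuous_intros continuous_on_compose2[OF cg]) auto
 have fE: "y \<in> E \<longleftrightarrow> f y < 0" if "y \<in> ball p dl" for y   proof -
  have "y \<in> E \<inter> ball p dl \<longleftrightarrow> y \<in> {y \<in> ball p dl. y \<bullet> e < g (y \<bullet> rot90 e)}" by (simp only: Eg)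
  then show ?thesis using that by (simp add: f_def)
 qed
 have f0: "f y = 0 \<longleftrightarrow> y \<in> range c" for y
 proof
  assume "f y = 0"
  then have "c (A (y \<bullet> rot90 e)) = y" using dec[of y] by (simp add: cw omA f_def add.commute)
  then show "y \<in> range c" by (metis rangeI)
 qed (auto simp: f_def cc)
 have pos_out: "y \<notin> closure E" if "y \<in> ball p dl" "0 < f y" for y
 proof -
  have "open (ball p dl \<inter> {y. 0 < f y})" by (intro open_Int open_ball open_Collect_less cf continuous_intros)
  moreover have "ball p dl \<inter> {y. 0 < f y} \<inter> E = {}" using fE by force
  ultimately show ?thesis using that open_Int_closure_eq_empty by blast
 qed
 define n where "n t = - rot90 (c1 t)" for t
 define q where "q t = 1 / sqrt (1 + (g1 (om t))\<^sup>2)" for t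
 have q: "0 < q t" "(q t)\<^sup>2 * (1 + (g1 (om t))\<^sup>2) = 1" for t
 proof -
  have "0 < 1 + (g1 (om t))\<^sup>2" by (simp add: add_pos_nonneg)
  then show "0 < q t" "(q t)\<^sup>2 * (1 + (g1 (om t))\<^sup>2) = 1" by (simp_all add: q_def power_divide)
 qed
 have nq: "n t = q t *. (e - g1 (om t) *. rot90 e)" for t
  by (simp add: n_def c1 q_def rot90_add rot90_scaleR rot90_rot90 scaleR_diff_right)
 have nc1: "norm (c1 t) = 1" for t
 proof -
  have "c1 t = q t *. (rot90 e + g1 (om t) *. e)" by (simp add: c1 q_def)
  then have "c1 t \<bullet> c1 t = (q t)\<^sup>2 * (1 + (g1 (om t))\<^sup>2)"
   by (simp add: inner_add_left inner_add_right ee power2_eq_square algebra_simps)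
  then show ?thesis using q(2) by (simp add: norm_eq_1)
 qed
 have df: "((%h. f (c t + h *. n t)) hrd q t * (1 + (g1 (om t))\<^sup>2)) (at 0)" for t
 proof -
  have "((%h. (c t + h *. n t) \<bullet> e - g ((c t + h *. n t) \<bullet> rot90 e)) hrd
    n t \<bullet> e - g1 (om t) * (n t \<bullet> rot90 e)) (at 0)"
  proof -
   have 1: "((%h. (c t + h *. n t) \<bullet> v) hrd n t \<bullet> v) (at 0)" for v
    unfolding inner_add_left by (auto intro!: derivative_eq_intros)
   have 2: "(g hrd g1 (om t)) (at ((c t + 0 *. n t) \<bullet> rot90 e))" using g1 by (simp add: cc)
   show ?thesis by (rule DERIV_diff[OF 1 DERIV_chain2[OF 2 1]])
  qed
  then show ?thesis by (simp add: f_def nq inner_diff_left ee power2_eq_square algebra_simps)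
 qed
 have f_c: "f (c t) = 0" for t using f0 by blast
 have side: "\<forall>\<^sub>F h in at_right 0. c t - h *. n t \<in> interior E & c t + h *. n t \<notin> closure E"
  if "c t \<in> ball p dl" for t
 proof -
  have dpos: "0 < q t * (1 + (g1 (om t))\<^sup>2)" using q(1)[of t] by (simp add: add_pos_nonneg)
  obtain d1 where d1: "0 < d1" "!!h. 0 < h ==> h < d1 ==> 0 < f (c t + h *. n t)"
   using DERIV_pos_inc_right[OF df dpos] by (auto simp: f_c)
  obtain d2 where d2: "0 < d2" "!!h. 0 < h ==> h < d2 ==> f (c t - h *. n t) < 0"
   using DERIV_pos_inc_left[OF df dpos] by (auto simp: f_c)
  note ct = that
  obtain d3 where d3: "0 < d3" "ball (c t) d3 \<subseteq> ball p dl"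
   using ct open_ball[of p dl] unfolding open_contains_ball by blast
  have nn: "norm (n t) = 1" using nc1 by (simp add: n_def)
  have near: "c t + h *. n t \<in> ball p dl" "c t - h *. n t \<in> ball p dl" if "0 < h" "h < d3" for h
   by (rule subsetD[OF d3(2)], use that nn in \<open>simp add: dist_norm\<close>)+
  show ?thesis
  proof (rule eventually_at_rightI[of 0 "min d1 (min d2 d3)"])
   show "0 < min d1 (min d2 d3)" using d1 d2 d3 by simp
   fix h assume "h \<in> {0<..<min d1 (min d2 d3)}"
   then show "c t - h *. n t \<in> interior E & c t + h *. n t \<notin> closure E"
    using d1 d2 near fE pos_out oE by (auto simp: interior_open)
  qed
 qed
 have fr: "frontier E \<inter> ball p dl = range c \<inter> ball p dl"
 proof (intro equalityI subsetI)
  fix y assume y: "y \<in> frontier E \<inter> ball p dl"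
  then have "y \<notin> E" "y \<in> closure E" using oE by (auto simp: frontier_def interior_open)
  then have "f y = 0" using fE[of y] pos_out[of y] y by force
  then show "y \<in> range c \<inter> ball p dl" using f0 y by blast
 next
  fix y assume y: "y \<in> range c \<inter> ball p dl"
  then obtain t where t: "y = c t" by blast
  have "y \<notin> E" using fE[of y] f_c[of t] t y by simp
  moreover have "y \<in> closure E"
  proof (rule Lim_in_closed_set[where F = "at_right (0::real)" and f = "%h. c t - h *. n t"])
   show "\<forall>\<^sub>F h in at_right 0. c t - h *. n t \<in> closure E"
    using side[of t] y t by (auto elim!: eventually_mono dest: interior_subset[THEN subsetD] closure_subset[THEN subsetD])
   show "((%h. c t - h *. n t) \<longlongrightarrow> y) (at_right 0)" unfolding t by (auto intro!: tendsto_eq_intros)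
  qed auto
  ultimately show "y \<in> frontier E \<inter> ball p dl" using y oE by (auto simp: frontier_def interior_open)
 qed
 define sig where "sig y = A (y \<bullet> rot90 e)" for y
 have dsig: "sig differentiable (at y)" for y
  unfolding sig_def[abs_def] differentiable_def
  using has_derivative_compose[OF bounded_linear_imp_has_derivative[OF bounded_linear_inner_left[of "rot90 e"]]
    A(1)[unfolded has_field_derivative_def]] by blast
 have sigc: "sig (c t) = t" for t by (simp add: sig_def cc omA)
 have c0: "c 0 = p"
 proof -
  have "p \<in> range c" using fr p dl by (metis IntD1 IntI centre_in_ball)
  then obtain t where "p = c t" by blast
  moreover have "sig p = 0" using A(2) by (simp add: sig_def)
  ultimately show ?thesis using sigc[of t] by simp
 qed
 have "is_outer_normal E (c t) (n t)" if "c t \<in> ball p dl" for t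
 proof (rule is_outer_normal_curveI[OF c(1)])
  show "c1 t ~= 0" using nc1[of t] by force
  show "norm (n t) = 1" "n t \<bullet> c1 t = 0" using nc1 by (simp_all add: n_def rot90_inner_self)
  show "\<forall>\<^sub>F h in at_right 0. c t - h *. n t \<in> interior E & c t + h *. n t \<notin> closure E"
   by (rule side[OF that])
  fix eps :: real assume "0 < eps"
  have "isCont sig (c t)" using dsig differentiable_imp_continuous_within by blast
  then obtain d where d: "0 < d" "!!y. dist y (c t) < d ==> dist (sig y) t < eps"
   using \<open>0 < eps\<close> unfolding continuous_at_eps_delta sigc by blast
  note ct = that
  obtain d3 where d3: "0 < d3" "ball (c t) d3 \<subseteq> ball p dl"
   using ct open_ball[of p dl] unfolding open_contains_ball by blast
  show "EX d>0. \<forall>y\<in>frontier E. dist y (c t) < d --> (EX s. \<bar>s - t\<bar> < eps & y = c s)"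
  proof (rule exI[of _ "min d d3"], intro conjI ballI impI)
   fix y assume y: "y \<in> frontier E" "dist y (c t) < min d d3"
   then have "y \<in> ball p dl" using d3(2) by (auto simp: dist_commute subset_eq)
   then obtain s where s: "y = c s" using fr y by blast
   then have "\<bar>s - t\<bar> < eps" using d(2)[of y] y sigc by (simp add: dist_real_def)
   then show "EX s. \<bar>s - t\<bar> < eps & y = c s" using s by blast
  qed (use d d3 in auto)
 qed
 then show thesis
  using that[of dl c c1 c2 sig] dl c nc1 dsig sigc c0 fr by (simp add: boundary_chart_def n_def)
qed

text \<open>\<open>h\<close> is a Lebesgue number of the cover of the compact frontier by chart
  balls; a chart that covers the ball around \<open>q\<close> is recentred at \<open>q\<close> by
  shifting its parameter.\<close>

lemma boundary_chart_uniform: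
 assumes E: "C2_open_set E" "bounded E"
 obtains h where "0 < h" "!!q. q \<in> frontier E ==> EX c c1 c2 sig. boundary_chart E h q c c1 c2 sig"
proof -
 define G where "G = {ball p h | p h. p \<in> frontier E & 0 < h & (EX c c1 c2 sig. boundary_chart E h p c c1 c2 sig)}"
 have "compact (frontier E)" using E(2) by (simp add: compact_frontier_bounded)
 moreover have "frontier E \<subseteq> \<Union>G"
 proof
  fix p assume p: "p \<in> frontier E"
  obtain h c c1 c2 sig where h: "0 < h" "boundary_chart E h p c c1 c2 sig"
   by (rule boundary_chart_exists[OF E(1) p])
  then have "ball p h \<in> G" using p unfolding G_def by blast
  then show "p \<in> \<Union>G" using h(1) by (intro UnionI[of "ball p h"]) auto
 qed
 moreover have "!!B. B \<in> G ==> open B" by (auto simp: G_def)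
 ultimately obtain h where h: "0 < h" "!!q. q \<in> frontier E ==> \<exists>B\<in>G. ball q h \<subseteq> B"
  by (rule Heine_Borel_lemma) (assumption, rule that, assumption, blast)
 have "EX c c1 c2 sig. boundary_chart E h q c c1 c2 sig" if q: "q \<in> frontier E" for q
 proof -
  obtain p h' c c1 c2 sig where sub: "ball q h \<subseteq> ball p h'" and ch: "boundary_chart E h' p c c1 c2 sig"
   using h(2)[OF q] unfolding G_def by blast
  note ch = ch[unfolded boundary_chart_def]
  have "q \<in> ball p h'" by (rule subsetD[OF sub]) (use h(1) in simp)
  then obtain t0 where t0: "q = c t0" using ch q by blast
  have sh: "((%s. s + t0) hvd 1) (at t)" for t
   by (auto intro!: derivative_eq_intros simp: hrd_iff_hvd[symmetric])
  have shift: "((%t. k (t + t0)) hvd k' (t + t0)) (at t)"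
   if "!!t. (k hvd k' t) (at t)" for k k' :: "real => real^2" and t
   using vector_diff_chain_at[OF sh that[of "t + t0"]] by (simp add: comp_def)
  have "frontier E \<inter> ball q h = range (%t. c (t + t0)) \<inter> ball q h"
  proof -
   have "range (%t. c (t + t0)) = range c"
   proof -
    have "c t \<in> range (%t. c (t + t0))" for t by (rule image_eqI[of _ _ "t - t0"]) auto
    then show ?thesis by auto
   qed
   then show ?thesis using ch sub by blast
  qed
  moreover have "is_outer_normal E (c (t + t0)) (- rot90 (c1 (t + t0)))" if "c (t + t0) \<in> ball q h" for t
   using ch sub that by blast
  moreover have c2c: "continuous_on UNIV c2" using ch by blast
  have "continuous_on UNIV (%t. c2 (t + t0))"
   by (rule continuous_on_compose2[OF c2c]) (auto intro!: continuous_intros)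
  moreover have "(%y. sig y - t0) differentiable (at y)" for y
   using ch by (intro differentiable_diff) auto
  ultimately have "boundary_chart E h q (%t. c (t + t0)) (%t. c1 (t + t0)) (%t. c2 (t + t0)) (%y. sig y - t0)"
   using ch shift t0 by (auto simp: boundary_chart_def)
  then show ?thesis by blast
 qed
 then show thesis using that h(1) by blast
qed

text \<open>The local unit speed charts form a local flow of the unit tangent field; following it from a
 point traverses the whole boundary component.\<close>

locale unit_flow =
 fixes S :: "(real^2) set" and tau :: "real^2 => real^2" and h :: real
  and F F1 F2 :: "real^2 => real => real^2" and sig :: "real^2 => real^2 => real"
 assumes compact_S: "compact S" and h: "0 < h"
  and F_0: "q \<in> S ==> F q 0 = q"
  and dF: "q \<in> S ==> (F q hvd F1 q t) (at t)"
  and dF1: "q \<in> S ==> (F1 q hvd F2 q t) (at t)"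
  and cF2: "q \<in> S ==> continuous_on UNIV (F2 q)"
  and nF1: "q \<in> S ==> norm (F1 q t) = 1"
  and F_S: "q \<in> S ==> dist q (F q t) < h ==> F q t \<in> S"
  and F_tau: "q \<in> S ==> dist q (F q t) < h ==> F1 q t = tau (F q t)"
  and sig_diff: "q \<in> S ==> sig q differentiable (at y)"
  and sig_F: "q \<in> S ==> sig q (F q t) = t"
  and F_sig: "q \<in> S ==> y \<in> S ==> dist q y < h ==> F q (sig q y) = y"
begin

lemma F_lipschitz: "q \<in> S ==> dist (F q s) (F q t) <= \<bar>s - t\<bar>"
 by (rule unit_speed_lipschitz[OF dF nF1])

lemma F_near: "q \<in> S ==> \<bar>t\<bar> < h ==> dist q (F q t) < h"
 using F_lipschitz[of q 0 t] F_0 by simp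

lemma F_in: "q \<in> S ==> \<bar>t\<bar> < h ==> F q t \<in> S"
 using F_near F_S by blast

text \<open>The change of charts \<open>psi\<close> has derivative 1, since both charts move with
  velocity \<open>tau\<close> at their common points, so it is a translation. Parameters below
  \<open>h / 2\<close> keep all points within distance \<open>h\<close> of \<open>q\<close>.\<close>

lemma F_add:
 assumes q: "q \<in> S" and t: "\<bar>t\<bar> < h / 2" and r: "\<bar>r\<bar> < h / 2"
 shows "F (F q t) r = F q (t + r)"
proof -
 define q' where "q' = F q t"
 have q': "q' \<in> S" unfolding q'_def by (rule F_in[OF q]) (use t h in simp)
 define psi where "psi r = sig q (F q' r)" for r
 have inS: "F q' r \<in> S & dist q (F q' r) < h" if "\<bar>r\<bar> < h / 2" for r
 proof
  show "F q' r \<in> S" by (rule F_in[OF q']) (use that h in simp)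
  have "dist q (F q' r) <= dist q q' + dist q' (F q' r)" by (rule dist_triangle)
  also have "... <= \<bar>t\<bar> + \<bar>r\<bar>"
   using F_lipschitz[OF q, of 0 t] F_lipschitz[OF q', of 0 r]
   by (simp add: F_0[OF q] F_0[OF q'] q'_def[symmetric])
  also have "... < h" using t that by simp
  finally show "dist q (F q' r) < h" .
 qed
 have Fpsi: "F q (psi r) = F q' r" if "\<bar>r\<bar> < h / 2" for r
  using F_sig[OF q] inS[OF that] by (simp add: psi_def)
 have dpsi: "(psi hrd 1) (at r)" if r: "\<bar>r\<bar> < h / 2" for r
 proof -
  have "psi differentiable (at r)" unfolding psi_def
   using differentiable_chain_at[of "F q'" r "sig q", OF _ sig_diff[OF q]] dF[OF q', of r]
   by (auto simp: has_vector_derivative_def differentiable_def comp_def)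
  then obtain d where d: "(psi hrd d) (at r)" using real_differentiableE by blast
  then have "(F q \<circ> psi hvd d *. F1 q (psi r)) (at r)"
   unfolding hrd_iff_hvd by (rule vector_diff_chain_at[OF _ dF[OF q]])
  then have "(F q' hvd d *. F1 q (psi r)) (at r)"
   by (rule has_vector_derivative_transform_within_open[of _ _ _ "{-h/2<..<h/2}"]) (use r Fpsi in \<open>auto simp: abs_less_iff\<close>)
  then have "F1 q' r = d *. F1 q (psi r)" using dF[OF q', of r] vector_derivative_unique_at by blast
  moreover have "F1 q (psi r) = tau (F q' r)" using F_tau[OF q, of "psi r"] Fpsi[OF r] inS[OF r] by simp
  moreover have "F1 q' r = tau (F q' r)" by (rule F_tau[OF q' F_near[OF q']]) (use r h in simp)
  moreover have "F1 q' r ~= 0" using nF1[OF q', of r] by force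
  ultimately have "d = 1" by (metis scaleR_cancel_right scaleR_one)
  then show ?thesis using d by simp
 qed
 have "psi r - r = psi 0 - 0"
 proof (rule has_derivative_zero_unique[of "{-h/2<..<h/2}" "%r. psi r - r"])
  fix x assume "x \<in> {- h / 2<..<h / 2}"
  then have "((%r. psi r - r) hrd 1 - 1) (at x)"
   by (intro DERIV_diff dpsi DERIV_ident) (auto simp: abs_less_iff)
  then show "((%r. psi r - r) has_derivative (%h. 0)) (at x within {- h / 2<..<h / 2})"
   by (simp add: has_field_derivative_def has_derivative_at_withinI lambda_zero)
 qed (use r h in \<open>auto simp: abs_less_iff\<close>)
 then have "psi r = t + r" using sig_F[OF q, of t] F_0[OF q'] by (simp add: psi_def q'_def)
 then show ?thesis using Fpsi[OF r] by (simp add: q'_def)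
qed

text \<open>The step length. Being \<open>h / 16\<close> it leaves room to compare charts that are
  several steps apart, while \<open>F_add\<close> allows parameters up to
  \<open>8 * eta\<close>.\<close>

definition eta :: real where "eta = h / 16"

lemma eta: "0 < eta" "16 * eta = h" using h by (auto simp: eta_def)

definition step :: "real^2 => int => real^2" where
 "step p k = (if 0 <= k then ((%q. F q eta) ^^ nat k) p else ((%q. F q (- eta)) ^^ nat (- k)) p)"

lemma step_in: "p \<in> S ==> step p k \<in> S"
proof -
 assume p: "p \<in> S"
 have "((%q. F q a) ^^ n) p \<in> S" if "\<bar>a\<bar> <= eta" for a n
  using that eta by (induction n) (auto simp: p intro!: F_in)
 then show ?thesis by (simp add: step_def eta less_imp_le)
qed

lemma step_Suc: "p \<in> S ==> step p (k + 1) = F (step p k) eta"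
proof -
 assume p: "p \<in> S"
 show ?thesis
 proof (cases "0 <= k")
  case True
  then have "nat (k + 1) = Suc (nat k)" by simp
  then show ?thesis using True by (simp add: step_def)
 next
  case False
  then have "nat (- k) = Suc (nat (- (k + 1)))" by simp
  then have "step p k = F (step p (k + 1)) (- eta)" using False by (auto simp: step_def)
  then show ?thesis using F_add[OF step_in[OF p], of "- eta" eta] eta F_0[OF step_in[OF p]] by simp
 qed
qed

definition X :: "real^2 => real => real^2" where
 "X p s = F (step p \<lfloor>s / eta\<rfloor>) (s - \<lfloor>s / eta\<rfloor> * eta)"

text \<open>\<open>X\<close> switches charts at the multiples of \<open>eta\<close>. The chart of
  step \<open>k\<close> still describes it two steps to either side, so the switching is invisible
  to derivatives.\<close>

lemma X_step:
 assumes p: "p \<in> S" and s: "\<bar>s - real_of_int k * eta\<bar> <= 2 * eta"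
 shows "X p s = F (step p k) (s - k * eta)"
proof -
 have up: "F (step p (j + 1)) (r - eta) = F (step p j) r" if "\<bar>r\<bar> <= 4 * eta" for j r
 proof -
  have "\<bar>eta\<bar> < h / 2" "\<bar>r - eta\<bar> < h / 2" using that eta by linarith+
  then show ?thesis using F_add[OF step_in[OF p], of eta "r - eta" j] by (simp add: step_Suc[OF p])
 qed
 have ups: "F (step p (j + int n)) (s - (j + int n) * eta) = F (step p j) (s - j * eta)"
  if "\<bar>s - j * eta\<bar> <= 2 * eta" "n <= 2" for j n
  using that(2)
 proof (induction n)
  case (Suc n)
  have "s - (j + int n) * eta = (s - j * eta) - n * eta" by (simp add: algebra_simps)
  then have "\<bar>s - (j + int n) * eta\<bar> <= \<bar>s - j * eta\<bar> + n * eta"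
   using eta(1) abs_triangle_ineq4[of "s - j * eta" "n * eta"] by simp
  also have "... <= 2 * eta + 2 * eta" using that(1) Suc.prems eta(1) by (intro add_mono mult_right_mono) auto
  finally have "F (step p (j + int n + 1)) ((s - (j + int n) * eta) - eta) = F (step p (j + int n)) (s - (j + int n) * eta)"
   by (intro up) simp
  then show ?case using Suc by (simp add: algebra_simps)
 qed simp
 define m where "m = \<lfloor>s / eta\<rfloor>"
 have m: "real_of_int m * eta <= s" "s < (real_of_int m + 1) * eta"
 proof -
  have "real_of_int m <= s / eta" "s / eta < real_of_int m + 1" by (simp_all add: m_def)
  then show "real_of_int m * eta <= s" "s < (real_of_int m + 1) * eta" using eta(1) by (simp_all add: field_simps)
 qed
 have "(real_of_int m - k) * eta <= 2 * eta" using m s by (simp add: algebra_simps)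
 then have mk: "m - k <= 2" using eta(1) by (simp add: mult_le_cancel_right)
 have "(real_of_int k - m) * eta < 3 * eta" using m s by (simp add: algebra_simps)
 then have "real_of_int k - m < 3" using eta(1) by simp
 then have km: "k - m <= 2" by linarith
 have ms: "\<bar>s - m * eta\<bar> <= 2 * eta" using m eta(1) by (simp add: algebra_simps)
 have "F (step p m) (s - m * eta) = F (step p k) (s - k * eta)"
 proof (cases "k <= m")
  case True
  then show ?thesis using ups[OF s, of "nat (m - k)"] mk by simp
 next
  case False
  then show ?thesis using ups[OF ms, of "nat (k - m)"] km by simp
 qed
 then show ?thesis by (simp add: X_def m_def)
qed

lemma X_flow:
 assumes p: "p \<in> S" and r: "\<bar>r\<bar> <= eta"
 shows "X p (s + r) = F (X p s) r"
proof -
 define k where "k = \<lfloor>s / eta\<rfloor>"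
 have "real_of_int k <= s / eta" "s / eta < real_of_int k + 1" by (simp_all add: k_def)
 then have "real_of_int k * eta <= s" "s < (real_of_int k + 1) * eta" using eta(1) by (simp_all add: field_simps)
 then have k: "\<bar>s - k * eta\<bar> <= eta" by (simp add: algebra_simps)
 have "X p (s + r) = F (step p k) (s + r - k * eta)" by (rule X_step[OF p]) (use k r in auto)
 also have "... = F (F (step p k) (s - k * eta)) r"
  using F_add[OF step_in[OF p], of "s - k * eta" r k] k r eta by (simp add: algebra_simps)
 finally show ?thesis by (simp add: X_def k_def)
qed

lemma X_0: "p \<in> S ==> X p 0 = p"
 by (simp add: X_def step_def F_0)

lemma X_in: "p \<in> S ==> X p s \<in> S"
proof -
 assume p: "p \<in> S"
 define k where "k = \<lfloor>s / eta\<rfloor>"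
 have "real_of_int k <= s / eta" "s / eta < real_of_int k + 1" by (simp_all add: k_def)
 then have "real_of_int k * eta <= s" "s < (real_of_int k + 1) * eta" using eta(1) by (simp_all add: field_simps)
 then have "\<bar>s - k * eta\<bar> <= eta" by (simp add: algebra_simps)
 then show ?thesis unfolding X_def k_def[symmetric] using step_in[OF p] eta by (intro F_in) auto
qed

lemma dX: "p \<in> S ==> (X p hvd tau (X p s)) (at s)"
 and dX1: "p \<in> S ==> ((%s. tau (X p s)) hvd F2 (X p s) 0) (at s)"
 and cX2: "p \<in> S ==> continuous_on UNIV (%s. F2 (X p s) 0)"
proof -
 assume p: "p \<in> S"
 have sh: "((%r. r - s) hvd 1) (at t)" for s t :: real
  by (auto intro!: derivative_eq_intros simp: hrd_iff_hvd[symmetric])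
 have ball: "open {s - eta<..<s + eta}" "s \<in> {s - eta<..<s + eta}" for s using eta(1) by auto
 have tauX: "tau (X p r) = F1 (X p s) (r - s)" if "\<bar>r - s\<bar> < eta" for r s
 proof -
  have "F1 (X p s) (r - s) = tau (F (X p s) (r - s))"
   by (rule F_tau[OF X_in[OF p] F_near[OF X_in[OF p]]]) (use that eta in linarith)
  then show ?thesis using X_flow[OF p, of "r - s" s] that by simp
 qed
 show 1: "(X p hvd tau (X p s)) (at s)" for s
 proof -
  have "((%r. F (X p s) (r - s)) hvd F1 (X p s) (s - s)) (at s)"
   using vector_diff_chain_at[OF sh[where s = s and t = s] dF[OF X_in[OF p, of s]]] by (simp add: comp_def)
  then have "(X p hvd F1 (X p s) (s - s)) (at s)"
   by (rule has_vector_derivative_transform_within_open[OF _ ball])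
     (use X_flow[OF p, of _ s] in \<open>metis abs_le_iff add.commute diff_add_cancel diff_le_eq greaterThanLessThan_iff less_eq_real_def minus_diff_eq\<close>)
  then show ?thesis using tauX[of s s] eta by simp
 qed
 have 2: "((%r. tau (X p r)) hvd F2 (X p s) (t - s)) (at t)" if "\<bar>t - s\<bar> < eta" for s t
 proof -
  have "((%r. F1 (X p s) (r - s)) hvd F2 (X p s) (t - s)) (at t)"
   using vector_diff_chain_at[OF sh[where s = s and t = t] dF1[OF X_in[OF p, of s]]] by (simp add: comp_def)
  then show ?thesis
   by (rule has_vector_derivative_transform_within_open[OF _ ball(1)[of s]])
     (use tauX[of _ s] that in \<open>auto simp: abs_less_iff\<close>)
 qed
 show "((%s. tau (X p s)) hvd F2 (X p s) 0) (at s)" for s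
  using 2[of s s] eta by simp
 show "continuous_on UNIV (%s. F2 (X p s) 0)"
 proof (intro cont_at_imp_cont_on ballI)
  fix s
  have "F2 (X p t) 0 = F2 (X p s) (t - s)" if "\<bar>t - s\<bar> < eta" for t
   using vector_derivative_unique_at[OF 2[OF that] 2[of t t]] eta by simp
  then have "\<forall>\<^sub>F t in nhds s. F2 (X p s) (t - s) = F2 (X p t) 0"
   unfolding eventually_nhds_metric by (intro exI[of _ eta]) (auto simp: dist_real_def eta)
  moreover have "continuous_on UNIV (%t. F2 (X p s) (t - s))"
   by (rule continuous_on_compose2[OF cF2[OF X_in[OF p]]]) (auto intro!: continuous_intros)
  then have "isCont (%t. F2 (X p s) (t - s)) s" by (simp add: continuous_on_eq_continuous_at)
  ultimately show "isCont (%t. F2 (X p t) 0) s"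
   by (rule iffD1[OF isCont_cong])
 qed
qed

lemma X_shift:
 assumes p: "p \<in> S" and eq: "X p s = X p t"
 shows "X p (s + r) = X p (t + r)"
proof -
 have small: "X p (s + r) = X p (t + r)" if "X p s = X p t" "\<bar>r\<bar> <= eta" for s t r
  using X_flow[OF p that(2)] that(1) by simp
 have many: "X p (s + real n * r) = X p (t + real n * r)" if "\<bar>r\<bar> <= eta" for r n
 proof (induction n)
  case (Suc n)
  then show ?case using small[OF Suc that] by (simp add: algebra_simps)
 qed (use eq in simp)
 obtain n :: nat where n: "\<bar>r\<bar> / eta < n" using reals_Archimedean2 by blast
 then have n0: "0 < real n" using eta(1) by (smt (verit) divide_nonneg_pos)
 then have "\<bar>r / n\<bar> <= eta" using n eta(1) by (simp add: field_simps)
 from many[OF this, of n] show ?thesis using n0 by simp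
qed

lemma X_reach:
 assumes p: "p \<in> S" and y: "y \<in> S" "dist (X p s) y < h" "\<bar>sig (X p s) y\<bar> <= eta"
 shows "y = X p (s + sig (X p s) y)"
 using X_flow[OF p y(3), of s] F_sig[OF X_in[OF p] y(1,2)] by simp

lemma sig_small: "q \<in> S ==> 0 < eps ==> EX dl>0. dl <= h & (ALL y. dist q y < dl --> \<bar>sig q y\<bar> < eps)"
proof -
 assume q: "q \<in> S" and "0 < eps"
 have "isCont (sig q) q" using sig_diff[OF q] differentiable_imp_continuous_within by blast
 moreover have "sig q q = 0" using sig_F[OF q, of 0] F_0[OF q] by simp
 ultimately obtain d where "0 < d" "!!y. dist y q < d ==> \<bar>sig q y\<bar> < eps"
  using \<open>0 < eps\<close> unfolding continuous_at_eps_delta by (auto simp: dist_real_def)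
 then show ?thesis using h by (intro exI[of _ "min d h"]) (auto simp: dist_commute)
qed

lemma X_near:
 assumes p: "p \<in> S" and "0 < eps"
 shows "EX dl>0. \<forall>y\<in>S. dist y (X p s) < dl --> (EX t. \<bar>t - s\<bar> < eps & y = X p t)"
proof -
 obtain dl where dl: "0 < dl" "dl <= h" "!!y. dist (X p s) y < dl ==> \<bar>sig (X p s) y\<bar> < min eps eta"
  using sig_small[OF X_in[OF p], of "min eps eta"] \<open>0 < eps\<close> eta(1) by auto
 show ?thesis
 proof (rule exI[of _ dl], intro conjI ballI impI dl(1))
  fix y assume y: "y \<in> S" "dist y (X p s) < dl"
  then have "\<bar>sig (X p s) y\<bar> < eps" "\<bar>sig (X p s) y\<bar> <= eta" using dl(3)[of y] by (auto simp: dist_commute)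
  moreover have "dist (X p s) y < h" using y dl(2) by (simp add: dist_commute)
  ultimately show "EX t. \<bar>t - s\<bar> < eps & y = X p t"
   using X_reach[OF p y(1)] by (intro exI[of _ "s + sig (X p s) y"]) simp
 qed
qed

lemma X_backward:
 assumes p: "p \<in> S" and q: "q \<in> S" "dist q (X p s) < h" "\<bar>sig q (X p s)\<bar> <= eta"
 shows "q = X p (s - sig q (X p s))"
proof -
 define t where "t = sig q (X p s)"
 have Ft: "F q t = X p s" using F_sig[OF q(1) X_in[OF p] q(2)] by (simp add: t_def)
 have "X p (s + (- t)) = F (X p s) (- t)" by (rule X_flow[OF p]) (use q(3) t_def in simp)
 also have "... = F q (t + - t)"
  unfolding Ft[symmetric] by (rule F_add[OF q(1)]) (use q(3) t_def eta in auto)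
 finally show ?thesis using F_0[OF q(1)] by (simp add: t_def)
qed

lemma closed_range_X:
 assumes p: "p \<in> S" shows "closed (range (X p))"
 unfolding closed_sequential_limits
proof (intro allI impI, elim conjE)
 fix x q assume x: "ALL n. x n \<in> range (X p)" and lim: "x \<longlonglongrightarrow> q"
 have q: "q \<in> S"
  using compact_imp_closed[OF compact_S] x lim X_in[OF p] closed_sequentially[of S x q] by (metis imageE)
 obtain dl where dl: "0 < dl" "dl <= h" "!!y. dist q y < dl ==> \<bar>sig q y\<bar> < eta"
  using sig_small[OF q eta(1)] by blast
 obtain n where "dist (x n) q < dl" using lim dl(1) unfolding LIMSEQ_def by blast
 moreover obtain s where "x n = X p s" using x by blast
 ultimately have "dist q (X p s) < dl" by (simp add: dist_commute)
 then have "q = X p (s - sig q (X p s))"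
  using dl(2) dl(3)[of "X p s"] by (intro X_backward[OF p q]) auto
 then show "q \<in> range (X p)" by (metis rangeI)
qed

lemma X_inj_local: "p \<in> S ==> X p s = X p t ==> \<bar>s - t\<bar> <= eta ==> s = t"
 using X_flow[of p "s - t" t] sig_F[OF X_in[of p t]] F_0[OF X_in[of p t]]
 by (metis abs_0 add.commute diff_add_cancel diff_self eq_iff_diff_eq_0)

text \<open>By compactness the points at integer times accumulate at some \<open>q\<close>. Two of
  them lie in the chart of \<open>q\<close>, and flowing back from each one reaches \<open>q\<close>
  at two different times.\<close>

lemma X_recurrent:
 assumes p: "p \<in> S" obtains a b where "a < b" "X p a = X p b"
proof -
 have "ALL n. X p (real n) \<in> S" using X_in[OF p] by blast
 then obtain q r where q: "q \<in> S" "strict_mono r" "((%n. X p (real n)) \<circ> r) \<longlonglongrightarrow> q"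
  using compact_S unfolding compact_def by metis
 \<comment> \<open>The sampled times differ by at least 1 and each correction is below 1/4, so the
   two times remain different.\<close>
 define eps where "eps = min eta (1/4)"
 have eps: "0 < eps" "eps <= eta" "eps <= 1/4" using eta(1) by (auto simp: eps_def)
 obtain dl where dl: "0 < dl" "dl <= h" "!!y. dist q y < dl ==> \<bar>sig q y\<bar> < eps"
  using sig_small[OF q(1) eps(1)] by blast
 obtain N where "!!n. n \<ge> N ==> dist (X p (real (r n))) q < dl"
  using q(3) dl(1) unfolding LIMSEQ_def comp_def by blast
 then have N: "dist q (X p (real (r N))) < dl" "dist q (X p (real (r (Suc N)))) < dl"
  by (simp_all add: dist_commute)
 have 1: "q = X p (real (r N) - sig q (X p (real (r N))))"
  using dl(2) dl(3)[OF N(1)] eps N(1) by (intro X_backward[OF p q(1)]) auto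
 have 2: "q = X p (real (r (Suc N)) - sig q (X p (real (r (Suc N)))))"
  using dl(2) dl(3)[OF N(2)] eps N(2) by (intro X_backward[OF p q(1)]) auto
 have "r N < r (Suc N)" using q(2) by (simp add: strict_mono_Suc_iff)
 then have "real (r N) + 1 <= real (r (Suc N))" by linarith
 then have "real (r N) - sig q (X p (real (r N))) < real (r (Suc N)) - sig q (X p (real (r (Suc N))))"
  using dl(3)[OF N(1)] dl(3)[OF N(2)] eps by linarith
 then show thesis using that 1 2 by metis
qed

text \<open>The positive return times are bounded below by local injectivity and form a closed set,
  so there is a least one; the remainder of any other return time modulo it must vanish.\<close>

lemma X_period:
 assumes p: "p \<in> S"
 obtains T where "0 < T" "!!s t. X p s = X p t \<longleftrightarrow> (EX k::int. s = t + T * k)"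
proof -
 define Q where "Q = {P. 0 < P & X p P = X p 0}"
 have cX: "continuous_on UNIV (X p)"
  using has_vector_derivative_continuous[OF dX[OF p]] by (intro cont_at_imp_cont_on) blast
 have Qeq: "X p s = X p t \<longleftrightarrow> X p (s - t) = X p 0" for s t
  using X_shift[OF p, of s t "- t"] X_shift[OF p, of "s - t" 0 t] by auto
 have Qne: "Q ~= {}"
 proof -
  obtain a b where "a < b" "X p a = X p b" by (rule X_recurrent[OF p])
  then have "b - a \<in> Q" using Qeq[of b a] by (simp add: Q_def)
  then show ?thesis by blast
 qed
 have Qge: "eta <= P" if "P \<in> Q" for P
  using X_inj_local[OF p, of P 0] that by (force simp: Q_def)
 define T where "T = Inf Q"
 have bdd: "bdd_below Q" using Qge by (auto simp: bdd_below_def)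
 have Teta: "eta <= T" unfolding T_def using Qne Qge by (intro cInf_greatest) auto
 have TQ: "T \<in> Q"
 proof -
  have "Q = {P \<in> {eta..}. X p P = X p 0}" using Qge eta(1) by (force simp: Q_def)
  moreover have "closed {P \<in> {eta..}. X p P = X p 0}"
   by (intro continuous_closed_preimage_constant continuous_on_subset[OF cX]) auto
  ultimately show ?thesis unfolding T_def using closed_contains_Inf[OF Qne bdd] by simp
 qed
 have T0: "0 < T" using Teta eta by simp
 have mult: "X p (t + T * of_int k) = X p t" for t and k :: int
 proof -
  have one: "X p (t + T) = X p t" for t using Qeq[of "t + T" t] TQ by (simp add: Q_def)
  have nat: "X p (t + T * real n) = X p t" for t n
  proof (induction n)
   case (Suc n)
   then show ?case using one[of "t + T * real n"] by (simp add: algebra_simps)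
  qed simp
  show ?thesis
  proof (cases "0 <= k")
   case True then show ?thesis using nat[of t "nat k"] by simp
  next
   case False then show ?thesis using nat[of "t + T * of_int k" "nat (- k)"] by simp
  qed
 qed
 have "EX k::int. s = t + T * k" if eq: "X p s = X p t" for s t
 proof -
  define k where "k = \<lfloor>(s - t) / T\<rfloor>"
  have "real_of_int k <= (s - t) / T" "(s - t) / T < real_of_int k + 1" by (simp_all add: k_def)
  then have k: "real_of_int k * T <= s - t" "s - t < (real_of_int k + 1) * T" using T0 by (simp_all add: field_simps)
  have "X p (s - t - T * k) = X p 0"
   using mult[of "s - t - T * k" k] eq Qeq[of s t] by simp
  moreover have "\<not> (0 < s - t - T * k)"
  proof
   assume "0 < s - t - T * k"
   then have "s - t - T * k \<in> Q" using \<open>X p (s - t - T * k) = X p 0\<close> by (simp add: Q_def)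
   then have "T <= s - t - T * k" unfolding T_def using bdd by (rule cInf_lower)
   then show False using k(2) by (simp add: algebra_simps)
  qed
  ultimately have "s - t = T * k" using k(1) by (simp add: algebra_simps)
  then show ?thesis by (intro exI[of _ k]) simp
 qed
 then show thesis using that[OF T0] mult by metis
qed

text \<open>The orbit is closed, and open in the component because the flow reaches all nearby
  points of \<open>S\<close>.\<close>

lemma range_X_component:
 assumes C: "C \<in> components S" and p: "p \<in> C" shows "range (X p) = C"
proof -
 have CS: "C \<subseteq> S" using C in_components_subset by blast
 then have pS: "p \<in> S" using p by blast
 have cX: "continuous_on UNIV (X p)"
  using has_vector_derivative_continuous[OF dX[OF pS]] by (intro cont_at_imp_cont_on) blast
 have sub: "range (X p) \<subseteq> C"
 proof (rule components_maximal[OF C])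
  show "connected (range (X p))" by (rule connected_continuous_image[OF cX]) simp
  show "range (X p) \<subseteq> S" using X_in[OF pS] by blast
  show "C \<inter> range (X p) ~= {}" using X_0[OF pS] p rangeI[of "X p" 0] by auto
 qed
 have "openin (top_of_set C) (range (X p))"
  unfolding openin_euclidean_subtopology_iff
 proof (intro conjI sub ballI)
  fix x assume "x \<in> range (X p)"
  then obtain s where s: "x = X p s" by blast
  obtain dl where "0 < dl" "\<forall>y\<in>S. dist y (X p s) < dl --> (EX t. \<bar>t - s\<bar> < 1 & y = X p t)"
   using X_near[OF pS zero_less_one] by blast
  then show "EX e>0. \<forall>x'\<in>C. dist x' x < e --> x' \<in> range (X p)" using CS s by blast
 qed
 moreover have "closedin (top_of_set C) (range (X p))"
  using closed_range_X[OF pS] sub by (simp add: closed_subset)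
 moreover have "connected C" using C in_components_connected by blast
 ultimately show ?thesis using connected_clopen[of C] by blast
qed

lemma finite_components_S: "finite (components S)"
proof -
 have "EX U. open U & S \<inter> U = C" if C: "C \<in> components S" for C
 proof -
  have "C ~= {}" "C \<subseteq> S" using C in_components_nonempty in_components_subset by blast+
  have "openin (top_of_set S) C"
   unfolding openin_euclidean_subtopology_iff
  proof (intro conjI \<open>C \<subseteq> S\<close> ballI)
   fix p assume p: "p \<in> C"
   then have pS: "p \<in> S" using \<open>C \<subseteq> S\<close> by blast
   obtain dl where "0 < dl" "\<forall>y\<in>S. dist y (X p 0) < dl --> (EX t. \<bar>t - 0\<bar> < 1 & y = X p t)"
    using X_near[OF pS zero_less_one] by blast
   then show "EX e>0. \<forall>x'\<in>S. dist x' p < e --> x' \<in> C"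
    using range_X_component[OF C p] X_0[OF pS] by (metis rangeI)
  qed
  then show ?thesis unfolding openin_open by blast
 qed
 then obtain U where U: "!!C. C \<in> components S ==> open (U C) & S \<inter> U C = C" by metis
 have "S \<subseteq> (\<Union>C\<in>components S. U C)" using U Union_components[of S] by blast
 then obtain D where D: "D \<subseteq> components S" "finite D" "S \<subseteq> (\<Union>C\<in>D. U C)"
  using compactE_image[OF compact_S, of "components S" U] U by blast
 have "components S \<subseteq> D"
 proof
  fix C assume C: "C \<in> components S"
  then obtain p where p: "p \<in> C" "p \<in> S" using in_components_nonempty in_components_subset by blast
  then obtain C' where C': "C' \<in> D" "p \<in> U C'" using D(3) by blast
  then have "p \<in> C'" using U[of C'] D(1) p by blast
  then have "C = C'" using components_nonoverlap[OF C, of C'] C' D(1) p by blast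
  then show "C \<in> D" using C' by simp
 qed
 then show ?thesis using D(2) finite_subset by blast
qed

end

text \<open>The data describing one boundary component: its unit speed parametrization, oriented so that
 \<open>- rot90 c'\<close> is the outer normal.\<close>

definition boundary_curve :: "(real^2) set => (real => real^2) => (real => real^2) => (real => real^2) => real => bool" where
 "boundary_curve E c c' c'' T \<longleftrightarrow> closed_curve c c' T &
  (ALL s. (c' hvd c'' s) (at s)) & continuous_on UNIV c'' &
  (ALL s. norm (c' s) = 1) & (ALL s. is_outer_normal E (c s) (- rot90 (c' s))) &
  (ALL s. outer_normal E (c s) = - rot90 (c' s)) &
  (ALL s. ALL eps>0. EX dl>0. \<forall>y\<in>frontier E. dist y (c s) < dl --> (EX t. \<bar>t - s\<bar> < eps & y = c t))"

text \<open>The charts of common radius form a \<open>unit_flow\<close> for the field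
  \<open>unit_tangent E\<close>, because the velocity of each chart is determined by the outer
  normal and thus agrees on overlaps.\<close>

theorem boundary_components:
 assumes E: "C2_open_set E" "bounded E"
 shows "finite (components (frontier E))"
  and "!!C. C \<in> components (frontier E) ==> EX c c' c'' T. boundary_curve E c c' c'' T & range c = C"
proof -
 obtain h where h: "0 < h" "!!q. q \<in> frontier E ==> EX c c1 c2 sig. boundary_chart E h q c c1 c2 sig"
  by (rule boundary_chart_uniform[OF E]) blast
 then obtain F F1 F2 sig where ch: "!!q. q \<in> frontier E ==> boundary_chart E h q (F q) (F1 q) (F2 q) (sig q)"
  by metis
 note ch = ch[unfolded boundary_chart_def]
 have nF: "is_outer_normal E (F q t) (- rot90 (F1 q t)) & outer_normal E (F q t) = - rot90 (F1 q t)"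
  if q: "q \<in> frontier E" and t: "dist q (F q t) < h" for q t
 proof -
  have n: "is_outer_normal E (F q t) (- rot90 (F1 q t))" using ch[OF q] t by auto
  have d: "(F q hvd F1 q t) (at t)" using ch[OF q] by blast
  have "isCont (F q) t" using d has_vector_derivative_continuous by blast
  then have "\<forall>\<^sub>F s in nhds t. F q s \<in> ball q h"
   using t by (intro topological_tendstoD[of "F q" "F q t"]) (auto simp: isCont_def tendsto_nhds_iff)
  then have "\<forall>\<^sub>F s in nhds t. F q s \<in> frontier E"
   by eventually_elim (use ch[OF q] in blast)
  moreover have "norm (F1 q t) = 1" using ch[OF q] by blast
  then have "F1 q t ~= 0" by force
  ultimately show ?thesis using outer_normal_eqI[OF n _ d] n by blast
 qed
 interpret unit_flow "frontier E" "unit_tangent E" h F F1 F2 sig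
 proof
  show "compact (frontier E)" using E(2) by (simp add: compact_frontier_bounded)
  show "0 < h" by (rule h(1))
  fix q t assume q: "q \<in> frontier E"
  note c = ch[OF q]
  show "F q 0 = q" "(F q hvd F1 q t) (at t)" "(F1 q hvd F2 q t) (at t)"
   "continuous_on UNIV (F2 q)" "norm (F1 q t) = 1" "sig q (F q t) = t" using c by blast+
  show "sig q differentiable (at y)" for y using c by blast
  show "F q t \<in> frontier E" if "dist q (F q t) < h" using c that by auto
  show "F1 q t = unit_tangent E (F q t)" if "dist q (F q t) < h"
   using nF[OF q that] by (simp add: unit_tangent_def rot90_minus rot90_rot90)
  show "F q (sig q y) = y" if "y \<in> frontier E" "dist q y < h" for y
  proof -
   have "y \<in> range (F q)" using c that by auto
   then show ?thesis using c by auto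
  qed
 qed
 show "finite (components (frontier E))" by (rule finite_components_S)
 fix C assume C: "C \<in> components (frontier E)"
 then obtain p where p: "p \<in> C" "p \<in> frontier E" using in_components_nonempty in_components_subset by blast
 obtain T where T: "0 < T" "!!s t. X p s = X p t \<longleftrightarrow> (EX k::int. s = t + T * k)"
  by (rule X_period[OF p(2)]) blast
 have n: "is_outer_normal E (X p s) (- rot90 (unit_tangent E (X p s))) &
   outer_normal E (X p s) = - rot90 (unit_tangent E (X p s)) & norm (unit_tangent E (X p s)) = 1" for s
  using nF[OF X_in[OF p(2)], of s 0] F_0[OF X_in[OF p(2)], of s] h(1) F_tau[OF X_in[OF p(2)], of s 0]
   nF1[OF X_in[OF p(2)], of s 0] by simp
 then have nz: "unit_tangent E (X p s) ~= 0" for s by (metis norm_zero zero_neq_one)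
 have "closed_curve (X p) (%s. unit_tangent E (X p s)) T"
 proof
  show "continuous_on UNIV (%s. unit_tangent E (X p s))"
   using has_vector_derivative_continuous[OF dX1[OF p(2)]] by (intro cont_at_imp_cont_on) blast
 qed (use T dX[OF p(2)] nz in auto)
 then have "boundary_curve E (X p) (%s. unit_tangent E (X p s)) (%s. F2 (X p s) 0) T"
  unfolding boundary_curve_def using n dX1[OF p(2)] cX2[OF p(2)] X_near[OF p(2)] by blast
 then show "EX c c' c'' T. boundary_curve E c c' c'' T & range c = C"
  using range_X_component[OF C p(1)] by blast
qed

section \<open>Closed curves with almost constant anisotropic curvature\<close>

locale framed_curve = anisotropy + closed_curve c c' T for c c' :: "real => real^2" and T +
 fixes c'' :: "real => real^2"
 assumes dc': "(c' hvd c'' s) (at s)" and cc'': "continuous_on UNIV c''"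
  and unit: "norm (c' s) = 1"
begin

definition kap :: "real => real" where "kap s = c'' s \<bullet> rot90 (c' s)"

lemma cont_kap: "continuous_on A kap"
 unfolding kap_def
 by (intro continuous_intros bounded_linear.continuous_on[OF bounded_linear_rot90] cont'_on continuous_on_subset[OF cc'']) auto

lemma c''_eq: "c'' s = kap s *. rot90 (c' s)"
proof -
 have "((%s. c' s \<bullet> c' s) hvd (c' s \<bullet> c'' s + c'' s \<bullet> c' s)) (at s)"
  by (rule bounded_bilinear_hvd[OF bounded_bilinear_inner dc' dc'])
 moreover have "(%s. c' s \<bullet> c' s) = (%s. 1)" using unit by (simp add: dot_square_norm)
 ultimately have "c' s \<bullet> c'' s + c'' s \<bullet> c' s = 0"
  using vector_derivative_unique_at[OF _ has_vector_derivative_const] by metis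
 then have "c'' s \<bullet> c' s = 0" by (simp add: inner_commute)
 then show ?thesis using orthonormal_decomp[OF unit, of "c'' s" s] by (simp add: kap_def)
qed

definition ang :: "real => real" where
 "ang = (SOME ang. (ALL s. (ang hrd kap s) (at s)) & (ALL s. - rot90 (c' s) = ev (ang s)))"

text \<open>Start at an angle of the initial normal and integrate the curvature. The inner product
  of the normal with \<open>ev\<close> of this angle has derivative zero and initial value 1, so the
  two unit vectors coincide.\<close>

lemma dang: "(ang hrd kap s) (at s)" and normal_ev: "- rot90 (c' s) = ev (ang s)"
proof -
 obtain A0 where A0: "!!s. (A0 hrd kap s) (at s)" "A0 0 = 0"
  by (rule ex_real_antiderivative[OF cont_kap]) (rule that, assumption+)
 have "norm (- rot90 (c' 0)) = 1" by (simp add: unit)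
 then obtain a0 where a0: "- rot90 (c' 0) = ev a0" using ex_ev by blast
 define B where "B s = a0 + A0 s" for s
 have B: "(B hrd kap s) (at s)" for s
  unfolding B_def[abs_def] using DERIV_add[OF DERIV_const A0(1)] by simp
 have d: "((%s. - rot90 (c' s) \<bullet> ev (B s)) hvd 0) (at s)" for s
 proof -
  have "((%s. - rot90 (c' s)) hvd - rot90 (c'' s)) (at s)"
   by (intro has_vector_derivative_minus bounded_linear_hvd[OF bounded_linear_rot90 dc'])
  from bounded_bilinear_hvd[OF bounded_bilinear_inner this has_derivative_ev[OF B]]
  show ?thesis
   by (rule has_vector_derivative_eq_rhs)
     (simp add: c''_eq rot90_scaleR rot90_rot90 rot90_inner_rot90)
 qed
 have "- rot90 (c' s) \<bullet> ev (B s) = - rot90 (c' 0) \<bullet> ev (B 0)" for s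
  by (rule DERIV_isconst_all[rule_format, where f = "%s. - rot90 (c' s) \<bullet> ev (B s)"])
    (use d in \<open>simp add: hrd_iff_hvd\<close>)
 then have one: "- rot90 (c' s) \<bullet> ev (B s) = 1" for s
  by (simp add: a0 B_def A0(2) ev_inner_ev)
 have "- rot90 (c' s) = ev (B s)" for s
 proof -
  have "1 = ((norm (- rot90 (c' s)))\<^sup>2 + (norm (ev (B s)))\<^sup>2 - (norm (- rot90 (c' s) - ev (B s)))\<^sup>2) / 2"
   unfolding one[of s, symmetric] by (rule dot_norm_neg)
  then have "norm (- rot90 (c' s) - ev (B s)) = 0" by (simp only: norm_minus_cancel norm_rot90 unit norm_ev) simp
  then show ?thesis by simp
 qed
 then have "EX ang. (ALL s. (ang hrd kap s) (at s)) & (ALL s. - rot90 (c' s) = ev (ang s))"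
  using B by blast
 from someI_ex[OF this, folded ang_def]
 show "(ang hrd kap s) (at s)" "- rot90 (c' s) = ev (ang s)"
  by blast+
qed

lemma c'_ev: "c' s = rot90 (ev (ang s))"
 using arg_cong[OF normal_ev[of s], of rot90] by (simp add: rot90_minus rot90_rot90)

lemma cont_ang: "continuous_on A ang"
 by (rule DERIV_continuous_on[OF hfd_at_within[OF dang]])

lemma c'_periodic: "c' (s + T) = c' s"
proof -
 have "((%s. s + T) hvd 1) (at s)"
  by (auto intro!: derivative_eq_intros simp: hrd_iff_hvd[symmetric])
 then have "((%s. c (s + T)) hvd c' (s + T)) (at s)"
  using vector_diff_chain_at[of "%s. s + T" 1 s c "c' (s + T)"] der by (simp add: comp_def)
 then show ?thesis using der[of s] vector_derivative_unique_at by (simp add: periodic_1)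
qed

lemma c''_periodic: "c'' (s + T) = c'' s"
proof -
 have "((%s. s + T) hvd 1) (at s)"
  by (auto intro!: derivative_eq_intros simp: hrd_iff_hvd[symmetric])
 then have "((%s. c' (s + T)) hvd c'' (s + T)) (at s)"
  using vector_diff_chain_at[of "%s. s + T" 1 s c' "c'' (s + T)"] dc' by (simp add: comp_def)
 then show ?thesis using dc'[of s] vector_derivative_unique_at by (simp add: c'_periodic)
qed

lemma kap_periodic: "kap (s + T) = kap s"
 by (simp add: kap_def c'_periodic c''_periodic)

text \<open>The turning number of the curve.\<close>

definition n :: int where "n = (SOME n. ang T = ang 0 + 2 * pi * of_int n)"

lemma ang_T: "ang (s + T) = ang s + 2 * pi * of_int n"
proof -
 have "ev (ang T) = ev (ang 0)" using c'_periodic[of 0] normal_ev[of T] normal_ev[of 0] by simp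
 then have "EX n::int. ang T = ang 0 + 2 * pi * of_int n" by (simp add: ev_eq_iff)
 from someI_ex[OF this] have "ang T = ang 0 + 2 * pi * of_int n" by (simp add: n_def)
 then show ?thesis using antiderivative_quasi_periodic[OF dang kap_periodic, of s] by simp
qed

text \<open>The anisotropic curvature along the curve, which is also the derivative of
  \<open>G (ang s)\<close>.\<close>

definition cur :: "real => real" where "cur s = g (ang s) * kap s"

lemma cont_cur: "continuous_on A cur"
 unfolding cur_def
 by (intro continuous_on_mult cont_kap continuous_on_compose2[OF cont_g[of UNIV] cont_ang]) simp

lemma g_periodic_int: "g (t + 2 * pi * of_int k) = g t"
proof -
 have nat: "g (t + 2 * pi * real n) = g t" for t n
 proof (induction n)
  case (Suc n)
  then show ?case using g_periodic[of "t + 2 * pi * real n"] by (simp add: algebra_simps)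
 qed simp
 show ?thesis
 proof (cases "0 <= k")
  case True then show ?thesis using nat[of t "nat k"] by simp
 next
  case False then show ?thesis using nat[of "t + 2 * pi * of_int k" "nat (- k)"] by simp
 qed
qed

lemma Y_periodic_int: "Y (t + 2 * pi * of_int k) = Y t"
 by (simp add: Y_eq_iff ev_periodic)

lemma cur_periodic: "cur (s + T) = cur s"
 by (simp add: cur_def ang_T kap_periodic g_periodic_int)

lemma dGang: "((%s. G (ang s)) hrd cur s) (at s)"
 unfolding cur_def by (rule DERIV_chain2[OF dG dang])

lemma quasi_periodic_int:
 fixes F :: "real => real"
 assumes "!!x. F (x + p) = F x + q" shows "F (x + p * of_int k) = F x + q * of_int k"
proof -
 have nat: "F (t + p * real n) = F t + q * real n" for t n
 proof (induction n)
  case (Suc n)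
  then show ?case using assms[of "t + p * real n"] by (simp add: algebra_simps)
 qed simp
 show ?thesis
 proof (cases "0 <= k")
  case True then show ?thesis using nat[of x "nat k"] by simp
 next
  case False then show ?thesis using nat[of "x + p * of_int k" "nat (- k)"] by simp
 qed
qed

lemma Gang_T: "G (ang (s + T)) = G (ang s) + lW * of_int n"
 unfolding ang_T by (rule quasi_periodic_int[of G "2 * pi" lW, OF G_periodic])

lemma integral_cur: "integral {0..T} cur = lW * of_int n"
 using antiderivative_integral(2)[OF dGang, of 0 T] T_pos Gang_T[of 0] by simp

lemma dYang: "((%s. Y (ang s)) hvd cur s *. c' s) (at s)"
proof -
 have "(ang hvd kap s) (at s)" using dang by (simp add: hrd_iff_hvd)
 then have "(Y \<circ> ang hvd kap s *. g (ang s) *. rot90 (ev (ang s))) (at s)"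
  by (rule vector_diff_chain_at) (rule dY)
 then show ?thesis by (simp add: comp_def cur_def c'_ev mult.commute)
qed

end

text \<open>\<open>a\<close> is meant to be the mean over the whole boundary of a domain and
  \<open>D\<close> its total deficit, so \<open>a\<close> is in general not the mean over this one
  curve. The three thresholds serve to exclude turning number 0, to tie the sign of \<open>n\<close>
  to that of \<open>a\<close>, and to make the curve star-shaped.\<close>

locale near_wulff_curve = framed_curve +
 fixes a D m0 :: real
 assumes D0: "0 <= D" and L2: "integral {0..T} (%s. (cur s - a)\<^sup>2) <= D\<^sup>2"
  and m0: "0 < m0" "!!t. m0 <= gam t"
  and small: "D * sqrt T <= k0 / 4" "D * sqrt T <= lW / 2" "D * sqrt T <= m0 / 2"
begin

definition eta :: real where "eta = D * sqrt T"

lemma eta_nonneg: "0 <= eta" using D0 T_pos by (simp add: eta_def)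

text \<open>Cauchy-Schwarz for \<open>\<integral> |cur - a|\<close> in differentiated form: \<open>2|v| <= mu + v\<^sup>2 / mu\<close>.\<close>

lemma L1_bound:
 fixes f :: "real => 'b::real_normed_vector"
 assumes f: "!!s. s0 <= s ==> s <= t0 ==> (f hvd f' s) (at s)"
  and bd: "!!s. s0 <= s ==> s <= t0 ==> norm (f' s) <= M * \<bar>cur s - a\<bar>" and M: "0 <= M"
  and st: "s0 <= t0" "t0 <= s0 + T"
 shows "norm (f t0 - f s0) <= M * (D * sqrt (t0 - s0))"
proof (cases "s0 = t0")
 case False
 then have lt: "s0 < t0" using st by simp
 have csq: "continuous_on UNIV (%s. (cur s - a)\<^sup>2)" by (intro continuous_intros cont_cur)
 obtain U where U: "!!s. (U hrd (cur s - a)\<^sup>2) (at s)"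
  by (rule ex_real_antiderivative[OF csq]) (rule that, assumption)
 have Umono: "x <= y ==> U x <= U y" for x y
  by (rule DERIV_nonneg_imp_nondecreasing) (use U in \<open>auto intro!: exI\<close>)
 have UT: "U (s + T) - U s <= D\<^sup>2" for s
  using antiderivative_quasi_periodic[OF U, of T s] antiderivative_integral(2)[OF U, of 0 T] L2 T_pos
  by (simp add: cur_periodic)
 have UD: "U t0 - U s0 <= D\<^sup>2" using UT[of s0] Umono[OF st(2)] by simp
 have key: "norm (f t0 - f s0) <= M * (mu * (t0 - s0) + D\<^sup>2 / mu) / 2" if l: "0 < mu" for mu
 proof -
  define p where "p s = M * (mu * s + U s / mu) / 2" for s
  have dp: "(p hvd M * (mu + (cur s - a)\<^sup>2 / mu) / 2) (at s)" for s
   unfolding p_def[abs_def] hrd_iff_hvd[symmetric]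
   using l by (auto intro!: derivative_eq_intros U)
  have "norm (f t0 - f s0) <= p t0 - p s0"
  proof (rule differentiable_bound_general[OF lt])
   show "continuous_on {s0..t0} f"
    using has_vector_derivative_continuous[OF f] by (intro cont_at_imp_cont_on) auto
   show "continuous_on {s0..t0} p"
    using has_vector_derivative_continuous[OF dp] by (intro cont_at_imp_cont_on) auto
   fix s assume s: "s0 < s" "s < t0"
   show "(f hvd f' s) (at s)" using f s by simp
   show "(p hvd M * (mu + (cur s - a)\<^sup>2 / mu) / 2) (at s)" by (rule dp)
   have "0 <= (mu - \<bar>cur s - a\<bar>)\<^sup>2" by simp
   then have "2 * mu * \<bar>cur s - a\<bar> <= mu * mu + (cur s - a)\<^sup>2"
    by (simp add: power2_diff power2_eq_square algebra_simps)
   then have "\<bar>cur s - a\<bar> <= (mu + (cur s - a)\<^sup>2 / mu) / 2" using l by (simp add: field_simps)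
   then have "M * \<bar>cur s - a\<bar> <= M * ((mu + (cur s - a)\<^sup>2 / mu) / 2)" using M by (rule mult_left_mono)
   then show "norm (f' s) <= M * (mu + (cur s - a)\<^sup>2 / mu) / 2" using bd[of s] s by simp
  qed
  also have "p t0 - p s0 = M * (mu * (t0 - s0) + (U t0 - U s0) / mu) / 2"
   by (simp add: p_def diff_divide_distrib algebra_simps)
  also have "... <= M * (mu * (t0 - s0) + D\<^sup>2 / mu) / 2"
   using UD l M by (intro divide_right_mono mult_left_mono add_left_mono) auto
  finally show ?thesis .
 qed
 show ?thesis
 \<comment> \<open>For \<open>D = 0\<close> the weight \<open>mu\<close> is sent to 0; otherwise
   \<open>mu = D / sqrt (t0 - s0)\<close> balances the two terms of \<open>key\<close>.\<close>
 proof (cases "D = 0")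
  case True
  have "norm (f t0 - f s0) <= 0"
  proof (rule field_le_epsilon)
   fix e :: real assume "0 < e"
   define l where "l = e / ((M + 1) * (t0 - s0))"
   have l: "0 < l" using \<open>0 < e\<close> M lt by (simp add: l_def)
   have "norm (f t0 - f s0) <= M * (l * (t0 - s0)) / 2" using key[OF l] True by simp
   also have "... <= e"
   proof -
    have "l * (t0 - s0) = e / (M + 1)" using lt by (simp add: l_def)
    then have "M * (l * (t0 - s0)) / 2 = (M / (M + 1)) * e / 2" by simp
    also have "... <= 1 * e / 2" using M \<open>0 < e\<close> by (intro divide_right_mono mult_right_mono) auto
    finally show ?thesis using \<open>0 < e\<close> by simp
   qed
   finally show "norm (f t0 - f s0) <= 0 + e" by simp
  qed
  then show ?thesis using True by simp
 next
  case False
  define r where "r = sqrt (t0 - s0)"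
  have r: "0 < r" "t0 - s0 = r * r" using lt by (auto simp: r_def)
  have "D / r * (r * r) + D\<^sup>2 / (D / r) = 2 * (D * r)" using r(1) False by (simp add: field_simps power2_eq_square)
  then show ?thesis using key[of "D / r"] D0 False r by (simp add: r_def[symmetric])
 qed
qed simp

lemma L1_period:
 fixes f :: "real => 'b::real_normed_vector"
 assumes "!!s. (f hvd f' s) (at s)" "!!s. norm (f' s) <= M * \<bar>cur s - a\<bar>" "0 <= M"
  and st: "s0 <= t0" "t0 <= s0 + T"
 shows "norm (f t0 - f s0) <= M * eta"
proof -
 have "norm (f t0 - f s0) <= M * (D * sqrt (t0 - s0))"
  by (rule L1_bound[where f' = f']) (use assms in auto)
 also have "... <= M * eta" unfolding eta_def using assms(3) st D0 by (intro mult_left_mono) auto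
 finally show ?thesis .
qed

text \<open>Integrate \<open>cur - a\<close> over one period: \<open>G (ang s)\<close> gains
  \<open>lW\<close> with each turn.\<close>

lemma length_bound: "\<bar>lW * of_int n - a * T\<bar> <= eta"
proof -
 have "((%s. G (ang s) - a * s) hvd cur s - a) (at s)" for s
  unfolding hrd_iff_hvd[symmetric]
  by (auto intro!: derivative_eq_intros dGang)
 from L1_period[OF this, of 1 0 T] have "\<bar>(G (ang T) - a * T) - G (ang 0)\<bar> <= eta" using T_pos by simp
 then show ?thesis using Gang_T[of 0] by simp
qed

lemma G_growth: "k0 * \<bar>x - y\<bar> <= \<bar>G x - G y\<bar>"
proof -
 have *: "k0 * (x - y) <= G x - G y" if "y <= x" for x y
 proof -
  have "G y - k0 * y <= G x - k0 * x"
   by (rule DERIV_nonneg_imp_nondecreasing[OF that])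
     (intro exI conjI, rule DERIV_diff[OF dG DERIV_cmult_Id], use ell in simp)
  then show ?thesis by (simp add: algebra_simps)
 qed
 show ?thesis using *[of y x] *[of x y] by (cases "y <= x") (auto simp: abs_if)
qed

text \<open>A closed curve cannot have an almost constant tangent.\<close>

lemma n_nonzero: "n ~= 0"
proof
 assume "n = 0"
 then have aT: "\<bar>a\<bar> * T <= eta" using length_bound T_pos by (simp add: abs_mult)
 \<comment> \<open>As \<open>n = 0\<close> also makes \<open>\<bar>a\<bar> * T\<close> at most
   \<open>eta\<close>, the oscillation of \<open>G (ang s)\<close> is at most
   \<open>2 * eta <= k0 / 2\<close>, and \<open>G\<close> has slope at least
   \<open>k0\<close>.\<close>
 have near: "\<bar>ang s - ang 0\<bar> <= 1/2" if s: "0 <= s" "s <= T" for s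
 proof -
  have "((%s. G (ang s) - a * s) hvd cur s - a) (at s)" for s
   unfolding hrd_iff_hvd[symmetric]
   by (auto intro!: derivative_eq_intros dGang)
  from L1_period[OF this, of 1 0 s] have "\<bar>(G (ang s) - a * s) - G (ang 0)\<bar> <= eta" using s by simp
  moreover have "\<bar>a * s\<bar> <= \<bar>a\<bar> * T" using s by (simp add: abs_mult mult_left_mono)
  ultimately have "\<bar>G (ang s) - G (ang 0)\<bar> <= 2 * eta" using aT by linarith
  then have "k0 * \<bar>ang s - ang 0\<bar> <= k0 * (1/2)" using G_growth[of "ang s" "ang 0"] small(1) by (simp add: eta_def)
  then show ?thesis using k0 by simp
 qed
 have "c 0 \<bullet> c' 0 < c T \<bullet> c' 0"
 proof (rule DERIV_pos_imp_increasing[OF T_pos])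
  fix s assume s: "0 <= s" "s <= T"
  have "((%s. c s \<bullet> c' 0) hrd c' s \<bullet> c' 0) (at s)"
   using bounded_linear_hvd[OF bounded_linear_inner_left der]
   by (simp add: hrd_iff_hvd)
  moreover have "c' s \<bullet> c' 0 = cos (ang s - ang 0)" by (simp add: c'_ev rot90_inner_rot90 ev_inner_ev)
  moreover have "0 < cos (ang s - ang 0)"
   by (rule cos_gt_zero_pi) (use near[OF s] pi_gt3 in linarith)+
  ultimately show "EX y. ((%s. c s \<bullet> c' 0) hrd y) (at s) & 0 < y" by auto
 qed
 then show False using periodic_1[of 0] by simp
qed

lemma a_nonzero: "a ~= 0"
proof
 assume "a = 0"
 then have "lW * \<bar>of_int n\<bar> <= eta" using length_bound lW_pos by (simp add: abs_mult)
 moreover have "1 <= \<bar>real_of_int n\<bar>" using n_nonzero by linarith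
 then have "lW * 1 <= lW * \<bar>of_int n\<bar>" using lW_pos by (intro mult_left_mono) auto
 ultimately show False using small(2) lW_pos by (simp add: eta_def)
qed

lemma n_sign: "0 < a ==> 1 <= n" "a < 0 ==> n <= -1"
proof -
 have e: "eta < lW" using small(2) lW_pos by (simp add: eta_def)
 show "1 <= n" if "0 < a"
 proof (rule ccontr)
  assume "\<not> 1 <= n"
  then have "real_of_int n <= -1" using n_nonzero by linarith
  then have "lW * of_int n <= lW * (- 1)" using lW_pos by (intro mult_left_mono) auto
  moreover have "0 < a * T" using that T_pos by simp
  ultimately show False using length_bound e by linarith
 qed
 show "n <= -1" if "a < 0"
 proof (rule ccontr)
  assume "\<not> n <= -1"
  then have "1 <= real_of_int n" using n_nonzero by linarith
  then have "lW * 1 <= lW * of_int n" using lW_pos by (intro mult_left_mono) auto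
  moreover have "a * T < 0" using that T_pos by (simp add: mult_neg_pos)
  ultimately show False using length_bound e by linarith
 qed
qed

definition ZZ :: "real => real^2" where "ZZ s = Y (ang s) - a *. c s"

lemma dZZ: "(ZZ hvd (cur s - a) *. c' s) (at s)"
 unfolding ZZ_def[abs_def]
 by (rule has_vector_derivative_eq_rhs[OF has_vector_derivative_diff[OF dYang
    bounded_linear_hvd[OF bounded_linear_scaleR_right der]]])
   (simp add: scaleR_diff_left)

lemma ZZ_T: "ZZ (s + T) = ZZ s"
 by (simp add: ZZ_def ang_T Y_periodic_int periodic_1)

lemma ZZ_holder: "s <= t ==> t <= s + T ==> norm (ZZ t - ZZ s) <= D * sqrt (t - s)"
 using L1_bound[of s t ZZ, OF dZZ, of 1] by (simp add: unit)

lemma ZZ_osc: "norm (ZZ t - ZZ s) <= eta"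
proof -
 have "ZZ (t + T * of_int k) = ZZ t" for k :: int
  using Y_periodic_int[of "ang t" "n * k"]
  by (simp add: ZZ_def periodic quasi_periodic_int[of ang T "2 * pi * of_int n", OF ang_T] mult.assoc)
 moreover obtain k :: int where "t + T * k \<in> {s..<s + T}" by (rule shift_into)
 ultimately obtain t' where t': "s <= t'" "t' <= s + T" "ZZ t' = ZZ t" by force
 have "norm (ZZ t' - ZZ s) <= 1 * eta"
  by (rule L1_period[OF dZZ]) (use t' in \<open>auto simp: unit\<close>)
 then show ?thesis using t'(3) by simp
qed

text \<open>An area-type functional whose derivative is \<open>rot90 ZZ \<bullet> ZZ'\<close>; its increment over a period
 is the isoperimetric defect, which is therefore quadratically small.\<close>

lemma isoperimetric_defect:
 fixes Gam PP AA :: "real => real"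
 assumes Gam: "!!x. (Gam hrd gam x * g x) (at x)" "!!x. Gam (x + 2 * pi) = Gam x + om"
  and PP: "!!s. (PP hrd gam (ang s)) (at s)"
  and AA: "!!s. (AA hrd rot90 (c s) \<bullet> c' s) (at s)"
 shows "\<bar>of_int n * om - 2 * a * (PP T - PP 0) + a\<^sup>2 * (AA T - AA 0)\<bar> <= eta\<^sup>2"
proof -
 \<comment> \<open>The terms with \<open>rot90 (c s) \<bullet> Y (ang s)\<close> and with
   \<open>ZZ 0\<close> are periodic and leave the increment unchanged. They turn the derivative into
   the product of \<open>rot90 (ZZ s - ZZ 0)\<close>, bounded by \<open>eta\<close>, with the
   derivative of \<open>ZZ\<close>, whose norm integrates to at most \<open>eta\<close>.\<close>
 define Q where "Q s = Gam (ang s) - 2 * a * PP s + a\<^sup>2 * AA s - a * (rot90 (c s) \<bullet> Y (ang s)) - rot90 (ZZ 0) \<bullet> ZZ s" for s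
 have rY: "rot90 (Y (ang s)) \<bullet> c' s = gam (ang s)" "rot90 (c' s) \<bullet> Y (ang s) = - gam (ang s)" for s
  by (simp_all add: c'_ev rot90_inner_rot90 Y_inner rot90_rot90 inner_commute[of "ev _" "Y _"])
 have dQ: "(Q hvd rot90 (ZZ s - ZZ 0) \<bullet> ((cur s - a) *. c' s)) (at s)" for s
 proof -
  have 1: "((%s. rot90 (c s) \<bullet> Y (ang s)) hrd
    (rot90 (c s) \<bullet> (cur s *. c' s) + rot90 (c' s) \<bullet> Y (ang s))) (at s)"
   using bounded_bilinear_hvd[OF bounded_bilinear_inner
     bounded_linear_hvd[OF bounded_linear_rot90 der] dYang]
   by (simp add: hrd_iff_hvd)
  have 2: "((%s. rot90 (ZZ 0) \<bullet> ZZ s) hrd rot90 (ZZ 0) \<bullet> ((cur s - a) *. c' s)) (at s)"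
   using bounded_linear_hvd[OF bounded_linear_inner_right dZZ]
   by (simp add: hrd_iff_hvd)
  have "(Q hrd (gam (ang s) * g (ang s)) * kap s - 2 * a * gam (ang s) + a\<^sup>2 * (rot90 (c s) \<bullet> c' s)
    - a * (rot90 (c s) \<bullet> (cur s *. c' s) + rot90 (c' s) \<bullet> Y (ang s)) - rot90 (ZZ 0) \<bullet> ((cur s - a) *. c' s)) (at s)"
   unfolding Q_def[abs_def]
   by (intro DERIV_diff DERIV_add DERIV_cmult DERIV_chain2[OF Gam(1) dang] PP AA 1 2)
  moreover have "(gam (ang s) * g (ang s)) * kap s - 2 * a * gam (ang s) + a\<^sup>2 * (rot90 (c s) \<bullet> c' s)
    - a * (rot90 (c s) \<bullet> (cur s *. c' s) + rot90 (c' s) \<bullet> Y (ang s)) - rot90 (ZZ 0) \<bullet> ((cur s - a) *. c' s)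
    = rot90 (ZZ s - ZZ 0) \<bullet> ((cur s - a) *. c' s)"
  proof -
   have r: "rot90 (ZZ s - ZZ 0) = rot90 (Y (ang s)) - a *. rot90 (c s) - rot90 (ZZ 0)"
    by (simp only: ZZ_def[of s] rot90_diff rot90_scaleR)
   show ?thesis
    unfolding r inner_diff_left inner_scaleR_left inner_scaleR_right rY cur_def
    by (simp add: power2_eq_square algebra_simps)
  qed
  ultimately show ?thesis by (simp add: hrd_iff_hvd)
 qed
 have "norm (Q T - Q 0) <= eta * eta"
 proof (rule L1_period[OF dQ])
  fix s
  have "\<bar>rot90 (ZZ s - ZZ 0) \<bullet> ((cur s - a) *. c' s)\<bar> <= norm (ZZ s - ZZ 0) * norm ((cur s - a) *. c' s)"
   by (rule rot90_abs_inner_le)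
  also have "... <= eta * \<bar>cur s - a\<bar>" using ZZ_osc[of s 0] by (simp add: unit mult_right_mono)
  finally show "norm (rot90 (ZZ s - ZZ 0) \<bullet> ((cur s - a) *. c' s)) <= eta * \<bar>cur s - a\<bar>" by simp
 qed (use eta_nonneg T_pos in auto)
 moreover have "Q T - Q 0 = of_int n * om - 2 * a * (PP T - PP 0) + a\<^sup>2 * (AA T - AA 0)"
  using ang_T[of 0] periodic_1[of 0] ZZ_T[of 0] quasi_periodic_int[of Gam "2 * pi" om, OF Gam(2), of "ang 0" n]
   Y_periodic_int[of "ang 0" n]
  by (simp add: Q_def algebra_simps)
 ultimately show ?thesis by (simp add: power2_eq_square)
qed

text \<open>Only linear in \<open>eta\<close>; combined with the quadratic defect it removes the
  perimeter and leaves a relation between \<open>a\<close> and the area.\<close>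

lemma perimeter_defect:
 fixes Gam PP :: "real => real"
 assumes Gam: "!!x. (Gam hrd gam x * g x) (at x)" "!!x. Gam (x + 2 * pi) = Gam x + om"
  and PP: "!!s. (PP hrd gam (ang s)) (at s)" and M0: "!!t. gam t <= M0"
 shows "\<bar>of_int n * om - a * (PP T - PP 0)\<bar> <= M0 * eta"
proof -
 have d: "((%s. Gam (ang s) - a * PP s) hvd gam (ang s) * (cur s - a)) (at s)" for s
  unfolding hrd_iff_hvd[symmetric]
  by (rule DERIV_cong[OF DERIV_diff[OF DERIV_chain2[OF Gam(1) dang] DERIV_cmult[OF PP]]])
    (simp add: cur_def algebra_simps)
 have "norm ((Gam (ang T) - a * PP T) - (Gam (ang 0) - a * PP 0)) <= M0 * eta"
 proof (rule L1_period[OF d])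
  show "norm (gam (ang s) * (cur s - a)) <= M0 * \<bar>cur s - a\<bar>" for s
   using M0[of "ang s"] gam_pos[of "ang s"] by (simp add: abs_mult mult_right_mono)
  show "0 <= M0" using M0[of 0] gam_pos[of 0] by simp
 qed (use T_pos in auto)
 then show ?thesis
  using ang_T[of 0] quasi_periodic_int[of Gam "2 * pi" om, OF Gam(2), of "ang 0" n] by (simp add: algebra_simps)
qed

end

section \<open>One boundary curve for positive \<open>a\<close>: centre, winding number and enclosed
  domain\<close>

locale positive_curve = near_wulff_curve + assumes a_pos: "0 < a"
begin

text \<open>The centre of the approximating Wulff shape of radius \<open>1 / a\<close>: if
  \<open>ZZ\<close> were constant, \<open>c s\<close> would be \<open>x0\<close> plus
  \<open>Y (ang s)\<close> divided by \<open>a\<close>.\<close>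

definition x0 :: "real^2" where "x0 = - (1 / a) *. ZZ 0"

lemma c_eq: "c s - x0 = (1 / a) *. (Y (ang s) - (ZZ s - ZZ 0))"
proof -
 have eq: "Y (ang s) - (ZZ s - ZZ 0) = a *. c s + ZZ 0" by (simp add: ZZ_def[of s])
 show ?thesis unfolding eq using a_pos by (simp add: x0_def scaleR_add_right)
qed

lemma inner_bounds:
 "(c s - x0) \<bullet> ev t <= (gam t + eta) / a" "(gam (ang s) - eta) / a <= (c s - x0) \<bullet> ev (ang s)"
proof -
 have e: "\<bar>(ZZ s - ZZ 0) \<bullet> ev t\<bar> <= eta" for t
  using Cauchy_Schwarz_ineq2[of "ZZ s - ZZ 0" "ev t"] ZZ_osc[of s 0] by simp
 have eq: "(c s - x0) \<bullet> ev t = (Y (ang s) \<bullet> ev t - (ZZ s - ZZ 0) \<bullet> ev t) / a" for t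
  by (simp add: c_eq inner_diff_left diff_divide_distrib)
 show "(c s - x0) \<bullet> ev t <= (gam t + eta) / a"
  unfolding eq using e[of t] Y_support'[of "ang s" t] a_pos by (intro divide_right_mono) auto
 show "(gam (ang s) - eta) / a <= (c s - x0) \<bullet> ev (ang s)"
  unfolding eq Y_inner using e[of "ang s"] a_pos by (intro divide_right_mono) auto
qed

lemma inner_pos: "0 < (c s - x0) \<bullet> ev (ang s)"
proof -
 have "0 < gam (ang s) - eta" using m0(1) m0(2)[of "ang s"] small(3) by (simp add: eta_def)
 then have "0 < (gam (ang s) - eta) / a" using a_pos by simp
 then show ?thesis using inner_bounds(2) by (rule less_le_trans)
qed

text \<open>The polar angle about \<open>x0\<close> as a correction of the normal angle by less than
  a quarter turn, so it gains the same multiple of \<open>2 * pi\<close> over a period.\<close>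

definition tht :: "real => real" where
 "tht s = ang s + arctan (((c s - x0) \<bullet> rot90 (ev (ang s))) / ((c s - x0) \<bullet> ev (ang s)))"

lemma dc: "((%s. c s - x0) hvd c' s) (at s)"
 using has_vector_derivative_diff[OF der has_vector_derivative_const] by simp

lemma tht_polar: "c s - x0 = norm (c s - x0) *. ev (tht s)"
 unfolding tht_def by (rule polar_arctan[OF inner_pos])

lemma cross_pos: "0 < rot90 (c s - x0) \<bullet> c' s"
 using inner_pos by (simp add: c'_ev rot90_inner_rot90)

lemma dtht: "(tht hrd (rot90 (c s - x0) \<bullet> c' s) / ((c s - x0) \<bullet> (c s - x0))) (at s)"
 unfolding tht_def[abs_def] by (rule polar_angle_derivative[OF dc dang inner_pos])

lemma tht_T: "tht (s + T) = tht s + 2 * pi * of_int n"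
 by (simp add: tht_def ang_T periodic_1 ev_periodic)

text \<open>An embedded closed curve cannot wind more than once: otherwise the radius at angle \<open>t + 2\<pi>\<close>
 minus the radius at \<open>t\<close> would have a zero, a self-intersection.\<close>

lemma n_eq_1: "n = 1"
proof -
 have n1: "1 <= n" by (rule n_sign(1)[OF a_pos])
 have pos: "0 < (rot90 (c s - x0) \<bullet> c' s) / ((c s - x0) \<bullet> (c s - x0))" for s
 proof -
  have "c s - x0 ~= 0" using inner_pos[of s] by force
  then show ?thesis using cross_pos by simp
 qed
 have L: "0 < 2 * pi * real_of_int n" using n1 by simp
 have "surj tht"
  by (rule surj_quasi_periodic[where A = tht and T = T, OF _ tht_T L])
    (rule DERIV_continuous_on[OF hfd_at_within[OF dtht]])
 obtain sig where sig: "!!y. tht (sig y) = y" "!!s. sig (tht s) = s"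
  "!!y. (sig hrd 1 / ((rot90 (c (sig y) - x0) \<bullet> c' (sig y)) / ((c (sig y) - x0) \<bullet> (c (sig y) - x0)))) (at y)"
  by (rule real_diffeomorphism_inverse[OF dtht pos \<open>surj tht\<close>]) (rule that, assumption+)
 have csig: "continuous_on UNIV sig" by (rule DERIV_continuous_on[OF hfd_at_within[OF sig(3)]])
 define rho where "rho t = norm (c (sig t) - x0)" for t
 have "continuous_on UNIV (%t. c (sig t))" by (rule continuous_on_compose2[OF cont[of UNIV] csig]) simp
 then have crho: "continuous_on UNIV rho" unfolding rho_def by (intro continuous_intros)
 define f where "f t = rho (t + 2 * pi) - rho t" for t
 have cf: "continuous_on UNIV f" unfolding f_def
  by (intro continuous_on_diff crho continuous_on_compose2[OF crho] continuous_intros) auto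
 have sign: "sig (t + 2 * pi * real_of_int n) = sig t + T" for t using sig(1)[of t] sig(2)[of "sig t + T"] tht_T[of "sig t"] by simp
 \<comment> \<open>After \<open>n\<close> turns \<open>rho\<close> returns to its value, so its
   increments per turn sum to zero and \<open>f\<close> cannot keep one strict sign.\<close>
 have sum0: "(\<Sum>k<nat n. f (t + 2 * pi * real k)) = 0" for t
 proof -
  have "(\<Sum>k<N. f (t + 2 * pi * real k)) = rho (t + 2 * pi * real N) - rho t" for N
  proof (induction N)
   case (Suc N)
   have e: "t + 2 * pi * real N + 2 * pi = t + 2 * pi * real (Suc N)" by (simp add: algebra_simps)
   have "(\<Sum>k<Suc N. f (t + 2 * pi * real k)) = (rho (t + 2 * pi * real N) - rho t) + f (t + 2 * pi * real N)"
    by (simp only: sum.lessThan_Suc Suc)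
   also have "... = rho (t + 2 * pi * real (Suc N)) - rho t" unfolding f_def e by simp
   finally show ?case .
  qed simp
  moreover have "rho (t + 2 * pi * real (nat n)) = rho t" using n1 sign[of t] by (simp add: rho_def periodic_1)
  ultimately show ?thesis by simp
 qed
 have "EX t. f t = 0"
 proof (rule ccontr)
  assume no: "\<nexists>t. f t = 0"
  have conn: "connected (range f)" by (rule connected_continuous_image[OF cf]) simp
  have nz: "0 \<notin> range f" using no by (metis imageE)
  have ne: "{..<nat n} ~= {}" using n1 by (simp add: lessThan_empty_iff)
  have "(ALL t. 0 < f t) | (ALL t. f t < 0)"
  proof (rule ccontr)
   assume "\<not> ((ALL t. 0 < f t) | (ALL t. f t < 0))"
   then obtain t1 t2 where "f t1 <= 0" "0 <= f t2" by (meson not_less)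
   then have "0 \<in> range f" using conn by (meson connectedD_interval rangeI)
   then show False using nz by simp
  qed
  then show False
  proof
   assume "ALL t. 0 < f t"
   then have "0 < (\<Sum>k<nat n. f (0 + 2 * pi * real k))" by (intro sum_pos ne) auto
   then show False using sum0[of 0] by simp
  next
   assume "ALL t. f t < 0"
   then have "0 < (\<Sum>k<nat n. - f (0 + 2 * pi * real k))" by (intro sum_pos ne) auto
   then show False using sum0[of 0] by (simp add: sum_negf)
  qed
 qed
 then obtain t where t: "rho (t + 2 * pi) = rho t" by (auto simp: f_def)
 have p: "c (sig t) - x0 = rho t *. ev t" for t using tht_polar[of "sig t"] by (simp add: rho_def sig(1))
 have "c (sig (t + 2 * pi)) - x0 = c (sig t) - x0"
  using ev_periodic[of t 1] by (simp add: p t)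
 then obtain k :: int where k: "sig (t + 2 * pi) = sig t + T * k" using eq_iff by auto
 \<comment> \<open>Embeddedness allows the coincidence only after \<open>k\<close> periods, over
   which the angle grows by \<open>2 * pi * n * k\<close>; hence \<open>n * k = 1\<close>.\<close>
 have "t + 2 * pi = tht (sig t + T * k)" using sig(1)[of "t + 2 * pi"] k by simp
 also have "... = t + 2 * pi * of_int n * of_int k"
  using quasi_periodic_int[of tht T "2 * pi * of_int n", OF tht_T] sig(1)[of t] by simp
 finally have "real_of_int (n * k) = 1" by (simp add: field_simps)
 then have "n * k = 1" by (metis of_int_1 of_int_eq_iff)
 then show ?thesis using n1 by (simp add: zmult_eq_1_iff)
qed

lemma ang_T': "ang (s + T) = ang s + 2 * pi" using ang_T[of s] by (simp add: n_eq_1)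

lemma surj_ang: "surj ang"
 by (rule surj_quasi_periodic[where A = ang and T = T, OF cont_ang ang_T']) simp

lemma star_curve_c: "star_curve (%s. c s - x0) c' T c'' tht"
proof
 show "0 < T" by (rule T_pos)
 show "c s - x0 = c t - x0 \<longleftrightarrow> (EX k::int. s = t + T * real_of_int k)" for s t using eq_iff[of s t] by simp
 show "tht (s + T) = tht s + 2 * pi" for s using tht_T by (simp add: n_eq_1)
qed (fact dc cont' nz dc' cc'' tht_polar cross_pos dtht)+

sublocale D: star_curve "%s. c s - x0" c' T c'' tht by (rule star_curve_c)

lemma D_support: "z \<in> closure D.D ==> z \<bullet> ev t <= (gam t + eta) / a"
proof -
 assume "z \<in> closure D.D"
 then obtain l s where z: "z = l *. (c s - x0)" "0 <= l" "l <= 1" unfolding D.closure_D by blast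
 have pos: "0 <= (gam t + eta) / a" using gam_pos[of t] eta_nonneg a_pos by simp
 have "l * ((c s - x0) \<bullet> ev t) <= l * ((gam t + eta) / a)" using z(2) inner_bounds(1) by (intro mult_left_mono) auto
 also have "... <= (gam t + eta) / a" by (rule mult_left_le_one_le[OF pos z(2,3)])
 finally show ?thesis by (simp add: z(1))
qed

text \<open>It suffices to test \<open>z\<close> against the normal at the boundary point on its own
  ray. With \<open>D_support\<close> the domain is squeezed between the sets cut out by the bounds
  \<open>(gam t - eta) / a\<close> and \<open>(gam t + eta) / a\<close>.\<close>

lemma in_closure_D:
 assumes "!!t. z \<bullet> ev t <= (gam t - eta) / a" shows "z \<in> closure D.D"
proof -
 obtain P where P: "polar_star P" "!!t. EX s. tht s = t & c s - x0 = P t *. ev t"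
  by (rule D.polar_star) blast
 obtain t where t: "z = norm z *. ev t" using ex_polar by blast
 obtain s where s: "c s - x0 = P t *. ev t" using P(2) by blast
 have Pt: "0 < P t" using P(1) by (simp add: polar_star_def)
 define l where "l = norm z / P t"
 have zl: "z = l *. (c s - x0)" using t Pt by (simp add: l_def s)
 have l0: "0 <= l" using Pt by (simp add: l_def)
 have "l * ((c s - x0) \<bullet> ev (ang s)) <= (gam (ang s) - eta) / a" using assms[of "ang s"] by (simp add: zl)
 also have "... <= (c s - x0) \<bullet> ev (ang s)" by (rule inner_bounds(2))
 finally have "l <= 1" using inner_pos[of s] by simp
 then show ?thesis unfolding D.closure_D using zl l0 by blast
qed

end

section \<open>Normal graphs over Wulff shapes\<close>

lemma sin_ge_half: "0 <= x ==> x <= 1 ==> x / 2 <= sin (x::real)"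
proof -
 assume x: "0 <= x" "x <= 1"
 have "sin 0 - 0 / 2 <= sin x - x / 2"
 proof (rule DERIV_nonneg_imp_nondecreasing[OF x(1)])
  fix y assume y: "0 <= y" "y <= x"
  have "cos (pi / 3) <= cos y" using y x pi_gt3 by (intro cos_monotone_0_pi_le) auto
  then have "0 <= cos y - 1 / 2" by (simp add: cos_60)
  moreover have "((%x. sin x - x / 2) hrd cos y - 1 / 2) (at y)" by (auto intro!: derivative_eq_intros)
  ultimately show "EX z. ((%x. sin x - x / 2) hrd z) (at y) & 0 <= z" by blast
 qed
 then show ?thesis by simp
qed

lemma sin_ge_eighth: "0 <= x ==> x <= pi / 2 ==> x / 8 <= sin (x::real)"
proof (cases "x <= 1")
 case False
 assume x: "0 <= x" "x <= pi / 2"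
 have "1 / 2 <= sin (1::real)" using sin_ge_half[of 1] by simp
 also have "... <= sin x" using False x by (intro sin_monotone_2pi_le) auto
 finally show ?thesis using x pi_less_4 by linarith
qed (use sin_ge_half[of x] in auto)

lemma cos_ge_half: "\<bar>x\<bar> <= 1 ==> 1 / 2 <= cos (x::real)"
proof -
 assume "\<bar>x\<bar> <= 1"
 then have "cos (pi / 3) <= cos \<bar>x\<bar>" using pi_gt3 by (intro cos_monotone_0_pi_le) auto
 then show ?thesis by (simp add: cos_60)
qed

lemma tan_diff_bound:
 fixes x y :: real
 assumes "\<bar>x\<bar> <= 1" "\<bar>y\<bar> <= 1" shows "\<bar>tan x - tan y\<bar> <= 4 * \<bar>x - y\<bar>"
proof -
 have "norm (tan x - tan y) <= 4 * norm (x - y)"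
 proof (rule field_differentiable_bound[of "{-1..1}"])
  fix z :: real assume "z \<in> {-1..1}"
  then have c: "1 / 2 <= cos z" by (intro cos_ge_half) auto
  show "(tan has_field_derivative inverse ((cos z)\<^sup>2)) (at z within {-1..1})"
   by (rule hfd_at_within[OF DERIV_tan]) (use c in auto)
  have "(1/2)\<^sup>2 <= (cos z)\<^sup>2" using c by (intro power_mono) auto
  then have "inverse ((cos z)\<^sup>2) <= inverse ((1/2)\<^sup>2)" by (intro le_imp_inverse_le) auto
  then show "norm (inverse ((cos z)\<^sup>2)) <= 4" by (simp add: power2_eq_square)
 qed (use assms in auto)
 then show ?thesis by simp
qed

context anisotropy begin

text \<open>On an arc of angle at most \<open>pi\<close> every tangent makes at most a right angle
  with the tangent at the middle angle \<open>m\<close>, so projecting on that direction loses no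
  sign. It bounds angles by distances in the Hoelder quotient.\<close>

lemma Y_chord: "\<bar>x - y\<bar> <= pi ==> k0 / 8 * \<bar>x - y\<bar> <= norm (Y x - Y y)"
proof -
 have *: "k0 / 8 * (x - y) <= norm (Y x - Y y)" if xy: "y <= x" "x <= y + pi" for x y
 proof -
  define m where "m = (x + y) / 2"
  define p where "p b = Y b \<bullet> rot90 (ev m) - k0 * sin (b - m)" for b
  have dp: "(p hrd (g b - k0) * cos (b - m)) (at b)" for b
  proof -
   have "((%b. Y b \<bullet> rot90 (ev m)) hrd (g b *. rot90 (ev b)) \<bullet> rot90 (ev m)) (at b)"
    using bounded_linear_hvd[OF bounded_linear_inner_left dY]
    by (simp add: hrd_iff_hvd)
   moreover have "((%b. k0 * sin (b - m)) hrd k0 * cos (b - m)) (at b)"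
    by (auto intro!: derivative_eq_intros)
   ultimately show ?thesis unfolding p_def[abs_def]
    by (rule DERIV_cong[OF DERIV_diff]) (simp add: rot90_inner_rot90 ev_inner_ev algebra_simps)
  qed
  have "p y <= p x"
  proof (rule DERIV_nonneg_imp_nondecreasing[OF xy(1)])
   fix b assume b: "y <= b" "b <= x"
   have "0 <= cos (b - m)" using b xy by (intro cos_ge_zero) (auto simp: m_def field_simps)
   then show "EX z. (p hrd z) (at b) & 0 <= z" using dp[of b] ell[of b]
    by (intro exI[of _ "(g b - k0) * cos (b - m)"]) auto
  qed
  moreover have "x - m = (x - y) / 2" "y - m = - ((x - y) / 2)" by (simp_all add: m_def field_simps)
  ultimately have "2 * k0 * sin ((x - y) / 2) <= (Y x - Y y) \<bullet> rot90 (ev m)"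
   by (simp add: p_def inner_diff_left)
  also have "... <= norm (Y x - Y y)"
   using Cauchy_Schwarz_ineq2[of "Y x - Y y" "rot90 (ev m)"] by simp
  finally have "2 * k0 * sin ((x - y) / 2) <= norm (Y x - Y y)" .
  moreover have "(x - y) / 2 / 8 <= sin ((x - y) / 2)" using xy by (intro sin_ge_eighth) auto
  then have "2 * k0 * ((x - y) / 2 / 8) <= 2 * k0 * sin ((x - y) / 2)" using k0 by (intro mult_left_mono) auto
  ultimately show ?thesis by simp
 qed
 show "\<bar>x - y\<bar> <= pi ==> ?thesis" using *[of y x] *[of x y] by (cases "y <= x") (auto simp: norm_minus_commute)
qed

lemma Y_lipschitz:
 assumes "!!t. g t <= g1" shows "norm (Y x - Y y) <= g1 * \<bar>x - y\<bar>"
proof -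
 have "norm (Y x - Y y) <= g1 * norm (x - y)"
 proof (rule differentiable_bound[of UNIV Y "%t h. h *. (g t *. rot90 (ev t))"])
  show "(Y has_derivative (%h. h *. g x *. rot90 (ev x))) (at x within UNIV)" for x
   using dY[of x] by (simp add: has_vector_derivative_def)
  show "onorm (%h. h *. g x *. rot90 (ev x)) <= g1" for x
   using mult_right_mono[OF assms[of x] abs_ge_zero] g_pos[of x] by (intro onorm_le) (simp add: abs_mult mult.commute)
 qed auto
 then show ?thesis by simp
qed

end

text \<open>The foot point angle \<open>b s\<close> of \<open>c s\<close> will be the root near \<open>ang s\<close> of the tangential component of
 \<open>c s - x - r Y\<close>.\<close>

locale near_wulff_graph = framed_curve +
 fixes x :: "real^2" and r eps H g1 :: real
 assumes r: "0 < r" and winding: "!!s. ang (s + T) = ang s + 2 * pi"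
  and g1: "!!t. g t <= g1"
  and eps0: "0 <= eps" and eps: "!!s. norm (c s - x - r *. Y (ang s)) <= r * eps"
  and eps_small: "eps <= k0 / 8 * min 1 (k0 / (4 * g1))" "eps <= 1"
  and H0: "0 <= H"
  and H: "!!s t. s <= t ==> t <= s + T ==>
   norm ((c t - x - r *. Y (ang t)) - (c s - x - r *. Y (ang s))) <= r * H * sqrt (t - s)"
begin

definition om :: "real => real^2" where "om s = (1 / r) *. (c s - x - r *. Y (ang s))"

lemma c_om: "c s = x + r *. (Y (ang s) + om s)"
 using r by (simp add: om_def scaleR_add_right scaleR_diff_right)

lemma om_bound: "norm (om s) <= eps"
 using eps[of s] r unfolding om_def norm_scaleR by (simp add: divide_le_eq mult.commute)

lemma om_holder: "s <= t ==> t <= s + T ==> norm (om t - om s) <= H * sqrt (t - s)"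
proof -
 assume "s <= t" "t <= s + T"
 from H[OF this] show ?thesis
  using r unfolding om_def scaleR_diff_right[symmetric] norm_scaleR by (simp add: divide_le_eq mult_ac)
qed

text \<open>Half-width of the window around \<open>ang s\<close> in which the foot point angle is
  sought: at most 1, so that cosines stay above 1/2, and with \<open>g1 * h0 <= k0 / 4\<close>, so
  that the normal component stays below \<open>k0 / 2\<close>.\<close>

definition h0 :: real where "h0 = min 1 (k0 / (4 * g1))"

lemma g1_pos: "0 < g1" using g1[of 0] g_pos[of 0] by simp

lemma h0: "0 < h0" "h0 <= 1" "g1 * h0 <= k0 / 4" "eps <= k0 / 8 * h0" "eps <= k0 / 8"
proof -
 show "0 < h0" "h0 <= 1" using k0 g1_pos by (auto simp: h0_def)
 have "h0 <= k0 / (4 * g1)" by (simp add: h0_def)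
 then show "g1 * h0 <= k0 / 4" using g1_pos by (simp add: field_simps)
 show e: "eps <= k0 / 8 * h0" using eps_small(1) by (simp add: h0_def)
 have "k0 / 8 * h0 <= k0 / 8 * 1" using k0 \<open>h0 <= 1\<close> by (intro mult_left_mono) auto
 then show "eps <= k0 / 8" using e by simp
qed

definition p :: "real => real => real" where "p s b = (Y (ang s) - Y b + om s) \<bullet> rot90 (ev b)"

lemma om_inner: "\<bar>om s \<bullet> ev t\<bar> <= eps" "\<bar>om s \<bullet> rot90 (ev t)\<bar> <= eps"
 using Cauchy_Schwarz_ineq2[of "om s" "ev t"] Cauchy_Schwarz_ineq2[of "om s" "rot90 (ev t)"] om_bound[of s] by simp_all

lemma dp: "(p s hrd - g b - (Y (ang s) - Y b + om s) \<bullet> ev b) (at b)"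
proof -
 have "((%b. Y (ang s) - Y b + om s) hvd - (g b *. rot90 (ev b))) (at b)"
  using has_vector_derivative_add[OF has_vector_derivative_diff[OF has_vector_derivative_const dY] has_vector_derivative_const]
  by simp
 from bounded_bilinear_hvd[OF bounded_bilinear_inner this has_vector_derivative_rot90_ev]
 show ?thesis unfolding p_def[abs_def] hrd_iff_hvd
  by (rule has_vector_derivative_eq_rhs) (simp add: rot90_inner_rot90 ev_inner_ev)
qed

lemma normal_component: "\<bar>b - ang s\<bar> <= h0 ==> \<bar>(Y (ang s) - Y b + om s) \<bullet> ev b\<bar> <= g1 * \<bar>b - ang s\<bar> + eps"
proof -
 have "\<bar>(Y (ang s) - Y b) \<bullet> ev b\<bar> <= norm (Y (ang s) - Y b)"
  using Cauchy_Schwarz_ineq2[of "Y (ang s) - Y b" "ev b"] by simp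
 also have "... <= g1 * \<bar>b - ang s\<bar>" using Y_lipschitz[OF g1, of "ang s" b] by (simp add: abs_minus_commute)
 finally show ?thesis using om_inner(1)[of s b] by (simp add: inner_add_left)
qed

lemma normal_component_small: "\<bar>b - ang s\<bar> <= h0 ==> \<bar>(Y (ang s) - Y b + om s) \<bullet> ev b\<bar> <= k0 / 2"
proof -
 assume b: "\<bar>b - ang s\<bar> <= h0"
 have "g1 * \<bar>b - ang s\<bar> <= g1 * h0" using b g1_pos by (intro mult_left_mono) auto
 then show ?thesis using normal_component[OF b] h0(3,5) k0 by linarith
qed

text \<open>The derivative of \<open>p s\<close> is \<open>- g b\<close> minus the normal component,
  hence at most \<open>- k0 + k0 / 2\<close> in the window. Existence, uniqueness and the size of
  the root all follow from this slope.\<close>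

lemma p_decreasing:
 assumes "\<bar>b - ang s\<bar> <= h0" "\<bar>b' - ang s\<bar> <= h0" "b <= b'"
 shows "p s b' + k0 / 2 * (b' - b) <= p s b"
proof -
 have "- p s b - k0 / 2 * b <= - p s b' - k0 / 2 * b'"
 proof (rule DERIV_nonneg_imp_nondecreasing[OF assms(3)])
  fix z assume z: "b <= z" "z <= b'"
  then have "\<bar>z - ang s\<bar> <= h0" using assms by auto
  then have "0 <= - (- g z - (Y (ang s) - Y z + om s) \<bullet> ev z) - k0 / 2"
   using normal_component_small[of z s] ell[of z] by (simp add: abs_le_iff)
  moreover have "((%b. - p s b - k0 / 2 * b) hrd
    - (- g z - (Y (ang s) - Y z + om s) \<bullet> ev z) - k0 / 2) (at z)"
   by (rule DERIV_diff[OF DERIV_minus[OF dp] DERIV_cmult_Id])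
  ultimately show "EX y. ((%b. - p s b - k0 / 2 * b) hrd y) (at z) & 0 <= y" by blast
 qed
 then show ?thesis unfolding right_diff_distrib by linarith
qed

lemma p_slope:
 assumes "\<bar>b - ang s\<bar> <= h0" "\<bar>b' - ang s\<bar> <= h0"
 shows "k0 / 2 * \<bar>b - b'\<bar> <= \<bar>p s b - p s b'\<bar>"
proof (cases "b <= b'")
 case True
 then have "k0 / 2 * \<bar>b - b'\<bar> = k0 / 2 * (b' - b)" by simp
 then show ?thesis using p_decreasing[OF assms True] by linarith
next
 case False
 then have "k0 / 2 * \<bar>b - b'\<bar> = k0 / 2 * (b - b')" by simp
 then show ?thesis using p_decreasing[OF assms(2,1)] False by linarith
qed

lemma root_exists: "EX b. \<bar>b - ang s\<bar> <= h0 & p s b = 0"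
proof -
 have p0: "\<bar>p s (ang s)\<bar> <= eps" using om_inner(2)[of s "ang s"] by (simp add: p_def)
 have "0 < h0 * k0" using h0(1) k0 by simp
 then have up: "p s (ang s + h0) <= 0" and lo: "0 <= p s (ang s - h0)"
  using p_decreasing[of "ang s" s "ang s + h0"] p_decreasing[of "ang s - h0" s "ang s"] p0 h0(1,4)
  by (auto simp: abs_le_iff algebra_simps)
 have "continuous_on {ang s - h0..ang s + h0} (p s)"
  by (rule DERIV_continuous_on[OF hfd_at_within[OF dp]])
 then have "\<exists>b\<ge>ang s - h0. b <= ang s + h0 & p s b = 0"
  using IVT2'[of "p s" "ang s + h0" 0 "ang s - h0"] up lo h0(1) by simp
 then show ?thesis by (auto simp: abs_le_iff algebra_simps)
qed

definition b :: "real => real" where "b s = (SOME b. \<bar>b - ang s\<bar> <= h0 & p s b = 0)"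

lemma b_root: "\<bar>b s - ang s\<bar> <= h0" "p s (b s) = 0"
 using someI_ex[OF root_exists[of s]] by (auto simp: b_def)

lemma b_unique: "\<bar>z - ang s\<bar> <= h0 ==> p s z = 0 ==> z = b s"
 using p_slope[of z s "b s"] b_root[of s] k0 by (simp add: mult_le_0_iff)

lemma b_near: "\<bar>b s - ang s\<bar> <= 2 / k0 * eps"
proof -
 have "k0 / 2 * \<bar>b s - ang s\<bar> <= \<bar>p s (b s) - p s (ang s)\<bar>" by (rule p_slope[OF b_root(1)]) (use h0(1) in simp)
 also have "... <= eps" using b_root(2)[of s] om_inner(2)[of s "ang s"] by (simp add: p_def)
 finally show ?thesis using k0 by (simp add: field_simps)
qed

lemma b_near_h0: "\<bar>b s - ang s\<bar> <= h0 / 4"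
proof -
 have "2 / k0 * eps <= 2 / k0 * (k0 / 8 * h0)" using h0(4) k0 by (intro mult_left_mono) auto
 then show ?thesis using b_near[of s] k0 by simp
qed

lemma b_T: "b (s + T) = b s + 2 * pi"
proof (rule sym, rule b_unique)
 show "\<bar>b s + 2 * pi - ang (s + T)\<bar> <= h0" using b_root(1)[of s] by (simp add: winding)
 have "om (s + T) = om s" by (simp add: om_def winding periodic_1 Y_periodic)
 then show "p (s + T) (b s + 2 * pi) = 0"
  using b_root(2)[of s] ev_periodic[of "b s" 1] by (simp add: p_def winding Y_periodic)
qed

text \<open>\<open>r\<close> times \<open>p\<close>, written without \<open>ang\<close>: it depends
  on \<open>s\<close> only through \<open>c s\<close>, and affinely. That is why the derivative of
  the foot point angle involves no curvature.\<close>

definition q :: "real => real => real" where "q s z = (c s - x) \<bullet> rot90 (ev z) - r * gam1 z"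

lemma q_p: "q s z = r * p s z"
 by (simp add: q_def p_def c_om inner_add_left inner_diff_left Y_inner algebra_simps)

definition t :: "real => real" where "t s = (c s - x - r *. Y (b s)) \<bullet> ev (b s)"

lemma t_om: "t s = r * ((Y (ang s) - Y (b s) + om s) \<bullet> ev (b s))"
 by (simp add: t_def c_om inner_add_left inner_diff_left algebra_simps)

lemma c_graph: "c s = x + r *. Y (b s) + t s *. ev (b s)"
proof -
 have "(c s - x - r *. Y (b s)) \<bullet> rot90 (ev (b s)) = 0"
  using b_root(2)[of s] q_p[of s "b s"] by (simp add: q_def inner_diff_left Y_inner)
 then have "c s - x - r *. Y (b s) = t s *. ev (b s)"
  using ev_decomp[of "c s - x - r *. Y (b s)" "b s"] by (simp add: t_def)
 then show ?thesis by (simp add: algebra_simps)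
qed

lemma t_small: "\<bar>t s\<bar> <= r * k0 / 2" and t_bound: "\<bar>t s\<bar> <= r * ((2 * g1 / k0 + 1) * eps)"
proof -
 show "\<bar>t s\<bar> <= r * k0 / 2"
  using normal_component_small[OF b_root(1)] r by (simp add: t_om abs_mult)
 have "g1 * \<bar>b s - ang s\<bar> <= g1 * (2 / k0 * eps)" using b_near[of s] g1_pos by (intro mult_left_mono) auto
 then have "\<bar>(Y (ang s) - Y (b s) + om s) \<bullet> ev (b s)\<bar> <= (2 * g1 / k0 + 1) * eps"
  using normal_component[OF b_root(1), of s] by (simp add: algebra_simps)
 then show "\<bar>t s\<bar> <= r * ((2 * g1 / k0 + 1) * eps)" using r by (simp add: t_om abs_mult)
qed

lemma speed_pos: "r * k0 / 2 <= r * g (b s) + t s" and speed_le: "r * g (b s) + t s <= 2 * r * g1"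
proof -
 have 1: "r * k0 <= r * g (b s)" "r * g (b s) <= r * g1" using ell[of "b s"] g1[of "b s"] r by auto
 show "r * k0 / 2 <= r * g (b s) + t s" using t_small[of s] 1 by linarith
 have "r * k0 <= r * g1" using 1 by linarith
 moreover have "0 < r * k0" using r k0 by simp
 ultimately show "r * g (b s) + t s <= 2 * r * g1" using t_small[of s] 1 by linarith
qed

lemma q_derivative: "(q s hrd - (r * g (b s) + t s)) (at (b s))"
proof -
 have "q s = (%z. r * p s z)" using q_p by blast
 then have "(q s hrd r * (- g (b s) - (Y (ang s) - Y (b s) + om s) \<bullet> ev (b s))) (at (b s))"
  using DERIV_cmult[OF dp] by simp
 then show ?thesis by (rule DERIV_cong) (simp add: t_om algebra_simps)
qed

lemma b_difference: "q s0 (b s) = - ((c s - c s0) \<bullet> rot90 (ev (b s)))"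
 using b_root(2)[of s] q_p[of s "b s"] by (simp add: q_def inner_diff_left algebra_simps)

lemma c_lipschitz: "norm (c s - c s1) <= \<bar>s - s1\<bar>"
 using unit_speed_lipschitz[OF der unit, of s s1] by (simp add: dist_norm)

lemma isCont_b: "isCont b s0"
proof -
 have "isCont ang s0" using dang DERIV_isCont by blast
 then obtain d where d: "0 < d" "!!s. dist s s0 < d ==> dist (ang s) (ang s0) < h0 / 4"
  using h0(1) unfolding continuous_at_eps_delta by (metis divide_pos_pos zero_less_numeral)
 have "\<forall>\<^sub>F s in at s0. norm (b s - b s0) <= 2 / (r * k0) * \<bar>s - s0\<bar>"
  unfolding eventually_at
 proof (rule exI[of _ d], intro conjI ballI impI d(1))
  fix s assume "s ~= s0 & dist s s0 < d"
  then have "\<bar>ang s - ang s0\<bar> < h0 / 4" using d(2) by (simp add: dist_real_def)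
  then have "\<bar>b s - ang s0\<bar> <= h0" using b_near_h0[of s] h0(1) by linarith
  then have "k0 / 2 * \<bar>b s - b s0\<bar> <= \<bar>p s0 (b s) - p s0 (b s0)\<bar>" using b_root(1) by (rule p_slope)
  then have "r * (k0 / 2 * \<bar>b s - b s0\<bar>) <= r * \<bar>p s0 (b s)\<bar>" using r b_root(2)[of s0] by simp
  also have "... = \<bar>q s0 (b s)\<bar>" using r by (simp add: q_p abs_mult)
  also have "... <= norm (c s - c s0)"
   using Cauchy_Schwarz_ineq2[of "c s - c s0" "rot90 (ev (b s))"] by (simp add: b_difference)
  also have "... <= \<bar>s - s0\<bar>" by (rule c_lipschitz)
  finally have "\<bar>b s - b s0\<bar> * (r * k0) <= 2 * \<bar>s - s0\<bar>" by (simp add: mult_ac)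
  then show "norm (b s - b s0) <= 2 / (r * k0) * \<bar>s - s0\<bar>" using r k0 by (simp add: pos_le_divide_eq)
 qed
 moreover have "((%s. 2 / (r * k0) * \<bar>s - s0\<bar>) \<longlongrightarrow> 2 / (r * k0) * \<bar>s0 - s0\<bar>) (at s0)"
  by (intro tendsto_intros)
 then have "((%s. 2 / (r * k0) * \<bar>s - s0\<bar>) \<longlongrightarrow> 0) (at s0)" by (simp only: diff_self abs_zero mult_zero_right)
 ultimately have "((%s. b s - b s0) \<longlongrightarrow> 0) (at s0)" by (rule Lim_null_comparison)
 then show ?thesis unfolding isCont_def by (rule LIM_zero_cancel)
qed

text \<open>Implicit differentiation of \<open>q s (b s) = 0\<close>. Only continuity of
  \<open>b\<close> is known beforehand, so the derivative of \<open>q s0\<close> is used as a factor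
  \<open>Q\<close> continuous at the root, in the sense of Caratheodory.\<close>

lemma db: "(b hrd cos (b s0 - ang s0) / (r * g (b s0) + t s0)) (at s0)"
proof -
 define m where "m = r * g (b s0) + t s0"
 have m: "0 < m" using speed_pos[of s0] r k0 by (simp add: m_def) (smt (verit) mult_pos_pos)
 obtain Q where Q: "!!z. q s0 z - q s0 (b s0) = Q z * (z - b s0)" "isCont Q (b s0)" "Q (b s0) = - m"
  using q_derivative[of s0] unfolding CARAT_DERIV m_def by blast
 have q0: "q s0 (b s0) = 0" by (simp add: q_p b_root(2))
 have Qb: "((%s. Q (b s)) \<longlongrightarrow> - m) (at s0)"
  using isCont_o2[OF isCont_b Q(2)] Q(3) by (simp add: isCont_def)
 have cq: "((%s. (c s - c s0) /\<^sub>R (s - s0)) \<longlongrightarrow> c' s0) (at s0)"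
 proof -
  have "((%s. ((c s - c s0) - (s - s0) *. c' s0) /\<^sub>R norm (s - s0)) \<longlongrightarrow> 0) (at s0)"
   using der[of s0] by (simp add: has_vector_derivative_def has_derivative_at_within)
  then have "((%s. norm (((c s - c s0) - (s - s0) *. c' s0) /\<^sub>R norm (s - s0))) \<longlongrightarrow> 0) (at s0)"
   by (rule tendsto_norm_zero)
  moreover have "\<forall>\<^sub>F s in at s0. norm (((c s - c s0) - (s - s0) *. c' s0) /\<^sub>R norm (s - s0))
    = norm ((c s - c s0) /\<^sub>R (s - s0) - c' s0)"
   unfolding eventually_at
  proof (rule exI[of _ 1], intro conjI ballI impI zero_less_one)
   fix s assume "s ~= s0 & dist s s0 < 1"
   then have "(c s - c s0) /\<^sub>R (s - s0) - c' s0 = ((c s - c s0) - (s - s0) *. c' s0) /\<^sub>R (s - s0)"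
    by (simp add: scaleR_diff_right)
   then show "norm (((c s - c s0) - (s - s0) *. c' s0) /\<^sub>R norm (s - s0)) = norm ((c s - c s0) /\<^sub>R (s - s0) - c' s0)"
    by simp
  qed
  ultimately have "((%s. norm ((c s - c s0) /\<^sub>R (s - s0) - c' s0)) \<longlongrightarrow> 0) (at s0)"
   by (rule Lim_transform_eventually)
  then show ?thesis by (rule LIM_zero_cancel[OF tendsto_norm_zero_cancel])
 qed
 have ce: "((%s. rot90 (ev (b s))) \<longlongrightarrow> rot90 (ev (b s0))) (at s0)"
  using isCont_o2[OF isCont_b has_vector_derivative_continuous[OF has_vector_derivative_rot90_ev]] by (simp add: isCont_def)
 have "((%s. - (((c s - c s0) /\<^sub>R (s - s0)) \<bullet> rot90 (ev (b s))) / Q (b s)) \<longlongrightarrow> - (c' s0 \<bullet> rot90 (ev (b s0))) / (- m)) (at s0)"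
  using m by (intro tendsto_intros cq ce Qb) simp
 moreover have "c' s0 \<bullet> rot90 (ev (b s0)) = cos (b s0 - ang s0)"
  using cos_minus[of "b s0 - ang s0"] by (simp add: c'_ev rot90_inner_rot90 ev_inner_ev)
 ultimately have lim: "((%s. - (((c s - c s0) /\<^sub>R (s - s0)) \<bullet> rot90 (ev (b s))) / Q (b s)) \<longlongrightarrow> cos (b s0 - ang s0) / m) (at s0)"
  by simp
 have "\<forall>\<^sub>F s in at s0. Q (b s) < 0" using Qb m by (intro order_tendstoD(2)[of _ "- m"]) auto
 then have "\<forall>\<^sub>F s in at s0. - (((c s - c s0) /\<^sub>R (s - s0)) \<bullet> rot90 (ev (b s))) / Q (b s) = (b s - b s0) / (s - s0)"
 proof (rule eventually_mono)
  fix s assume "Q (b s) < 0"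
  moreover have "Q (b s) * (b s - b s0) = - ((c s - c s0) \<bullet> rot90 (ev (b s)))"
   using Q(1)[of "b s"] b_difference[of s0 s] by (simp add: q0)
  ultimately have "b s - b s0 = - ((c s - c s0) \<bullet> rot90 (ev (b s))) / Q (b s)" by (simp add: field_simps)
  then show "- (((c s - c s0) /\<^sub>R (s - s0)) \<bullet> rot90 (ev (b s))) / Q (b s) = (b s - b s0) / (s - s0)"
   by (simp add: divide_inverse mult_ac)
 qed
 then have "((%s. (b s - b s0) / (s - s0)) \<longlongrightarrow> cos (b s0 - ang s0) / m) (at s0)"
  using lim by (rule Lim_transform_eventually[rotated])
 then show ?thesis by (simp add: has_field_derivative_iff m_def)
qed

lemma b_ang_le_1: "\<bar>b s - ang s\<bar> <= 1" using b_root(1)[of s] h0(2) by linarith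

lemma db_pos: "0 < cos (b s - ang s) / (r * g (b s) + t s)"
proof -
 have "0 < r * g (b s) + t s" using speed_pos[of s] r k0 by (smt (verit) divide_pos_pos mult_pos_pos)
 moreover have "0 < cos (b s - ang s)" using cos_ge_half[OF b_ang_le_1[of s]] by simp
 ultimately show ?thesis by simp
qed

text \<open>All terms with the derivative of \<open>b\<close> are products of a tangential and a
  normal vector and vanish. What remains is the component of \<open>c'\<close> along
  \<open>ev (b s)\<close>.\<close>

lemma dt: "(t hrd sin (b s - ang s)) (at s)"
proof -
 let ?b' = "cos (b s - ang s) / (r * g (b s) + t s)"
 have "(b hvd ?b') (at s)" using db by (simp add: hrd_iff_hvd)
 then have "(Y \<circ> b hvd ?b' *. (g (b s) *. rot90 (ev (b s)))) (at s)"
  by (rule vector_diff_chain_at) (rule dY)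
 then have dYb: "((%s. r *. Y (b s)) hvd r *. (?b' *. (g (b s) *. rot90 (ev (b s))))) (at s)"
  by (intro bounded_linear_hvd[OF bounded_linear_scaleR_right]) (simp add: comp_def)
 have "((%s. c s - x - r *. Y (b s)) hvd c' s - r *. (?b' *. (g (b s) *. rot90 (ev (b s))))) (at s)"
  using has_vector_derivative_diff[OF has_vector_derivative_diff[OF der has_vector_derivative_const] dYb] by simp
 from bounded_bilinear_hvd[OF bounded_bilinear_inner this has_derivative_ev[OF db]]
 have "((%s. (c s - x - r *. Y (b s)) \<bullet> ev (b s)) hvd
   (c s - x - r *. Y (b s)) \<bullet> ?b' *. rot90 (ev (b s)) +
   (c' s - r *. ?b' *. g (b s) *. rot90 (ev (b s))) \<bullet> ev (b s)) (at s)" .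
 moreover have "(c s - x - r *. Y (b s)) = t s *. ev (b s)" using c_graph[of s] by (simp add: algebra_simps)
 then have "(c s - x - r *. Y (b s)) \<bullet> ?b' *. rot90 (ev (b s)) +
   (c' s - r *. ?b' *. g (b s) *. rot90 (ev (b s))) \<bullet> ev (b s) = sin (b s - ang s)"
  by (simp add: inner_diff_left rot90_inner_self c'_ev rot90_ev_inner_ev)
 ultimately show ?thesis unfolding t_def[abs_def] hrd_iff_hvd by simp
qed

lemma t_T: "t (s + T) = t s"
 using ev_periodic[of "b s" 1] by (simp add: t_def b_T periodic_1 Y_periodic)

end

lemma abs_add_le: "z = x + y ==> \<bar>x\<bar> <= a ==> \<bar>y\<bar> <= b ==> \<bar>z\<bar> <= a + b" for z :: real
 by linarith

lemma norm_ev_diff: "norm (ev s - ev t) <= \<bar>s - t\<bar>"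
proof -
 have "norm (ev s - ev t) <= 1 * norm (s - t)"
 proof (rule differentiable_bound[of UNIV ev "%t h. h *. rot90 (ev t)"])
  show "(ev has_derivative (%h. h *. rot90 (ev x))) (at x within UNIV)" for x
   using has_derivative_ev[of "%x. x" 1 x UNIV] by (simp add: has_vector_derivative_def)
  show "onorm (%h. h *. rot90 (ev x)) <= 1" for x by (intro onorm_le) (simp)
 qed auto
 then show ?thesis by simp
qed

lemma norm_rot90_diff: "norm (rot90 x - rot90 y) = norm (x - y)"
 by (simp flip: rot90_diff add: norm_rot90)

lemma C1_half_norm_le:
 assumes "!!x. x \<in> frontier W ==> f differentiable (at x within frontier W)"
  and "!!x. x \<in> frontier W ==> \<bar>f x\<bar> <= A"
  and "!!x. x \<in> frontier W ==> \<bar>tangential_deriv (frontier W) f x (unit_tangent W x)\<bar> <= B"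
  and "!!x y. x \<in> frontier W ==> y \<in> frontier W ==> x ~= y ==>
   \<bar>tangential_deriv (frontier W) f x (unit_tangent W x) - tangential_deriv (frontier W) f y (unit_tangent W y)\<bar>
    <= C * sqrt (dist x y)"
  and "0 <= A" "0 <= B" "0 <= C"
 shows "C1_half_norm W f <= ennreal (A + B + C)"
proof -
 let ?S = "frontier W" let ?f' = "%x. tangential_deriv ?S f x (unit_tangent W x)"
 have 1: "(SUP x\<in>?S. ennreal \<bar>f x\<bar>) <= ennreal A" using assms(2) by (intro SUP_least ennreal_leI) auto
 have 2: "(SUP x\<in>?S. ennreal \<bar>?f' x\<bar>) <= ennreal B" using assms(3) by (intro SUP_least ennreal_leI) auto
 have 3: "(SUP x\<in>?S. SUP y\<in>?S - {x}. ennreal (\<bar>?f' x - ?f' y\<bar> / sqrt (dist x y))) <= ennreal C"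
  using assms(4) by (intro SUP_least ennreal_leI) (auto simp: divide_le_eq)
 have "C1_half_norm W f = (SUP x\<in>?S. ennreal \<bar>f x\<bar>) + (SUP x\<in>?S. ennreal \<bar>?f' x\<bar>) +
   (SUP x\<in>?S. SUP y\<in>?S - {x}. ennreal (\<bar>?f' x - ?f' y\<bar> / sqrt (dist x y)))"
  using assms(1) by (simp add: C1_half_norm_def Let_def)
 also have "... <= ennreal A + ennreal B + ennreal C" by (intro add_mono 1 2 3)
 also have "... = ennreal (A + B + C)" using assms(5-7) by (simp add: ennreal_plus)
 finally show ?thesis .
qed

section \<open>The graph function over the Wulff shape and its Hoelder norm\<close>

context near_wulff_graph begin

lemma surj_b: "surj b"
proof -
 have "continuous_on UNIV b" using isCont_b by (simp add: cont_at_imp_cont_on)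
 then show ?thesis by (rule surj_quasi_periodic[where T=T and L="2 * pi"]) (simp_all add: b_T)
qed

definition bet :: "real => real" where "bet = inv b"

lemma bet: "b (bet z) = z" "bet (b s) = s"
 "(bet hrd 1 / (cos (z - ang (bet z)) / (r * g z + t (bet z)))) (at z)" "strict_mono bet"
proof -
 obtain v where v: "!!y. b (v y) = y" "!!s. v (b s) = s"
  "!!y. (v hrd 1 / (cos (b (v y) - ang (v y)) / (r * g (b (v y)) + t (v y)))) (at y)"
  "strict_mono b" "strict_mono v"
  by (rule real_diffeomorphism_inverse[OF db db_pos surj_b]) (rule that, assumption+)
 have "bet y = v y" for y unfolding bet_def by (rule inv_f_eq) (use v strict_mono_imp_inj_on[OF v(4)] in auto)
 then have "bet = v" by blast
 then show "b (bet z) = z" "bet (b s) = s"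
  "(bet hrd 1 / (cos (z - ang (bet z)) / (r * g z + t (bet z)))) (at z)" "strict_mono bet"
  using v v(3)[of z] by simp_all
qed

lemma bet_T: "bet (z + 2 * pi) = bet z + T"
 using bet(2)[of "bet z + T"] by (simp add: b_T bet(1))

text \<open>The height of the graph as a function of the foot point angle; \<open>psi\<close> is the
  angle from the normal of the curve to the normal of the Wulff shape at the foot point.\<close>

definition tau :: "real => real" where "tau z = t (bet z)"
definition psi :: "real => real" where "psi z = z - ang (bet z)"

lemma tau_periodic: "tau (z + 2 * pi) = tau z"
 by (simp add: tau_def bet_T t_T)

lemma psi_bound: "\<bar>psi z\<bar> <= 1" "\<bar>psi z\<bar> <= 2 / k0 * eps" "\<bar>psi z\<bar> <= h0"
 using b_ang_le_1[of "bet z"] b_near[of "bet z"] b_root(1)[of "bet z"] by (simp_all add: psi_def bet)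

lemma tan_psi: "\<bar>tan (psi z)\<bar> <= 4 * \<bar>psi z\<bar>"
 using tan_diff_bound[of "psi z" 0] psi_bound(1) by simp

lemma dtau: "(tau hrd tan (psi z) * (r * g z + tau z)) (at z)"
proof -
 have "(t \<circ> bet hrd sin (b (bet z) - ang (bet z)) * (1 / (cos (z - ang (bet z)) / (r * g z + t (bet z))))) (at z)"
  by (rule DERIV_chain[OF dt bet(3)])
 then show ?thesis by (simp add: tau_def[abs_def] comp_def psi_def bet tan_def)
qed

lemma tau_speed: "r * k0 / 2 <= r * g z + tau z" "r * g z + tau z <= 2 * r * g1" "\<bar>tau z\<bar> <= r * k0 / 2"
 "\<bar>tau z\<bar> <= r * ((2 * g1 / k0 + 1) * eps)"
 using speed_pos[of "bet z"] speed_le[of "bet z"] t_small[of "bet z"] t_bound[of "bet z"] by (simp_all add: tau_def bet)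

lemma tau_lipschitz: "\<bar>tau y - tau z\<bar> <= 8 * r * g1 * \<bar>y - z\<bar>"
proof -
 have "norm (tau y - tau z) <= (8 * r * g1) * norm (y - z)"
 proof (rule field_differentiable_bound[of UNIV])
  show "(tau has_field_derivative tan (psi z) * (r * g z + tau z)) (at z within UNIV)" for z using dtau by simp
  show "norm (tan (psi z) * (r * g z + tau z)) <= 8 * r * g1" for z
  proof -
   have "\<bar>tan (psi z)\<bar> * \<bar>r * g z + tau z\<bar> <= 4 * (2 * r * g1)"
   proof (rule mult_mono)
    show "\<bar>tan (psi z)\<bar> <= 4" using tan_psi[of z] psi_bound(1)[of z] by linarith
    have "0 < r * k0" using r k0 by simp
    then show "\<bar>r * g z + tau z\<bar> <= 2 * r * g1" using tau_speed(1,2)[of z] by linarith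
   qed auto
   then show ?thesis by (simp add: abs_mult)
  qed
 qed auto
 then show ?thesis by simp
qed

lemma bet_lipschitz: "\<bar>bet y - bet z\<bar> <= 4 * r * g1 * \<bar>y - z\<bar>"
proof -
 have "norm (bet y - bet z) <= (4 * r * g1) * norm (y - z)"
 proof (rule field_differentiable_bound[of UNIV])
  show "(bet has_field_derivative (r * g z + tau z) / cos (psi z)) (at z within UNIV)" for z
   using bet(3)[of z] by (simp add: tau_def psi_def)
  show "norm ((r * g z + tau z) / cos (psi z)) <= 4 * r * g1" for z
  proof -
   have c: "1 / 2 <= cos (psi z)" by (rule cos_ge_half[OF psi_bound(1)])
   have "0 < r * k0" "0 < r * g1" using r k0 g1_pos by simp_all
   then have s: "\<bar>r * g z + tau z\<bar> <= 2 * (r * g1)" using tau_speed(1,2)[of z] by linarith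
   have "4 * (r * g1) * (1 / 2) <= 4 * (r * g1) * cos (psi z)" using c \<open>0 < r * g1\<close> by (intro mult_left_mono) auto
   then have "\<bar>r * g z + tau z\<bar> <= 4 * (r * g1) * cos (psi z)" using s by linarith
   then show ?thesis using c by (simp add: divide_le_eq mult.assoc)
  qed
 qed auto
 then show ?thesis by simp
qed

text \<open>\<open>- psi z\<close> solves
  \<open>P z h = - (om (bet z) \<bullet> rot90 (ev z))\<close>. The function \<open>P y\<close> has
  slope at least \<open>k0 / 2\<close> on \<open>[-1, 1]\<close>, the right sides differ by the
  oscillation of \<open>om\<close> and of the frame, and \<open>P y - P z\<close> is at most
  \<open>Lam * \<bar>y - z\<bar>\<close> times \<open>\<bar>h\<bar>\<close>, where \<open>h\<close>
  is itself of size \<open>eps\<close>.\<close>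

lemma psi_difference:
 "\<bar>psi y - psi z\<bar> <= 2 / k0 * (norm (om (bet y) - om (bet z)) + (1 + 2 * Lam / k0) * eps * \<bar>y - z\<bar>)"
proof -
 define P where "P z h = (Y (z + h) - Y z) \<bullet> rot90 (ev z)" for z h
 have dP: "(P z hrd g (z + h) * cos h) (at h)" for z h
 proof -
  have "(Y \<circ> (%h. z + h) hvd 1 *. (g (z + h) *. rot90 (ev (z + h)))) (at h)"
   by (rule vector_diff_chain_at) (auto intro!: derivative_eq_intros dY)
  then have "((%h. Y (z + h) - Y z) hvd g (z + h) *. rot90 (ev (z + h))) (at h)"
   using has_vector_derivative_diff[OF _ has_vector_derivative_const] by (fastforce simp: comp_def)
  from bounded_linear_hvd[OF bounded_linear_inner_left[of "rot90 (ev z)"] this]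
  show ?thesis by (simp add: P_def[abs_def] hrd_iff_hvd rot90_inner_rot90 ev_inner_ev)
 qed
 have root: "P z (- psi z) = - (om (bet z) \<bullet> rot90 (ev z))" for z
  using b_root(2)[of "bet z"] by (simp add: P_def psi_def p_def bet inner_add_left)
 have "k0 / 2 * \<bar>h - k\<bar> <= \<bar>P y h - P y k\<bar>" if "\<bar>h\<bar> <= 1" "\<bar>k\<bar> <= 1" for h k
 proof -
  have *: "k0 / 2 * (h - k) <= P y h - P y k" if "k <= h" "\<bar>h\<bar> <= 1" "\<bar>k\<bar> <= 1" for h k
  proof -
   have "P y k - k0 / 2 * k <= P y h - k0 / 2 * h"
   proof (rule DERIV_nonneg_imp_nondecreasing[OF that(1)])
    fix z assume z: "k <= z" "z <= h"
    then have "1 / 2 <= cos z" using that by (intro cos_ge_half) auto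
    then have "k0 * (1 / 2) <= g (y + z) * cos z" using ell[of "y + z"] k0 by (intro mult_mono) auto
    moreover have "((%h. P y h - k0 / 2 * h) hrd g (y + z) * cos z - k0 / 2) (at z)"
     by (rule DERIV_diff[OF dP DERIV_cmult_Id])
    ultimately show "EX x. ((%h. P y h - k0 / 2 * h) hrd x) (at z) & 0 <= x"
     by (intro exI[of _ "g (y + z) * cos z - k0 / 2"]) simp
   qed
   then show ?thesis unfolding right_diff_distrib by linarith
  qed
  show ?thesis
  proof (cases "k <= h")
   case True
   then have "k0 / 2 * \<bar>h - k\<bar> = k0 / 2 * (h - k)" by simp
   then show ?thesis using *[OF True that] by linarith
  next
   case False
   then have "k0 / 2 * \<bar>h - k\<bar> = k0 / 2 * (k - h)" by simp
   then show ?thesis using *[OF _ that(2,1)] False by linarith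
  qed
 qed
 from this[of "- psi y" "- psi z"] have 1: "k0 / 2 * \<bar>psi y - psi z\<bar> <= \<bar>P y (- psi y) - P y (- psi z)\<bar>"
  using psi_bound(1) by (simp add: abs_minus_commute)
 have 2: "\<bar>P y h - P z h\<bar> <= Lam * \<bar>y - z\<bar> * \<bar>h\<bar>" for h
 proof -
  have "norm ((P y h - P z h) - (P y 0 - P z 0)) <= (Lam * \<bar>y - z\<bar>) * norm (h - 0)"
  proof (rule field_differentiable_bound[of UNIV])
   show "((%h. P y h - P z h) has_field_derivative (g (y + h) - g (z + h)) * cos h) (at h within UNIV)" for h
    using DERIV_diff[OF dP[of y h] dP[of z h]] by (simp add: left_diff_distrib)
   show "norm ((g (y + h) - g (z + h)) * cos h) <= Lam * \<bar>y - z\<bar>" for h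
   proof -
    have "\<bar>g (y + h) - g (z + h)\<bar> * \<bar>cos h\<bar> <= (Lam * \<bar>y - z\<bar>) * 1"
     using g_lip[of "y + h" "z + h"] by (intro mult_mono) auto
    then show ?thesis by (simp add: abs_mult)
   qed
  qed auto
  then show ?thesis by (simp add: P_def)
 qed
 have 3: "\<bar>om (bet y) \<bullet> rot90 (ev y) - om (bet z) \<bullet> rot90 (ev z)\<bar> <= norm (om (bet y) - om (bet z)) + eps * \<bar>y - z\<bar>"
 proof -
  have "om (bet y) \<bullet> rot90 (ev y) - om (bet z) \<bullet> rot90 (ev z) =
    (om (bet y) - om (bet z)) \<bullet> rot90 (ev y) + om (bet z) \<bullet> (rot90 (ev y) - rot90 (ev z))"
   by (simp add: inner_diff_left inner_diff_right)
  moreover have "\<bar>(om (bet y) - om (bet z)) \<bullet> rot90 (ev y)\<bar> <= norm (om (bet y) - om (bet z))"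
   using Cauchy_Schwarz_ineq2[of "om (bet y) - om (bet z)" "rot90 (ev y)"] by simp
  moreover have "\<bar>om (bet z) \<bullet> (rot90 (ev y) - rot90 (ev z))\<bar> <= eps * \<bar>y - z\<bar>"
  proof -
   have "norm (om (bet z)) * norm (rot90 (ev y) - rot90 (ev z)) <= eps * \<bar>y - z\<bar>"
    using om_bound[of "bet z"] norm_ev_diff[of y z] eps0 by (intro mult_mono) (auto simp: norm_rot90_diff)
   then show ?thesis using Cauchy_Schwarz_ineq2[of "om (bet z)" "rot90 (ev y) - rot90 (ev z)"] by linarith
  qed
  ultimately show ?thesis by linarith
 qed
 have 4: "Lam * \<bar>y - z\<bar> * \<bar>- psi z\<bar> <= Lam * \<bar>y - z\<bar> * (2 / k0 * eps)"
  using psi_bound(2)[of z] Lam_nonneg by (intro mult_left_mono) auto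
 have "k0 / 2 * \<bar>psi y - psi z\<bar> <= norm (om (bet y) - om (bet z)) + eps * \<bar>y - z\<bar> + Lam * \<bar>y - z\<bar> * (2 / k0 * eps)"
  using 1 2[of "- psi z"] 3 4 root[of y] root[of z] by linarith
 also have "... = norm (om (bet y) - om (bet z)) + (1 + 2 * Lam / k0) * eps * \<bar>y - z\<bar>"
  by (simp add: algebra_simps)
 finally have "k0 / 2 * \<bar>psi y - psi z\<bar> <= ..." .
 then have "2 / k0 * (k0 / 2 * \<bar>psi y - psi z\<bar>) <= 2 / k0 * (norm (om (bet y) - om (bet z)) + (1 + 2 * Lam / k0) * eps * \<bar>y - z\<bar>)"
  using k0 by (intro mult_left_mono) auto
 then show ?thesis using k0 by simp
qed

text \<open>The derivative of \<open>tau\<close> divided by \<open>r * g z\<close>, that is, the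
  derivative of the graph function along the unit tangent of the scaled Wulff shape.\<close>

definition tau' :: "real => real" where "tau' z = tan (psi z) * (1 + tau z / (r * g z))"

lemma tau_ratio: "\<bar>tau z / (r * g z)\<bar> <= 1 / 2"
proof -
 have "r * k0 <= r * g z" using ell[of z] r by simp
 then have "\<bar>tau z\<bar> <= 1 / 2 * (r * g z)" using tau_speed(3)[of z] by linarith
 moreover have "0 < r * g z" using r g_pos[of z] by simp
 ultimately show ?thesis by (simp only: abs_divide abs_of_pos divide_le_eq if_True)
qed

lemma tau'_bound: "\<bar>tau' z\<bar> <= 12 / k0 * eps"
proof -
 have "\<bar>tan (psi z)\<bar> * \<bar>1 + tau z / (r * g z)\<bar> <= (4 * (2 / k0 * eps)) * (3 / 2)"
 proof (rule mult_mono)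
  show "\<bar>tan (psi z)\<bar> <= 4 * (2 / k0 * eps)" using tan_psi[of z] psi_bound(2)[of z] by linarith
  show "\<bar>1 + tau z / (r * g z)\<bar> <= 3 / 2" using tau_ratio[of z] by linarith
 qed (use eps0 k0 in auto)
 then show ?thesis by (simp add: tau'_def abs_mult)
qed

lemma tau_ratio_lipschitz: "\<bar>tau y / (r * g y) - tau z / (r * g z)\<bar> <= (8 * g1 / k0 + Lam / (2 * k0)) * \<bar>y - z\<bar>"
proof -
 have gp: "0 < g y" "0 < g z" by (rule g_pos)+
 have "tau y / (r * g y) - tau z / (r * g z) = (tau y - tau z) / (r * g y) + (tau z / (r * g z)) * ((g z - g y) / g y)"
  using gp r by (simp add: field_simps)
 moreover have "\<bar>(tau y - tau z) / (r * g y)\<bar> <= 8 * g1 / k0 * \<bar>y - z\<bar>"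
 proof -
  have "\<bar>tau y - tau z\<bar> / (r * g y) <= (8 * r * g1 * \<bar>y - z\<bar>) / (r * k0)"
   using tau_lipschitz[of y z] ell[of y] r k0 g1_pos by (intro frac_le) auto
  then show ?thesis using r gp by (simp add: abs_divide abs_mult)
 qed
 moreover have "\<bar>(tau z / (r * g z)) * ((g z - g y) / g y)\<bar> <= Lam / (2 * k0) * \<bar>y - z\<bar>"
 proof -
  have "\<bar>tau z / (r * g z)\<bar> * \<bar>(g z - g y) / g y\<bar> <= (1 / 2) * ((Lam * \<bar>y - z\<bar>) / k0)"
  proof (rule mult_mono[OF tau_ratio])
   have "\<bar>g z - g y\<bar> / g y <= (Lam * \<bar>y - z\<bar>) / k0"
    using g_lip[of z y] ell[of y] k0 by (intro frac_le) (auto simp: abs_minus_commute)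
   then show "\<bar>(g z - g y) / g y\<bar> <= (Lam * \<bar>y - z\<bar>) / k0" using gp by (simp add: abs_divide)
  qed auto
  then show ?thesis by (simp add: abs_mult)
 qed
 moreover have "(8 * g1 / k0 + Lam / (2 * k0)) * \<bar>y - z\<bar> = 8 * g1 / k0 * \<bar>y - z\<bar> + Lam / (2 * k0) * \<bar>y - z\<bar>"
  by (rule distrib_right)
 ultimately show ?thesis by (metis abs_add_le)
qed

text \<open>A Hoelder bound in the arc length of \<open>c\<close> becomes one in the angle because
  \<open>bet\<close> is Lipschitz.\<close>

lemma om_bet_holder:
 assumes "\<bar>y - z\<bar> <= pi" shows "norm (om (bet y) - om (bet z)) <= H * (2 * sqrt (r * g1) * sqrt \<bar>y - z\<bar>)"
proof -
 have *: "norm (om (bet y) - om (bet z)) <= H * sqrt \<bar>bet y - bet z\<bar>" if "z <= y" "y <= z + pi" for y z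
 proof -
  have "bet z <= bet y" "bet y <= bet (z + 2 * pi)" using that pi_ge_zero by (auto simp: strict_mono_less_eq[OF bet(4)])
  then show ?thesis using om_holder[of "bet z" "bet y"] by (simp add: bet_T)
 qed
 have 1: "norm (om (bet y) - om (bet z)) <= H * sqrt \<bar>bet y - bet z\<bar>"
 proof (cases "z <= y")
  case True then show ?thesis using *[of z y] assms by auto
 next
  case False then show ?thesis using *[of y z] assms by (auto simp: norm_minus_commute abs_minus_commute)
 qed
 have "sqrt \<bar>bet y - bet z\<bar> <= sqrt (4 * (r * g1 * \<bar>y - z\<bar>))"
  using bet_lipschitz[of y z] by (intro real_sqrt_le_mono) (simp add: mult.assoc)
 then have "sqrt \<bar>bet y - bet z\<bar> <= 2 * sqrt (r * g1) * sqrt \<bar>y - z\<bar>" by (simp add: real_sqrt_mult mult_ac)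
 then have "H * sqrt \<bar>bet y - bet z\<bar> <= H * (2 * sqrt (r * g1) * sqrt \<bar>y - z\<bar>)" using H0 by (rule mult_left_mono)
 then show ?thesis using 1 by linarith
qed

text \<open>The first summand stems from the variation of \<open>tan (psi z)\<close>, the second
  from that of \<open>tau z / (r * g z)\<close>.\<close>

definition K0 :: real where
 "K0 = 12 / k0 * (2 * sqrt (r * g1) + 2 + 4 * Lam / k0) + 16 / k0 * (8 * g1 / k0 + Lam / (2 * k0))"

lemma tau'_holder:
 assumes "\<bar>y - z\<bar> <= pi" shows "\<bar>tau' y - tau' z\<bar> <= K0 * (eps + H) * sqrt \<bar>y - z\<bar>"
proof -
 define q where "q = sqrt \<bar>y - z\<bar>"
 have q0: "0 <= q" by (simp add: q_def)
 \<comment> \<open>As \<open>pi < 4\<close>, \<open>\<bar>y - z\<bar>\<close> is at most twice its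
   square root, so Lipschitz terms count as Hoelder terms.\<close>
 have "q <= sqrt (2 * 2)" unfolding q_def using assms pi_less_4 by (intro real_sqrt_le_mono) auto
 then have "q * q <= 2 * q" using q0 by (intro mult_right_mono) auto
 then have q2: "\<bar>y - z\<bar> <= 2 * q" by (simp add: q_def)
 define G where "G = 2 * sqrt (r * g1)"
 define L where "L = 1 + 2 * Lam / k0"
 define N where "N = 8 * g1 / k0 + Lam / (2 * k0)"
 have pos: "0 <= G" "0 <= L" "0 <= N" using r g1_pos k0 Lam_nonneg by (auto simp: G_def L_def N_def)
 have K0: "K0 = 12 / k0 * (G + 2 * L) + 16 / k0 * N" by (simp add: K0_def G_def L_def N_def)
 have "tau' y - tau' z = (tan (psi y) - tan (psi z)) * (1 + tau y / (r * g y)) +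
   tan (psi z) * (tau y / (r * g y) - tau z / (r * g z))"
  by (simp add: tau'_def algebra_simps)
 moreover have "\<bar>(tan (psi y) - tan (psi z)) * (1 + tau y / (r * g y))\<bar> <= 12 / k0 * (G + 2 * L) * (eps + H) * q"
 proof -
  have "norm (om (bet y) - om (bet z)) <= H * (G * q)"
   using om_bet_holder[OF assms] by (simp add: G_def q_def)
  moreover have "L * eps * \<bar>y - z\<bar> <= L * eps * (2 * q)" using q2 pos(2) eps0 by (intro mult_left_mono) auto
  moreover have "0 <= eps * (G * q)" "0 <= L * H * (2 * q)" using pos q0 eps0 H0 by simp_all
  moreover have "(G + 2 * L) * (eps + H) * q = H * (G * q) + L * eps * (2 * q) + eps * (G * q) + L * H * (2 * q)"
   by (simp add: algebra_simps)
  ultimately have "norm (om (bet y) - om (bet z)) + L * eps * \<bar>y - z\<bar> <= (G + 2 * L) * (eps + H) * q" by linarith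
  then have "2 / k0 * (norm (om (bet y) - om (bet z)) + L * eps * \<bar>y - z\<bar>) <= 2 / k0 * ((G + 2 * L) * (eps + H) * q)"
   using k0 by (intro mult_left_mono) auto
  then have "\<bar>psi y - psi z\<bar> <= 2 / k0 * ((G + 2 * L) * (eps + H) * q)"
   using psi_difference[of y z] by (simp add: L_def)
  then have "\<bar>tan (psi y) - tan (psi z)\<bar> <= 4 * (2 / k0 * ((G + 2 * L) * (eps + H) * q))"
   using tan_diff_bound[OF psi_bound(1) psi_bound(1), of y z] by (meson mult_left_mono order_trans zero_le_numeral)
  moreover have "\<bar>1 + tau y / (r * g y)\<bar> <= 3 / 2" using tau_ratio[of y] by linarith
  ultimately have "\<bar>tan (psi y) - tan (psi z)\<bar> * \<bar>1 + tau y / (r * g y)\<bar> <= 4 * (2 / k0 * ((G + 2 * L) * (eps + H) * q)) * (3 / 2)"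
   using pos q0 eps0 H0 k0 by (intro mult_mono) auto
  also have "... = 12 / k0 * (G + 2 * L) * (eps + H) * q" by simp
  finally show ?thesis by (simp only: abs_mult)
 qed
 moreover have "\<bar>tan (psi z) * (tau y / (r * g y) - tau z / (r * g z))\<bar> <= 16 / k0 * N * (eps + H) * q"
 proof -
  have "\<bar>tan (psi z)\<bar> <= 4 * (2 / k0 * (eps + H))"
  proof -
   have "2 / k0 * eps <= 2 / k0 * (eps + H)" using k0 H0 by (intro mult_left_mono) auto
   then show ?thesis using tan_psi[of z] psi_bound(2)[of z] by linarith
  qed
  moreover have "\<bar>tau y / (r * g y) - tau z / (r * g z)\<bar> <= N * (2 * q)"
  proof -
   have "N * \<bar>y - z\<bar> <= N * (2 * q)" using q2 pos(3) by (rule mult_left_mono)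
   then show ?thesis using tau_ratio_lipschitz[of y z] by (simp add: N_def)
  qed
  ultimately have "\<bar>tan (psi z)\<bar> * \<bar>tau y / (r * g y) - tau z / (r * g z)\<bar> <= 4 * (2 / k0 * (eps + H)) * (N * (2 * q))"
   using eps0 H0 k0 by (intro mult_mono) auto
  also have "... = 16 / k0 * N * (eps + H) * q" by simp
  finally show ?thesis by (simp only: abs_mult)
 qed
 ultimately have "\<bar>tau' y - tau' z\<bar> <= 12 / k0 * (G + 2 * L) * (eps + H) * q + 16 / k0 * N * (eps + H) * q"
  by (rule abs_add_le)
 then show ?thesis by (simp add: K0 q_def distrib_right)
qed

lemma K0_nonneg: "0 <= K0"
 using r g1_pos k0 Lam_nonneg by (simp add: K0_def)

lemma periodic_int:
 fixes f :: "real => real"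
 assumes "!!z. f (z + 2 * pi) = f z" shows "f (z + 2 * pi * of_int k) = f z"
proof (induction k rule: int_induct[of _ 0])
 case (step1 i) then show ?case using assms[of "z + 2 * pi * of_int i"] by (simp add: algebra_simps)
next
 case (step2 i) then show ?case using assms[of "z + 2 * pi * of_int (i - 1)"] by (simp add: algebra_simps)
qed simp

lemma Y_point_eq: "x + r *. Y y = x + r *. Y z \<longleftrightarrow> (EX k::int. y = z + 2 * pi * k)"
 using r by (simp add: Y_eq_iff ev_eq_iff)

theorem normal_graph:
 shows "EX f. bij_betw (normal_graph_map (wulff_at \<phi> x r) f) (frontier (wulff_at \<phi> x r)) (range c) &
  C1_half_norm (wulff_at \<phi> x r) f <=
   ennreal ((r * (2 * g1 / k0 + 1) + 12 / k0 + K0 * sqrt (8 / (r * k0))) * (eps + H))"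
proof -
 define y where "y z = x + r *. Y z" for z
 define W where "W = wulff_at \<phi> x r"
 interpret w: closed_curve y "%z. (r * g z) *. rot90 (ev z)" "2 * pi"
  unfolding y_def by (rule closed_curve_wulff_at[OF r])
 have fr: "frontier W = range y" by (simp add: W_def y_def[abs_def] frontier_wulff_at[OF r])
 define f where "f p = tau (SOME z. p = y z)" for p
 have f: "f (y z) = tau z" for z
 proof -
  have "y z = y (SOME z'. y z = y z')" by (rule someI[of "%z'. y z = y z'" z]) simp
  then have "EX k::int. z = (SOME z'. y z = y z') + 2 * pi * k" unfolding y_def Y_point_eq .
  then obtain k :: int where "z = (SOME z'. y z = y z') + 2 * pi * k" ..
  then show ?thesis using periodic_int[of tau, OF tau_periodic] by (metis f_def)
 qed
 have map: "normal_graph_map W f (y z) = c (bet z)" for z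
  using c_graph[of "bet z"] f[of z] outer_normal_wulff_at[OF r, of x z]
  by (simp add: normal_graph_map_def y_def W_def bet tau_def)
 have bij: "bij_betw (normal_graph_map W f) (frontier W) (range c)"
  unfolding bij_betw_def
 proof
  show "inj_on (normal_graph_map W f) (frontier W)"
  proof (rule inj_onI)
   fix p q assume "p \<in> frontier W" "q \<in> frontier W" and eq: "normal_graph_map W f p = normal_graph_map W f q"
   then obtain y1 y2 where p: "p = y y1" "q = y y2" by (auto simp: fr)
   then have "c (bet y1) = c (bet y2)" using eq by (simp add: map)
   then obtain k :: int where "bet y1 = bet y2 + T * k" using eq_iff by blast
   then have "y1 = b (bet y2 + T * k)" using bet(1) by metis
   moreover have "b (bet y2 + T * k) = y2 + 2 * pi * k"
   proof (induction k rule: int_induct[of _ 0])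
    case (step1 i) then show ?case using b_T[of "bet y2 + T * of_int i"] by (simp add: algebra_simps)
   next
    case (step2 i) then show ?case using b_T[of "bet y2 + T * of_int (i - 1)"] by (simp add: algebra_simps)
   qed (simp add: bet)
   ultimately have "EX k::int. y1 = y2 + 2 * pi * k" by auto
   then show "p = q" unfolding p y_def Y_point_eq .
  qed
  have "normal_graph_map W f ` range y = range (%z. c (bet z))" by (simp add: map image_image)
  also have "... = range c"
  proof
   show "range c \<subseteq> range (%z. c (bet z))"
   proof
    fix p assume "p \<in> range c"
    then obtain s where "p = c (bet (b s))" by (auto simp: bet)
    then show "p \<in> range (%z. c (bet z))" by blast
   qed
  qed auto
  finally show "normal_graph_map W f ` frontier W = range c" by (simp add: fr)
 qed
 have nz: "(r * g z) *. rot90 (ev z) ~= 0" for z by (rule w.nz)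
 have fd: "(f has_derivative (%h. ((h \<bullet> (r * g z) *. rot90 (ev z)) / ((r * g z) *. rot90 (ev z) \<bullet> (r * g z) *. rot90 (ev z)))
   *. (tan (psi z) * (r * g z + tau z)))) (at (y z) within frontier W)" for z
  using w.near_range dtau[of z]
  by (intro has_derivative_within_curve[OF w.der nz]) (auto simp: fr f hrd_iff_hvd)
 have f': "tangential_deriv (frontier W) f (y z) (unit_tangent W (y z)) = tau' z" for z
 proof -
  have gz: "0 < r * g z" using r g_pos[of z] by simp
  \<comment> \<open>Rescaled so that \<open>y (v s)\<close> leaves \<open>y z\<close> with the unit
    tangent as its velocity.\<close>
  define v where "v s = z + s / (r * g z)" for s
  have v: "(v hrd 1 / (r * g z)) (at 0)" unfolding v_def
   using gz by (auto intro!: derivative_eq_intros)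
  have v0: "v 0 = z" by (simp add: v_def)
  have yv: "((%s. y (v s)) hvd rot90 (ev z)) (at 0)"
  proof -
   have "(y \<circ> v hvd (1 / (r * g z)) *. ((r * g (v 0)) *. rot90 (ev (v 0)))) (at 0)"
    by (rule vector_diff_chain_at) (use v w.der in \<open>auto simp: hrd_iff_hvd\<close>)
   then show ?thesis using gz g_pos[of z] r by (simp add: v0 comp_def)
  qed
  have "(tau \<circ> v hrd (tan (psi z) * (r * g z + tau z)) * (1 / (r * g z))) (at 0)"
   by (rule DERIV_chain) (use v v0 dtau in auto)
  moreover have "(tan (psi z) * (r * g z + tau z)) * (1 / (r * g z)) = tau' z"
   using gz g_pos[of z] r by (simp add: tau'_def field_simps)
  ultimately have fv: "((%s. f (y (v s))) hvd tau' z) (at 0)"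
   by (simp add: f comp_def hrd_iff_hvd)
  have "tangential_deriv (frontier W) f (y (v 0)) (rot90 (ev z)) = tau' z"
   by (rule tangential_deriv_curve[OF _ _ yv fv]) (use fd[of z] v0 in \<open>auto simp: fr differentiable_def intro: always_eventually\<close>)
  then show ?thesis using unit_tangent_wulff_at[OF r, of x z] by (simp add: v0 W_def y_def)
 qed
 have "C1_half_norm W f <= ennreal (r * ((2 * g1 / k0 + 1) * eps) + 12 / k0 * eps + K0 * (eps + H) * sqrt (8 / (r * k0)))"
 proof (rule C1_half_norm_le)
  fix p assume "p \<in> frontier W"
  then obtain z where p: "p = y z" by (auto simp: fr)
  show "f differentiable (at p within frontier W)" using fd[of z] by (auto simp: p differentiable_def)
  show "\<bar>f p\<bar> <= r * ((2 * g1 / k0 + 1) * eps)" using tau_speed(4) by (simp add: p f)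
  show "\<bar>tangential_deriv (frontier W) f p (unit_tangent W p)\<bar> <= 12 / k0 * eps" using tau'_bound by (simp add: p f')
 next
  fix p q assume "p \<in> frontier W" "q \<in> frontier W"
  then obtain y1 y0 where p: "p = y y1" "q = y y0" by (auto simp: fr)
  \<comment> \<open>The points determine their angles only up to full turns; the representatives are
    chosen at distance at most \<open>pi\<close>, as \<open>Y_chord\<close> and
    \<open>tau'_holder\<close> require.\<close>
  obtain k :: int where k: "\<bar>y1 - (y0 + 2 * pi * k)\<bar> <= pi"
  proof
   let ?k = "round ((y1 - y0) / (2 * pi))"
   have "\<bar>of_int ?k - (y1 - y0) / (2 * pi)\<bar> <= 1 / 2" by (rule of_int_round_abs_le)
   then have "2 * pi * \<bar>of_int ?k - (y1 - y0) / (2 * pi)\<bar> <= 2 * pi * (1 / 2)" by (intro mult_left_mono) auto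
   then have 1: "\<bar>2 * pi * (of_int ?k - (y1 - y0) / (2 * pi))\<bar> <= pi" by (simp only: abs_mult) simp
   have "2 * pi * ((y1 - y0) / (2 * pi)) = y1 - y0" by simp
   then have "2 * pi * (of_int ?k - (y1 - y0) / (2 * pi)) = 2 * pi * of_int ?k - (y1 - y0)"
    by (simp only: right_diff_distrib)
   then show "\<bar>y1 - (y0 + 2 * pi * ?k)\<bar> <= pi" using 1 by linarith
  qed
  define y2 where "y2 = y0 + 2 * pi * k"
  have q: "q = y y2" unfolding p y_def Y_point_eq y2_def by (rule exI[of _ "- k"]) simp
  have d: "\<bar>y1 - y2\<bar> <= pi" using k by (simp add: y2_def)
  have "\<bar>tau' y1 - tau' y2\<bar> <= K0 * (eps + H) * sqrt \<bar>y1 - y2\<bar>" by (rule tau'_holder[OF d])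
  also have "... <= K0 * (eps + H) * sqrt (8 / (r * k0) * dist p q)"
  proof (rule mult_left_mono)
   have "r * (k0 / 8 * \<bar>y1 - y2\<bar>) <= r * norm (Y y1 - Y y2)" using Y_chord[OF d] r by simp
   also have "... = dist p q" using r by (simp add: p(1) q y_def dist_norm flip: scaleR_diff_right)
   finally have "\<bar>y1 - y2\<bar> <= 8 / (r * k0) * dist p q" using r k0 by (simp add: field_simps)
   then show "sqrt \<bar>y1 - y2\<bar> <= sqrt (8 / (r * k0) * dist p q)" by (rule real_sqrt_le_mono)
   show "0 <= K0 * (eps + H)" using K0_nonneg eps0 H0 by simp
  qed
  also have "... = K0 * (eps + H) * sqrt (8 / (r * k0)) * sqrt (dist p q)"
   by (simp only: real_sqrt_mult mult.assoc)
  finally show "\<bar>tangential_deriv (frontier W) f p (unit_tangent W p) - tangential_deriv (frontier W) f q (unit_tangent W q)\<bar>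
    <= K0 * (eps + H) * sqrt (8 / (r * k0)) * sqrt (dist p q)"
   by (simp only: p(1) q f')
 qed (use r g1_pos k0 eps0 H0 K0_nonneg in auto)
 also have "... <= ennreal ((r * (2 * g1 / k0 + 1) + 12 / k0 + K0 * sqrt (8 / (r * k0))) * (eps + H))"
 proof (rule ennreal_leI)
  have "0 <= r * (2 * g1 / k0 + 1) * H" "0 <= 12 / k0 * H" using r g1_pos k0 H0 by simp_all
  moreover have "(A + B + K * S) * (eps + H) = A * eps + B * eps + K * (eps + H) * S + A * H + B * H" for A B K S :: real
   by (simp add: algebra_simps)
  ultimately show "r * ((2 * g1 / k0 + 1) * eps) + 12 / k0 * eps + K0 * (eps + H) * sqrt (8 / (r * k0))
   <= (r * (2 * g1 / k0 + 1) + 12 / k0 + K0 * sqrt (8 / (r * k0))) * (eps + H)"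
   by (simp add: mult.assoc)
 qed
 finally show ?thesis using bij unfolding W_def by blast
qed

end

section \<open>Locality and transversality of the outer normal\<close>

lemma local_topology:
 assumes U: "open U" and eq: "A \<inter> U = B \<inter> U"
 shows "interior A \<inter> U = interior B \<inter> U" "closure A \<inter> U = closure B \<inter> U" "frontier A \<inter> U = frontier B \<inter> U"
proof -
 show i: "interior A \<inter> U = interior B \<inter> U" using eq interior_open[OF U] by (metis interior_Int)
 have *: "closure A \<inter> U \<subseteq> closure B \<inter> U" if "A \<inter> U = B \<inter> U" for A B
  using open_Int_closure_subset[OF U, of A] closure_mono[of "U \<inter> A" B] that by blast
 show c: "closure A \<inter> U = closure B \<inter> U" using *[OF eq] *[OF eq[symmetric]] by blast
 show "frontier A \<inter> U = frontier B \<inter> U" using i c by (auto simp: frontier_def)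
qed

lemma is_outer_normal_local:
 assumes U: "open U" "p \<in> U" and eq: "A \<inter> U = B \<inter> U" and n: "is_outer_normal A p n"
 shows "is_outer_normal B p n"
proof -
 note l = local_topology[OF U(1) eq]
 have "at p within frontier A = at p within frontier B"
  by (rule at_within_nhd[OF U(2,1)]) (use l(3) in blast)
 then have 1: "((%y. (n \<bullet> (y - p)) / norm (y - p)) \<longlongrightarrow> 0) (at p within frontier B)"
  using n by (simp add: is_outer_normal_def)
 have t: "((%t. p - t *. n) \<longlongrightarrow> p - 0 *. n) (at_right 0)" "((%t. p + t *. n) \<longlongrightarrow> p + 0 *. n) (at_right 0)"
  by (intro tendsto_intros)+
 have "\<forall>\<^sub>F t in at_right 0. p - t *. n \<in> U" "\<forall>\<^sub>F t in at_right 0. p + t *. n \<in> U"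
  using topological_tendstoD[OF t(1) U(1)] topological_tendstoD[OF t(2) U(1)] U(2) by simp_all
 moreover have "\<forall>\<^sub>F t in at_right 0. p - t *. n \<in> interior A & p + t *. n \<notin> closure A"
  using n by (simp add: is_outer_normal_def)
 ultimately have "\<forall>\<^sub>F t in at_right 0. p - t *. n \<in> interior B & p + t *. n \<notin> closure B"
  by eventually_elim (use l in blast)
 then show ?thesis using 1 n by (simp add: is_outer_normal_def)
qed

lemma outer_normal_local:
 assumes "open U" "p \<in> U" "A \<inter> U = B \<inter> U" shows "outer_normal A p = outer_normal B p"
proof -
 have "is_outer_normal A p = is_outer_normal B p"
  by (intro ext iffI) (erule is_outer_normal_local[OF assms] is_outer_normal_local[OF assms(1,2) assms(3)[symmetric]])+
 then show ?thesis by (simp add: outer_normal_def)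
qed

text \<open>Near \<open>p\<close> the frontier lies in a thin cone around the tangent line. The
  segment from \<open>p + t *. v\<close> to the point \<open>p + (t * k) *. n\<close> on the normal
  has constant normal component \<open>t * k\<close>, hence misses the frontier, and connectedness
  transfers the side from \<open>n\<close> to \<open>v\<close>; likewise on the inner side.\<close>

lemma outer_normal_transversal:
 assumes n: "is_outer_normal A p n" and v: "0 < v \<bullet> n"
 shows "\<forall>\<^sub>F t in at_right 0. p - t *. v \<in> interior A & p + t *. v \<notin> closure A"
proof -
 \<comment> \<open>Points of these segments have distance at most \<open>t * (norm v + k)\<close>
   from \<open>p\<close>; the threshold \<open>k / (norm v + k + 1)\<close> lies below the ratio of
   their normal component to this distance.\<close>
 define k where "k = v \<bullet> n"
 have nn: "n \<bullet> n = 1" using n by (simp add: is_outer_normal_def norm_eq_1)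
 have v0: "0 < norm v" using v by auto
 have "\<forall>\<^sub>F y in at p within frontier A. \<bar>(n \<bullet> (y - p)) / norm (y - p)\<bar> < k / (norm v + k + 1)"
 proof -
  have "((%y. (n \<bullet> (y - p)) / norm (y - p)) \<longlongrightarrow> 0) (at p within frontier A)" "0 < k / (norm v + k + 1)"
   using n v by (simp_all add: is_outer_normal_def k_def add_nonneg_pos)
  from tendstoD[OF this] show ?thesis by (simp add: dist_real_def)
 qed
 then obtain d where d: "0 < d"
  "!!y. y \<in> frontier A ==> y ~= p ==> dist y p < d ==> \<bar>(n \<bullet> (y - p)) / norm (y - p)\<bar> < k / (norm v + k + 1)"
  unfolding eventually_at by blast
 have far: "q \<notin> frontier A" if q: "n \<bullet> (q - p) = t * k | n \<bullet> (q - p) = - (t * k)" "norm (q - p) <= t * (norm v + k)"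
  "0 < t" "t * (norm v + k) < d" for q t
 proof
  assume f: "q \<in> frontier A"
  have k: "0 < k" using v by (simp add: k_def)
  have tk: "0 < t * k" using q(3) k by simp
  have ne: "q ~= p" using q(1) tk by auto
  have "\<bar>(n \<bullet> (q - p)) / norm (q - p)\<bar> < k / (norm v + k + 1)" using q(2,4) by (intro d(2) f ne) (simp add: dist_norm)
  moreover have "\<bar>n \<bullet> (q - p)\<bar> = t * k" using q(1) tk by auto
  ultimately have "t * k / norm (q - p) < k / (norm v + k + 1)" by (simp add: abs_divide)
  then have "t * k * (norm v + k + 1) < k * norm (q - p)" using ne v0 k by (simp add: divide_less_eq less_divide_eq field_simps)
  also have "... <= k * (t * (norm v + k))" using q(2) k by (intro mult_left_mono) auto
  finally show False using tk by (simp add: algebra_simps)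
 qed
 have k: "0 < k" using v by (simp add: k_def)
 have seg: "norm (q - p) <= t * (norm v + k) & n \<bullet> (q - p) = sig * (t * k)"
  if sg: "q \<in> closed_segment (p + (sig * t) *. v) (p + (sig * (t * k)) *. n)" and "0 < t" "\<bar>sig\<bar> = 1" for q sig t
 proof -
  obtain u where u: "0 <= u" "u <= 1" "q = (1 - u) *. (p + (sig * t) *. v) + u *. (p + (sig * (t * k)) *. n)"
   using sg unfolding in_segment(1) by blast
  have e: "q - p = (1 - u) *. ((sig * t) *. v) + u *. ((sig * (t * k)) *. n)"
   by (simp add: u(3) algebra_simps)
  have n1: "norm n = 1" using n by (simp add: is_outer_normal_def)
  have "norm (q - p) <= norm ((1 - u) *. ((sig * t) *. v)) + norm (u *. ((sig * (t * k)) *. n))"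
   unfolding e by (rule norm_triangle_ineq)
  also have "... = (1 - u) * (t * norm v) + u * (t * k)" using u(1,2) that(2,3) k n1 by (simp add: abs_mult)
  also have "... <= t * norm v + t * k"
  proof -
   have "0 <= t * norm v" "0 <= t * k" using that(2) k by simp_all
   then show ?thesis using u(1,2) by (intro add_mono mult_left_le_one_le) auto
  qed
  finally have 1: "norm (q - p) <= t * (norm v + k)" by (simp add: distrib_left)
  have "n \<bullet> (q - p) = (1 - u) * (sig * t * k) + u * (sig * (t * k))"
   unfolding e by (simp add: inner_add_right nn k_def inner_commute)
  then show ?thesis using 1 by (simp add: algebra_simps)
 qed
 have "\<forall>\<^sub>F t in at_right 0. p - t *. n \<in> interior A & p + t *. n \<notin> closure A"
  using n by (simp add: is_outer_normal_def)
 then obtain e where e: "0 < e" "!!t. 0 < t ==> t < e ==> p - t *. n \<in> interior A & p + t *. n \<notin> closure A"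
  unfolding eventually_at_right_field by auto
 define t0 where "t0 = min (e / k) (d / (norm v + k))"
 have "0 < t0" using e(1) d(1) k v0 add_pos_pos[OF v0 k] by (simp add: t0_def)
 moreover have "p - t *. v \<in> interior A & p + t *. v \<notin> closure A" if t: "0 < t" "t < t0" for t
 proof
  have tk: "0 < t * k" "t * k < e" "t * (norm v + k) < d" using t k v0 by (simp_all add: t0_def pos_less_divide_eq add_pos_pos)
  let ?S = "closed_segment (p + (- 1 * t) *. v) (p + (- 1 * (t * k)) *. n)"
  have nf: "?S \<inter> frontier A = {}" using seg[of _ "- 1" t] far[of _ t] t tk by fastforce
  have "p - (t * k) *. n \<in> ?S" using ends_in_segment(2)[of "p + (- 1 * (t * k)) *. n"] by simp
  moreover have "p - (t * k) *. n \<in> A" using e(2)[OF tk(1,2)] interior_subset by blast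
  ultimately have "?S \<subseteq> A" using connected_Int_frontier[OF connected_segment, of _ _ A] nf by blast
  moreover have "p - t *. v \<in> ?S" using ends_in_segment(1)[of "p + (- 1 * t) *. v"] by simp
  ultimately show "p - t *. v \<in> interior A" using nf closure_subset unfolding frontier_def by blast
  let ?S = "closed_segment (p + (1 * t) *. v) (p + (1 * (t * k)) *. n)"
  have nf: "?S \<inter> frontier A = {}" using seg[of _ 1 t] far[of _ t] t tk by fastforce
  have "p + (t * k) *. n \<in> ?S" using ends_in_segment(2)[of "p + (1 * (t * k)) *. n"] by simp
  moreover have "p + (t * k) *. n \<notin> A" using e(2)[OF tk(1,2)] closure_subset by blast
  ultimately have "?S \<inter> A = {}" using connected_Int_frontier[OF connected_segment, of _ _ A] nf by blast
  moreover have "p + t *. v \<in> ?S" using ends_in_segment(1)[of "p + (1 * t) *. v"] by simp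
  ultimately show "p + t *. v \<notin> closure A" using nf interior_subset unfolding frontier_def by blast
 qed
 ultimately show ?thesis unfolding eventually_at_right_field by blast
qed

section \<open>Spreading points apart\<close>

lemma relpow_dist:
 fixes x :: "'i => 'a::real_normed_vector"
 assumes "!!i j. (i, j) \<in> Q ==> norm (x i - x j) <= R" "(i, j) \<in> Q ^^ n"
 shows "norm (x i - x j) <= real n * R"
 using assms(2)
proof (induction n arbitrary: j)
 case (Suc n)
 then obtain k where k: "(i, k) \<in> Q ^^ n" "(k, j) \<in> Q" by auto
 have "norm (x i - x j) <= norm (x i - x k) + norm (x k - x j)" using norm_triangle_ineq[of "x i - x k" "x k - x j"] by simp
 then show ?case using Suc.IH[OF k(1)] assms(1)[OF k(2)] by (simp add: algebra_simps)
qed simp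

text \<open>Points of one cluster are dilated about a representative; clusters are far apart from each other.
 The displacement is independent of the diameter of the configuration.\<close>

lemma spread_points:
 fixes x :: "'i => 'a::real_normed_vector"
 assumes "finite J" "0 <= R" "0 <= mu"
 obtains y where "!!i. i \<in> J ==> norm (y i - x i) <= mu * ((real (card J))\<^sup>2 * R)"
  "!!i j. i \<in> J ==> j \<in> J ==> y i - y j = (1 + mu) *. (x i - x j) | R < norm (x i - x j)"
proof -
 define Q where "Q = {(i, j). i \<in> J & j \<in> J & norm (x i - x j) <= R}"
 have Q: "Q \<subseteq> J \<times> J" by (auto simp: Q_def)
 then have fQ: "finite Q" using assms(1) by (meson finite_SigmaI finite_subset)
 have "sym Q" by (auto simp: Q_def sym_def norm_minus_commute)
 then have symQ: "sym (Q\<^sup>*)" by (rule sym_rtrancl)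
 define rep where "rep i = (SOME k. (i, k) \<in> Q\<^sup>*)" for i
 have rep: "(i, rep i) \<in> Q\<^sup>*" for i unfolding rep_def by (rule someI[of _ i]) simp
 have rep_eq: "rep i = rep j" if "(i, j) \<in> Q\<^sup>*" for i j
 proof -
  have "(i, k) \<in> Q\<^sup>* \<longleftrightarrow> (j, k) \<in> Q\<^sup>*" for k using that symQ by (meson rtrancl_trans symD)
  then show ?thesis by (simp add: rep_def)
 qed
 \<comment> \<open>A chain from a point to its representative can be shortened to at most
   \<open>card Q\<close> links of length at most \<open>R\<close>; this is where the factor
   \<open>(card J)^2\<close> comes from.\<close>
 have card: "card Q <= (card J)\<^sup>2"
  using card_mono[OF _ Q] assms(1) by (simp add: card_cartesian_product power2_eq_square)
 have near: "norm (x i - x (rep i)) <= (real (card J))\<^sup>2 * R" for i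
 proof -
  obtain n where n: "n <= card Q" "(i, rep i) \<in> Q ^^ n" using rep[of i] rtrancl_finite_eq_relpow[OF fQ] by auto
  have "norm (x i - x (rep i)) <= real n * R" by (rule relpow_dist[OF _ n(2)]) (auto simp: Q_def)
  also have "... <= (real (card J))\<^sup>2 * R"
  proof (rule mult_right_mono[OF _ assms(2)])
   have "real n <= real ((card J)\<^sup>2)" using n(1) card by (simp only: of_nat_le_iff)
   then show "real n <= (real (card J))\<^sup>2" by simp
  qed
  finally show ?thesis .
 qed
 define y where "y i = x i + mu *. (x i - x (rep i))" for i
 show thesis
 proof (rule that)
  show "norm (y i - x i) <= mu * ((real (card J))\<^sup>2 * R)" for i
   using mult_left_mono[OF near assms(3), of i] assms(3) by (simp add: y_def)
  show "y i - y j = (1 + mu) *. (x i - x j) | R < norm (x i - x j)" if "i \<in> J" "j \<in> J" for i j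
  proof (rule disjCI)
   assume "\<not> R < norm (x i - x j)"
   then have "(i, j) \<in> Q\<^sup>*" using that by (intro r_into_rtrancl) (simp add: Q_def)
   from rep_eq[OF this] show "y i - y j = (1 + mu) *. (x i - x j)" by (simp add: y_def algebra_simps)
  qed
 qed
qed

section \<open>Gluing diffeomorphisms\<close>

lemma disjoint_neighbourhoods:
 fixes A :: "'i => 'a::euclidean_space set"
 assumes "finite J" "!!i. i \<in> J ==> compact (A i)" "!!i j. i \<in> J ==> j \<in> J ==> i ~= j ==> A i \<inter> A j = {}"
 obtains N where "!!i. i \<in> J ==> open (N i) & A i \<subseteq> N i" "!!i j. i \<in> J ==> j \<in> J ==> i ~= j ==> N i \<inter> N j = {}"
proof -
 have "EX d>0. \<forall>x\<in>A i. \<forall>y\<in>A j. d <= dist x y" if "i \<in> J" "j \<in> J" "i ~= j" for i j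
  using separate_compact_closed[OF assms(2)[OF that(1)] compact_imp_closed[OF assms(2)[OF that(2)]] assms(3)[OF that]] by blast
 then obtain d where d: "!!i j. i \<in> J ==> j \<in> J ==> i ~= j ==> 0 < d i j & (\<forall>x\<in>A i. \<forall>y\<in>A j. d i j <= dist x y)" by metis
 define e where "e = Min (insert 1 ((%(i, j). d i j) ` {(i, j) \<in> J \<times> J. i ~= j}))"
 have fin: "finite ((%(i, j). d i j) ` {(i, j) \<in> J \<times> J. i ~= j})"
  by (rule finite_imageI, rule finite_subset[OF _ finite_cartesian_product[OF assms(1) assms(1)]]) auto
 have e0: "0 < e" unfolding e_def using fin d by (subst Min_gr_iff) auto
 have e: "e <= dist x y" if "i \<in> J" "j \<in> J" "i ~= j" "x \<in> A i" "y \<in> A j" for i j x y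
 proof -
  have "e <= d i j" unfolding e_def using fin that(1-3) by (intro Min_le) force+
  then show ?thesis using d[OF that(1-3)] that(4,5) by force
 qed
 show thesis
 proof (rule that[of "%i. \<Union>x\<in>A i. ball x (e / 2)"])
  show "open (\<Union>x\<in>A i. ball x (e / 2)) & A i \<subseteq> (\<Union>x\<in>A i. ball x (e / 2))" for i using e0 by force
  show "(\<Union>x\<in>A i. ball x (e / 2)) \<inter> (\<Union>x\<in>A j. ball x (e / 2)) = {}" if "i \<in> J" "j \<in> J" "i ~= j" for i j
  proof (rule ccontr)
   assume "(\<Union>x\<in>A i. ball x (e / 2)) \<inter> (\<Union>x\<in>A j. ball x (e / 2)) ~= {}"
   then obtain z x y where z: "x \<in> A i" "y \<in> A j" "dist x z < e / 2" "dist y z < e / 2" by auto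
   then have "dist x y < e" using dist_triangle_half_r[of z x e y] by (simp add: dist_commute)
   then show False using e[OF that z(1,2)] by simp
  qed
 qed
qed

lemma closure_finite_UN: "finite I ==> closure (\<Union>i\<in>I. A i) = (\<Union>i\<in>I. closure (A i))"
 by (induction rule: finite_induct) (simp_all add: closure_Un)

text \<open>The diffeomorphism of each piece is restricted to \<open>U i\<close>, the part of a
  neighbourhood \<open>N i\<close> of the closed piece that is mapped into the neighbourhood
  \<open>M i\<close> of the target. Both families are disjoint, so the restrictions glue to one map
  with an inverse.\<close>

lemma diffeomorphic_domains_union:
 fixes A B :: "'i => (real^2) set"
 assumes fin: "finite J" and cA: "!!i. i \<in> J ==> bounded (A i)" and cB: "!!i. i \<in> J ==> bounded (B i)"
  and dA: "!!i j. i \<in> J ==> j \<in> J ==> i ~= j ==> closure (A i) \<inter> closure (A j) = {}"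
  and dB: "!!i j. i \<in> J ==> j \<in> J ==> i ~= j ==> closure (B i) \<inter> closure (B j) = {}"
  and h: "!!i. i \<in> J ==> EX Th Xi. homeomorphism UNIV UNIV Th Xi & C2_on UNIV Th & C2_on UNIV Xi &
   Th ` A i = interior (B i) & Th ` closure (A i) = closure (B i)"
  and E: "E = (\<Union>i\<in>J. A i)" "open E" and F: "F = (\<Union>i\<in>J. B i)"
 shows "diffeomorphic_domains E F"
proof -
 obtain Th Xi where h: "!!i. i \<in> J ==> homeomorphism UNIV UNIV (Th i) (Xi i) & C2_on UNIV (Th i) & C2_on UNIV (Xi i) &
   Th i ` A i = interior (B i) & Th i ` closure (A i) = closure (B i)" using h by metis
 obtain N where N: "!!i. i \<in> J ==> open (N i) & closure (A i) \<subseteq> N i" "!!i j. i \<in> J ==> j \<in> J ==> i ~= j ==> N i \<inter> N j = {}"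
  by (rule disjoint_neighbourhoods[of J "%i. closure (A i)"]) (use fin cA dA in \<open>auto simp: compact_closure\<close>)
 obtain M where M: "!!i. i \<in> J ==> open (M i) & closure (B i) \<subseteq> M i" "!!i j. i \<in> J ==> j \<in> J ==> i ~= j ==> M i \<inter> M j = {}"
  by (rule disjoint_neighbourhoods[of J "%i. closure (B i)"]) (use fin cB dB in \<open>auto simp: compact_closure\<close>)
 define U where "U i = N i \<inter> Th i -` M i" for i
 define V where "V i = M i \<inter> Xi i -` N i" for i
 have inv: "Xi i (Th i z) = z" "Th i (Xi i z) = z" if "i \<in> J" for i z using h[OF that] by (auto simp: homeomorphism_def)
 have cont: "continuous_on UNIV (Th i)" "continuous_on UNIV (Xi i)" if "i \<in> J" for i using h[OF that] by (auto simp: homeomorphism_def)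
 have oU: "open (U i)" "open (V i)" if "i \<in> J" for i
  using N(1)[OF that] M(1)[OF that]
  by (auto simp: U_def V_def intro!: open_Int open_vimage cont[OF that])
 have UV: "z \<in> U i \<longleftrightarrow> Th i z \<in> V i" "w \<in> V i \<longleftrightarrow> Xi i w \<in> U i" if "i \<in> J" for i z w
  using inv[OF that] by (auto simp: U_def V_def)
 have AU: "closure (A i) \<subseteq> U i" and BV: "closure (B i) \<subseteq> V i" if i: "i \<in> J" for i
 proof -
  show AU: "closure (A i) \<subseteq> U i" using N(1)[OF i] M(1)[OF i] h[OF i] unfolding U_def by blast
  show "closure (B i) \<subseteq> V i"
  proof
   fix w assume "w \<in> closure (B i)"
   then obtain z where "z \<in> closure (A i)" "w = Th i z" using h[OF i] by blast
   then show "w \<in> V i" using AU UV(1)[OF i] by blast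
  qed
 qed
 define ix where "ix z = (SOME i. i \<in> J & z \<in> U i)" for z
 define jx where "jx z = (SOME i. i \<in> J & z \<in> V i)" for z
 have ix: "ix z = i" if "i \<in> J" "z \<in> U i" for i z
 proof -
  have "ix z \<in> J & z \<in> U (ix z)" unfolding ix_def by (rule someI[of _ i]) (use that in simp)
  then show ?thesis using that N(2)[of "ix z" i] by (auto simp: U_def)
 qed
 have jx: "jx z = i" if "i \<in> J" "z \<in> V i" for i z
 proof -
  have "jx z \<in> J & z \<in> V (jx z)" unfolding jx_def by (rule someI[of _ i]) (use that in simp)
  then show ?thesis using that M(2)[of "jx z" i] by (auto simp: V_def)
 qed
 define Phi where "Phi z = Th (ix z) z" for z
 define Psi where "Psi z = Xi (jx z) z" for z
 have Phi: "Phi z = Th i z" if "i \<in> J" "z \<in> U i" for i z using ix[OF that] by (simp add: Phi_def)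
 have Psi: "Psi z = Xi i z" if "i \<in> J" "z \<in> V i" for i z using jx[OF that] by (simp add: Psi_def)
 let ?U = "\<Union>i\<in>J. U i" and ?V = "\<Union>i\<in>J. V i"
 have C2Phi: "C2_on ?U Phi"
 proof (rule C2_on_local)
  fix z assume "z \<in> ?U"
  then obtain i where i: "i \<in> J" "z \<in> U i" by blast
  show "EX S. open S & z \<in> S & C2_on S Phi"
   using oU(1)[OF i(1)] i C2_on_cong[OF oU(1)[OF i(1)], of Phi "Th i"] Phi[OF i(1)] C2_on_subset[of UNIV "Th i" "U i"] h[OF i(1)]
   by (intro exI[of _ "U i"]) auto
 qed
 have C2Psi: "C2_on ?V Psi"
 proof (rule C2_on_local)
  fix z assume "z \<in> ?V"
  then obtain i where i: "i \<in> J" "z \<in> V i" by blast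
  show "EX S. open S & z \<in> S & C2_on S Psi"
   using oU(2)[OF i(1)] i C2_on_cong[OF oU(2)[OF i(1)], of Psi "Xi i"] Psi[OF i(1)] C2_on_subset[of UNIV "Xi i" "V i"] h[OF i(1)]
   by (intro exI[of _ "V i"]) auto
 qed
 have imPhi: "Phi ` ?U = ?V" and imPsi: "Psi ` ?V = ?U" and invPhi: "!!z. z \<in> ?U ==> Psi (Phi z) = z" and invPsi: "!!z. z \<in> ?V ==> Phi (Psi z) = z"
 proof -
  have a: "Phi z \<in> V i & Psi (Phi z) = z" if "i \<in> J" "z \<in> U i" for i z
   using that Phi[OF that] Psi[of i "Th i z"] UV(1)[of i z] inv by simp
  have b: "Psi z \<in> U i & Phi (Psi z) = z" if "i \<in> J" "z \<in> V i" for i z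
   using that Psi[OF that] Phi[of i "Xi i z"] UV(2)[of i z] inv by simp
  show i1: "!!z. z \<in> ?U ==> Psi (Phi z) = z" using a by blast
  show i2: "!!z. z \<in> ?V ==> Phi (Psi z) = z" using b by blast
  have "Phi z \<in> ?V" if "z \<in> ?U" for z using a that by blast
  moreover have "Psi z \<in> ?U" if "z \<in> ?V" for z using b that by blast
  ultimately show "Phi ` ?U = ?V" "Psi ` ?V = ?U" using i1 i2 by (fast intro: image_eqI[OF sym])+
 qed
 have cE: "closure E = (\<Union>i\<in>J. closure (A i))" unfolding E(1) by (rule closure_finite_UN[OF fin])
 have cF: "closure F = (\<Union>i\<in>J. closure (B i))" unfolding F by (rule closure_finite_UN[OF fin])
 have iF: "interior F = (\<Union>i\<in>J. interior (B i))"
 proof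
  show "(\<Union>i\<in>J. interior (B i)) \<subseteq> interior F" by (rule interior_maximal) (use interior_subset F in \<open>blast+\<close>)
  show "interior F \<subseteq> (\<Union>i\<in>J. interior (B i))"
  proof
   fix z assume z: "z \<in> interior F"
   then obtain i where i: "i \<in> J" "z \<in> B i" using interior_subset F by blast
   have "open (M i \<inter> interior F)" using M(1)[OF i(1)] by auto
   moreover have "M i \<inter> interior F \<subseteq> B i"
   proof
    fix w assume w: "w \<in> M i \<inter> interior F"
    then obtain j where j: "j \<in> J" "w \<in> B j" using interior_subset F by blast
    then have "w \<in> M j" using M(1)[OF j(1)] closure_subset by blast
    then show "w \<in> B i" using M(2)[of i j] i j w by blast
   qed
   moreover have "z \<in> M i" using M(1)[OF i(1)] closure_subset i(2) by blast
   ultimately show "z \<in> (\<Union>i\<in>J. interior (B i))" using z i(1) interior_maximal by blast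
  qed
 qed
 have img: "Phi ` (\<Union>i\<in>J. S i) = (\<Union>i\<in>J. Th i ` S i)" if "!!i. i \<in> J ==> S i \<subseteq> U i" for S
 proof -
  have "Phi ` S i = Th i ` S i" if "i \<in> J" for i using Phi[OF that] \<open>!!i. i \<in> J ==> S i \<subseteq> U i\<close>[OF that] by (intro image_cong) auto
  then show ?thesis by (simp add: image_UN)
 qed
 have h1: "Th i ` A i = interior (B i)" "Th i ` closure (A i) = closure (B i)" if "i \<in> J" for i using h[OF that] by auto
 show ?thesis
  unfolding diffeomorphic_domains_def
 proof (rule exI[of _ ?U], rule exI[of _ ?V], rule exI[of _ Phi], rule exI[of _ Psi], intro conjI)
  show "open ?U" "open ?V" using oU by auto
  show "closure E \<subseteq> ?U" unfolding cE by (rule UN_mono[OF subset_refl AU])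
  show "closure F \<subseteq> ?V" unfolding cF by (rule UN_mono[OF subset_refl BV])
  have "continuous_on ?U Phi" "continuous_on ?V Psi"
   using C1_on_imp_continuous_on[OF C2_on_imp_C1_on[OF C2Phi]] C1_on_imp_continuous_on[OF C2_on_imp_C1_on[OF C2Psi]] by auto
  then show "homeomorphism ?U ?V Phi Psi" unfolding homeomorphism_def using imPhi imPsi invPhi invPsi by auto
  show "Phi ` interior E = interior F"
  proof -
   have "Phi ` (\<Union>i\<in>J. A i) = (\<Union>i\<in>J. Th i ` A i)"
    by (rule img) (rule order_trans[OF closure_subset AU])
   then show ?thesis by (simp add: iF h1 interior_open[OF E(2)] E(1)[symmetric])
  qed
  show "Phi ` closure E = closure F" using img[of "%i. closure (A i)"] AU by (simp add: cE cF h1)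
 qed (fact C2Phi C2Psi)+
qed

context closed_curve begin

text \<open>Integrands built from the normal are known only through their values along the
  parametrization; continuity on the range follows from \<open>near_range\<close>.\<close>

lemma integral_parametrized:
 fixes h :: "real^2 => real"
 assumes h: "!!s. h (c s) = k s" and k: "continuous_on UNIV k"
 shows "set_integrable hausdorff1 (range c) h"
  and "(LINT x:range c|hausdorff1. h x) = integral {0..T} (%s. norm (c' s) * k s)"
proof -
 have "continuous_on (range c) h"
  unfolding continuous_on_iff
 proof (intro ballI allI impI)
  fix p and e :: real assume "p \<in> range c" and e: "0 < e"
  then obtain s where p: "p = c s" by blast
  have "isCont k s" using k by (simp add: continuous_on_eq_continuous_at)
  then obtain d where d: "0 < d" "!!t. dist t s < d ==> dist (k t) (k s) < e"
   using e unfolding continuous_at_eps_delta by blast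
  obtain dl where dl: "0 < dl" "!!y. y \<in> range c ==> dist y (c s) < dl ==> EX t. \<bar>t - s\<bar> < d & y = c t"
   using near_range[OF d(1), of s] by blast
  show "EX d>0. \<forall>y\<in>range c. dist y p < d --> dist (h y) (h p) < e"
  proof (rule exI[of _ dl], intro conjI ballI impI dl(1))
   fix y assume "y \<in> range c" "dist y p < dl"
   then obtain t where "\<bar>t - s\<bar> < d" "y = c t" using dl(2) p by blast
   then show "dist (h y) (h p) < e" using d(2)[of t] by (simp add: p h dist_real_def)
  qed
 qed
 from hausdorff1_integral[OF this] show "set_integrable hausdorff1 (range c) h"
  "(LINT x:range c|hausdorff1. h x) = integral {0..T} (%s. norm (c' s) * k s)" by (simp_all add: h)
qed

end

section \<open>Domains bounded by finitely many curves\<close>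

text \<open>The components of the frontier are their own indices, and \<open>c\<close>,
  \<open>c'\<close>, \<open>c''\<close>, \<open>T\<close> pick one parametrization for each.\<close>

locale curve_domain = anisotropy +
 fixes E :: "(real^2) set" and c c' c'' :: "(real^2) set => real => real^2" and T :: "(real^2) set => real"
 assumes open_E: "open E" and bounded_E: "bounded E" and nonempty: "E ~= {}"
  and fin: "finite (components (frontier E))"
  and curve: "!!C. C \<in> components (frontier E) ==> boundary_curve E (c C) (c' C) (c'' C) (T C)"
  and range_c: "!!C. C \<in> components (frontier E) ==> range (c C) = C"
begin

abbreviation J where "J \<equiv> components (frontier E)"
abbreviation ang where "ang C \<equiv> framed_curve.ang (c' C) (c'' C)"
abbreviation cur where "cur C \<equiv> framed_curve.cur gam gam2 (c' C) (c'' C)"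

lemma framed: "C \<in> J ==> framed_curve \<phi> gam gam1 gam2 k0 Lam (c C) (c' C) (T C) (c'' C)"
 using curve[of C] anisotropy_axioms unfolding boundary_curve_def framed_curve_def framed_curve_axioms_def by blast

lemma normal: "C \<in> J ==> is_outer_normal E (c C s) (ev (ang C s))" "C \<in> J ==> outer_normal E (c C s) = ev (ang C s)"
proof -
 assume C: "C \<in> J"
 interpret B: framed_curve \<phi> gam gam1 gam2 k0 Lam "c C" "c' C" "T C" "c'' C" by (rule framed[OF C])
 show "is_outer_normal E (c C s) (ev (ang C s))" "outer_normal E (c C s) = ev (ang C s)"
  using curve[OF C] by (simp_all add: boundary_curve_def B.normal_ev)
qed

lemma c_mem: "C \<in> J ==> c C s \<in> C" using range_c by blast

lemma C_frontier: "C \<in> J ==> C \<subseteq> frontier E" by (rule in_components_subset)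

text \<open>Along the curve \<open>grad \<phi>\<close> of the normal is \<open>Y (ang C t)\<close>,
  so its tangential derivative is read off from \<open>dYang\<close>.\<close>

lemma curvature: "C \<in> J ==> aniso_curvature \<phi> E (c C s) = cur C s"
proof -
 assume C: "C \<in> J"
 interpret B: framed_curve \<phi> gam gam1 gam2 k0 Lam "c C" "c' C" "T C" "c'' C" by (rule framed[OF C])
 let ?f = "%y. grad \<phi> (outer_normal E y)"
 have f: "?f (c C t) = Y (ang C t)" for t by (simp add: normal(2)[OF C] grad_ev)
 have df: "((%t. ?f (c C t)) hvd cur C s *. c' C s) (at s)" unfolding f by (rule B.dYang)
 have near: "EX dl>0. \<forall>y\<in>frontier E. dist y (c C s) < dl --> (EX t. \<bar>t - s\<bar> < eps & y = c C t)" if "0 < eps" for eps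
  using curve[OF C] that by (simp add: boundary_curve_def)
 have "?f differentiable (at (c C s) within frontier E)"
  using has_derivative_within_curve[OF B.der B.nz near df] by (auto simp: differentiable_def)
 moreover have "\<forall>\<^sub>F t in nhds s. c C t \<in> frontier E" using c_mem[OF C] C_frontier[OF C] by (auto intro!: always_eventually)
 ultimately have "tangential_deriv (frontier E) ?f (c C s) (c' C s) = cur C s *. c' C s"
  by (rule tangential_deriv_curve[OF _ _ B.der df])
 moreover have "unit_tangent E (c C s) = c' C s" by (simp add: unit_tangent_def normal(2)[OF C] B.c'_ev)
 ultimately show ?thesis using B.unit[of s] by (simp add: aniso_curvature_def norm_eq_1)
qed

lemma frontier_integral:
 fixes h :: "real^2 => real"
 assumes h: "!!C s. C \<in> J ==> h (c C s) = k C s" and k: "!!C. C \<in> J ==> continuous_on UNIV (k C)"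
 shows "(LINT x:frontier E|hausdorff1. h x) = (\<Sum>C\<in>J. integral {0..T C} (k C))"
proof -
 have *: "set_integrable hausdorff1 C h & (LINT x:C|hausdorff1. h x) = integral {0..T C} (k C)" if C: "C \<in> J" for C
 proof -
  interpret B: framed_curve \<phi> gam gam1 gam2 k0 Lam "c C" "c' C" "T C" "c'' C" by (rule framed[OF C])
  show ?thesis using B.integral_parametrized[OF h[OF C] k[OF C]] range_c[OF C] by (simp add: B.unit)
 qed
 have U: "frontier E = (\<Union>C\<in>J. C)" using Union_components[of "frontier E"] by simp
 have disj: "disjoint_family_on (%C. C) J"
  unfolding disjoint_family_on_def using components_nonoverlap[of _ "frontier E"] by blast
 have sets: "C \<in> sets hausdorff1" if "C \<in> J" for C
 proof -
  have "closed C" by (rule closed_components[OF frontier_closed that])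
  then show ?thesis by (simp add: sets_hausdorff1)
 qed
 have "(LINT x:(\<Union>C\<in>J. C)|hausdorff1. h x) = (\<Sum>C\<in>J. LINT x:C|hausdorff1. h x)"
  by (rule set_integral_finite_Union[OF fin disj]) (use * sets in auto)
 also have "... = (\<Sum>C\<in>J. integral {0..T C} (k C))" using * by (intro sum.cong) auto
 finally show ?thesis by (simp only: U[symmetric])
qed

lemma T_pos: "C \<in> J ==> 0 < T C"
 using framed[of C] closed_curve.T_pos[of "c C" "c' C" "T C"] unfolding framed_curve_def by blast

lemma J_nonempty: "J ~= {}"
proof
 assume "J = {}"
 then have "frontier E = {}" using Union_components[of "frontier E"] by simp
 then have "E = UNIV" using nonempty frontier_eq_empty by blast
 then show False using bounded_E not_bounded_UNIV by blast
qed

lemma length: "measure hausdorff1 (frontier E) = (\<Sum>C\<in>J. T C)"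
proof -
 have "(LINT x:frontier E|hausdorff1. (1::real)) = measure hausdorff1 (frontier E)"
  by (simp add: set_lebesgue_integral_def space_hausdorff1)
 moreover have "(LINT x:frontier E|hausdorff1. (1::real)) = (\<Sum>C\<in>J. integral {0..T C} (%_. 1))"
  by (rule frontier_integral[where h = "%_. 1" and k = "%_ _. 1"]) auto
 ultimately show ?thesis using T_pos by (simp add: less_imp_le)
qed

lemma cont_ang: "C \<in> J ==> continuous_on A (ang C)" and cont_cur: "C \<in> J ==> continuous_on A (cur C)"
 using framed framed_curve.cont_ang framed_curve.cont_cur by metis+

lemma cont_gamang: "C \<in> J ==> continuous_on A (%s. gam (ang C s))"
 by (rule continuous_on_compose2[OF cont_gam[of UNIV] cont_ang]) auto

lemma perimeter: "aniso_perimeter \<phi> E = (\<Sum>C\<in>J. integral {0..T C} (%s. gam (ang C s)))"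
 unfolding aniso_perimeter_def by (rule frontier_integral) (simp_all add: normal(2) gam cont_gamang)

definition a :: real where "a = mean_aniso_curvature \<phi> E"
definition dl :: real where "dl = curvature_deficit \<phi> E"
definition L :: real where "L = (\<Sum>C\<in>J. T C)"

lemma L_pos: "0 < L" unfolding L_def using fin J_nonempty T_pos by (intro sum_pos) auto

lemma T_le_L: "C \<in> J ==> T C <= L"
 unfolding L_def by (rule member_le_sum) (use fin T_pos in \<open>auto simp: less_imp_le\<close>)

lemma mean: "a * L = (\<Sum>C\<in>J. integral {0..T C} (cur C))"
proof -
 have "(LINT x:frontier E|hausdorff1. aniso_curvature \<phi> E x) = (\<Sum>C\<in>J. integral {0..T C} (cur C))"
  by (rule frontier_integral) (simp_all add: curvature cont_cur)
 then show ?thesis using L_pos by (simp add: a_def mean_aniso_curvature_def length L_def)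
qed

lemma deficit_nonneg: "0 <= dl"
 unfolding dl_def curvature_deficit_def set_lebesgue_integral_def
 by (intro real_sqrt_ge_zero integral_nonneg_AE) (auto simp: indicator_def)

lemma deficit: "dl\<^sup>2 = (\<Sum>C\<in>J. integral {0..T C} (%s. (cur C s - a)\<^sup>2))"
proof -
 have "(LINT x:frontier E|hausdorff1. (aniso_curvature \<phi> E x - a)\<^sup>2) = (\<Sum>C\<in>J. integral {0..T C} (%s. (cur C s - a)\<^sup>2))"
  by (rule frontier_integral) (auto simp: curvature intro!: continuous_intros cont_cur)
 moreover have "0 <= (\<Sum>C\<in>J. integral {0..T C} (%s. (cur C s - a)\<^sup>2))"
  by (intro sum_nonneg integral_nonneg integrable_continuous_real) (auto intro!: continuous_intros cont_cur)
 ultimately show ?thesis by (simp add: dl_def curvature_deficit_def a_def)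
qed

lemma component_deficit: "C \<in> J ==> integral {0..T C} (%s. (cur C s - a)\<^sup>2) <= dl\<^sup>2"
 unfolding deficit
 by (rule member_le_sum[where f = "%C. integral {0..T C} (%s. (cur C s - a)\<^sup>2)"])
   (use fin in \<open>auto intro!: integral_nonneg integrable_continuous_real continuous_intros cont_cur\<close>)

end

section \<open>Domains with small deficit: sign of the mean and decomposition into star-shaped
  pieces\<close>

locale near_critical_domain = curve_domain +
 fixes m0 L1 :: real
 assumes m0: "0 < m0" "!!t. m0 <= gam t"
  and perimeter_le: "aniso_perimeter \<phi> E <= m0 * L1"
  and small: "dl * sqrt L1 <= k0 / 4" "dl * sqrt L1 <= lW / 2" "dl * sqrt L1 <= m0 / 8"
begin

definition eta :: real where "eta = dl * sqrt L1"

text \<open>The lower bound \<open>m0\<close> on the integrand turns the perimeter bound into a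
  length bound.\<close>

lemma L_le: "L <= L1"
proof -
 have "m0 * L = (\<Sum>C\<in>J. m0 * T C)" by (simp add: L_def sum_distrib_left)
 also have "... <= (\<Sum>C\<in>J. integral {0..T C} (%s. gam (ang C s)))"
 proof (rule sum_mono)
  fix C assume C: "C \<in> J"
  have "integral {0..T C} (%s. m0) <= integral {0..T C} (%s. gam (ang C s))"
   by (intro integral_le integrable_continuous_real cont_gamang C) (auto simp: m0)
  then show "m0 * T C <= integral {0..T C} (%s. gam (ang C s))" using T_pos[OF C] by (simp add: mult.commute)
 qed
 also have "... <= m0 * L1" using perimeter_le by (simp add: perimeter)
 finally show ?thesis using m0(1) by simp
qed

lemma T_le: "C \<in> J ==> T C <= L1" using T_le_L L_le by fastforce

lemma eta_nonneg: "0 <= eta" using deficit_nonneg L_pos L_le by (simp add: eta_def)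

lemma eta_le: "C \<in> J ==> dl * sqrt (T C) <= eta"
 unfolding eta_def using T_le deficit_nonneg by (intro mult_left_mono) auto

lemma near: "C \<in> J ==> near_wulff_curve \<phi> gam gam1 gam2 k0 Lam (c C) (c' C) (T C) (c'' C) a dl m0"
proof -
 assume C: "C \<in> J"
 have "dl * sqrt (T C) <= k0 / 4" "dl * sqrt (T C) <= lW / 2" "dl * sqrt (T C) <= m0 / 2"
  using eta_le[OF C] small m0(1) by (auto simp: eta_def)
 then show ?thesis
  unfolding near_wulff_curve_def near_wulff_curve_axioms_def
  using framed[OF C] deficit_nonneg component_deficit[OF C] m0 by blast
qed

text \<open>If the mean were negative, every boundary curve would turn clockwise; compare the point of largest
 abscissa with a point of the same component where the normal is opposite.\<close>

lemma a_pos: "0 < a"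
proof (rule ccontr)
 assume "\<not> 0 < a"
 obtain C0 where "C0 \<in> J" using J_nonempty by blast
 then have "a ~= 0" using near_wulff_curve.a_nonzero near by metis
 then have neg: "a < 0" using \<open>\<not> 0 < a\<close> by simp
 have "compact (closure E)" using bounded_E by (simp add: compact_closure)
 moreover have "closure E ~= {}" using nonempty by simp
 moreover have "continuous_on (closure E) (%x. x \<bullet> ev 0)" by (intro continuous_intros)
 ultimately obtain p where p: "p \<in> closure E" "!!y. y \<in> closure E ==> y \<bullet> ev 0 <= p \<bullet> ev 0"
  using continuous_attains_sup[of "closure E" "%x. x \<bullet> ev 0"] by blast
 have "p \<notin> E"
 proof
  assume "p \<in> E"
  then obtain e where e: "0 < e" "ball p e \<subseteq> E" using open_E openE by blast
  have "p + (e / 2) *. ev 0 \<in> ball p e" using e(1) by (simp add: dist_norm)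
  then have "p + (e / 2) *. ev 0 \<in> closure E" using e(2) closure_subset by blast
  then show False using p(2)[of "p + (e / 2) *. ev 0"] e(1) by (simp add: inner_add_left ev_inner_ev)
 qed
 then have "p \<in> frontier E" using p(1) open_E by (simp add: frontier_def interior_open)
 then obtain C where C: "C \<in> J" "p \<in> C" using Union_components[of "frontier E"] by blast
 interpret B: near_wulff_curve \<phi> gam gam1 gam2 k0 Lam "c C" "c' C" "T C" "c'' C" a dl m0 by (rule near[OF C(1)])
 obtain s0 where s0: "p = c C s0" using C range_c by blast
 have max: "c C s \<bullet> ev 0 <= c C s0 \<bullet> ev 0" for s
 proof -
  have "c C s \<in> closure E" using c_mem[OF C(1)] C_frontier[OF C(1)] by (auto simp: frontier_def)
  then show ?thesis using p(2) s0 by blast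
 qed
 have "((%s. c C s \<bullet> ev 0) hrd c' C s0 \<bullet> ev 0) (at s0)"
  using bounded_linear_hvd[OF bounded_linear_inner_left B.der]
  by (simp add: hrd_iff_hvd)
 then have "c' C s0 \<bullet> ev 0 = 0" by (rule DERIV_local_max[OF _ zero_less_one]) (use max in blast)
 then have sin0: "ev (ang C s0) \<bullet> rot90 (ev 0) = 0"
  by (simp add: B.c'_ev) (metis inner_commute neg_equal_0_iff_equal rot90_inner_left)
 have "\<forall>\<^sub>F t in at_right 0. c C s0 - t *. ev (ang C s0) \<in> interior E"
  using normal(1)[OF C(1), of s0] unfolding is_outer_normal_def by (auto elim: eventually_mono)
 then obtain b where b: "0 < b" "!!t. 0 < t ==> t < b ==> c C s0 - t *. ev (ang C s0) \<in> interior E"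
  unfolding eventually_at_right_field by auto
 have "c C s0 - (b / 2) *. ev (ang C s0) \<in> interior E" using b(1) by (intro b(2)) auto
 then have "c C s0 - (b / 2) *. ev (ang C s0) \<in> closure E" using interior_subset closure_subset by blast
 from p(2)[OF this] have "0 <= (b / 2) * (ev (ang C s0) \<bullet> ev 0)" by (simp add: s0 inner_diff_left)
 then have cos0: "0 <= ev (ang C s0) \<bullet> ev 0" using b(1) by (simp add: zero_le_mult_iff)
 have eq: "ev (ang C s0) = ev 0"
 proof -
  have d: "ev (ang C s0) = (ev (ang C s0) \<bullet> ev 0) *. ev 0" using ev_decomp[of "ev (ang C s0)" 0] sin0 by simp
  then have "norm ((ev (ang C s0) \<bullet> ev 0) *. ev 0) = 1" by (metis norm_ev)
  then have "ev (ang C s0) \<bullet> ev 0 = 1" using cos0 by (simp del: ev_inner_ev)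
  then show ?thesis using d by simp
 qed
 have n: "B.n <= -1" by (rule B.n_sign(2)[OF neg])
 \<comment> \<open>Surjectivity of quasi-periodic functions is available for a positive increment,
   whence the sign.\<close>
 have "surj (%s. - ang C s)"
 proof (rule surj_quasi_periodic[where A = "%s. - ang C s" and T = "T C" and L = "- (2 * pi * of_int B.n)"])
  show "continuous_on UNIV (%s. - ang C s)" by (intro continuous_intros cont_ang C(1))
  show "0 < - (2 * pi * real_of_int B.n)" using n by (simp add: mult_pos_neg)
 qed (simp add: B.ang_T)
 then obtain s1 where "- (ang C s0 + pi) = - ang C s1" by (metis surjD)
 then have s1: "ang C s1 = ang C s0 + pi" by simp
 have Y0: "Y (ang C s0) = Y 0" using eq by (simp add: Y_eq_iff)
 have Y1: "Y (ang C s1) = Y (0 + pi)" unfolding s1 Y_eq_iff ev_plus_pi using eq by simp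
 have "Y (0 + pi) \<bullet> ev 0 = - gam 0"
  using Y_inner(1)[of "0 + pi"] gam_pi[of 0] by (simp only: ev_plus_pi inner_minus_right)
 \<comment> \<open>Passing to the opposite normal changes \<open>Y\<close> by
   \<open>- 2 * gam 0\<close> in this direction. For \<open>a < 0\<close> the term with
   \<open>c\<close> has the same sign, so \<open>ZZ\<close> would oscillate by at least
   \<open>2 * m0\<close>, more than \<open>eta\<close> permits.\<close>
 then have "(B.ZZ s1 - B.ZZ s0) \<bullet> ev 0 = - 2 * gam 0 - a * (c C s1 \<bullet> ev 0 - c C s0 \<bullet> ev 0)"
  unfolding B.ZZ_def Y0 Y1 by (simp add: inner_diff_left Y_inner algebra_simps)
 moreover have "0 <= a * (c C s1 \<bullet> ev 0 - c C s0 \<bullet> ev 0)" using neg max[of s1] by (intro mult_nonpos_nonpos) auto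
 ultimately have "(B.ZZ s1 - B.ZZ s0) \<bullet> ev 0 <= - 2 * m0" using m0(2)[of 0] by simp
 moreover have "\<bar>(B.ZZ s1 - B.ZZ s0) \<bullet> ev 0\<bar> <= eta"
  using Cauchy_Schwarz_ineq2[of "B.ZZ s1 - B.ZZ s0" "ev 0"] B.ZZ_osc[of s1 s0] eta_le[OF C(1)] by (simp add: B.eta_def)
 ultimately show False using small(3) m0(1) by (simp add: eta_def)
qed

lemma positive: "C \<in> J ==> positive_curve \<phi> gam gam1 gam2 k0 Lam (c C) (c' C) (T C) (c'' C) a dl m0"
 unfolding positive_curve_def positive_curve_axioms_def using near a_pos by blast

abbreviation x0 where "x0 C \<equiv> positive_curve.x0 gam gam1 (c C) (c' C) (c'' C) a"

definition S :: "(real^2) set => (real^2) set" where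
 "S C = (%z. x0 C + z) ` star_curve.D (%s. c C s - x0 C)"

end

context anisotropy begin

text \<open>Twice the area of the Wulff shape, which is also its anisotropic perimeter.\<close>

definition omW :: real where "omW = 2 * measure lebesgue W.D"

text \<open>In arc length the integrand of \<open>area_D\<close> for the Wulff shape is
  \<open>gam (u s)\<close>; substituting the normal angle turns it into
  \<open>gam x * g x\<close>.\<close>

lemma wulff_area_antiderivative:
 obtains Gam where "!!x. (Gam hrd gam x * g x) (at x)" "!!x. Gam (x + 2 * pi) = Gam x + omW"
proof -
 have "continuous_on UNIV (%x. gam x * g x)" by (intro continuous_intros cont_gam cont_g)
 then obtain Gam where Gam: "!!x. (Gam hrd gam x * g x) (at x)"
  by (rule ex_real_antiderivative) (rule that, assumption)
 have per: "Gam (x + 2 * pi) = Gam x + (Gam (2 * pi) - Gam 0)" for x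
  using antiderivative_quasi_periodic[of Gam "%x. gam x * g x" "2 * pi", OF Gam] by (simp add: gam_periodic g_periodic)
 have du: "((%y. Gam (u y)) hrd gam (u y)) (at y)" for y
  using DERIV_chain[OF Gam du, of y] g_pos[of "u y"] by (simp add: comp_def)
 have "omW = integral {0..lW} (%s. gam (u s))"
  unfolding omW_def W.area_D by (simp add: rot90_inner_rot90 Z_def Y_inner)
 also have "... = Gam (u lW) - Gam (u 0)" using antiderivative_integral(2)[OF du, of 0 lW] lW_pos by simp
 also have "u lW = u 0 + 2 * pi" using u_periodic[of 0] by simp
 also have "Gam (u 0 + 2 * pi) - Gam (u 0) = Gam (2 * pi) - Gam 0" using per[of "u 0"] by simp
 finally show thesis using that[OF Gam] per by simp
qed

end

context near_critical_domain begin

lemma S_facts: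
 assumes C: "C \<in> J"
 shows S_open: "open (S C)" and S_frontier: "frontier (S C) = C" and S_closure: "closure (S C) = S C \<union> C"
  and S_connected: "connected (S C)" and S_bounded: "bounded (S C)"
  and mem_S: "!!p l. p \<in> C ==> 0 <= l ==> l < 1 ==> x0 C + l *. (p - x0 C) \<in> S C"
  and S_cases: "!!z. z \<in> S C ==> \<exists>p\<in>C. \<exists>l\<ge>0. l < 1 & z = x0 C + l *. (p - x0 C)"
  and S_measure: "measure lebesgue (S C) = measure lebesgue (star_curve.D (%s. c C s - x0 C))"
proof -
 interpret P: positive_curve \<phi> gam gam1 gam2 k0 Lam "c C" "c' C" "T C" "c'' C" a dl m0 by (rule positive[OF C])
 note S_def' = S_def[of C]
 show o: "open (S C)" unfolding S_def' by (rule open_translation[OF P.D.open_D])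
 show "bounded (S C)" unfolding S_def' by (rule bounded_translation[OF P.D.bounded_D])
 show "connected (S C)" unfolding S_def' by (rule connected_continuous_image[OF _ P.D.connected_D]) (intro continuous_intros)
 show "measure lebesgue (S C) = measure lebesgue (star_curve.D (%s. c C s - x0 C))"
  unfolding S_def' by (rule measure_translation)
 have "frontier (S C) = (%z. x0 C + z) ` range (%s. c C s - x0 C)"
  unfolding S_def' by (simp only: frontier_translation P.D.frontier_D)
 also have "... = C" using range_c[OF C] by (simp add: image_image)
 finally show f: "frontier (S C) = C" .
 show "closure (S C) = S C \<union> C" using closure_Un_frontier[of "S C"] f by simp
 show "x0 C + l *. (p - x0 C) \<in> S C" if pl: "p \<in> C" "0 <= l" "l < 1" for p l
 proof -
  obtain s where "p = c C s" using pl(1) range_c[OF C] by blast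
  then show ?thesis unfolding S_def' P.D.D_def using pl by blast
 qed
 show "\<exists>p\<in>C. \<exists>l\<ge>0. l < 1 & z = x0 C + l *. (p - x0 C)" if z: "z \<in> S C" for z
 proof -
  obtain l s where "z = x0 C + l *. (c C s - x0 C)" "0 <= l" "l < 1"
   using z unfolding S_def' P.D.D_def by blast
  then show ?thesis using c_mem[OF C] by blast
 qed
qed

lemma support_bounds:
 assumes C: "C \<in> J"
 shows "z \<in> closure (S C) ==> (z - x0 C) \<bullet> ev t <= (gam t + eta) / a"
  and "(gam (ang C s) - eta) / a <= (c C s - x0 C) \<bullet> ev (ang C s)"
  and "(!!t. (z - x0 C) \<bullet> ev t <= (gam t - eta) / a) ==> z \<in> closure (S C)"
proof -
 interpret P: positive_curve \<phi> gam gam1 gam2 k0 Lam "c C" "c' C" "T C" "c'' C" a dl m0 by (rule positive[OF C])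
 have e: "P.eta <= eta" using eta_le[OF C] by (simp add: P.eta_def)
 have le: "(gam t + P.eta) / a <= (gam t + eta) / a" "(gam t - eta) / a <= (gam t - P.eta) / a" for t
  using e a_pos by (auto intro!: divide_right_mono)
 have cl: "z \<in> closure (S C) \<longleftrightarrow> z - x0 C \<in> closure P.D.D" for z
  unfolding S_def[of C] closure_translation using image_eqI[of z "%y. x0 C + y" "z - x0 C"] by auto
 show "z \<in> closure (S C) ==> (z - x0 C) \<bullet> ev t <= (gam t + eta) / a"
  unfolding cl using P.D_support le(1) by (rule order_trans)
 show "(gam (ang C s) - eta) / a <= (c C s - x0 C) \<bullet> ev (ang C s)"
  using le(2) P.inner_bounds(2) by (rule order_trans)
 show "(!!t. (z - x0 C) \<bullet> ev t <= (gam t - eta) / a) ==> z \<in> closure (S C)"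
  unfolding cl by (rule P.in_closure_D) (rule order_trans[OF _ le(2)])
qed

lemma eta_small: "8 * eta <= m0" using small(3) by (simp add: eta_def)

lemma own_normal: "C \<in> J ==> 0 < (c C s - x0 C) \<bullet> ev (ang C s)"
proof -
 assume C: "C \<in> J"
 have "0 < (gam (ang C s) - eta) / a" using eta_small m0(1) m0(2)[of "ang C s"] a_pos eta_nonneg by (intro divide_pos_pos) linarith+
 then show ?thesis using support_bounds(2)[OF C, of s] by linarith
qed

lemma surj_ang: "C \<in> J ==> EX s. ang C s = t"
 using positive_curve.surj_ang[OF positive] by (metis surjD)

lemma frontier_point: "p \<in> frontier E ==> \<exists>C\<in>J. EX s. p = c C s"
 using Union_components[of "frontier E"] range_c by blast

lemma J_disjoint: "C \<in> J ==> C' \<in> J ==> C ~= C' ==> C \<inter> C' = {}"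
 using components_nonoverlap by blast

text \<open>If \<open>C'\<close> enters the piece of \<open>C\<close> it lies wholly inside.
  Comparing the supporting bounds in all directions, the two centres differ by at most
  \<open>2 * eta / a\<close> in each, so the normals of \<open>C'\<close> also point away from the
  centre of \<open>C\<close>.\<close>

lemma inner_frontier_normal:
 assumes C: "C \<in> J" and C': "C' \<in> J" and p: "c C' s \<in> S C"
 shows "0 < (c C' s - x0 C) \<bullet> ev (ang C' s)"
proof -
 have "C ~= C'"
 proof
  assume "C = C'"
  then have "c C' s \<in> frontier (S C)" using c_mem[OF C'] S_frontier[OF C] by simp
  then show False using p S_open[OF C] by (simp add: frontier_def interior_open)
 qed
 then have "C' \<inter> frontier (S C) = {}" using J_disjoint[OF C C'] S_frontier[OF C] by blast
 moreover have "C' \<inter> S C ~= {}" using p c_mem[OF C'] by blast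
 ultimately have sub: "C' \<subseteq> S C" using connected_Int_frontier[OF in_components_connected[OF C'], of "S C"] by blast
 have d: "(x0 C' - x0 C) \<bullet> ev t <= 2 * eta / a" for t
 proof -
  obtain s' where s': "ang C' s' = t" using surj_ang[OF C'] by blast
  have "c C' s' \<in> closure (S C)" using sub c_mem[OF C'] closure_subset by blast
  from support_bounds(1)[OF C this, of t] support_bounds(2)[OF C', of s']
  have "(c C' s' - x0 C) \<bullet> ev t - (c C' s' - x0 C') \<bullet> ev t <= (gam t + eta) / a - (gam t - eta) / a" by (simp add: s')
  also have "... = 2 * eta / a" by (simp flip: diff_divide_distrib)
  finally show ?thesis by (simp add: inner_diff_left)
 qed
 define t where "t = ang C' s"
 have "- ((x0 C' - x0 C) \<bullet> ev t) <= 2 * eta / a" using d[of "t + pi"] by (simp add: ev_plus_pi)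
 moreover have "(gam t - eta) / a <= (c C' s - x0 C') \<bullet> ev t" unfolding t_def by (rule support_bounds(2)[OF C'])
 moreover have "0 < (gam t - eta) / a - 2 * eta / a"
 proof -
  have "0 < (gam t - eta - 2 * eta) / a" using eta_small m0(1) m0(2)[of t] eta_nonneg a_pos by (intro divide_pos_pos) linarith+
  then show ?thesis by (simp add: diff_divide_distrib)
 qed
 moreover have "(c C' s - x0 C) \<bullet> ev t = (c C' s - x0 C') \<bullet> ev t + (x0 C' - x0 C) \<bullet> ev t" by (simp add: inner_diff_left)
 ultimately show ?thesis unfolding t_def by linarith
qed

lemma frontier_not_E: "p \<in> frontier E ==> p \<notin> E"
 using open_E by (simp add: frontier_def interior_open)

text \<open>Moving from the boundary curve towards the centre one stays in \<open>E\<close>: at the first exit point the outer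
 normal would have to point towards the centre.\<close>

lemma S_subset: assumes C: "C \<in> J" shows "S C \<subseteq> E"
proof (rule subsetI, rule ccontr)
 fix z assume z: "z \<in> S C" "z \<notin> E"
 obtain q l where q: "q \<in> C" and l: "0 <= l" "l < 1" "z = x0 C + l *. (q - x0 C)" using S_cases[OF C z(1)] by blast
 define f where "f l = x0 C + l *. (q - x0 C)" for l
 obtain s where s: "q = c C s" using q range_c[OF C] by blast
 from outer_normal_transversal[OF normal(1)[OF C] own_normal[OF C], of s]
 obtain b where b: "0 < b" "!!t. 0 < t ==> t < b ==> q - t *. (q - x0 C) \<in> interior E"
  unfolding eventually_at_right_field s by auto
 have f1: "f l \<in> E" if "1 - b < l" "l < 1" for l
 proof -
  have "q - (1 - l) *. (q - x0 C) \<in> interior E" using that by (intro b(2)) auto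
  moreover have "q - (1 - l) *. (q - x0 C) = f l" by (simp add: f_def algebra_simps)
  ultimately show ?thesis using interior_subset by auto
 qed
 \<comment> \<open>Parameters at which the segment is outside \<open>E\<close>. Those close to 1 are
   known to be inside, so cutting off there loses nothing and makes \<open>K\<close> compact; its
   maximum is the exit point met first when coming from \<open>q\<close>.\<close>
 define K where "K = {0..1 - min b 1 / 2} \<inter> f -` (- E)"
 have "closed (f -` (- E))" unfolding f_def
  by (intro continuous_closed_vimage) (use open_E in \<open>auto intro!: continuous_intros\<close>)
 then have "compact K" unfolding K_def by (intro compact_Int_closed) auto
 moreover have "l \<in> K"
 proof -
  have "f l \<notin> E" using z(2) l(3) by (simp add: f_def)
  moreover have "l <= 1 - b" using f1[of l] calculation l(2) by force
  ultimately show ?thesis using l b(1) by (auto simp: K_def)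
 qed
 ultimately obtain l0 where l0: "l0 \<in> K" "!!k. k \<in> K ==> k <= l0" using compact_attains_sup[of K] by blast
 have l01: "0 <= l0" "l0 < 1" "f l0 \<notin> E" using l0(1) b(1) by (auto simp: K_def)
 have up: "f k \<in> E" if "l0 < k" "k < 1" for k
 proof (cases "k \<in> {0..1 - min b 1 / 2}")
  case True then show ?thesis using l0(2)[of k] that by (auto simp: K_def)
 next
  case False then show ?thesis using f1[of k] that l01 b(1) by force
 qed
 have "f l0 \<in> closure E"
 proof -
  have "(f \<longlongrightarrow> f l0) (at_right l0)" unfolding f_def by (intro tendsto_intros)
  moreover have "\<forall>\<^sub>F k in at_right l0. f k \<in> closure E"
   unfolding eventually_at_right_field using up l01(2) closure_subset by blast
  ultimately show ?thesis by (intro Lim_in_closed_set[OF closed_closure]) auto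
 qed
 then have fr: "f l0 \<in> frontier E" using l01(3) open_E by (simp add: frontier_def interior_open)
 obtain C' s' where C': "C' \<in> J" "f l0 = c C' s'" using frontier_point[OF fr] by blast
 have inS: "f l0 \<in> S C" unfolding f_def by (rule mem_S[OF C q l01(1,2)])
 have v: "0 < (f l0 - x0 C) \<bullet> ev (ang C' s')" using inner_frontier_normal[OF C C'(1)] inS C'(2) by simp
 then have l0p: "0 < l0" using l01(1) by (cases "l0 = 0") (auto simp: f_def)
 from outer_normal_transversal[OF normal(1)[OF C'(1)] v]
 obtain e where e: "0 < e" "!!t. 0 < t ==> t < e ==> f l0 + t *. (f l0 - x0 C) \<notin> closure E"
  unfolding eventually_at_right_field C'(2)[symmetric] by auto
 define t where "t = min (e / 2) ((1 - l0) / 2)"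
 have t: "0 < t" "t < e" using e(1) l01(2) by (auto simp: t_def)
 have t2: "t <= (1 - l0) / 2" unfolding t_def by (rule min.cobounded2)
 have eq: "f l0 + t *. (f l0 - x0 C) = f (l0 * (1 + t))" by (simp add: f_def algebra_simps)
 have gt: "l0 < l0 * (1 + t)" using l0p t(1) by simp
 have "l0 * t <= t" using l01 t(1) by (intro mult_left_le_one_le) auto
 then have "l0 * (1 + t) < 1" using t2 l0p l01(2) by (simp add: distrib_left)
 from up[OF gt this] have "f l0 + t *. (f l0 - x0 C) \<in> closure E" unfolding eq using closure_subset by blast
 then show False using e(2)[OF t(1,2)] by simp
qed

text \<open>Pieces lie in the open set \<open>E\<close> and so contain no frontier points.
  Overlapping pieces would be nested, which would put the boundary curve of one into the other piece
  or onto its boundary.\<close>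

lemma S_disjoint:
 assumes C: "C \<in> J" "C' \<in> J" "C ~= C'" shows "closure (S C) \<inter> closure (S C') = {}"
proof -
 have d: "S C \<inter> C' = {}" if "C \<in> J" "C' \<in> J" for C C'
  using S_subset[OF that(1)] C_frontier[OF that(2)] frontier_not_E by blast
 have "S C \<inter> S C' = {}"
 proof (rule ccontr)
  assume "S C \<inter> S C' ~= {}"
  moreover have "S C \<inter> frontier (S C') = {}" using d[OF C(1,2)] S_frontier[OF C(2)] by simp
  ultimately have "S C \<subseteq> S C'" using connected_Int_frontier[OF S_connected[OF C(1)], of "S C'"] by blast
  then have "C \<subseteq> S C' \<union> C'" using closure_mono[of "S C" "S C'"] S_closure C by blast
  then have "C = {}" using d[OF C(2,1)] J_disjoint[OF C] by blast
  then show False using C(1) in_components_nonempty by blast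
 qed
 then show ?thesis using d[OF C(1,2)] d[OF C(2,1)] J_disjoint[OF C] S_closure C by auto
qed

text \<open>A point of \<open>E\<close> outside all the star shaped pieces has a nearest boundary point \<open>p\<close>, and there \<open>E\<close>
 lies, near \<open>p\<close>, in the piece bounded by the component of \<open>p\<close>.\<close>

lemma E_eq: "E = (\<Union>C\<in>J. S C)"
proof
 show "(\<Union>C\<in>J. S C) \<subseteq> E" using S_subset by blast
 show "E \<subseteq> (\<Union>C\<in>J. S C)"
 proof (rule subsetI, rule ccontr)
  fix z assume z: "z \<in> E" "z \<notin> (\<Union>C\<in>J. S C)"
  have "frontier E ~= {}" using J_nonempty by (metis components_empty)
  then obtain p where p: "p \<in> frontier E" "!!y. y \<in> frontier E ==> dist z p <= dist z y"
   using distance_attains_inf[OF frontier_closed] by blast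
  define r where "r = dist z p"
  have zp: "z ~= p" using z(1) p(1) frontier_not_E by blast
  then have r: "0 < r" by (simp add: r_def)
  have nf: "ball z r \<inter> frontier E = {}" using p(2) by (force simp: r_def)
  have bE: "ball z r \<subseteq> E"
   using connected_Int_frontier[OF connected_ball, of z r E] nf z(1) r by (metis Diff_eq_empty_iff centre_in_ball disjoint_iff)
  have bS: "ball z r \<inter> S C = {}" if C: "C \<in> J" for C
  proof -
   have "ball z r \<inter> frontier (S C) = {}" using nf C_frontier[OF C] S_frontier[OF C] by blast
   moreover have "z \<in> ball z r - S C" using z(2) C r by simp
   ultimately show ?thesis using connected_Int_frontier[OF connected_ball, of z r "S C"] by blast
  qed
  obtain C s where C: "C \<in> J" "p = c C s" using frontier_point[OF p(1)] by blast
  interpret B: framed_curve \<phi> gam gam1 gam2 k0 Lam "c C" "c' C" "T C" "c'' C" by (rule framed[OF C(1)])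
  have "((%t. c C t - z) hvd c' C s) (at s)"
   using has_vector_derivative_diff[OF B.der has_vector_derivative_const] by simp
  from bounded_bilinear_hvd[OF bounded_bilinear_inner this this]
  have "((%t. (c C t - z) \<bullet> (c C t - z)) hrd 2 * ((c C s - z) \<bullet> c' C s)) (at s)"
   by (simp add: hrd_iff_hvd inner_commute)
  then have "2 * ((c C s - z) \<bullet> c' C s) = 0"
  proof (rule DERIV_local_min[OF _ zero_less_one], intro allI impI)
   fix t :: real
   have "c C t \<in> frontier E" using c_mem[OF C(1)] C_frontier[OF C(1)] by blast
   from p(2)[OF this] have "norm (c C s - z) <= norm (c C t - z)"
    unfolding C(2) by (simp only: dist_norm norm_minus_commute[of z])
   then show "(c C s - z) \<bullet> (c C s - z) <= (c C t - z) \<bullet> (c C t - z)" by (simp add: norm_le)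
  qed
  then have perp: "(p - z) \<bullet> rot90 (ev (ang C s)) = 0" by (simp add: C(2) B.c'_ev)
  define nu where "nu = ev (ang C s)"
  define k where "k = (p - z) \<bullet> nu"
  have pz: "p - z = k *. nu" using ev_decomp[of "p - z" "ang C s"] perp by (simp add: k_def nu_def)
  have nu1: "norm nu = 1" by (simp add: nu_def)
  have kr: "\<bar>k\<bar> = r" using pz nu1 by (simp add: r_def dist_norm norm_minus_commute[of z p])
  \<comment> \<open>Otherwise the outer normal at \<open>p\<close> would point into the ball around
    \<open>z\<close>, which is contained in \<open>E\<close>.\<close>
  have "0 < k"
  proof (rule ccontr)
   assume "\<not> 0 < k"
   then have k: "k = - r" using kr r by linarith
   have "\<forall>\<^sub>F t in at_right 0. p + t *. nu \<notin> closure E"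
    using normal(1)[OF C(1), of s] unfolding is_outer_normal_def C(2) nu_def by (auto elim: eventually_mono)
   then obtain e where e: "0 < e" "!!t. 0 < t ==> t < e ==> p + t *. nu \<notin> closure E"
    unfolding eventually_at_right_field by auto
   define t where "t = min (e / 2) r"
   have t: "0 < t" "t < e" "t <= r" using e(1) r by (auto simp: t_def)
   have "p + t *. nu - z = (k + t) *. nu" using pz by (simp add: algebra_simps)
   then have "p + t *. nu \<in> ball z r" using t nu1 k by (simp add: dist_norm norm_minus_commute[of z])
   then show False using bE e(2)[OF t(1,2)] closure_subset by blast
  qed
  then have k: "k = r" using kr by simp
  define w where "w = p - x0 C"
  have w: "0 < w \<bullet> nu" using own_normal[OF C(1), of s] by (simp add: w_def nu_def C(2))
  then have w0: "0 < norm w" by auto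
  \<comment> \<open>A step towards the centre that stays in the ball: the squared distance to
    \<open>z\<close> becomes \<open>r^2 - 2 * t * r * (w \<bullet> nu) + t^2 * (norm w)^2\<close>,
    which is below \<open>r^2\<close> for this \<open>t\<close>.\<close>
  define t where "t = min 1 (r * (w \<bullet> nu) / (norm w)\<^sup>2)"
  have t: "0 < t" "t <= 1" using r w w0 by (auto simp: t_def)
  have tw: "t * (norm w)\<^sup>2 <= r * (w \<bullet> nu)"
  proof -
   have "t <= r * (w \<bullet> nu) / (norm w)\<^sup>2" by (simp add: t_def)
   then show ?thesis using w0 by (simp add: pos_le_divide_eq)
  qed
  have e: "p - t *. w - z = r *. nu - t *. w" using pz k by (simp add: algebra_simps)
  have "(norm (r *. nu - t *. w))\<^sup>2 = r\<^sup>2 - 2 * (t * (r * (w \<bullet> nu))) + t * (t * (norm w)\<^sup>2)"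
  proof -
   have nn: "nu \<bullet> nu = 1" using nu1 by (simp add: norm_eq_1)
   show ?thesis unfolding power2_norm_eq_inner
    by (simp add: nn inner_diff_left inner_diff_right inner_commute[of nu w] power2_eq_square algebra_simps)
  qed
  also have "... < r\<^sup>2"
  proof -
   have "t * (t * (norm w)\<^sup>2) <= t * (r * (w \<bullet> nu))" using tw t(1) by (intro mult_left_mono) auto
   moreover have "0 < t * (r * (w \<bullet> nu))" using t(1) r w by simp
   ultimately show ?thesis by linarith
  qed
  finally have "(norm (r *. nu - t *. w))\<^sup>2 < r\<^sup>2" .
  then have "norm (r *. nu - t *. w) < r" by (rule power_less_imp_less_base) (use r in simp)
  then have "norm (p - t *. w - z) < r" by (simp only: e)
  then have "p - t *. w \<in> ball z r" by (simp add: dist_norm norm_minus_commute[of z])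
  moreover have "p - t *. w = x0 C + (1 - t) *. (p - x0 C)" by (simp add: w_def algebra_simps)
  then have "p - t *. w \<in> S C" using mem_S[OF C(1), of p "1 - t"] c_mem[OF C(1)] C(2) t by simp
  ultimately show False using bS[OF C(1)] by blast
 qed
qed

section \<open>Number of components, total area and the defects of the components\<close>

definition d :: nat where "d = card J"

lemma d_pos: "0 < d" using J_nonempty fin by (simp add: d_def card_gt_0_iff)

lemma length_d: "a * L = real d * lW"
proof -
 have "integral {0..T C} (cur C) = lW" if C: "C \<in> J" for C
 proof -
  interpret P: positive_curve \<phi> gam gam1 gam2 k0 Lam "c C" "c' C" "T C" "c'' C" a dl m0 by (rule positive[OF C])
  show ?thesis using P.integral_cur P.n_eq_1 by simp
 qed
 then show ?thesis by (simp add: mean d_def)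
qed

lemma area: "measure lebesgue E = (\<Sum>C\<in>J. measure lebesgue (S C))"
proof -
 have "measure lebesgue (\<Union>C\<in>J. S C) = (\<Sum>C\<in>J. measure lebesgue (S C))"
 proof (rule measure_finite_Union[OF fin])
  show "disjoint_family_on S J" unfolding disjoint_family_on_def using S_disjoint closure_subset by blast
  show "S ` J \<subseteq> sets lebesgue" using S_open by auto
  show "emeasure lebesgue (S C) ~= \<infinity>" if "C \<in> J" for C
   using bounded_set_imp_lmeasurable[OF S_bounded[OF that]] S_open[OF that] by (auto simp: fmeasurable_def less_top)
 qed
 then show ?thesis using E_eq by simp
qed

text \<open>The first bound keeps the length of the component, so that its sum over all components
  is at most \<open>dl^2 * L\<close>.\<close>

lemma defects:
 assumes C: "C \<in> J" and M0: "!!t. gam t <= M0"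
 shows "\<bar>omW - 2 * a * integral {0..T C} (%s. gam (ang C s)) + 2 * a\<^sup>2 * measure lebesgue (S C)\<bar> <= dl\<^sup>2 * T C"
  and "\<bar>omW - a * integral {0..T C} (%s. gam (ang C s))\<bar> <= M0 * eta"
proof -
 interpret P: positive_curve \<phi> gam gam1 gam2 k0 Lam "c C" "c' C" "T C" "c'' C" a dl m0 by (rule positive[OF C])
 obtain Gam where Gam: "!!x. (Gam hrd gam x * g x) (at x)" "!!x. Gam (x + 2 * pi) = Gam x + omW"
  by (rule wulff_area_antiderivative) (rule that, assumption+)
 obtain PP where PP: "!!s. (PP hrd gam (ang C s)) (at s)"
  by (rule ex_real_antiderivative[OF cont_gamang[OF C]]) (rule that, assumption)
 have "continuous_on UNIV (%s. rot90 (c C s) \<bullet> c' C s)"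
  by (intro continuous_intros P.cont P.cont'_on bounded_linear.continuous_on[OF bounded_linear_rot90])
 then obtain AA where AA: "!!s. (AA hrd rot90 (c C s) \<bullet> c' C s) (at s)"
  by (rule ex_real_antiderivative) (rule that, assumption)
 have I: "integral {0..T C} (%s. gam (ang C s)) = PP (T C) - PP 0"
  using antiderivative_integral(2)[OF PP, of 0 "T C"] T_pos[OF C] by simp
 \<comment> \<open>Moving the origin to \<open>x0 C\<close> changes the antiderivative of the area
   by a periodic term, which drops out over one period.\<close>
 have "((%s. rot90 (x0 C) \<bullet> c C s) hrd rot90 (x0 C) \<bullet> c' C s) (at s)" for s
  using bounded_linear_hvd[OF bounded_linear_inner_right P.der]
  by (simp add: hrd_iff_hvd)
 from DERIV_diff[OF AA this]
 have "((%s. AA s - rot90 (x0 C) \<bullet> c C s) hrd rot90 (c C s - x0 C) \<bullet> c' C s) (at s)" for s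
  by (simp add: rot90_diff inner_diff_left)
 from antiderivative_integral(2)[OF this, of 0 "T C"]
 have "measure lebesgue (S C) = (AA (T C) - AA 0) / 2"
  using T_pos[OF C] P.periodic_1[of 0] by (simp add: S_measure[OF C] P.D.area_D)
 then have A: "AA (T C) - AA 0 = 2 * measure lebesgue (S C)" by simp
 have "P.eta\<^sup>2 = dl\<^sup>2 * T C" using T_pos[OF C] by (simp add: P.eta_def power_mult_distrib)
 then show "\<bar>omW - 2 * a * integral {0..T C} (%s. gam (ang C s)) + 2 * a\<^sup>2 * measure lebesgue (S C)\<bar> <= dl\<^sup>2 * T C"
  using P.isoperimetric_defect[OF Gam PP AA] by (simp add: P.n_eq_1 I A mult_ac)
 have "M0 * P.eta <= M0 * eta" using eta_le[OF C] M0[of 0] gam_pos[of 0] by (intro mult_left_mono) (auto simp: P.eta_def)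
 then show "\<bar>omW - a * integral {0..T C} (%s. gam (ang C s))\<bar> <= M0 * eta"
  using P.perimeter_defect[OF Gam PP M0] by (simp add: P.n_eq_1 I)
qed

end

section \<open>Area and perimeter of disjoint unions of Wulff shapes\<close>

context anisotropy begin

lemma omW_pos: "0 < omW"
proof -
 obtain Gam where Gam: "!!x. (Gam hrd gam x * g x) (at x)" "!!x. Gam (x + 2 * pi) = Gam x + omW"
  by (rule wulff_area_antiderivative) (rule that, assumption+)
 have "Gam 0 < Gam (0 + 2 * pi)"
 proof (rule DERIV_pos_imp_increasing[where f = Gam and a = 0 and b = "0 + 2 * pi"])
  fix x show "EX y. (Gam hrd y) (at x) & 0 < y" using Gam(1) gam_pos g_pos mult_pos_pos by blast
 qed simp
 then show ?thesis using Gam(2)[of 0] by simp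
qed

text \<open>The interior has area \<open>omW / 2\<close> by definition, and the boundary is
  negligible because the shape is convex.\<close>

lemma measure_wulff_at:
 assumes "0 < r" shows "measure lebesgue (wulff_at \<phi> x r) = r\<^sup>2 * (omW / 2)"
proof -
 have "convex (wulff \<phi>)"
 proof (rule convexI)
  fix x y :: "real^2" and u v :: real
  assume xy: "x \<in> wulff \<phi>" "y \<in> wulff \<phi>" and uv: "0 <= u" "0 <= v" "u + v = 1"
  show "u *. x + v *. y \<in> wulff \<phi>"
   unfolding wulff_def
  proof (rule CollectI, rule allI)
   fix nu
   have "u * (x \<bullet> nu) + v * (y \<bullet> nu) <= u * \<phi> nu + v * \<phi> nu"
    using xy uv by (intro add_mono mult_left_mono) (auto simp: wulff_def)
   also have "... = \<phi> nu" using uv(3) by (simp flip: distrib_right)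
   finally show "(u *. x + v *. y) \<bullet> nu <= \<phi> nu" by (simp add: inner_add_left)
  qed
 qed
 then have "measure lebesgue (interior (wulff \<phi>)) = measure lebesgue (wulff \<phi>)"
  using W.bounded_D closure_W_D by (intro measure_interior negligible_convex_frontier) (metis bounded_closure)+
 then have m: "measure lebesgue (wulff \<phi>) = omW / 2" by (simp add: interior_wulff omW_def)
 have "wulff_at \<phi> x r = (%w. r *. w + x) ` wulff \<phi>" by (simp add: wulff_at_def add.commute)
 then show ?thesis using m measure_lebesgue_affine[of r x "wulff \<phi>"] assms by simp
qed

text \<open>Stated for any \<open>h\<close> with the right values on the boundary, because the
  integrand for a union involves the normal of the union.\<close>

lemma wulff_at_perimeter:
 assumes r: "0 < r" and h: "!!t. h (x + r *. Y t) = gam t"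
 shows "set_integrable hausdorff1 (frontier (wulff_at \<phi> x r)) h"
  and "(LINT p:frontier (wulff_at \<phi> x r)|hausdorff1. h p) = r * omW"
proof -
 interpret w: closed_curve "%t. x + r *. Y t" "%t. (r * g t) *. rot90 (ev t)" "2 * pi"
  by (rule closed_curve_wulff_at[OF r])
 note I = w.integral_parametrized[OF h cont_gam, folded frontier_wulff_at[OF r]]
 show "set_integrable hausdorff1 (frontier (wulff_at \<phi> x r)) h" by (rule I(1))
 obtain Gam where Gam: "!!x. (Gam hrd gam x * g x) (at x)" "!!x. Gam (x + 2 * pi) = Gam x + omW"
  by (rule wulff_area_antiderivative) (rule that, assumption+)
 have d: "((%x. r * Gam x) hrd norm ((r * g t) *. rot90 (ev t)) * gam t) (at t)" for t
  using DERIV_cmult[OF Gam(1), of r t] r g_pos[of t] by (simp add: mult_ac abs_of_pos)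
 show "(LINT p:frontier (wulff_at \<phi> x r)|hausdorff1. h p) = r * omW"
  unfolding I(2) using antiderivative_integral(2)[OF d, of 0 "2 * pi"] Gam(2)[of 0] by (simp add: algebra_simps)
qed

text \<open>Disjoint closed shapes have neighbourhoods free of the others, and frontier and normal
  are local notions.\<close>

lemma wulff_union:
 fixes y :: "'i => real^2"
 assumes r: "0 < r" and fin: "finite J"
  and disj: "!!i j. i \<in> J ==> j \<in> J ==> i ~= j ==> wulff_at \<phi> (y i) r \<inter> wulff_at \<phi> (y j) r = {}"
 shows "aniso_perimeter \<phi> (\<Union>j\<in>J. wulff_at \<phi> (y j) r) = real (card J) * (r * omW)"
  and "measure lebesgue (\<Union>j\<in>J. wulff_at \<phi> (y j) r) = real (card J) * (r\<^sup>2 * (omW / 2))"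
proof -
 let ?W = "%j. wulff_at \<phi> (y j) r" and ?F = "\<Union>j\<in>J. wulff_at \<phi> (y j) r"
 have cl: "closed (?W j)" for j by (rule closed_wulff_at)
 have nb: "EX U. open U & p \<in> U & ?F \<inter> U = ?W j \<inter> U" if j: "j \<in> J" "p \<in> ?W j" for j p
 proof (rule exI[of _ "- (\<Union>i\<in>J - {j}. ?W i)"], intro conjI)
  show "open (- (\<Union>i\<in>J - {j}. ?W i))" using fin cl by (intro open_Compl closed_UN) auto
 qed (use disj j in blast)+
 have fr: "frontier ?F = (\<Union>j\<in>J. frontier (?W j))"
 proof
  have "closed ?F" using fin cl by (intro closed_UN) auto
  show "frontier ?F \<subseteq> (\<Union>j\<in>J. frontier (?W j))"
  proof
   fix p assume p: "p \<in> frontier ?F"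
   then have "p \<in> ?F" using \<open>closed ?F\<close> frontier_subset_closed by blast
   then obtain j where j: "j \<in> J" "p \<in> ?W j" by blast
   obtain U where U: "open U" "p \<in> U" "?F \<inter> U = ?W j \<inter> U" using nb[OF j] by blast
   show "p \<in> (\<Union>j\<in>J. frontier (?W j))" using local_topology(3)[OF U(1,3)] p U(2) j(1) by blast
  qed
  show "(\<Union>j\<in>J. frontier (?W j)) \<subseteq> frontier ?F"
  proof
   fix p assume "p \<in> (\<Union>j\<in>J. frontier (?W j))"
   then obtain j where j: "j \<in> J" "p \<in> frontier (?W j)" by blast
   then have "p \<in> ?W j" using cl frontier_subset_closed by blast
   then obtain U where U: "open U" "p \<in> U" "?F \<inter> U = ?W j \<inter> U" using nb[OF j(1)] by blast
   show "p \<in> frontier ?F" using local_topology(3)[OF U(1,3)] j U(2) by blast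
  qed
 qed
 have n: "outer_normal ?F (y j + r *. Y t) = ev t" if j: "j \<in> J" for j t
 proof -
  have "y j + r *. Y t \<in> frontier (?W j)" unfolding frontier_wulff_at[OF r] by (rule rangeI)
  then have "y j + r *. Y t \<in> ?W j" using cl frontier_subset_closed by blast
  then obtain U where U: "open U" "y j + r *. Y t \<in> U" "?F \<inter> U = ?W j \<inter> U" using nb[OF j] by blast
  show ?thesis using outer_normal_local[OF U] outer_normal_wulff_at[OF r] by simp
 qed
 have "aniso_perimeter \<phi> ?F = (\<Sum>j\<in>J. LINT p:frontier (?W j)|hausdorff1. \<phi> (outer_normal ?F p))"
  unfolding aniso_perimeter_def fr
 proof (rule set_integral_finite_Union[OF fin])
  show "disjoint_family_on (%j. frontier (?W j)) J"
   unfolding disjoint_family_on_def using disj frontier_subset_closed[OF cl] by blast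
  show "set_integrable hausdorff1 (frontier (?W j)) (%p. \<phi> (outer_normal (\<Union>j\<in>J. wulff_at \<phi> (y j) r) p))" if "j \<in> J" for j
   by (rule wulff_at_perimeter(1)[OF r]) (simp add: n[OF that] gam)
  show "frontier (?W j) \<in> sets hausdorff1" for j by (simp add: sets_hausdorff1)
 qed
 also have "... = (\<Sum>j\<in>J. r * omW)"
  by (intro sum.cong refl wulff_at_perimeter(2)[OF r]) (simp add: n gam)
 finally show "aniso_perimeter \<phi> ?F = real (card J) * (r * omW)" by simp
 have "measure lebesgue ?F = (\<Sum>j\<in>J. measure lebesgue (?W j))"
 proof (rule measure_finite_Union[OF fin])
  show "disjoint_family_on ?W J" unfolding disjoint_family_on_def using disj by blast
  show "?W ` J \<subseteq> sets lebesgue" using cl by (auto simp: borel_closed)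
  have "bounded (wulff \<phi>)" using W.bounded_D closure_W_D by (metis bounded_closure)
  then have "bounded (?W j)" for j unfolding wulff_at_eq by (intro bounded_translation bounded_scaling)
  then show "emeasure lebesgue (?W j) ~= \<infinity>" for j
   using lmeasurable_compact[of "?W j"] cl[of j] by (auto simp: compact_eq_bounded_closed fmeasurable_def less_top)
 qed
 then show "measure lebesgue ?F = real (card J) * (r\<^sup>2 * (omW / 2))" by (simp add: measure_wulff_at[OF r])
qed

lemma bounded_wulff_at: "bounded (wulff_at \<phi> x r)"
proof -
 have "bounded (wulff \<phi>)" using W.bounded_D closure_W_D by (metis bounded_closure)
 then show ?thesis unfolding wulff_at_eq by (intro bounded_translation bounded_scaling)
qed

end

section \<open>Constants depending only on the integrand and on the bounds for area and
  length\<close>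

locale wulff_bounds = anisotropy +
 fixes m0 L1 M0 M1 g1 m :: real
 assumes m0_pos: "0 < m0" and M0: "!!t. gam t <= M0" and M1: "!!t. norm (Y t) <= M1" "0 < M1"
  and g1: "!!t. g t <= g1" and m_pos: "0 < m" and L1_pos: "0 < L1"
begin

text \<open>\<open>a0\<close> and \<open>a1\<close> bound the mean curvature, \<open>d1\<close> the
  number of components, \<open>r0\<close> and \<open>r1\<close> the radius, and \<open>c1\<close>
  measures \<open>a * r - 1\<close> in units of \<open>eta\<close>. The dilation
  \<open>mu1 * eta\<close> separates the shapes and moves the centres by at most
  \<open>c2 * eta\<close>; \<open>8 * r1 * M1\<close> is a distance beyond which shapes are disjoint
  anyway. \<open>c3\<close> and \<open>c4\<close> give the closeness \<open>c3 * eta\<close> and the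
  Hoelder constant \<open>c4 * dl\<close> required for the graphs.\<close>

definition a0 :: real where "a0 = lW / L1"
definition a1 :: real where "a1 = L1 * (omW + 1 + 2 * M0) / (2 * m * lW)"
definition d1 :: real where "d1 = a1 * L1 / lW"
definition c1 :: real where "c1 = (1 + 2 * M0) / omW"
definition r0 :: real where "r0 = 1 / (2 * a1)"
definition r1 :: real where "r1 = 3 / (2 * a0)"
definition mu1 :: real where "mu1 = 2 * (c1 + 1 / m0)"
definition c2 :: real where "c2 = mu1 * (d1\<^sup>2 * (8 * r1 * M1))"
definition c3 :: real where "c3 = (c2 + (c1 * M1 + 1) / a0) / r0"
definition c4 :: real where "c4 = ((c1 * sqrt L1 * (1 + a1 * sqrt L1) + 1) / a0) / r0"
text \<open>The constant of \<open>normal_graph\<close> made uniform: \<open>r1\<close> is inserted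
  where it increases in \<open>r\<close>, and \<open>r0\<close> where it decreases.\<close>

definition K1 :: real where
 "K1 = r1 * (2 * g1 / k0 + 1) + 12 / k0 +
  (12 / k0 * (2 * sqrt (r1 * g1) + 2 + 4 * Lam / k0) + 16 / k0 * (8 * g1 / k0 + Lam / (2 * k0))) * sqrt (8 / (r0 * k0))"
definition CC :: real where "CC = L1 * (d1 * omW * c1\<^sup>2 + 1) / (2 * a0) + K1 * (c3 * sqrt L1 + c4)"
text \<open>The entries in order: 1 bounds \<open>eta^2\<close> by \<open>eta\<close>; three are the
  thresholds of \<open>near_critical_domain\<close>; \<open>1 / (2 * c1)\<close> keeps
  \<open>a * r\<close> between 1/2 and 3/2; the next keeps the displacement of a centre below a
  quarter of the cluster distance; the last two are \<open>eps_small\<close> of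
  \<open>near_wulff_graph\<close>.\<close>

definition eta0 :: real where
 "eta0 = min 1 (min (k0 / 4) (min (lW / 2) (min (m0 / 8) (min (1 / (2 * c1)) (min (1 / (4 * (mu1 * d1\<^sup>2)))
  (min (1 / c3) ((k0 / 8 * min 1 (k0 / (4 * g1))) / c3)))))))"
definition dl0 :: real where "dl0 = min (1 / 2) (eta0 / sqrt L1)"

lemma consts_pos: "0 < M0" "0 < g1" "0 < a0" "0 < a1" "0 < d1" "0 < c1" "0 < r0" "0 < r1" "0 < mu1" "0 < c2" "0 < c3" "0 < c4"
 "0 < K1" "0 < CC" "0 < eta0" "0 < dl0"
proof -
 show M0p: "0 < M0" using M0[of 0] gam_pos[of 0] by simp
 show g1p: "0 < g1" using g1[of 0] g_pos[of 0] by simp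
 note b = lW_pos L1_pos m_pos omW_pos M0p k0 m0_pos M1(2)
 show a0: "0 < a0" using b by (simp add: a0_def)
 show a1: "0 < a1" using b by (simp add: a1_def)
 show d1: "0 < d1" using b a1 by (simp add: d1_def)
 show c1: "0 < c1" using b by (simp add: c1_def)
 show r0: "0 < r0" using a1 by (simp add: r0_def)
 show r1: "0 < r1" using a0 by (simp add: r1_def)
 show mu1: "0 < mu1" using c1 b by (simp add: mu1_def add_pos_pos)
 show c2: "0 < c2" using mu1 d1 r1 b by (simp add: c2_def)
 have "0 < c1 * M1 + 1" using c1 b by (simp add: add_pos_pos)
 then show c3: "0 < c3" using c2 a0 r0 by (simp add: c3_def add_pos_pos)
 have "0 < c1 * sqrt L1 * (1 + a1 * sqrt L1)" using c1 b a1 by (intro mult_pos_pos add_pos_pos) auto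
 then show c4: "0 < c4" using a0 r0 by (simp add: c4_def add_pos_pos)
 have "0 <= (12 / k0 * (2 * sqrt (r1 * g1) + 2 + 4 * Lam / k0) + 16 / k0 * (8 * g1 / k0 + Lam / (2 * k0))) * sqrt (8 / (r0 * k0))"
  using r1 g1p r0 Lam_nonneg k0 by (intro mult_nonneg_nonneg add_nonneg_nonneg) auto
 moreover have "0 < r1 * (2 * g1 / k0 + 1)" "0 < 12 / k0" using r1 g1p k0 by (simp_all add: add_pos_pos)
 ultimately show K1: "0 < K1" unfolding K1_def by linarith
 have "0 < L1 * (d1 * omW * c1\<^sup>2 + 1) / (2 * a0)" using b d1 c1 a0 by (simp add: add_pos_pos)
 moreover have "0 < K1 * (c3 * sqrt L1 + c4)" using K1 c3 c4 b by (simp add: add_pos_pos)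
 ultimately show "0 < CC" unfolding CC_def by linarith
 have "0 < 1 / (2 * c1)" "0 < 1 / (4 * (mu1 * d1\<^sup>2))" "0 < 1 / c3" using c1 mu1 d1 c3 by simp_all
 moreover have "0 < k0 / (4 * g1)" using k0 g1p by simp
 then have "0 < (k0 / 8 * min 1 (k0 / (4 * g1))) / c3" using k0 c3 by (intro divide_pos_pos mult_pos_pos) simp_all
 moreover have "0 < k0 / 4" "0 < lW / 2" "0 < m0 / 8" using k0 lW_pos m0_pos by simp_all
 ultimately show eta0: "0 < eta0" unfolding eta0_def by (simp only: min_less_iff_conj zero_less_one simp_thms)
 then show "0 < dl0" using b by (simp add: dl0_def)
qed

lemma eta0_le: "eta0 <= 1" "eta0 <= k0 / 4" "eta0 <= lW / 2" "eta0 <= m0 / 8" "eta0 <= 1 / (2 * c1)" "eta0 <= 1 / (4 * (mu1 * d1\<^sup>2))"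
 "eta0 <= 1 / c3" "eta0 <= (k0 / 8 * min 1 (k0 / (4 * g1))) / c3"
 unfolding eta0_def by (simp_all only: min_le_iff_disj order_refl simp_thms)

end

section \<open>Quantitative estimates for the mean, the radius, the perimeter and the
  centres\<close>

locale critical_domain = near_critical_domain + wulff_bounds +
 assumes area_m: "measure lebesgue E = m" and dl_le: "dl <= dl0"
begin

lemma eta_le0: "eta <= eta0"
proof -
 have "dl <= eta0 / sqrt L1" using dl_le unfolding dl0_def by linarith
 then show ?thesis using L1_pos by (simp add: eta_def pos_le_divide_eq)
qed

lemma dl_le_1: "dl <= 1" using dl_le unfolding dl0_def by linarith

lemma a_lower: "a0 <= a"
proof -
 have "lW <= real d * lW" using d_pos lW_pos by simp
 also have "... <= a * L1" unfolding length_d[symmetric] using L_le a_pos by (intro mult_left_mono) auto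
 finally show ?thesis using L1_pos by (simp add: a0_def pos_divide_le_eq)
qed

text \<open>Subtracting twice the linear perimeter defect from the quadratic defect eliminates the
  perimeter.\<close>

lemma area_defect: "\<bar>2 * a\<^sup>2 * m - real d * omW\<bar> <= real d * ((1 + 2 * M0) * eta)"
proof -
 have *: "\<bar>2 * a\<^sup>2 * measure lebesgue (S C) - omW\<bar> <= (1 + 2 * M0) * eta" if C: "C \<in> J" for C
 proof -
  note d = defects[OF C M0]
  have "dl\<^sup>2 * T C <= dl\<^sup>2 * L1" using T_le[OF C] by (intro mult_left_mono) auto
  also have "... = eta * eta" using L1_pos by (simp add: eta_def power2_eq_square mult_ac)
  also have "... <= 1 * eta" using eta_le0 eta0_le(1) eta_nonneg by (intro mult_right_mono) auto
  finally have "dl\<^sup>2 * T C <= eta" by simp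
  then have "\<bar>2 * a\<^sup>2 * measure lebesgue (S C) - omW\<bar> <= eta + 2 * (M0 * eta)"
   using d by linarith
  then show ?thesis by (simp add: distrib_right)
 qed
 have eq: "2 * a\<^sup>2 * m - real d * omW = (\<Sum>C\<in>J. 2 * a\<^sup>2 * measure lebesgue (S C) - omW)"
  using area area_m by (simp add: sum_subtractf d_def sum_distrib_left)
 have "\<bar>2 * a\<^sup>2 * m - real d * omW\<bar> <= (\<Sum>C\<in>J. \<bar>2 * a\<^sup>2 * measure lebesgue (S C) - omW\<bar>)" unfolding eq by (rule sum_abs)
 also have "... <= (\<Sum>C\<in>J. (1 + 2 * M0) * eta)" by (intro sum_mono *)
 finally show ?thesis by (simp add: d_def)
qed

lemma d_lW: "real d * lW <= a * L1"
 unfolding length_d[symmetric] using L_le a_pos by (intro mult_left_mono) auto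

text \<open>The area bounds \<open>a^2\<close> by a multiple of \<open>d\<close>, and the length
  bounds \<open>d\<close> by a multiple of \<open>a\<close>; one factor \<open>a\<close>
  cancels.\<close>

lemma a_upper: "a <= a1"
proof -
 have "(1 + 2 * M0) * eta <= (1 + 2 * M0) * 1" using eta_le0 eta0_le(1) consts_pos(1) by (intro mult_left_mono) auto
 then have "real d * ((1 + 2 * M0) * eta) <= real d * (1 + 2 * M0)" by (intro mult_left_mono) auto
 then have "2 * a\<^sup>2 * m <= real d * omW + real d * (1 + 2 * M0)" using area_defect by linarith
 then have "2 * a\<^sup>2 * m <= real d * (omW + 1 + 2 * M0)" by (simp add: distrib_left)
 then have "2 * a\<^sup>2 * m * lW <= real d * (omW + 1 + 2 * M0) * lW" using lW_pos by (intro mult_right_mono) auto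
 also have "... = (real d * lW) * (omW + 1 + 2 * M0)" by (simp add: mult_ac)
 also have "... <= (a * L1) * (omW + 1 + 2 * M0)" using d_lW omW_pos consts_pos(1) by (intro mult_right_mono) auto
 finally have "a * (a * (2 * m * lW)) <= a * (L1 * (omW + 1 + 2 * M0))" by (simp add: power2_eq_square mult_ac)
 then have "a * (2 * m * lW) <= L1 * (omW + 1 + 2 * M0)" using a_pos by (simp only: mult_le_cancel_left_pos)
 then show ?thesis using m_pos lW_pos by (simp add: a1_def pos_le_divide_eq)
qed

lemma d_upper: "real d <= d1"
proof -
 have "a * L1 <= a1 * L1" using a_upper L1_pos by (intro mult_right_mono) auto
 then show ?thesis using d_lW lW_pos by (simp add: d1_def pos_le_divide_eq)
qed

definition r :: real where "r = sqrt (2 * m / (real d * omW))"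

lemma r_pos: "0 < r" using m_pos d_pos omW_pos by (simp add: r_def)

lemma r_square: "real d * (r\<^sup>2 * (omW / 2)) = m"
 using m_pos d_pos omW_pos by (simp add: r_def)

lemma area_r: "2 * a\<^sup>2 * m = (a * r)\<^sup>2 * (real d * omW)"
proof -
 have "2 * a\<^sup>2 * m = 2 * a\<^sup>2 * (real d * (r\<^sup>2 * (omW / 2)))" by (simp only: r_square)
 also have "... = (a * r)\<^sup>2 * (real d * omW)" by (simp add: power_mult_distrib)
 finally show ?thesis .
qed

lemma ar_near_1: "\<bar>a * r - 1\<bar> <= c1 * eta"
proof -
 have dw: "0 < real d * omW" using d_pos omW_pos by simp
 have "2 * a\<^sup>2 * m - real d * omW = ((a * r)\<^sup>2 - 1) * (real d * omW)"
  unfolding area_r by (simp add: left_diff_distrib)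
 then have "\<bar>(a * r)\<^sup>2 - 1\<bar> * (real d * omW) <= real d * ((1 + 2 * M0) * eta)"
  using area_defect abs_mult[of "(a * r)\<^sup>2 - 1" "real d * omW"] abs_of_pos[OF dw] by (simp only:)
 also have "... = (c1 * eta) * (real d * omW)" using omW_pos by (simp add: c1_def)
 finally have 1: "\<bar>(a * r)\<^sup>2 - 1\<bar> <= c1 * eta" using dw by (simp only: mult_le_cancel_right_pos)
 have ar: "0 < a * r" using a_pos r_pos by simp
 have "\<bar>a * r - 1\<bar> * 1 <= \<bar>a * r - 1\<bar> * (a * r + 1)" using ar by (intro mult_left_mono) auto
 also have "... = \<bar>(a * r - 1) * (a * r + 1)\<bar>" using ar by (simp add: abs_mult)
 also have "(a * r - 1) * (a * r + 1) = (a * r)\<^sup>2 - 1" by (simp add: algebra_simps power2_eq_square)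
 finally show ?thesis using 1 by simp
qed

lemma ar_bounds: "1 / 2 <= a * r" "a * r <= 3 / 2"
proof -
 have "eta <= 1 / (2 * c1)" using eta_le0 eta0_le(5) by linarith
 then have "c1 * eta <= 1 / 2" using consts_pos(6) by (simp add: pos_le_divide_eq mult_ac)
 then show "1 / 2 <= a * r" "a * r <= 3 / 2" using ar_near_1 by linarith+
qed

lemma r_bounds: "r0 <= r" "r <= r1"
proof -
 have "1 / 2 <= a1 * r" using ar_bounds(1) a_upper r_pos mult_right_mono[of a a1 r] by linarith
 then show "r0 <= r" using consts_pos(4) by (simp add: r0_def pos_divide_le_eq mult_ac)
 have "a0 * r <= 3 / 2" using ar_bounds(2) a_lower r_pos mult_right_mono[of a0 a r] by linarith
 then show "r <= r1" using consts_pos(3) by (simp add: r1_def pos_le_divide_eq mult_ac)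
qed

text \<open>With \<open>r\<close> fixed by the area, the summed defects are
  \<open>d * omW - 2 * a * P + (a * r)^2 * d * omW\<close>. Comparing with the perimeter
  \<open>d * r * omW\<close> of the shapes completes the square in \<open>a * r - 1\<close>, so no
  first order term is left.\<close>

lemma perimeter_close: "\<bar>aniso_perimeter \<phi> E - real d * (r * omW)\<bar> <= CC * dl\<^sup>2"
proof -
 let ?P = "aniso_perimeter \<phi> E"
 let ?e = "%C. omW - 2 * a * integral {0..T C} (%s. gam (ang C s)) + 2 * a\<^sup>2 * measure lebesgue (S C)"
 have "(\<Sum>C\<in>J. ?e C) = real d * omW - 2 * a * ?P + 2 * a\<^sup>2 * m"
  by (simp add: sum.distrib sum_subtractf perimeter area_m[symmetric] area d_def sum_distrib_left)
 then have eq: "2 * a * (?P - real d * (r * omW)) = real d * omW * (a * r - 1)\<^sup>2 - (\<Sum>C\<in>J. ?e C)"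
  unfolding area_r by (simp add: power2_eq_square algebra_simps)
 have "\<bar>\<Sum>C\<in>J. ?e C\<bar> <= (\<Sum>C\<in>J. \<bar>?e C\<bar>)" by (rule sum_abs)
 also have "... <= (\<Sum>C\<in>J. dl\<^sup>2 * T C)" by (intro sum_mono defects(1)[OF _ M0])
 also have "... = dl\<^sup>2 * L" by (simp add: L_def sum_distrib_left)
 also have "... <= dl\<^sup>2 * L1" using L_le by (intro mult_left_mono) auto
 finally have e: "\<bar>\<Sum>C\<in>J. ?e C\<bar> <= dl\<^sup>2 * L1" .
 have "(a * r - 1)\<^sup>2 <= (c1 * eta)\<^sup>2" using ar_near_1 by (metis abs_ge_zero power2_abs power_mono)
 also have "... = c1\<^sup>2 * (dl\<^sup>2 * L1)" using L1_pos by (simp add: eta_def power_mult_distrib)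
 finally have q: "real d * omW * (a * r - 1)\<^sup>2 <= d1 * omW * (c1\<^sup>2 * (dl\<^sup>2 * L1))"
  using d_upper omW_pos consts_pos(5) by (intro mult_mono) auto
 have q0: "0 <= real d * omW * (a * r - 1)\<^sup>2" using omW_pos by simp
 have "2 * a0 * \<bar>?P - real d * (r * omW)\<bar> <= 2 * a * \<bar>?P - real d * (r * omW)\<bar>"
  using a_lower by (intro mult_right_mono) auto
 also have "... = \<bar>2 * a * (?P - real d * (r * omW))\<bar>" using a_pos by (simp add: abs_mult)
 also have "... <= d1 * omW * (c1\<^sup>2 * (dl\<^sup>2 * L1)) + dl\<^sup>2 * L1" unfolding eq using e q q0 by linarith
 also have "... = L1 * (d1 * omW * c1\<^sup>2 + 1) * dl\<^sup>2" by (simp add: algebra_simps)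
 finally have "\<bar>?P - real d * (r * omW)\<bar> <= L1 * (d1 * omW * c1\<^sup>2 + 1) / (2 * a0) * dl\<^sup>2"
  using consts_pos(3) by (simp add: pos_le_divide_eq mult_ac)
 also have "... <= CC * dl\<^sup>2"
 proof (rule mult_right_mono)
  have "0 < K1 * (c3 * sqrt L1 + c4)" using consts_pos L1_pos by (simp add: add_pos_pos)
  then show "L1 * (d1 * omW * c1\<^sup>2 + 1) / (2 * a0) <= CC" unfolding CC_def by linarith
 qed simp
 finally show ?thesis .
qed

text \<open>If this failed in every direction, the midpoint of the two centres would satisfy the
  inner supporting bounds of both pieces and lie in both closures; \<open>gam\<close> being even
  handles the opposite direction. Since \<open>gam >= m0\<close>, the additive loss
  \<open>eta\<close> becomes the factor \<open>1 - eta / m0\<close>.\<close>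

lemma separated:
 assumes C: "C \<in> J" "C' \<in> J" "C ~= C'"
 shows "EX t. 2 * ((1 - eta / m0) / a * gam t) < (x0 C - x0 C') \<bullet> ev t"
proof (rule ccontr)
 assume "\<not> ?thesis"
 then have le: "(x0 C - x0 C') \<bullet> ev t <= 2 * ((1 - eta / m0) / a * gam t)" for t by (simp add: not_less)
 have g: "(1 - eta / m0) / a * gam t <= (gam t - eta) / a" for t
 proof -
  have "eta / m0 * m0 <= eta / m0 * gam t" using eta_nonneg m0 by (intro mult_left_mono) auto
  then have "(1 - eta / m0) * gam t <= gam t - eta" using m0(1) by (simp add: left_diff_distrib)
  then have "(1 - eta / m0) * gam t / a <= (gam t - eta) / a" using a_pos by (intro divide_right_mono) auto
  then show ?thesis by simp
 qed
 define z where "z = (1/2) *. (x0 C + x0 C')"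
 have z1: "z - x0 C' = (1/2) *. (x0 C - x0 C')" and z2: "z - x0 C = - ((1/2) *. (x0 C - x0 C'))"
  by (simp_all add: z_def vec_eq_iff field_simps)
 have "z \<in> closure (S C')"
 proof (rule support_bounds(3)[OF C(2)])
  fix t show "(z - x0 C') \<bullet> ev t <= (gam t - eta) / a" using le[of t] g[of t] unfolding z1 inner_scaleR_left by linarith
 qed
 moreover have "z \<in> closure (S C)"
 proof (rule support_bounds(3)[OF C(1)])
  fix t show "(z - x0 C) \<bullet> ev t <= (gam t - eta) / a"
   using le[of "t + pi", unfolded ev_plus_pi gam_pi inner_minus_right] g[of t]
   unfolding z2 inner_minus_left inner_scaleR_left by linarith
 qed
 ultimately show False using S_disjoint[OF C] by blast
qed

lemma norm_wulff: "w \<in> wulff \<phi> ==> norm w <= M1"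
proof -
 assume "w \<in> wulff \<phi>"
 then obtain l s where "w = l *. Z s" "0 <= l" "l <= 1" unfolding wulff_eq by blast
 then have "norm w <= 1 * norm (Z s)" by (simp add: mult_left_le_one_le)
 then show ?thesis using M1(1)[of "u s"] by (simp add: Z_def)
qed

text \<open>Within a cluster the dilation by \<open>1 + mu\<close> turns the separation by
  \<open>separated\<close> into one that suffices for radius \<open>r\<close>. Centres in different
  clusters are more than \<open>R\<close> apart and each moves by at most \<open>R / 4\<close>, so
  shapes of size at most \<open>r1 * M1\<close> cannot meet.\<close>

lemma centres:
 obtains y where "!!C. C \<in> J ==> norm (y C - x0 C) <= c2 * eta"
  "!!C C'. C \<in> J ==> C' \<in> J ==> C ~= C' ==> wulff_at \<phi> (y C) r \<inter> wulff_at \<phi> (y C') r = {}"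
proof -
 define R where "R = 8 * r1 * M1"
 have R: "0 < R" using consts_pos M1(2) by (simp add: R_def)
 define mu where "mu = mu1 * eta"
 have mu0: "0 <= mu" using consts_pos(9) eta_nonneg by (simp add: mu_def)
 obtain y where y: "!!i. i \<in> J ==> norm (y i - x0 i) <= mu * ((real (card J))\<^sup>2 * R)"
  "!!i j. i \<in> J ==> j \<in> J ==> y i - y j = (1 + mu) *. (x0 i - x0 j) | R < norm (x0 i - x0 j)"
  by (rule spread_points[OF fin less_imp_le[OF R] mu0]) (rule that, assumption+)
 have d2: "(real d)\<^sup>2 <= d1\<^sup>2" using d_upper by (intro power_mono) auto
 then have "mu * ((real d)\<^sup>2 * R) <= mu * (d1\<^sup>2 * R)" using R mu0 by (intro mult_left_mono mult_right_mono) auto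
 then have y1: "norm (y C - x0 C) <= mu * (d1\<^sup>2 * R)" if "C \<in> J" for C using y(1)[OF that] unfolding d_def by linarith
 have c2: "mu * (d1\<^sup>2 * R) = c2 * eta" by (simp add: c2_def mu_def R_def mult_ac)
 have quarter: "mu * (d1\<^sup>2 * R) <= R / 4"
 proof -
  have "eta <= 1 / (4 * (mu1 * d1\<^sup>2))" using eta_le0 eta0_le(6) by linarith
  moreover have "0 < 4 * (mu1 * d1\<^sup>2)" using consts_pos by simp
  ultimately have "eta * (4 * (mu1 * d1\<^sup>2)) <= 1" by (simp only: pos_le_divide_eq)
  then have "eta * (4 * (mu1 * d1\<^sup>2)) * R <= 1 * R" using R by (intro mult_right_mono) auto
  then show ?thesis by (simp add: mu_def mult_ac)
 qed
 \<comment> \<open>\<open>mu\<close> is \<open>2 * (c1 * eta) + 2 * e\<close>: it pays for the error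
   \<open>c1 * eta\<close> of \<open>a * r\<close>, for the factor \<open>1 - e\<close> and for the
   product \<open>mu * e\<close>, as \<open>e <= 1 / 8\<close>.\<close>
 have ratio: "r <= (1 + mu) * ((1 - eta / m0) / a)"
 proof -
  define e where "e = eta / m0"
  have e: "0 <= e" "e <= 1 / 8" using eta_small eta_nonneg m0(1) by (simp_all add: e_def divide_le_eq)
  have mu: "mu = 2 * (c1 * eta) + 2 * e" by (simp add: mu_def mu1_def e_def distrib_right)
  have "mu * e <= mu * (1 / 8)" using e mu0 by (intro mult_left_mono) auto
  moreover have "0 <= c1 * eta" using consts_pos(6) eta_nonneg by simp
  moreover have "(1 + mu) * (1 - e) = 1 + mu - e - mu * e" by (simp add: algebra_simps)
  ultimately have "a * r <= (1 + mu) * (1 - e)" using ar_near_1 e mu by linarith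
  then have "r <= (1 + mu) * (1 - e) / a" using a_pos by (simp add: pos_le_divide_eq mult.commute)
  then show ?thesis by (simp add: e_def)
 qed
 show thesis
 proof (rule that[of y])
  show "norm (y C - x0 C) <= c2 * eta" if "C \<in> J" for C using y1[OF that] c2 by simp
  fix C C' assume C: "C \<in> J" "C' \<in> J" "C ~= C'"
  show "wulff_at \<phi> (y C) r \<inter> wulff_at \<phi> (y C') r = {}"
  proof (rule ccontr)
   assume "wulff_at \<phi> (y C) r \<inter> wulff_at \<phi> (y C') r ~= {}"
   then obtain w w' where w: "w \<in> wulff \<phi>" "w' \<in> wulff \<phi>" "y C + r *. w = y C' + r *. w'"
    by (auto simp: wulff_at_def)
   have eq: "y C - y C' = r *. (w' - w)" using w(3) by (simp add: algebra_simps)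
   from y(2)[OF C(1,2)] show False
   proof
    assume s: "y C - y C' = (1 + mu) *. (x0 C - x0 C')"
    obtain t where t: "2 * ((1 - eta / m0) / a * gam t) < (x0 C - x0 C') \<bullet> ev t" using separated[OF C] by blast
    have "r * gam t <= (1 + mu) * ((1 - eta / m0) / a) * gam t" using ratio gam_pos[of t] by (intro mult_right_mono) auto
    then have "2 * (r * gam t) <= 2 * ((1 + mu) * ((1 - eta / m0) / a) * gam t)" by linarith
    also have "... = (1 + mu) * (2 * ((1 - eta / m0) / a * gam t))" by (simp only: mult.assoc mult.left_commute[of 2])
    also have "... < (1 + mu) * ((x0 C - x0 C') \<bullet> ev t)" using t mu0 by (intro mult_strict_left_mono) auto
    also have "... = (y C - y C') \<bullet> ev t" by (simp add: s)
    also have "... = r * (w' \<bullet> ev t - w \<bullet> ev t)" by (simp add: eq inner_diff_left)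
    also have "... <= r * (2 * gam t)"
    proof (rule mult_left_mono)
     have "w' \<bullet> ev t <= gam t" "w \<bullet> ev (t + pi) <= gam (t + pi)" using w mem_wulff by blast+
     then show "w' \<bullet> ev t - w \<bullet> ev t <= 2 * gam t" by (simp add: ev_plus_pi gam_pi)
    qed (use r_pos in simp)
    finally show False by simp
   next
    assume far: "R < norm (x0 C - x0 C')"
    have "norm (x0 C - x0 C') <= norm ((y C - y C') - (y C - x0 C)) + norm (y C' - x0 C')"
     using norm_triangle_ineq[of "(y C - y C') - (y C - x0 C)" "y C' - x0 C'"] by simp
    then have "norm (x0 C - x0 C') <= norm (y C - y C') + norm (y C - x0 C) + norm (y C' - x0 C')"
     using norm_triangle_ineq4[of "y C - y C'" "y C - x0 C"] by linarith
    then have "R / 2 < norm (y C - y C')" using far y1[OF C(1)] y1[OF C(2)] quarter by linarith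
    also have "... = r * norm (w' - w)" using r_pos by (simp add: eq)
    also have "... <= r1 * (2 * M1)"
    proof (rule mult_mono)
     show "norm (w' - w) <= 2 * M1" using norm_triangle_ineq4[of w' w] norm_wulff[OF w(1)] norm_wulff[OF w(2)] by linarith
    qed (use r_bounds consts_pos in auto)
    also have "... <= R / 2" using consts_pos M1(2) by (simp add: R_def)
    finally show False by simp
   qed
  qed
 qed
qed

end

section \<open>Graphs, diffeomorphisms and the conclusion for one domain\<close>

context critical_domain begin

text \<open>The deviation from the Wulff shape has three sources: the shift of the centre, the
  mismatch \<open>1 - a * r\<close> and the oscillation of \<open>ZZ\<close>. The first is constant
  along the curve and drops out of the Hoelder estimate.\<close>

lemma graph:
 assumes C: "C \<in> J" and y: "norm (y - x0 C) <= c2 * eta"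
 shows "EX f. bij_betw (normal_graph_map (wulff_at \<phi> y r) f) (frontier (wulff_at \<phi> y r)) C &
  C1_half_norm (wulff_at \<phi> y r) f <= ennreal (CC * dl)"
proof -
 interpret P: positive_curve \<phi> gam gam1 gam2 k0 Lam "c C" "c' C" "T C" "c'' C" a dl m0 by (rule positive[OF C])
 define eps where "eps = c3 * eta"
 define H where "H = c4 * dl"
 note cp = consts_pos
 have ia: "1 / a <= 1 / a0" using a_lower cp(3) by (intro divide_left_mono) (auto simp: a_pos)
 have sL: "0 < sqrt L1" using L1_pos by simp
 have dev: "c C s - y - r *. Y (ang C s) = (x0 C - y) + (1 / a) *. ((1 - a * r) *. Y (ang C s) - (P.ZZ s - P.ZZ 0))" for s
 proof -
  define Q where "Q = P.ZZ s - P.ZZ 0"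
  have e: "1 / a * (1 - a * r) = 1 / a - r" using a_pos by (simp add: field_simps)
  have A: "(1 / a) *. ((1 - a * r) *. Y (ang C s) - Q) = (1 / a) *. Y (ang C s) - r *. Y (ang C s) - (1 / a) *. Q"
  proof -
   have B: "(1 / a) *. ((1 - a * r) *. Y (ang C s)) = (1 / a - r) *. Y (ang C s)" by (simp only: scaleR_scaleR e)
   show ?thesis unfolding scaleR_diff_right[of "1 / a" _ Q] B by (simp only: scaleR_left_diff_distrib)
  qed
  have "c C s - x0 C = (1 / a) *. Y (ang C s) - (1 / a) *. Q" unfolding P.c_eq Q_def[symmetric] by (rule scaleR_diff_right)
  then have "c C s = x0 C + ((1 / a) *. Y (ang C s) - (1 / a) *. Q)" by (simp only: diff_eq_eq add.commute)
  then show ?thesis unfolding Q_def[symmetric] A by simp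
 qed
 have one_ar: "\<bar>1 - a * r\<bar> <= c1 * eta" using ar_near_1 by linarith
 have eps_bound: "norm (c C s - y - r *. Y (ang C s)) <= r * eps" for s
 proof -
  have "norm ((1 - a * r) *. Y (ang C s) - (P.ZZ s - P.ZZ 0)) <= norm ((1 - a * r) *. Y (ang C s)) + norm (P.ZZ s - P.ZZ 0)"
   by (rule norm_triangle_ineq4)
  also have "... <= (c1 * eta) * M1 + eta"
  proof (rule add_mono)
   show "norm ((1 - a * r) *. Y (ang C s)) <= (c1 * eta) * M1"
    unfolding norm_scaleR using one_ar M1 cp(6) eta_nonneg by (intro mult_mono) auto
   show "norm (P.ZZ s - P.ZZ 0) <= eta" using P.ZZ_osc[of s 0] eta_le[OF C] by (simp add: P.eta_def)
  qed
  finally have n: "norm ((1 - a * r) *. Y (ang C s) - (P.ZZ s - P.ZZ 0)) <= (c1 * eta) * M1 + eta" .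
  have "norm (c C s - y - r *. Y (ang C s)) <= norm (x0 C - y) +
    norm ((1 / a) *. ((1 - a * r) *. Y (ang C s) - (P.ZZ s - P.ZZ 0)))"
   unfolding dev by (rule norm_triangle_ineq)
  also have "... <= c2 * eta + (1 / a0) * ((c1 * eta) * M1 + eta)"
  proof (rule add_mono)
   show "norm (x0 C - y) <= c2 * eta" using y by (simp add: norm_minus_commute)
   have "\<bar>1 / a\<bar> * norm ((1 - a * r) *. Y (ang C s) - (P.ZZ s - P.ZZ 0)) <= (1 / a0) * ((c1 * eta) * M1 + eta)"
    using ia n a_pos cp(3) by (intro mult_mono) auto
   then show "norm ((1 / a) *. ((1 - a * r) *. Y (ang C s) - (P.ZZ s - P.ZZ 0))) <= (1 / a0) * ((c1 * eta) * M1 + eta)"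
    by (simp only: norm_scaleR)
  qed
  also have "... = r0 * eps"
  proof -
   have "r0 * c3 = c2 + (c1 * M1 + 1) / a0" using cp(7) by (simp add: c3_def)
   then have "r0 * eps = (c2 + (c1 * M1 + 1) / a0) * eta" unfolding eps_def by (simp only: mult.assoc[symmetric])
   also have "... = c2 * eta + (1 / a0) * ((c1 * eta) * M1 + eta)" using cp(3) by (simp add: field_simps)
   finally show ?thesis by simp
  qed
  also have "... <= r * eps" using r_bounds(1) cp(11) eta_nonneg by (intro mult_right_mono) (auto simp: eps_def)
  finally show ?thesis .
 qed
 have H_bound: "norm ((c C t - y - r *. Y (ang C t)) - (c C s - y - r *. Y (ang C s))) <= r * H * sqrt (t - s)"
  if st: "s <= t" "t <= s + T C" for s t
 proof -
  let ?q = "sqrt (t - s)"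
  have q0: "0 <= ?q" using st by simp
  have ZZ: "norm (P.ZZ t - P.ZZ s) <= dl * ?q" by (rule P.ZZ_holder[OF st])
  have tq: "t - s <= sqrt L1 * ?q"
  proof -
   have "?q <= sqrt L1" using st T_le[OF C] by (intro real_sqrt_le_mono) linarith
   then have "?q * ?q <= sqrt L1 * ?q" using q0 by (intro mult_right_mono) auto
   then show ?thesis using st by simp
  qed
  \<comment> \<open>The curvature has no pointwise bound, but \<open>Y (ang C s)\<close> equals
    \<open>ZZ\<close> plus \<open>a\<close> times the unit speed curve, and \<open>ZZ\<close> is
    Hoelder.\<close>
  have YY: "norm (Y (ang C t) - Y (ang C s)) <= (1 + a1 * sqrt L1) * ?q"
  proof -
   have "Y (ang C t) - Y (ang C s) = (P.ZZ t - P.ZZ s) + a *. (c C t - c C s)"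
    by (simp add: P.ZZ_def scaleR_diff_right)
   then have "norm (Y (ang C t) - Y (ang C s)) <= norm (P.ZZ t - P.ZZ s) + norm (a *. (c C t - c C s))"
    using norm_triangle_ineq by metis
   moreover have "norm (a *. (c C t - c C s)) <= a1 * (sqrt L1 * ?q)"
   proof -
    have "norm (c C t - c C s) <= t - s" using unit_speed_lipschitz[OF P.der P.unit, of t s] st by (simp add: dist_norm)
    then have "\<bar>a\<bar> * norm (c C t - c C s) <= a1 * (sqrt L1 * ?q)" using tq a_upper a_pos cp(4) by (intro mult_mono) auto
    then show ?thesis by simp
   qed
   moreover have "dl * ?q <= 1 * ?q" using dl_le_1 q0 by (intro mult_right_mono) auto
   ultimately show ?thesis using ZZ by (simp add: distrib_right mult.assoc)
  qed
  have eq: "(c C t - y - r *. Y (ang C t)) - (c C s - y - r *. Y (ang C s)) =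
    (1 / a) *. ((1 - a * r) *. (Y (ang C t) - Y (ang C s)) - (P.ZZ t - P.ZZ s))"
   unfolding dev by (simp add: scaleR_diff_right)
  have "norm ((1 - a * r) *. (Y (ang C t) - Y (ang C s)) - (P.ZZ t - P.ZZ s)) <=
    norm ((1 - a * r) *. (Y (ang C t) - Y (ang C s))) + norm (P.ZZ t - P.ZZ s)" by (rule norm_triangle_ineq4)
  also have "... <= (c1 * eta) * ((1 + a1 * sqrt L1) * ?q) + dl * ?q"
  proof (rule add_mono[OF _ ZZ])
   show "norm ((1 - a * r) *. (Y (ang C t) - Y (ang C s))) <= (c1 * eta) * ((1 + a1 * sqrt L1) * ?q)"
    unfolding norm_scaleR using one_ar YY cp(6) eta_nonneg by (intro mult_mono) auto
  qed
  also have "... = (c1 * sqrt L1 * (1 + a1 * sqrt L1) + 1) * (dl * ?q)"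
   by (simp add: eta_def algebra_simps)
  finally have n: "norm ((1 - a * r) *. (Y (ang C t) - Y (ang C s)) - (P.ZZ t - P.ZZ s)) <= ..." .
  have p: "0 < c1 * sqrt L1 * (1 + a1 * sqrt L1) + 1" using cp sL by (simp add: add_pos_pos)
  have "norm ((c C t - y - r *. Y (ang C t)) - (c C s - y - r *. Y (ang C s)))
    <= (1 / a0) * ((c1 * sqrt L1 * (1 + a1 * sqrt L1) + 1) * (dl * ?q))"
   unfolding eq norm_scaleR using ia n a_pos cp(3) by (intro mult_mono) auto
  also have "... = r0 * (H * ?q)"
  proof -
   have "r0 * c4 = (c1 * sqrt L1 * (1 + a1 * sqrt L1) + 1) / a0" using cp(7) by (simp add: c4_def)
   then have "r0 * c4 * (dl * ?q) = (c1 * sqrt L1 * (1 + a1 * sqrt L1) + 1) / a0 * (dl * ?q)" by (simp only:)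
   then show ?thesis by (simp add: H_def mult.assoc)
  qed
  also have "... <= r * (H * ?q)" using r_bounds(1) cp(12) deficit_nonneg q0 by (intro mult_right_mono) (auto simp: H_def)
  finally show ?thesis by (simp add: mult.assoc)
 qed
 have eps0: "0 <= eps" using cp(11) eta_nonneg by (simp add: eps_def)
 have H0: "0 <= H" using cp(12) deficit_nonneg by (simp add: H_def)
 have "eta <= 1 / c3" "eta <= (k0 / 8 * min 1 (k0 / (4 * g1))) / c3" using eta_le0 eta0_le(7,8) by linarith+
 then have eps_small: "eps <= k0 / 8 * min 1 (k0 / (4 * g1))" "eps <= 1"
  using cp(11) by (simp_all only: pos_le_divide_eq) (simp_all add: eps_def mult.commute)
 have "near_wulff_graph \<phi> gam gam1 gam2 k0 Lam (c C) (c' C) (T C) (c'' C) y r eps H g1"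
  by (unfold_locales) (fact r_pos P.ang_T' g1 eps0 eps_bound eps_small H0 H_bound)+
 then interpret N: near_wulff_graph \<phi> gam gam1 gam2 k0 Lam "c C" "c' C" "T C" "c'' C" y r eps H g1 .
 have K: "r * (2 * g1 / k0 + 1) + 12 / k0 + N.K0 * sqrt (8 / (r * k0)) <= K1"
  unfolding K1_def N.K0_def
 proof (intro add_mono mult_mono)
  show "sqrt (8 / (r * k0)) <= sqrt (8 / (r0 * k0))"
   using r_bounds(1) cp(7) k0 r_pos by (intro real_sqrt_le_mono divide_left_mono mult_right_mono mult_pos_pos) auto
  show "sqrt (r * g1) <= sqrt (r1 * g1)" using r_bounds(2) cp(2) by (intro real_sqrt_le_mono mult_right_mono) auto
 qed (use r_bounds(2) cp k0 r_pos Lam_nonneg in \<open>auto intro!: add_nonneg_nonneg mult_nonneg_nonneg\<close>)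
 have "(r * (2 * g1 / k0 + 1) + 12 / k0 + N.K0 * sqrt (8 / (r * k0))) * (eps + H) <= K1 * (eps + H)"
  using K eps0 H0 by (intro mult_right_mono) auto
 also have "... = K1 * (c3 * sqrt L1 + c4) * dl" by (simp add: eps_def H_def eta_def algebra_simps)
 also have "... <= CC * dl"
 proof (rule mult_right_mono[OF _ deficit_nonneg])
  have "0 < L1 * (d1 * omW * c1\<^sup>2 + 1) / (2 * a0)" using cp L1_pos omW_pos by (simp add: add_pos_pos)
  then show "K1 * (c3 * sqrt L1 + c4) <= CC" unfolding CC_def by linarith
 qed
 finally have "ennreal ((r * (2 * g1 / k0 + 1) + 12 / k0 + N.K0 * sqrt (8 / (r * k0))) * (eps + H)) <= ennreal (CC * dl)"
  by (rule ennreal_leI)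
 then show ?thesis using N.normal_graph unfolding range_c[OF C] by (meson order_trans)
qed

text \<open>Piece and Wulff shape are both images of the unit disc under diffeomorphisms of the
  plane; compose through the disc.\<close>

lemma component_diffeomorphism:
 assumes C: "C \<in> J"
 shows "EX Th Xi. homeomorphism UNIV UNIV Th Xi & C2_on UNIV Th & C2_on UNIV Xi &
  Th ` S C = interior (wulff_at \<phi> y r) & Th ` closure (S C) = closure (wulff_at \<phi> y r)"
proof -
 interpret P: positive_curve \<phi> gam gam1 gam2 k0 Lam "c C" "c' C" "T C" "c'' C" a dl m0 by (rule positive[OF C])
 obtain Phi1 Psi1 :: "real^2 => real^2" where 1: "homeomorphism UNIV UNIV Phi1 Psi1" "C2_on UNIV Phi1" "C2_on UNIV Psi1"
  "Phi1 ` ball 0 1 = P.D.D" "Phi1 ` cball 0 1 = {l *. (c C s - x0 C) | l s. 0 <= l & l <= 1}"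
  by (rule P.D.diffeomorphism) (rule that, assumption+)
 obtain Phi2 Psi2 :: "real^2 => real^2" where 2: "homeomorphism UNIV UNIV Phi2 Psi2" "C2_on UNIV Phi2" "C2_on UNIV Psi2"
  "Phi2 ` ball 0 1 = W.D" "Phi2 ` cball 0 1 = {l *. Z s | l s. 0 <= l & l <= 1}"
  by (rule W.diffeomorphism) (rule that, assumption+)
 have i1: "Psi1 (Phi1 z) = z" "Phi1 (Psi1 z) = z" and i2: "Psi2 (Phi2 z) = z" "Phi2 (Psi2 z) = z" for z
  using 1(1) 2(1) by (auto simp: homeomorphism_def)
 define Th where "Th z = y + r *. Phi2 (Psi1 (z - x0 C))" for z
 define Xi where "Xi w = x0 C + Phi1 (Psi2 ((1 / r) *. (w + - y)))" for w
 have inv: "Xi (Th z) = z" "Th (Xi z) = z" for z using r_pos by (simp_all add: Th_def Xi_def i1 i2)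
 have tr: "C2_on UNIV (%z. z + v)" for v :: "real^2"
  by (rule C2_on_add[OF C2_on_bounded_linear[OF bounded_linear_ident] C2_on_const])
 have c: "C2_on UNIV (%z. g (f z))" if "C2_on UNIV f" "C2_on UNIV g" for f g :: "real^2 => real^2"
  by (rule C2_on_compose[where f = f and T = UNIV]) (use that in auto)
 have sc: "C2_on UNIV (%z::real^2. k *. z)" for k by (rule C2_on_bounded_linear[OF bounded_linear_scaleR_right])
 have "C2_on UNIV (%z. r *. Phi2 (Psi1 (z + - x0 C)) + y)"
  by (rule c[OF c[OF c[OF c[OF tr 1(3)] 2(2)] sc] tr])
 then have C2Th: "C2_on UNIV Th" by (simp add: Th_def[abs_def] add.commute)
 have "C2_on UNIV (%w. Phi1 (Psi2 ((1 / r) *. (w + - y))) + x0 C)"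
  by (rule c[OF c[OF c[OF c[OF tr sc] 2(3)] 1(2)] tr])
 then have C2Xi: "C2_on UNIV Xi" by (simp add: Xi_def[abs_def] add.commute)
 have cont: "continuous_on UNIV Th" "continuous_on UNIV Xi"
  by (intro C1_on_imp_continuous_on C2_on_imp_C1_on C2Th C2Xi)+
 have "Th ` UNIV = UNIV" "Xi ` UNIV = UNIV" using inv by (metis surjI)+
 then have hom: "homeomorphism UNIV UNIV Th Xi" using cont inv by (simp add: homeomorphism_def)
 have im: "Th ` (%z. x0 C + z) ` Phi1 ` B = (%w. y + r *. w) ` Phi2 ` B" for B
  by (simp add: image_image Th_def i1)
 have S: "S C = (%z. x0 C + z) ` Phi1 ` ball 0 1" by (simp add: S_def 1(4))
 have cS: "closure (S C) = (%z. x0 C + z) ` Phi1 ` cball 0 1"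
  unfolding S_def[of C] closure_translation P.D.closure_D 1(5) ..
 have "Th ` S C = interior (wulff_at \<phi> y r)"
  unfolding S im interior_wulff_at[OF r_pos] 2(4) ..
 moreover have "Th ` closure (S C) = closure (wulff_at \<phi> y r)"
  unfolding cS im 2(5) wulff_eq[symmetric] by (subst closure_closed[OF closed_wulff_at]) (simp only: wulff_at_def)
 ultimately show ?thesis using hom C2Th C2Xi by blast
qed

theorem conclusion:
 "\<exists>(d :: nat) (x :: nat => real^2) (r :: real). r > 0 &
   disjoint_family_on (%j. wulff_at \<phi> (x j) r) {..<d} &
   (let F = (\<Union>j<d. wulff_at \<phi> (x j) r) in
    diffeomorphic_domains E F &
    measure lebesgue E = measure lebesgue F &
    \<bar>aniso_perimeter \<phi> E - aniso_perimeter \<phi> F\<bar> <= CC * (curvature_deficit \<phi> E)\<^sup>2) &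
   (\<forall>Gam \<in> components (frontier E). EX j<d. EX f :: real^2 => real.
    bij_betw (normal_graph_map (wulff_at \<phi> (x j) r) f) (frontier (wulff_at \<phi> (x j) r)) Gam &
    C1_half_norm (wulff_at \<phi> (x j) r) f <= ennreal (CC * curvature_deficit \<phi> E))"
proof -
 obtain y where y: "!!C. C \<in> J ==> norm (y C - x0 C) <= c2 * eta"
  "!!C C'. C \<in> J ==> C' \<in> J ==> C ~= C' ==> wulff_at \<phi> (y C) r \<inter> wulff_at \<phi> (y C') r = {}"
  by (rule centres) (rule that, assumption+)
 obtain h where h: "bij_betw h {..<d} J"
  using ex_bij_betw_nat_finite[OF fin] unfolding d_def by (auto simp: lessThan_atLeast0)
 define x where "x j = y (h j)" for j
 have hJ: "h j \<in> J" if "j < d" for j using h that by (auto simp: bij_betw_def)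
 have hne: "h i ~= h j" if "i < d" "j < d" "i ~= j" for i j using h that by (auto simp: bij_betw_def inj_on_def)
 have UJ: "(\<Union>j<d. f (h j)) = (\<Union>C\<in>J. f C)" for f :: "_ => (real^2) set"
  unfolding bij_betw_imp_surj_on[OF h, symmetric] by simp
 have disj: "wulff_at \<phi> (x i) r \<inter> wulff_at \<phi> (x j) r = {}" if "i < d" "j < d" "i ~= j" for i j
  unfolding x_def by (rule y(2)[OF hJ[OF that(1)] hJ[OF that(2)] hne[OF that]])
 let ?F = "\<Union>j<d. wulff_at \<phi> (x j) r"
 have "diffeomorphic_domains E ?F"
 proof (rule diffeomorphic_domains_union[where J = "{..<d}" and A = "%j. S (h j)" and B = "%j. wulff_at \<phi> (x j) r"])
  show "E = (\<Union>j<d. S (h j))" unfolding UJ by (rule E_eq)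
  show "closure (S (h i)) \<inter> closure (S (h j)) = {}" if "i \<in> {..<d}" "j \<in> {..<d}" "i ~= j" for i j
   using that by (intro S_disjoint hJ hne) auto
  show "closure (wulff_at \<phi> (x i) r) \<inter> closure (wulff_at \<phi> (x j) r) = {}" if "i \<in> {..<d}" "j \<in> {..<d}" "i ~= j" for i j
   using disj[of i j] that by (simp add: closure_closed[OF closed_wulff_at])
  show "bounded (S (h i))" if "i \<in> {..<d}" for i using that by (intro S_bounded hJ) auto
  show "EX Th Xi. homeomorphism UNIV UNIV Th Xi & C2_on UNIV Th & C2_on UNIV Xi &
   Th ` S (h i) = interior (wulff_at \<phi> (x i) r) & Th ` closure (S (h i)) = closure (wulff_at \<phi> (x i) r)"
   if "i \<in> {..<d}" for i using that by (intro component_diffeomorphism hJ) auto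
 qed (use bounded_wulff_at open_E in auto)
 moreover have "aniso_perimeter \<phi> ?F = real d * (r * omW)" "measure lebesgue ?F = real d * (r\<^sup>2 * (omW / 2))"
  using wulff_union[OF r_pos finite_lessThan, of d x] disj by auto
 then have "\<bar>aniso_perimeter \<phi> E - aniso_perimeter \<phi> ?F\<bar> <= CC * (curvature_deficit \<phi> E)\<^sup>2" "measure lebesgue E = measure lebesgue ?F"
  using perimeter_close r_square area_m by (simp_all add: dl_def)
 moreover have "EX j<d. EX f :: real^2 => real.
    bij_betw (normal_graph_map (wulff_at \<phi> (x j) r) f) (frontier (wulff_at \<phi> (x j) r)) C &
    C1_half_norm (wulff_at \<phi> (x j) r) f <= ennreal (CC * curvature_deficit \<phi> E)" if C: "C \<in> J" for C
 proof -
  have "C \<in> h ` {..<d}" using C by (simp add: bij_betw_imp_surj_on[OF h])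
  then obtain j where j: "j < d" "h j = C" by blast
  show ?thesis
   using graph[OF C y(1)[OF C]] j by (intro exI[of _ j] conjI) (simp_all add: x_def dl_def)
 qed
 moreover have "disjoint_family_on (%j. wulff_at \<phi> (x j) r) {..<d}"
  unfolding disjoint_family_on_def using disj by blast
 ultimately show ?thesis unfolding Let_def using r_pos by blast
qed

end

lemma (in wulff_bounds) domain_conclusion:
 assumes E: "bounded E" "C2_open_set E" "measure lebesgue E = m" "aniso_perimeter \<phi> E <= m0 * L1"
  "curvature_deficit \<phi> E <= dl0" and m0: "!!t. m0 <= gam t"
 shows "\<exists>(d :: nat) (x :: nat => real^2) (r :: real). r > 0 &
   disjoint_family_on (%j. wulff_at \<phi> (x j) r) {..<d} &
   (let F = (\<Union>j<d. wulff_at \<phi> (x j) r) in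
    diffeomorphic_domains E F &
    measure lebesgue E = measure lebesgue F &
    \<bar>aniso_perimeter \<phi> E - aniso_perimeter \<phi> F\<bar> <= CC * (curvature_deficit \<phi> E)\<^sup>2) &
   (\<forall>Gam \<in> components (frontier E). EX j<d. EX f :: real^2 => real.
    bij_betw (normal_graph_map (wulff_at \<phi> (x j) r) f) (frontier (wulff_at \<phi> (x j) r)) Gam &
    C1_half_norm (wulff_at \<phi> (x j) r) f <= ennreal (CC * curvature_deficit \<phi> E))"
proof -
 have "\<forall>C\<in>components (frontier E). EX c c' c'' T. boundary_curve E c c' c'' T & range c = C"
  using boundary_components(2)[OF E(2,1)] by blast
 from bchoice[OF this] obtain c where
  "\<forall>C\<in>components (frontier E). EX c' c'' T. boundary_curve E (c C) c' c'' T & range (c C) = C" ..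
 from bchoice[OF this] obtain c' where
  "\<forall>C\<in>components (frontier E). EX c'' T. boundary_curve E (c C) (c' C) c'' T & range (c C) = C" ..
 from bchoice[OF this] obtain c'' where
  "\<forall>C\<in>components (frontier E). EX T. boundary_curve E (c C) (c' C) (c'' C) T & range (c C) = C" ..
 from bchoice[OF this] obtain T where
  bc: "\<forall>C\<in>components (frontier E). boundary_curve E (c C) (c' C) (c'' C) (T C) & range (c C) = C" ..
 have "E ~= {}" using E(3) m_pos by auto
 have op: "open E" using E(2) by (simp add: C2_open_set_def)
 interpret D: curve_domain \<phi> gam gam1 gam2 k0 Lam E c c' c'' T
  by unfold_locales (use bc E(1) op \<open>E ~= {}\<close> boundary_components(1)[OF E(2,1)] in auto)
 have d: "D.dl <= dl0" using E(5) by (simp add: D.dl_def)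
 have sL: "0 < sqrt L1" using L1_pos by simp
 have "D.dl * sqrt L1 <= eta0"
 proof -
  have "D.dl <= eta0 / sqrt L1" using d unfolding dl0_def by linarith
  then show ?thesis using sL by (simp only: pos_le_divide_eq)
 qed
 then interpret N: critical_domain \<phi> gam gam1 gam2 k0 Lam E c c' c'' T m0 L1 M0 M1 g1 m
  by unfold_locales (use eta0_le m0_pos m0 E d in auto)
 show ?thesis by (rule N.conclusion)
qed

text \<open>The ellipticity constant passes to \<open>g\<close> by
  \<open>ellipticity_angular\<close>. The Lipschitz constant of \<open>g\<close> adds the one given
  for \<open>gam2\<close> to one for \<open>gam\<close>, which exists because \<open>gam1\<close> is
  periodic and hence bounded.\<close>

lemma M21_anisotropy:
 assumes "\<phi> \<in> M21"
 obtains gam gam1 gam2 k0 Lam where "anisotropy \<phi> gam gam1 gam2 k0 Lam"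
proof -
 have reg: "is_norm \<phi>" "C2_on UNIV (angular \<phi>)" and
  "EX c>0. ALL nu e. norm nu = 1 --> norm e = 1 -->
    e \<bullet> frechet_derivative (grad \<phi>) (at nu) e \<ge> c * (norm (e - (nu \<bullet> e) *. nu))\<^sup>2"
  and "EX L. L-lipschitz_on UNIV (deriv (deriv (angular \<phi>)))"
  using assms by (simp_all add: M21_def regular_elliptic_integrand_def)
 then obtain kp L where kp: "0 < kp"
  "!!nu e. norm nu = 1 ==> norm e = 1 ==> e \<bullet> frechet_derivative (grad \<phi>) (at nu) e \<ge> kp * (norm (e - (nu \<bullet> e) *. nu))\<^sup>2"
  and L: "L-lipschitz_on UNIV (deriv (deriv (angular \<phi>)))" by blast
 define gam where "gam = angular \<phi>"
 obtain gam1 gam2 where v: "!!t. (angular \<phi> hvd gam1 t) (at t)"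
  "!!t. (gam1 hvd gam2 t) (at t)" "continuous_on UNIV gam2"
  by (rule C2_on_realE[OF reg(2)]) (rule that, assumption+)
 then have d: "!!t. (gam hrd gam1 t) (at t)" "!!t. (gam1 hrd gam2 t) (at t)" "continuous_on UNIV gam2"
  by (simp_all add: gam_def hrd_iff_hvd)
 have "deriv gam = gam1" using d(1) DERIV_imp_deriv by blast
 moreover have "deriv gam1 = gam2" using d(2) DERIV_imp_deriv by blast
 ultimately have L2: "\<bar>gam2 s - gam2 t\<bar> <= L * \<bar>s - t\<bar>" for s t
  using lipschitz_onD[OF L, of s t] by (simp add: gam_def dist_real_def)
 interpret smooth_norm \<phi> gam gam1 gam2
  by unfold_locales (use reg d in \<open>simp_all add: gam_def angular_def ev_def\<close>)
 obtain A B where AB: "!!t. gam1 A <= gam1 t" "!!t. gam1 t <= gam1 B"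
  by (rule periodic_bounded[OF cont_gam1 gam1_periodic]) (rule that, assumption+)
 have gam_lip: "\<bar>gam s - gam t\<bar> <= (\<bar>gam1 A\<bar> + \<bar>gam1 B\<bar>) * \<bar>s - t\<bar>" for s t
 proof -
  have "norm (gam s - gam t) <= (\<bar>gam1 A\<bar> + \<bar>gam1 B\<bar>) * norm (s - t)"
  proof (rule field_differentiable_bound[of UNIV gam gam1])
   show "norm (gam1 z) <= \<bar>gam1 A\<bar> + \<bar>gam1 B\<bar>" for z using AB[of z] unfolding real_norm_def by linarith
  qed (use d in auto)
  then show ?thesis by simp
 qed
 have "anisotropy \<phi> gam gam1 gam2 kp (\<bar>gam1 A\<bar> + \<bar>gam1 B\<bar> + L)"
 proof
  show "kp <= g t" for t by (rule ellipticity_angular) (use kp in auto)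
  show "0 < kp" by (rule kp(1))
  show "\<bar>g s - g t\<bar> <= (\<bar>gam1 A\<bar> + \<bar>gam1 B\<bar> + L) * \<bar>s - t\<bar>" for s t
  proof -
   have "g s - g t = (gam s - gam t) + (gam2 s - gam2 t)" by (simp add: g_def)
   from abs_add_le[OF this gam_lip L2] show ?thesis by (simp only: distrib_right)
  qed
 qed
 then show thesis by (rule that)
qed

theorem theorem1p2:
  fixes \<phi> :: "real^2 \<Rightarrow> real" and m M :: real
  assumes "\<phi> \<in> M21" and "m > 0" and "M > 0"
  shows "\<exists>\<epsilon>0 C. 0 < \<epsilon>0 \<and> \<epsilon>0 < 1 \<and> 0 < C \<and>
    (\<forall>E :: (real^2) set.
       bounded E \<longrightarrow> C2_open_set E \<longrightarrow> measure lebesgue E = m \<longrightarrow>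
       aniso_perimeter \<phi> E \<le> M \<longrightarrow> curvature_deficit \<phi> E \<le> \<epsilon>0 \<longrightarrow>
       (\<exists>(d :: nat) (x :: nat \<Rightarrow> real^2) (r :: real). r > 0 \<and>
          disjoint_family_on (\<lambda>j. wulff_at \<phi> (x j) r) {..<d} \<and>
          (let F = (\<Union>j<d. wulff_at \<phi> (x j) r) in
             diffeomorphic_domains E F \<and>
             measure lebesgue E = measure lebesgue F \<and>
             \<bar>aniso_perimeter \<phi> E - aniso_perimeter \<phi> F\<bar> \<le> C * (curvature_deficit \<phi> E)\<^sup>2) \<and>
          (\<forall>\<Gamma> \<in> components (frontier E). \<exists>j<d. \<exists>f :: real^2 \<Rightarrow> real.
             bij_betw (normal_graph_map (wulff_at \<phi> (x j) r) f) (frontier (wulff_at \<phi> (x j) r)) \<Gamma> \<and>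
             C1_half_norm (wulff_at \<phi> (x j) r) f \<le> ennreal (C * curvature_deficit \<phi> E))))"
proof -
 obtain gam gam1 gam2 k0 Lam where an: "anisotropy \<phi> gam gam1 gam2 k0 Lam"
  by (rule M21_anisotropy[OF assms(1)])
 interpret anisotropy \<phi> gam gam1 gam2 k0 Lam by (rule an)
 obtain t0 t1 where gam01: "!!t. gam t0 <= gam t" "!!t. gam t <= gam t1"
  by (rule periodic_bounded[OF cont_gam gam_periodic]) (rule that, assumption+)
 define m0 where "m0 = gam t0"
 define M0 where "M0 = gam t1"
 have mM: "!!t. m0 <= gam t" "0 < m0" "!!t. gam t <= M0" using gam01 gam_pos by (simp_all add: m0_def M0_def)
 obtain t2 t3 where "!!t. g t2 <= g t" and g1: "!!t. g t <= g t3"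
  by (rule periodic_bounded[OF cont_g g_periodic]) (rule that, assumption+)
 obtain R where R: "!!t. norm (Y t) <= R"
 proof -
  have "compact (range Z)" by (rule W.compact_range)
  then obtain R where "!!y. y \<in> range Y ==> norm y <= R"
   unfolding range_Z using compact_imp_bounded bounded_iff by metis
  then show thesis using that by blast
 qed
 \<comment> \<open>\<open>L1 = M / m0\<close> makes \<open>m0 * L1\<close> the given bound
   \<open>M\<close>; the maximum with 1 makes the bound on \<open>Y\<close> visibly
   positive.\<close>
 interpret wulff_bounds \<phi> gam gam1 gam2 k0 Lam m0 "M / m0" M0 "max R 1" "g t3" m
 proof
  show "0 < M / m0" using assms(3) mM(2) by simp
  show "norm (Y t) <= max R 1" for t using R[of t] by simp
 qed (use mM g1 assms in auto)
 have eq: "m0 * (M / m0) = M" using m0_pos by simp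
 have "dl0 < 1" unfolding dl0_def by linarith
 then show ?thesis
  using consts_pos domain_conclusion[unfolded eq] mM(1) by (intro exI[of _ dl0] exI[of _ CC] conjI allI impI) auto
qed

end
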